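(* Let $E\in(-2,2)\setminus\{0\}$ and consider the decaying model. As $n\to\infty$, the processes $(Q^\lambda_{\lfloor nt\rfloor})_{t\in[0,1)}$ converge in distribution on $[0,1)$, in the sense of finite dimensional distributions for $\lambda\in\mathbb C$ and uniformly on compacts in $t$, to the solution $Q^\lambda(t)$, $t\in[0,1)$, of $$dQ^\lambda=\frac12Z\left(\begin{pmatrix}i\lambda&0\\0&-i\lambda\end{pmatrix}dt+\frac{\sigma\rho}{\sqrt{1-t}}\begin{pmatrix}i\,d\mathcal B&d\mathcal W\\ d\overline{\mathcal W}&-i\,d\mathcal B\end{pmatrix}\right)Z^{-1}Q^\lambda,\qquad Q^\lambda(0)=I.$$
   Context: Let $\omega_1,\omega_2,\dots$ be independent real random variables with mean $0$, variance $1$ and uniformly bounded third absolute moments, and let $\sigma>0$. In the decaying model (with reversed indices) $H_n$ is the random symmetric tridiagonal $n\times n$ matrix with diagonal entries $v_k=\sigma\omega_k/\sqrt{n+1-k}$, $1\le k\le n$, and all entries directly above and below the diagonal equal to $1$. Put $\rho=1/\sqrt{1-E^2/4}$, $z=E/2+i\sqrt{1-(E/2)^2}$, $Z=\begin{pmatrix}\bar z&z\\1&1\end{pmatrix}$, $T(x)=\begin{pmatrix}x&-1\\1&0\end{pmatrix}$. For $\lambda\in\mathbb C$, $0\le\ell\le n$, let $\varepsilon_\ell=\frac{\lambda}{\rho n}-v_\ell$, $M_\ell^\lambda=T(E+\varepsilon_\ell)\cdots T(E+\varepsilon_1)$, $M_0^\lambda=I$, and $Q_\ell^\lambda=T(E)^{-\ell}M_\ell^\lambda$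 (dependence on $n$ suppressed). $\mathcal B,\mathcal B_2,\mathcal B_3$ are independent standard real Brownian motions, $\mathcal W=\frac1{\sqrt2}(\mathcal B_2+i\mathcal B_3)$, and the same Brownian motions drive the SDE for all $\lambda$. *)

theory Defs
  imports "HOL-Probability.Probability"
begin

section \<open>Convergence in distribution, locally uniformly in time\<close>

definition borel_of :: "'a topology \<Rightarrow> 'a measure" where
  "borel_of X = sigma (topspace X) {U. openin X U}"

definition converges_in_distribution ::
  "'s topology \<Rightarrow> (nat \<Rightarrow> 'a measure) \<Rightarrow> (nat \<Rightarrow> 'a \<Rightarrow> 's) \<Rightarrow> 'b measure \<Rightarrow> ('b \<Rightarrow> 's) \<Rightarrow> bool" where
  "converges_in_distribution X M U N V \<longleftrightarrow>
     (\<forall>n. U n \<in> measurable (M n) (borel_of X)) \<and>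
     V \<in> measurable N (borel_of X) \<and>
     (\<forall>f. continuous_map X euclideanreal f \<and> bounded (f ` topspace X) \<longrightarrow>
        (\<lambda>n. \<integral>x. f (U n x) \<partial>M n) \<longlonglongrightarrow> (\<integral>y. f (V y) \<partial>N))"

text \<open>
  The topology of uniform convergence on compact subsets of \<open>S\<close>, on all functions on \<open>S\<close>
  (with the value \<open>undefined\<close> outside \<open>S\<close>). Discontinuous functions are included because
  the rescaled discrete processes have step functions as paths.
\<close>

definition uniform_on_compacts ::
  "'t::t2_space set \<Rightarrow> ('t \<Rightarrow> 'v::metric_space) topology" where
  "uniform_on_compacts S = topology (\<lambda>U. U \<subseteq> S \<rightarrow>\<^sub>E UNIV \<and>
     (\<forall>f\<in>U. \<exists>K e. compact K \<and> K \<subseteq> S \<and> 0 < e \<and>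
        (\<forall>g \<in> S \<rightarrow>\<^sub>E UNIV. (\<forall>t\<in>K. dist (f t) (g t) < e) \<longrightarrow> g \<in> U)))"

lemma openin_uniform_on_compacts:
  fixes U :: "('t::t2_space \<Rightarrow> 'v::metric_space) set"
  shows "openin (uniform_on_compacts S) U \<longleftrightarrow> U \<subseteq> S \<rightarrow>\<^sub>E UNIV \<and>
     (\<forall>f\<in>U. \<exists>K e. compact K \<and> K \<subseteq> S \<and> 0 < e \<and>
        (\<forall>g \<in> S \<rightarrow>\<^sub>E UNIV. (\<forall>t\<in>K. dist (f t) (g t) < e) \<longrightarrow> g \<in> U))"
proof -
  let ?nb = "\<lambda>U f K e. compact K \<and> K \<subseteq> S \<and> 0 < e \<and>
        (\<forall>g \<in> S \<rightarrow>\<^sub>E UNIV. (\<forall>t\<in>K. dist (f t) (g t) < e) \<longrightarrow> g \<in> U)"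
  let ?op = "\<lambda>U::('t \<Rightarrow> 'v) set. U \<subseteq> S \<rightarrow>\<^sub>E UNIV \<and> (\<forall>f\<in>U. \<exists>K e. ?nb U f K (e::real))"
  have "istopology ?op"
    unfolding istopology_def
  proof (intro conjI allI impI)
    fix U V assume U: "?op U" and V: "?op V"
    have "\<exists>K e. ?nb (U \<inter> V) f K e" if "f \<in> U \<inter> V" for f
    proof -
      obtain K d L e where "?nb U f K d" "?nb V f L e"
        using U V \<open>f \<in> U \<inter> V\<close> by (metis IntE)
      then have "?nb (U \<inter> V) f (K \<union> L) (min d e)"
        by (auto intro: compact_Un)
      then show ?thesis by blast
    qed
    then show "U \<inter> V \<subseteq> S \<rightarrow>\<^sub>E UNIV" "\<forall>f\<in>U \<inter> V. \<exists>K e. ?nb (U \<inter> V) f K e"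
      using U by blast+
  next
    fix \<U> assume \<U>: "\<forall>U\<in>\<U>. ?op U"
    then show "\<Union>\<U> \<subseteq> S \<rightarrow>\<^sub>E UNIV" by blast
    show "\<forall>f\<in>\<Union>\<U>. \<exists>K e. ?nb (\<Union>\<U>) f K e"
    proof
      fix f assume "f \<in> \<Union>\<U>"
      then obtain U where "U \<in> \<U>" "f \<in> U" by blast
      then obtain K e where "?nb U f K e" using \<U> by metis
      with \<open>U \<in> \<U>\<close> have "?nb (\<Union>\<U>) f K e" by blast
      then show "\<exists>K e. ?nb (\<Union>\<U>) f K e" by blast
    qed
  qed
  then show ?thesis
    unfolding uniform_on_compacts_def by (simp add: topology_inverse')
qed

lemma topspace_uniform_on_compacts [simp]: "topspace (uniform_on_compacts S) = S \<rightarrow>\<^sub>E UNIV"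
proof
  show "topspace (uniform_on_compacts S) \<subseteq> S \<rightarrow>\<^sub>E UNIV"
    using openin_topspace[of "uniform_on_compacts S"] unfolding openin_uniform_on_compacts by blast
  have "openin (uniform_on_compacts S) (S \<rightarrow>\<^sub>E UNIV)"
    unfolding openin_uniform_on_compacts by (auto intro!: exI[of _ "{}"] exI[of _ "1::real"])
  then show "S \<rightarrow>\<^sub>E UNIV \<subseteq> topspace (uniform_on_compacts S)"
    by (rule openin_subset)
qed

section \<open>Brownian motion and stochastic differential equations\<close>

text \<open>
  Standard Brownian motion in \<open>\<real>\<^sup>d\<close> relative to a filtration: its coordinates are
  independent standard real Brownian motions. Only times \<open>t \<ge> 0\<close> matter.
\<close>

locale brownian_motion = prob_space P + filtration "space P" F
  for P :: "'w measure" and F :: "real \<Rightarrow> 'w measure" +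
  fixes B :: "real \<Rightarrow> 'w \<Rightarrow> real^'d"
  assumes sets_F: "\<And>t. sets (F t) \<subseteq> sets P"
    and start: "\<And>w. w \<in> space P \<Longrightarrow> B 0 w = 0"
    and continuous_paths: "\<And>w. w \<in> space P \<Longrightarrow> continuous_on {0..} (\<lambda>t. B t w)"
    and adapted: "\<And>t. 0 \<le> t \<Longrightarrow> B t \<in> borel_measurable (F t)"
    and increment_indep_past: "\<And>s t. 0 \<le> s \<Longrightarrow> s < t \<Longrightarrow>
      indep_set (sets (F s)) {(\<lambda>w. B t w - B s w) -` A \<inter> space P | A. A \<in> sets borel}"
    and increment_indep_components: "\<And>s t. 0 \<le> s \<Longrightarrow> s < t \<Longrightarrow>
      indep_vars (\<lambda>_. borel) (\<lambda>j w. (B t w - B s w) $ j) UNIV"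
    and increment_normal: "\<And>s t j. 0 \<le> s \<Longrightarrow> s < t \<Longrightarrow>
      distributed P lborel (\<lambda>w. (B t w - B s w) $ j) (normal_density 0 (sqrt (t - s)))"

text \<open>
  The elementary process \<open>\<Sum>\<^bsub>k<m\<^esub> \<xi>\<^sub>k 1(\<tau>\<^sub>k, \<tau>\<^sub>k\<^sub>+\<^sub>1]\<close>, with \<open>\<xi>\<^sub>k\<close> bounded and
  \<open>F(\<tau>\<^sub>k)\<close>-measurable, and its integral against a real process \<open>X\<close>.
\<close>

definition elementary_process ::
  "(real \<Rightarrow> 'w measure) \<Rightarrow> nat \<Rightarrow> (nat \<Rightarrow> real) \<Rightarrow> (nat \<Rightarrow> 'w \<Rightarrow> 'v::euclidean_space) \<Rightarrow> bool" where
  "elementary_process F m \<tau> \<xi> \<longleftrightarrow> 0 \<le> \<tau> 0 \<and>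
     (\<forall>k<m. \<tau> k \<le> \<tau> (Suc k) \<and> \<xi> k \<in> borel_measurable (F (\<tau> k)) \<and> bounded (\<xi> k ` space (F (\<tau> k))))"

definition elementary_value ::
  "nat \<Rightarrow> (nat \<Rightarrow> real) \<Rightarrow> (nat \<Rightarrow> 'w \<Rightarrow> 'v::euclidean_space) \<Rightarrow> real \<Rightarrow> 'w \<Rightarrow> 'v" where
  "elementary_value m \<tau> \<xi> t w = (\<Sum>k<m. indicator {\<tau> k<..\<tau> (Suc k)} t *\<^sub>R \<xi> k w)"

definition elementary_integral ::
  "nat \<Rightarrow> (nat \<Rightarrow> real) \<Rightarrow> (nat \<Rightarrow> 'w \<Rightarrow> 'v::euclidean_space) \<Rightarrow> (real \<Rightarrow> 'w \<Rightarrow> real) \<Rightarrow>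
     real \<Rightarrow> 'w \<Rightarrow> 'v" where
  "elementary_integral m \<tau> \<xi> X t w =
     (\<Sum>k<m. (X (min t (\<tau> (Suc k))) w - X (min t (\<tau> k)) w) *\<^sub>R \<xi> k w)"

definition progressively_measurable ::
  "(real \<Rightarrow> 'w measure) \<Rightarrow> real \<Rightarrow> (real \<Rightarrow> 'w \<Rightarrow> 'v::topological_space) \<Rightarrow> bool" where
  "progressively_measurable F T H \<longleftrightarrow>
     (\<forall>t\<in>{0..<T}. (\<lambda>(s, w). H s w) \<in> borel_measurable (restrict_space borel {0..t} \<Otimes>\<^sub>M F t))"

definition continuous_adapted ::
  "'w measure \<Rightarrow> (real \<Rightarrow> 'w measure) \<Rightarrow> real \<Rightarrow> (real \<Rightarrow> 'w \<Rightarrow> 'v::topological_space) \<Rightarrow> bool" where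
  "continuous_adapted P F T Y \<longleftrightarrow>
     (\<forall>t\<in>{0..<T}. Y t \<in> borel_measurable (F t)) \<and>
     (\<forall>w\<in>space P. continuous_on {0..<T} (\<lambda>t. Y t w))"

text \<open>
  \<open>has_ito_integral P F X T H J\<close>: the process \<open>J\<^sub>t = \<integral>\<^sub>0\<^sup>t H\<^sub>s dX\<^sub>s\<close> on \<open>[0,T)\<close>, where \<open>X\<close> is a
  real Brownian motion. For elementary \<open>H\<close> the integral is the finite sum above; in general it is the
  limit, locally uniformly in probability, of the integrals of elementary processes
  \<open>H\<^sup>n\<close> such that \<open>\<integral>\<^sub>0\<^sup>t \<parallel>H\<^sup>n\<^sub>s - H\<^sub>s\<parallel>\<^sup>2 ds\<close> tends to \<open>0\<close> in probability for all \<open>t < T\<close>.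
  The measurability and continuity conditions make the events below measurable.
\<close>

definition has_ito_integral ::
  "'w measure \<Rightarrow> (real \<Rightarrow> 'w measure) \<Rightarrow> (real \<Rightarrow> 'w \<Rightarrow> real) \<Rightarrow> real \<Rightarrow>
     (real \<Rightarrow> 'w \<Rightarrow> 'v::euclidean_space) \<Rightarrow> (real \<Rightarrow> 'w \<Rightarrow> 'v) \<Rightarrow> bool" where
  "has_ito_integral P F X T H J \<longleftrightarrow>
     progressively_measurable F T H \<and> continuous_adapted P F T J \<and>
     (\<exists>m \<tau> \<xi>. (\<forall>n. elementary_process F (m n) (\<tau> n) (\<xi> n)) \<and>
        (\<forall>t\<in>{0..<T}. \<forall>e>0.
           (\<lambda>n. measure P {w \<in> space P.
              (\<integral>\<^sup>+s\<in>{0..t}. ennreal ((norm (elementary_value (m n) (\<tau> n) (\<xi> n) s w - H s w))\<^sup>2) \<partial>lborel)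
                > ennreal e}) \<longlonglongrightarrow> 0 \<and>
           (\<lambda>n. measure P {w \<in> space P.
              \<exists>s\<in>{0..t}. norm (elementary_integral (m n) (\<tau> n) (\<xi> n) X s w - J s w) > e}) \<longlonglongrightarrow> 0))"

text \<open>
  \<open>Y\<close> solves \<open>dY = b(t,Y) dt + S(t,Y) dB\<close>, \<open>Y(0) = y\<^sub>0\<close> on \<open>[0,T)\<close>. The linear map \<open>S t y\<close> is
  applied to the increment \<open>dB = \<Sum>\<^sub>j dB\<^sub>j e\<^sub>j\<close>, so that \<open>dB\<^sub>j\<close> has the coefficient \<open>S t y e\<^sub>j\<close>.
\<close>

definition solves_sde ::
  "'w measure \<Rightarrow> (real \<Rightarrow> 'w measure) \<Rightarrow> (real \<Rightarrow> 'w \<Rightarrow> real^'d) \<Rightarrow> real \<Rightarrow>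
     (real \<Rightarrow> 'v \<Rightarrow> 'v) \<Rightarrow> (real \<Rightarrow> 'v \<Rightarrow> real^'d \<Rightarrow> 'v) \<Rightarrow> 'v \<Rightarrow>
     (real \<Rightarrow> 'w \<Rightarrow> 'v::euclidean_space) \<Rightarrow> bool" where
  "solves_sde P F B T b S y\<^sub>0 Y \<longleftrightarrow>
     continuous_adapted P F T Y \<and>
     (\<exists>J. (\<forall>j. has_ito_integral P F (\<lambda>t w. B t w $ j) T (\<lambda>t w. S t (Y t w) (axis j 1)) (J j)) \<and>
        (AE w in P. \<forall>t\<in>{0..<T}.
           (\<lambda>s. b s (Y s w)) integrable_on {0..t} \<and>
           Y t w = y\<^sub>0 + integral {0..t} (\<lambda>s. b s (Y s w)) + (\<Sum>j\<in>UNIV. J j t w)))"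

section \<open>The transfer matrices and the limiting equation\<close>

definition transfer_matrix :: "complex \<Rightarrow> complex^2^2" where
  "transfer_matrix x = vector [vector [x, -1], vector [1, 0]]"

definition rho :: "real \<Rightarrow> real" where
  "rho E = 1 / sqrt (1 - E\<^sup>2 / 4)"

text \<open>In the following, \<open>\<omega>\<close> is one realisation of the random sequence, indexed from \<open>1\<close>.\<close>

definition potential :: "real \<Rightarrow> (nat \<Rightarrow> real) \<Rightarrow> nat \<Rightarrow> nat \<Rightarrow> real" where
  "potential \<sigma> \<omega> n k = \<sigma> * \<omega> k / sqrt (real n + 1 - real k)"

definition eps :: "real \<Rightarrow> real \<Rightarrow> (nat \<Rightarrow> real) \<Rightarrow> nat \<Rightarrow> complex \<Rightarrow> nat \<Rightarrow> complex" where
  "eps E \<sigma> \<omega> n lam l = lam / of_real (rho E * real n) - of_real (potential \<sigma> \<omega> n l)"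

primrec transfer_prod ::
  "real \<Rightarrow> real \<Rightarrow> (nat \<Rightarrow> real) \<Rightarrow> nat \<Rightarrow> complex \<Rightarrow> nat \<Rightarrow> complex^2^2" where
  "transfer_prod E \<sigma> \<omega> n lam 0 = mat 1"
| "transfer_prod E \<sigma> \<omega> n lam (Suc l) =
     transfer_matrix (of_real E + eps E \<sigma> \<omega> n lam (Suc l)) ** transfer_prod E \<sigma> \<omega> n lam l"

text \<open>\<open>T(E)\<^sup>-\<^sup>l M\<^sub>l\<close>, as the \<open>l\<close>-fold left multiplication of \<open>M\<^sub>l\<close> by \<open>T(E)\<^sup>-\<^sup>1\<close>.\<close>

definition Q_discrete ::
  "real \<Rightarrow> real \<Rightarrow> (nat \<Rightarrow> real) \<Rightarrow> nat \<Rightarrow> complex \<Rightarrow> nat \<Rightarrow> complex^2^2" where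
  "Q_discrete E \<sigma> \<omega> n lam l =
     ((**) (matrix_inv (transfer_matrix (of_real E))) ^^ l) (transfer_prod E \<sigma> \<omega> n lam l)"

definition z_of :: "real \<Rightarrow> complex" where
  "z_of E = Complex (E / 2) (sqrt (1 - (E / 2)\<^sup>2))"

definition Z_of :: "real \<Rightarrow> complex^2^2" where
  "Z_of E = vector [vector [cnj (z_of E), z_of E], vector [1, 1]]"

text \<open>The three coordinates of \<open>b\<close> are \<open>\<B>\<close>, \<open>\<B>\<^sub>2\<close>, \<open>\<B>\<^sub>3\<close>, or their increments; \<open>W\<close> is \<open>\<W>\<close>.\<close>

definition noise :: "real^3 \<Rightarrow> complex^2^2" where
  "noise b = (let W = Complex (b $ 2) (b $ 3) / of_real (sqrt 2) in
     vector [vector [\<i> * of_real (b $ 1), W], vector [cnj W, - \<i> * of_real (b $ 1)]])"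

definition drift :: "real \<Rightarrow> complex \<Rightarrow> complex^2^2 \<Rightarrow> complex^2^2" where
  "drift E lam q = (1 / 2) *\<^sub>R
     (Z_of E ** vector [vector [\<i> * lam, 0], vector [0, - \<i> * lam]] ** matrix_inv (Z_of E) ** q)"

definition diffusion :: "real \<Rightarrow> real \<Rightarrow> real \<Rightarrow> complex^2^2 \<Rightarrow> real^3 \<Rightarrow> complex^2^2" where
  "diffusion E \<sigma> t q b = (1 / 2) *\<^sub>R
     (Z_of E ** ((\<sigma> * rho E / sqrt (1 - t)) *\<^sub>R noise b) ** matrix_inv (Z_of E) ** q)"

end

theory Submission
  imports Defs
begin

text \<open>
Conjugating the transfer matrices by \<open>T(E)\<^sup>l\<close> turns the product into an exact linear recursion. With
\<open>z\<close> as in the statement and \<open>\<zeta> = z^(2l)\<close>, the step from \<open>Q\<^sub>l\<^sub>-\<^sub>1\<close> to \<open>Q\<^sub>l\<close> adds (\<open>Q_discrete_Suc\<close>, \<open>kick_eps\<close>)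

  \<^item> the drift of the limiting equation, times \<open>1/n\<close>;
  \<^item> an off-diagonal term, linear in \<open>\<zeta>\<close> and its conjugate, times \<open>1/n\<close>;
  \<^item> the random term \<open>\<omega>\<^sub>l \<sigma>\<rho> / (2 sqrt (n + 1 - l)) Z N(u\<^sub>l) Z\<^sup>-\<^sup>1 Q\<^sub>l\<^sub>-\<^sub>1\<close>, where \<open>N\<close> is the noise matrix and
    \<open>u\<^sub>l = (-1, sqrt 2 Im \<zeta>, - sqrt 2 Re \<zeta>)\<close>.

Since \<open>0 < |E| < 2\<close>, neither \<open>z\<^sup>2\<close> nor \<open>z\<^sup>4\<close> is \<open>1\<close>, so the sums of \<open>z^(2l)\<close> and of \<open>z^(4l)\<close> over intervals
stay bounded. Hence the off-diagonal term averages out, and the matrices \<open>u\<^sub>l u\<^sub>l\<^sup>T\<close> average to the identity: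
the three coordinates of the sum of \<open>\<omega>\<^sub>l u\<^sub>l / sqrt n\<close> over \<open>l \<le> nt\<close> behave like the independent Brownian
motions of the limit, although they are built from a single sequence.

To pass from the driving noise to the solutions, divide \<open>[0,T]\<close>, \<open>T < 1\<close>, into \<open>K\<close> cells. The Euler
scheme of the limiting equation on this grid is a continuous function of the finitely many increments
of its noise, simultaneously for finitely many \<open>\<lambda>\<close>. Three facts are combined, letting first \<open>n\<close> and then
\<open>K\<close> tend to infinity:

  \<^item> the solution of the equation is uniformly close, in probability, to the Euler scheme driven by
    the Brownian increments (\<open>Euler_scheme_converges\<close>);
  \<^item> for large \<open>n\<close>, the recursion is uniformly close, in probability, to the Euler scheme driven by the
    sums of \<open>\<omega>\<^sub>l u\<^sub>l / sqrt n\<close> over the cells (\<open>discrete_Euler_scheme\<close>);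
  \<^item> for fixed \<open>K\<close>, these sums converge in distribution to the Brownian increments
    (\<open>block_noise_converges\<close>, by characteristic functions).

The first two facts rest on one stability estimate (\<open>Euler_stability\<close>): a process that satisfies the
recursion of the Euler scheme up to a small defect is close to the scheme. For the solution of the
equation, the defect compares Ito integrals with Riemann sums; it is estimated with Lenglart's
inequality, because Ito integrals are only given as limits in probability. Finally, functionals that are
Lipschitz for the uniform distance on some \<open>[0,T]\<close> suffice to test convergence in distribution
(\<open>converges_in_distribution_if_Lipschitz\<close>).
\<close>

section \<open>Convergence of path processes\<close>

abbreviation "paths \<equiv> {0..<1::real} \<rightarrow>\<^sub>E UNIV"

text \<open>
 The cap at \<open>1\<close> keeps the supremum finite for unbounded paths.
\<close>

definition path_dist :: "real => (real => 'v::metric_space) => (real => 'v) => real" where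
 "path_dist T u v = (SUP t\<in>{0..T}. min 1 (dist (u t) (v t)))"

lemma path_dist_bdd: "bdd_above ((\<lambda>t. min 1 (dist (u t) (v t))) ` {0..T})"
 by (rule bdd_aboveI[of _ 1]) auto

lemma path_dist_upper: "t \<in> {0..T} ==> min 1 (dist (u t) (v t)) \<le> path_dist T u v"
 unfolding path_dist_def by (rule cSUP_upper[OF _ path_dist_bdd])

lemma path_dist_least:
 assumes "0 \<le> T" "\<And>t. t \<in> {0..T} ==> min 1 (dist (u t) (v t)) \<le> c"
 shows "path_dist T u v \<le> c"
 unfolding path_dist_def using assms by (intro cSUP_least) auto

lemma path_dist_le_1: "0 \<le> T ==> path_dist T u v \<le> 1"
 by (rule path_dist_least) auto

lemma path_dist_nonneg: "0 \<le> T ==> 0 \<le> path_dist T u v"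
proof -
 assume "0 \<le> T"
 then have "min 1 (dist (u 0) (v 0)) \<le> path_dist T u v" by (intro path_dist_upper) auto
 moreover have "0 \<le> min 1 (dist (u 0) (v 0))" by simp
 ultimately show ?thesis by linarith
qed

lemma path_dist_triangle:
 assumes "0 \<le> T" shows "path_dist T u w \<le> path_dist T u v + path_dist T v w"
proof (rule path_dist_least[OF assms])
 fix t assume t: "t \<in> {0..T}"
 have "min 1 (dist (u t) (w t)) \<le> min 1 (dist (u t) (v t)) + min 1 (dist (v t) (w t))"
  using dist_triangle[of "u t" "w t" "v t"] zero_le_dist[of "u t" "v t"] zero_le_dist[of "v t" "w t"]
  by linarith
 then show "min 1 (dist (u t) (w t)) \<le> path_dist T u v + path_dist T v w"
  using path_dist_upper[OF t, of u v] path_dist_upper[OF t, of v w] by linarith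
qed

lemma path_dist_commute: "path_dist T u v = path_dist T v u"
 unfolding path_dist_def by (simp add: dist_commute)

lemma path_dist_self [simp]: "0 \<le> T ==> path_dist T u u = 0"
 using path_dist_nonneg[of T u u] path_dist_least[of T u u 0] by force

definition path_Lipschitz :: "real => real => ((real => 'v::metric_space) => real) => bool" where
 "path_Lipschitz T L f \<longleftrightarrow> 0 \<le> L \<and> (\<forall>u\<in>paths. \<forall>v\<in>paths. \<bar>f u - f v\<bar> \<le> L * path_dist T u v)"

text \<open>
 The interval \<open>[0,T]\<close> is one of the compact sets of the topology.
\<close>

lemma path_Lipschitz_continuous_map:
 assumes f: "path_Lipschitz T L f" and T: "0 \<le> T" "T < 1"
 shows "continuous_map (uniform_on_compacts {0..<1}) euclideanreal f"
 unfolding continuous_map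
proof (intro conjI allI impI)
 fix O' :: "real set" assume "openin euclidean O'"
 then have O: "open O'" by simp
 show "openin (uniform_on_compacts {0..<1}) {u \<in> topspace (uniform_on_compacts {0..<1}). f u \<in> O'}"
  unfolding openin_uniform_on_compacts topspace_uniform_on_compacts
 proof (intro conjI ballI)
  fix u assume "u \<in> {u \<in> paths. f u \<in> O'}"
  then have u: "u \<in> paths" "f u \<in> O'" by auto
  from O u(2) obtain e where e: "e > 0" "\<And>y. dist y (f u) < e ==> y \<in> O'"
   unfolding open_dist by blast
  have L: "0 \<le> L" using f by (simp add: path_Lipschitz_def)
  define d where "d = e / (2 * (L + 1))"
  have d: "d > 0" using e L unfolding d_def by (intro divide_pos_pos) auto
  have "f v \<in> O'" if v: "v \<in> paths" "\<forall>t\<in>{0..T}. dist (u t) (v t) < d" for v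
  proof (rule e(2))
   have "path_dist T u v \<le> d"
    by (rule path_dist_least[OF T(1)]) (use v in \<open>force intro: min.coboundedI2\<close>)
   then have "\<bar>f u - f v\<bar> \<le> L * d"
    using f u v L unfolding path_Lipschitz_def by (meson mult_left_mono order_trans)
   also have "L * d < e"
   proof -
    have "L * d \<le> (L + 1) * d" using d by (simp add: mult_right_mono)
    also have "\<dots> = e / 2" using L by (simp add: d_def field_simps)
    finally show ?thesis using e by simp
   qed
   finally show "dist (f v) (f u) < e" by (simp add: dist_real_def abs_minus_commute)
  qed
  then show "\<exists>K d. compact K \<and> K \<subseteq> {0..<1} \<and> 0 < d \<and>
    (\<forall>v\<in>paths. (\<forall>t\<in>K. dist (u t) (v t) < d) \<longrightarrow> v \<in> {u \<in> paths. f u \<in> O'})"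
   using d T by (intro exI[of _ "{0..T}"] exI[of _ d]) auto
 qed auto
qed auto

text \<open>
 The largest minorant of \<open>f\<close> that is Lipschitz with constant \<open>m\<close> for the distance on \<open>[0, m/(m+1)]\<close>; every
 compact subset of \<open>[0,1)\<close> lies in one of these intervals.
\<close>

definition inf_conv :: "((real => 'v::metric_space) => real) => nat => (real => 'v) => real" where
 "inf_conv f m u = (INF v\<in>paths. f v + real m * path_dist (1 - 1 / (real m + 1)) u v)"

lemma time_horizon: "0 \<le> 1 - 1 / (real m + 1)" "1 - 1 / (real m + 1) < 1"
 by (auto simp: field_simps)

lemma paths_ne: "(paths :: (real => 'v) set) \<noteq> {}"
 by (simp add: PiE_eq_empty_iff)

context
 fixes f :: "(real => 'v::metric_space) => real" and C :: real
 assumes f_bdd: "\<And>v. v \<in> paths ==> \<bar>f v\<bar> \<le> C"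
begin

lemma inf_conv_bdd: "bdd_below ((\<lambda>v. f v + real m * path_dist (1 - 1 / (real m + 1)) u v) ` paths)"
proof (rule bdd_belowI2[of _ "- C"])
 fix v :: "real => 'v" assume "v \<in> paths"
 then show "- C \<le> f v + real m * path_dist (1 - 1 / (real m + 1)) u v"
  using f_bdd[of v] path_dist_nonneg[OF time_horizon(1), of m u v] by (smt (verit) mult_nonneg_nonneg of_nat_0_le_iff)
qed

lemma inf_conv_le: "u \<in> paths ==> inf_conv f m u \<le> f u"
 unfolding inf_conv_def by (rule cINF_lower2[OF inf_conv_bdd, of u]) (simp_all add: time_horizon(1))

lemma inf_conv_abs_le: assumes "u \<in> paths" shows "\<bar>inf_conv f m u\<bar> \<le> C"
proof -
 have "- C \<le> inf_conv f m u"
  unfolding inf_conv_def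
 proof (rule cINF_greatest[OF paths_ne])
  fix v :: "real => 'v" assume "v \<in> paths"
  then show "- C \<le> f v + real m * path_dist (1 - 1 / (real m + 1)) u v"
   using f_bdd[of v] path_dist_nonneg[OF time_horizon(1), of m u v] by (smt (verit) mult_nonneg_nonneg of_nat_0_le_iff)
 qed
 then show ?thesis using inf_conv_le[OF assms, of m] f_bdd[OF assms] by linarith
qed

lemma inf_conv_Lipschitz: "path_Lipschitz (1 - 1 / (real m + 1)) (real m) (inf_conv f m)"
proof -
 have *: "inf_conv f m u \<le> inf_conv f m v + real m * path_dist (1 - 1 / (real m + 1)) u v" for u v
 proof -
  have "inf_conv f m u - real m * path_dist (1 - 1 / (real m + 1)) u v
    \<le> f w + real m * path_dist (1 - 1 / (real m + 1)) v w" if "w \<in> paths" for w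
  proof -
   have "inf_conv f m u \<le> f w + real m * path_dist (1 - 1 / (real m + 1)) u w"
    unfolding inf_conv_def by (rule cINF_lower[OF inf_conv_bdd that])
   also have "\<dots> \<le> f w + real m * (path_dist (1 - 1 / (real m + 1)) u v + path_dist (1 - 1 / (real m + 1)) v w)"
    using path_dist_triangle[OF time_horizon(1)] by (intro add_left_mono mult_left_mono) auto
   finally show ?thesis by (simp add: algebra_simps)
  qed
  then have "inf_conv f m u - real m * path_dist (1 - 1 / (real m + 1)) u v \<le> inf_conv f m v"
   unfolding inf_conv_def[of f m v] by (intro cINF_greatest[OF paths_ne])
  then show ?thesis by simp
 qed
 have "\<bar>inf_conv f m u - inf_conv f m v\<bar> \<le> real m * path_dist (1 - 1 / (real m + 1)) u v" for u v
  using *[of u v] *[of v u] path_dist_commute[of "1 - 1 / (real m + 1)" u v] by (simp add: abs_le_iff)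
 then show ?thesis by (simp add: path_Lipschitz_def)
qed

text \<open>
 A path that nearly attains the infimum defining \<open>inf_conv f m u\<close> has distance at most of order \<open>C/m\<close> from
 \<open>u\<close>. For large \<open>m\<close> it thus lies in a neighbourhood of \<open>u\<close> on which \<open>f\<close> is at least \<open>f u - e\<close>.
\<close>

lemma inf_conv_tendsto:
 assumes u: "u \<in> paths"
  and lsc: "\<And>e. e > 0 ==> \<exists>K d. compact K \<and> K \<subseteq> {0..<1} \<and> 0 < d \<and>
    (\<forall>v\<in>paths. (\<forall>t\<in>K. dist (u t) (v t) < d) \<longrightarrow> f u - e < f v)"
 shows "(\<lambda>m. inf_conv f m u) \<longlonglongrightarrow> f u"
proof (rule LIMSEQ_I)
 fix e :: real assume e: "e > 0"
 then obtain K d where K: "compact K" "K \<subseteq> {0..<1}" and d: "0 < d"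
  and nb: "\<And>v. v \<in> paths ==> (\<forall>t\<in>K. dist (u t) (v t) < d) ==> f u - e/2 < f v"
  using lsc[of "e/2"] by auto
 obtain s where s: "s < 1" "K \<subseteq> {0..s}"
 proof (cases "K = {}")
  case False
  then obtain s where "s \<in> K" "\<forall>t\<in>K. t \<le> s" using compact_attains_sup[OF K(1)] by blast
  then show ?thesis using K(2) that[of s] by force
 qed (use that[of 0] in auto)
 define d' where "d' = min d 1"
 have d': "d' > 0" "d' \<le> 1" "d' \<le> d" using d by (auto simp: d'_def)
 obtain N where N: "real N \<ge> 2 * C / d'" "real N \<ge> 1 / (1 - s)"
  using real_arch_simple[of "max (2 * C / d') (1 / (1 - s))"] by auto
 have "norm (inf_conv f m u - f u) < e" if m: "m \<ge> N" for m
 proof -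
  let ?T = "1 - 1 / (real m + 1)"
  have "1 / (real m + 1) \<le> 1 - s"
  proof -
   have "1 / (1 - s) \<le> real m + 1" using N(2) m by linarith
   then show ?thesis using s(1) by (simp add: field_simps)
  qed
  then have KT: "K \<subseteq> {0..?T}" using s(2) by auto
  have "f u - e/2 \<le> inf_conv f m u"
   unfolding inf_conv_def
  proof (rule cINF_greatest[OF paths_ne])
   fix v :: "real => 'v" assume v: "v \<in> paths"
   show "f u - e/2 \<le> f v + real m * path_dist ?T u v"
   proof (cases "path_dist ?T u v < d'")
    case True
    have "dist (u t) (v t) < d" if "t \<in> K" for t
     using path_dist_upper[of t ?T u v] True d' KT that by (auto simp: min_def split: if_splits)
    then have "f u - e/2 < f v" using nb[OF v] by blast
    then show ?thesis using path_dist_nonneg[OF time_horizon(1), of m u v]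
     by (smt (verit) mult_nonneg_nonneg of_nat_0_le_iff)
   next
    case False
    have "2 * C \<le> real N * d'" using N(1) d' by (simp add: field_simps)
    also have "\<dots> \<le> real m * path_dist ?T u v"
     using m False d' by (intro mult_mono) auto
    finally show ?thesis using f_bdd[OF u] f_bdd[OF v] e by linarith
   qed
  qed
  then show ?thesis using inf_conv_le[OF u, of m] e by (simp add: abs_less_iff)
 qed
 then show "\<exists>N. \<forall>m\<ge>N. norm (inf_conv f m u - f u) < e" by blast
qed

end

lemma openin_uniform_on_compactsD:
 assumes "openin (uniform_on_compacts S) U" "u \<in> U"
 shows "\<exists>K d. compact K \<and> K \<subseteq> S \<and> 0 < d \<and>
  (\<forall>v \<in> S \<rightarrow>\<^sub>E UNIV. (\<forall>t\<in>K. dist (u t) (v t) < d) \<longrightarrow> v \<in> U)"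
 using assms by (simp add: openin_uniform_on_compacts)

lemma measurable_borel_of:
 assumes "\<And>w. w \<in> space M ==> V w \<in> topspace X"
  and "\<And>U. openin X U ==> V -` U \<inter> space M \<in> sets M"
 shows "V \<in> measurable M (borel_of X)"
 unfolding borel_of_def
 by (rule measurable_measure_of) (use assms in \<open>auto dest: openin_subset\<close>)

lemma continuous_map_borel_of:
 assumes V: "V \<in> measurable M (borel_of X)" and f: "continuous_map X euclideanreal f"
 shows "(\<lambda>w. f (V w)) \<in> borel_measurable M"
proof (rule borel_measurableI)
 fix S :: "real set" assume "open S"
 then have op: "openin X {x \<in> topspace X. f x \<in> S}" using f by (simp add: continuous_map)
 have sub: "{U. openin X U} \<subseteq> Pow (topspace X)" by (auto dest: openin_subset)
 have "{x \<in> topspace X. f x \<in> S} \<in> sets (borel_of X)"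
  unfolding borel_of_def sets_measure_of[OF sub] using op by (intro sigma_sets.Basic) simp
 from measurable_sets[OF V this] 
 have "V -` {x \<in> topspace X. f x \<in> S} \<inter> space M \<in> sets M" .
 moreover have "V w \<in> topspace X" if "w \<in> space M" for w
  using measurable_space[OF V that] by (simp add: borel_of_def space_measure_of_conv)
 then have "V -` {x \<in> topspace X. f x \<in> S} \<inter> space M = (\<lambda>w. f (V w)) -` S \<inter> space M" by auto
 ultimately show "(\<lambda>w. f (V w)) -` S \<inter> space M \<in> sets M" by simp
qed

text \<open>
 A step path depends on finitely many random values, and an open set of paths pulls back to an open
 set of such values.
\<close>

lemma measurable_step_path:
 fixes q :: "nat => 'w => 'v::{metric_space, second_countable_topology}"
 assumes q: "\<And>i. q i \<in> borel_measurable M" and k: "\<And>t. t \<in> {0..<1} ==> \<kappa> t \<le> N"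
 shows "(\<lambda>w. \<lambda>t\<in>{0..<1::real}. q (\<kappa> t) w) \<in> measurable M (borel_of (uniform_on_compacts {0..<1}))"
proof (rule measurable_borel_of)
 fix U :: "(real => 'v) set" assume U: "openin (uniform_on_compacts {0..<1}) U"
 let ?V = "{c :: nat => 'v. (\<lambda>t\<in>{0..<1}. c (\<kappa> t)) \<in> U}"
 have "open ?V"
 proof (subst open_subopen, safe)
  fix c :: "nat => 'v" assume c: "(\<lambda>t\<in>{0..<1}. c (\<kappa> t)) \<in> U"
  obtain K e where e: "0 < e" "K \<subseteq> {0..<1}"
   "\<And>g. g \<in> paths ==> (\<forall>t\<in>K. dist ((\<lambda>t\<in>{0..<1}. c (\<kappa> t)) t) (g t) < e) ==> g \<in> U"
   using openin_uniform_on_compactsD[OF U c] by blast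
  let ?O = "\<Inter>i\<in>{..N}. (\<lambda>c'. c' i) -` ball (c i) e"
  have "open ?O"
   by (intro open_INT finite_atMost ballI open_vimage open_ball continuous_on_product_coordinates)
  moreover have "c \<in> ?O" using e by auto
  moreover have "?O \<subseteq> ?V"
  proof safe
   fix c' assume c': "c' \<in> ?O"
   show "(\<lambda>t\<in>{0..<1}. c' (\<kappa> t)) \<in> U"
    by (rule e(3)) (use c' e(2) k in \<open>auto simp: subset_iff\<close>)
  qed
  ultimately show "\<exists>T. open T \<and> c \<in> T \<and> T \<subseteq> ?V" by blast
 qed
 moreover have "(\<lambda>w i. q i w) \<in> borel_measurable M"
  by (rule measurable_coordinatewise_then_product) (rule q)
 ultimately have "(\<lambda>w i. q i w) -` ?V \<inter> space M \<in> sets M"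
  by (intro measurable_sets[of _ M borel]) auto
 then show "(\<lambda>w. \<lambda>t\<in>{0..<1}. q (\<kappa> t) w) -` U \<inter> space M \<in> sets M"
  by (simp add: vimage_def)
qed auto

text \<open>
 Open sets are not generated by countably many evaluations, so measurability of the coordinates does not
 suffice by itself. The indicator of an open set is the limit of its Lipschitz minorants, and on
 a continuous path the value of such a minorant is the limit of its values on the step paths that
 approximate the path uniformly on compacts.
\<close>

lemma measurable_continuous_path:
 fixes Y :: "real => 'w => 'v::{metric_space, second_countable_topology}"
 assumes Y: "\<And>t. t \<in> {0..<1} ==> Y t \<in> borel_measurable M"
  and cont: "\<And>w. w \<in> space M ==> continuous_on {0..<1} (\<lambda>t. Y t w)"
 shows "(\<lambda>w. \<lambda>t\<in>{0..<1}. Y t w) \<in> measurable M (borel_of (uniform_on_compacts {0..<1}))"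
proof (rule measurable_borel_of)
 fix U :: "(real => 'v) set" assume U: "openin (uniform_on_compacts {0..<1}) U"
 define f :: "(real => 'v) => real" where "f = indicator U"
 have f_bdd: "\<bar>f v\<bar> \<le> 1" for v by (simp add: f_def indicator_def)
 let ?V = "\<lambda>w. \<lambda>t\<in>{0..<1}. Y t w"
 let ?q = "\<lambda>K i. if i < K then Y (real i / real K) else (\<lambda>_. undefined)"
 let ?s = "\<lambda>K w. \<lambda>t\<in>{0..<1}. ?q (Suc K) (nat \<lfloor>real (Suc K) * t\<rfloor>) w"
 have fl: "nat \<lfloor>real (Suc K) * t\<rfloor> \<le> K" if "t \<in> {0..<1}" for t K
 proof -
  have "real (Suc K) * t < real (Suc K)" using that by simp
  then have "\<lfloor>real (Suc K) * t\<rfloor> < int (Suc K)" by (simp add: floor_less_iff)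
  then show ?thesis by linarith
 qed
 have meas_q: "?q K i \<in> borel_measurable M" for K i
  using Y by (auto intro!: Y simp: field_simps)
 have lim: "(\<lambda>m. inf_conv f m (?V w)) \<longlonglongrightarrow> f (?V w)" for w
 proof (rule inf_conv_tendsto[of f 1])
  fix e :: real assume e: "e > 0"
  show "\<exists>K d. compact K \<and> K \<subseteq> {0..<1} \<and> 0 < d \<and>
    (\<forall>v\<in>paths. (\<forall>t\<in>K. dist (?V w t) (v t) < d) \<longrightarrow> f (?V w) - e < f v)"
  proof (cases "?V w \<in> U")
   case True
   from openin_uniform_on_compactsD[OF U True] obtain K d where "compact K \<and> K \<subseteq> {0..<1} \<and> 0 < d \<and>
    (\<forall>v\<in>paths. (\<forall>t\<in>K. dist (?V w t) (v t) < d) \<longrightarrow> v \<in> U)" by (elim exE)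
   then show ?thesis using e True by (intro exI[of _ K] exI[of _ d]) (simp add: f_def)
  next
   case False
   then have "f (?V w) - e < f v" for v using e by (simp add: f_def indicator_def)
   then show ?thesis by (intro exI[of _ "{}"] exI[of _ 1]) simp
  qed
 qed (use f_bdd in auto)
 have "(\<lambda>w. inf_conv f m (?V w)) \<in> borel_measurable M" for m
 proof (rule borel_measurable_LIMSEQ_metric)
  let ?T = "1 - 1 / (real m + 1)"
  note Lip = inf_conv_Lipschitz[of f 1 m, OF f_bdd]
  note cm = path_Lipschitz_continuous_map[OF Lip time_horizon]
  show "(\<lambda>w. inf_conv f m (?s K w)) \<in> borel_measurable M" for K
   by (rule continuous_map_borel_of[OF measurable_step_path[where N=K] cm]) (use meas_q fl in auto)
  fix w assume w: "w \<in> space M"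
  have Tsub: "{0..?T} \<subseteq> {0..<1}" using time_horizon(2)[of m] by (simp only: atLeastAtMost_subseteq_atLeastLessThan_iff) simp
  have "continuous_on {0..?T} (\<lambda>t. Y t w)"
   by (rule continuous_on_subset[OF cont[OF w] Tsub])
  then have uc: "uniformly_continuous_on {0..?T} (\<lambda>t. Y t w)"
   by (rule compact_uniformly_continuous) simp
  show "(\<lambda>K. inf_conv f m (?s K w)) \<longlonglongrightarrow> inf_conv f m (?V w)"
  proof (rule metric_LIMSEQ_I)
   fix e :: real assume e: "e > 0"
   define d where "d = e / (real m + 1)"
   have d: "d > 0" using e by (simp add: d_def)
   obtain \<delta> where \<delta>: "\<delta> > 0"
    "\<And>s t. s \<in> {0..?T} ==> t \<in> {0..?T} ==> dist s t < \<delta> ==> dist (Y s w) (Y t w) < d"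
    using uc d unfolding uniformly_continuous_on_def by metis
   obtain N where N: "real N > 1 / \<delta>" using reals_Archimedean2 by blast
   have "dist (inf_conv f m (?s K w)) (inf_conv f m (?V w)) < e" if K: "K \<ge> N" for K
   proof -
    have "path_dist ?T (?s K w) (?V w) \<le> d"
    proof (rule path_dist_least[OF time_horizon(1)])
     fix t assume t: "t \<in> {0..?T}"
     then have t1: "t \<in> {0..<1}" using Tsub by blast
     let ?i = "nat \<lfloor>real (Suc K) * t\<rfloor>"
     have i: "real ?i \<le> real (Suc K) * t" "real (Suc K) * t < real ?i + 1"
      using t1 by (auto simp: of_nat_nat) linarith?
     have le: "real ?i / real (Suc K) \<le> t" using i(1) by (simp add: field_simps)
     have "t - real ?i / real (Suc K) < 1 / real (Suc K)" using i(2) by (simp add: divide_simps mult.commute)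
     also have "\<dots> < \<delta>"
     proof -
      have "1 / \<delta> < real (Suc K)" using N K by simp
      then show ?thesis using \<delta>(1) by (simp add: field_simps)
     qed
     finally have "dist (Y (real ?i / real (Suc K)) w) (Y t w) < d"
      using le t by (intro \<delta>(2)) (auto simp: dist_real_def)
     moreover have "?s K w t = Y (real ?i / real (Suc K)) w"
      using t1 fl[OF t1, of K] by (simp add: less_Suc_eq_le)
     ultimately show "min 1 (dist (?s K w t) (?V w t)) \<le> d"
      using t1 by (simp add: min.coboundedI2)
    qed
    then have "\<bar>inf_conv f m (?s K w) - inf_conv f m (?V w)\<bar> \<le> real m * d"
     using Lip unfolding path_Lipschitz_def
     by (smt (verit, best) mult_left_mono of_nat_0_le_iff restrict_PiE_iff UNIV_I)
    also have "\<dots> < e" using e by (simp add: d_def field_simps)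
    finally show ?thesis by (simp add: dist_real_def)
   qed
   then show "\<exists>N. \<forall>K\<ge>N. dist (inf_conv f m (?s K w)) (inf_conv f m (?V w)) < e" by blast
  qed
 qed
 then have "(\<lambda>w. f (?V w)) \<in> borel_measurable M"
  by (rule borel_measurable_LIMSEQ_real[OF lim])
 then have "(\<lambda>w. f (?V w)) -` {1} \<inter> space M \<in> sets M"
  by (rule measurable_sets) simp
 also have "(\<lambda>w. f (?V w)) -` {1} \<inter> space M = ?V -` U \<inter> space M"
  by (auto simp: f_def indicator_def split: if_splits)
 finally show "?V -` U \<inter> space M \<in> sets M" .
qed auto

text \<open>
 A bounded continuous \<open>f\<close> is the pointwise limit of its Lipschitz minorants. Under the limit law their
 expectations come close to that of \<open>f\<close> by dominated convergence; since they lie below \<open>f\<close>, this bounds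
 the expectations of \<open>f\<close> from below in the limit. The upper bound is the same argument for \<open>- f\<close>.
\<close>

lemma converges_in_distribution_if_Lipschitz:
 fixes U :: "nat => 'a => real => 'v::metric_space"
 assumes M: "\<And>n. prob_space (M n)" and P: "prob_space P"
  and U: "\<And>n. U n \<in> measurable (M n) (borel_of (uniform_on_compacts {0..<1}))"
  and V: "V \<in> measurable P (borel_of (uniform_on_compacts {0..<1}))"
  and Lip: "\<And>T L \<phi>. 0 \<le> T ==> T < 1 ==> path_Lipschitz T L \<phi> ==>
    (\<lambda>n. \<integral>x. \<phi> (U n x) \<partial>M n) \<longlonglongrightarrow> (\<integral>y. \<phi> (V y) \<partial>P)"
 shows "converges_in_distribution (uniform_on_compacts {0..<1}) M U P V"
proof -
 let ?X = "uniform_on_compacts {0..<1} :: (real => 'v) topology"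
 have Us: "U n x \<in> paths" if "x \<in> space (M n)" for n x
  using measurable_space[OF U that] by (simp add: borel_of_def space_measure_of_conv)
 have Vs: "V y \<in> paths" if "y \<in> space P" for y
  using measurable_space[OF V that] by (simp add: borel_of_def space_measure_of_conv)
 have lower: "\<forall>e>0. \<forall>\<^sub>F n in sequentially. (\<integral>y. f (V y) \<partial>P) - e < (\<integral>x. f (U n x) \<partial>M n)"
  if f: "continuous_map ?X euclideanreal f" and C: "\<And>v. v \<in> paths ==> \<bar>f v\<bar> \<le> C" for f C
 proof (intro allI impI)
  fix e :: real assume e: "e > 0"
  interpret P: prob_space P by fact
  note cm = path_Lipschitz_continuous_map[OF inf_conv_Lipschitz[of f C, OF C] time_horizon]
  note mV = continuous_map_borel_of[OF V cm]
  have "(\<lambda>m. \<integral>y. inf_conv f m (V y) \<partial>P) \<longlonglongrightarrow> (\<integral>y. f (V y) \<partial>P)"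
  proof (rule integral_dominated_convergence[where w="\<lambda>_. C"])
   show "AE y in P. (\<lambda>m. inf_conv f m (V y)) \<longlonglongrightarrow> f (V y)"
   proof (rule AE_I2, rule inf_conv_tendsto[of f C])
    fix y e assume y: "y \<in> space P" and e: "(e::real) > 0"
    have op: "openin ?X {v \<in> topspace ?X. f v \<in> {f (V y) - e<..}}"
     by (rule f[unfolded continuous_map, THEN conjunct2, rule_format]) simp
    have mem: "V y \<in> {v \<in> topspace ?X. f v \<in> {f (V y) - e<..}}" using Vs[OF y] e by simp
    from openin_uniform_on_compactsD[OF op mem] obtain K d where Kd: "compact K \<and> K \<subseteq> {0..<1} \<and> 0 < d \<and>
     (\<forall>v\<in>paths. (\<forall>t\<in>K. dist (V y t) (v t) < d) \<longrightarrow> v \<in> {v \<in> topspace ?X. f v \<in> {f (V y) - e<..}})"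
     by (elim exE)
    then show "\<exists>K d. compact K \<and> K \<subseteq> {0..<1} \<and> 0 < d \<and>
     (\<forall>v\<in>paths. (\<forall>t\<in>K. dist (V y t) (v t) < d) \<longrightarrow> f (V y) - e < f v)"
     by (intro exI[of _ K] exI[of _ d]) simp
   qed (use C Vs in auto)
   show "AE y in P. norm (inf_conv f m (V y)) \<le> C" for m
    using inf_conv_abs_le[of f C, OF C] Vs by (intro AE_I2) auto
  qed (use mV continuous_map_borel_of[OF V f] in auto)
  then have "\<forall>\<^sub>F m in sequentially. (\<integral>y. f (V y) \<partial>P) - e < (\<integral>y. inf_conv f m (V y) \<partial>P)"
   by (rule order_tendstoD) (use e in simp)
  then obtain m where m: "(\<integral>y. f (V y) \<partial>P) - e < (\<integral>y. inf_conv f m (V y) \<partial>P)"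
   using eventually_happens'[OF sequentially_bot] by blast
  have "\<forall>\<^sub>F n in sequentially. (\<integral>y. f (V y) \<partial>P) - e < (\<integral>x. inf_conv f m (U n x) \<partial>M n)"
   using order_tendstoD(1)[OF Lip[OF time_horizon inf_conv_Lipschitz[of f C, OF C]] m] by simp
  then show "\<forall>\<^sub>F n in sequentially. (\<integral>y. f (V y) \<partial>P) - e < (\<integral>x. f (U n x) \<partial>M n)"
  proof eventually_elim
   case (elim n)
   interpret Mn: prob_space "M n" by fact
   have "(\<integral>x. inf_conv f m (U n x) \<partial>M n) \<le> (\<integral>x. f (U n x) \<partial>M n)"
   proof (rule integral_mono)
    show "integrable (M n) (\<lambda>x. inf_conv f m (U n x))"
     by (rule Mn.integrable_const_bound[of _ C])
       (use inf_conv_abs_le[of f C, OF C] Us continuous_map_borel_of[OF U cm] in auto)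
    show "integrable (M n) (\<lambda>x. f (U n x))"
     by (rule Mn.integrable_const_bound[of _ C])
       (use C Us continuous_map_borel_of[OF U f] in auto)
   qed (use inf_conv_le[of f C, OF C] Us in auto)
   with elim show ?case by linarith
  qed
 qed
 have "(\<lambda>n. \<integral>x. f (U n x) \<partial>M n) \<longlonglongrightarrow> (\<integral>y. f (V y) \<partial>P)"
  if f: "continuous_map ?X euclideanreal f" and b: "bounded (f ` topspace ?X)" for f
 proof -
  obtain C where C: "\<And>v. v \<in> paths ==> \<bar>f v\<bar> \<le> C" using b by (auto simp: bounded_iff)
  have f': "continuous_map ?X euclideanreal (\<lambda>v. - f v)" using f by (rule continuous_map_minus)
  show ?thesis
  proof (rule order_tendstoI)
   fix a assume "a < (\<integral>y. f (V y) \<partial>P)"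
   then show "\<forall>\<^sub>F n in sequentially. a < (\<integral>x. f (U n x) \<partial>M n)"
    using lower[OF f C, rule_format, of "(\<integral>y. f (V y) \<partial>P) - a"] by simp
  next
   fix a assume "(\<integral>y. f (V y) \<partial>P) < a"
   then show "\<forall>\<^sub>F n in sequentially. (\<integral>x. f (U n x) \<partial>M n) < a"
    using lower[OF f', of C, rule_format, of "a - (\<integral>y. f (V y) \<partial>P)"] C by simp
  qed
 qed
 then show ?thesis unfolding converges_in_distribution_def using U V by blast
qed
section \<open>Sums of martingale noise\<close>

abbreviation (in prob_space) moment2 :: "('a \<Rightarrow> 'v::real_normed_vector) \<Rightarrow> real" where
 "moment2 f \<equiv> expectation (\<lambda>w. (norm (f w))^2)"

text \<open>
 Once a partial sum has reached norm \<open>a\<close>, the stopped sum does not change any more.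
\<close>

lemma stopped_sum_reaches:
 fixes g :: "nat => 'v::real_normed_vector"
 assumes "\<exists>m\<le>n. a \<le> norm (\<Sum>i<m. g i)"
 shows "a \<le> norm (\<Sum>i<n. if \<forall>m\<le>i. norm (\<Sum>j<m. g j) < a then g i else 0)"
proof -
 define m where "m = (LEAST m. a \<le> norm (\<Sum>i<m. g i))"
 obtain m0 where m0: "m0 \<le> n" "a \<le> norm (\<Sum>i<m0. g i)" using assms by blast
 have m: "a \<le> norm (\<Sum>i<m. g i)" unfolding m_def by (rule LeastI[of _ m0]) (rule m0)
 have mn: "m \<le> n" unfolding m_def by (rule order_trans[OF Least_le m0(1)]) (rule m0)
 have less: "norm (\<Sum>i<j. g i) < a" if "j < m" for j
  using not_less_Least[of j "\<lambda>m. a \<le> norm (\<Sum>i<m. g i)"] that unfolding m_def by simp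
 have "(\<forall>k\<le>i. norm (\<Sum>j<k. g j) < a) \<longleftrightarrow> i < m" for i
  using less m by (meson leD le_less_trans not_le)
 then have "(\<Sum>i<n. if \<forall>m\<le>i. norm (\<Sum>j<m. g j) < a then g i else 0) = (\<Sum>i<n. if i < m then g i else 0)"
  by simp
 also have "\<dots> = (\<Sum>i<m. g i)"
  using mn by (subst sum.inter_filter[symmetric]) (auto intro!: sum.cong)
 finally show ?thesis using m by simp
qed

lemma truncated_sum_le:
 fixes a :: "nat => real"
 assumes "\<And>i. 0 \<le> a i" "0 \<le> c"
 shows "(\<Sum>i<n. if (\<Sum>j\<le>i. a j) \<le> c then a i else 0) \<le> c"
proof (induction n)
 case (Suc n)
 show ?case
 proof (cases "(\<Sum>j\<le>n. a j) \<le> c")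
  case True
  have "(\<Sum>j\<le>i. a j) \<le> c" if "i \<le> n" for i
   using sum_mono2[of "{..n}" "{..i}" a] assms(1) that True by force
  then have "(\<Sum>i<Suc n. if (\<Sum>j\<le>i. a j) \<le> c then a i else 0) = (\<Sum>j\<le>n. a j)"
   by (auto simp: lessThan_Suc_atMost intro!: sum.cong)
  then show ?thesis using True by simp
 qed (use Suc in simp)
qed (use assms in simp)

text \<open>
 Taylor's formula for \<open>\<bar>x\<bar>\<^sup>3\<close>, of which only an upper bound is needed. If \<open>y\<close> is centred given \<open>x\<close>, the second term has
 mean \<open>0\<close>.
\<close>

lemma abs_add_cubed_le:
 fixes x y :: real
 shows "\<bar>x + y\<bar>^3 \<le> \<bar>x\<bar>^3 + 3 * (x * \<bar>x\<bar>) * y + 3 * \<bar>x\<bar> * y^2 + \<bar>y\<bar>^3"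
proof -
 have *: "\<bar>x + y\<bar>^3 \<le> \<bar>x\<bar>^3 + 3 * (x * \<bar>x\<bar>) * y + 3 * \<bar>x\<bar> * y^2 + \<bar>y\<bar>^3" if x: "0 \<le> x" for x y :: real
 proof (cases "x + y \<ge> 0")
  case True
  have "y^3 \<le> \<bar>y\<bar>^3" by (simp add: power_abs[symmetric])
  then show ?thesis using True x by (simp add: power3_eq_cube power2_eq_square algebra_simps)
 next
  case False
  define t where "t = - y"
  have t: "t \<ge> 0" using False x by (simp add: t_def)
  have "0 \<le> 2 * x * ((x - 3/2 * t)^2 + 3/4 * t^2)" using x by simp
  then have "(t - x)^3 \<le> x^3 - 3 * x^2 * t + 3 * x * t^2 + t^3"
   by (simp add: power3_eq_cube power2_eq_square algebra_simps)
  moreover have "\<bar>x + y\<bar> = t - x" "\<bar>y\<bar> = t" "\<bar>x\<bar> = x" "y = - t" using False x by (auto simp: t_def)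
  ultimately show ?thesis by (simp only:) (simp add: power2_eq_square algebra_simps)
 qed
 show ?thesis
 proof (cases "0 \<le> x")
  case False
  then show ?thesis using *[of "-x" "-y"] by (simp add: abs_minus_commute add.commute)
 qed (rule *)
qed

lemma norm_add_sq_le: "(norm (x + y))^2 \<le> 2 * (norm x)^2 + 2 * (norm y)^2" for x y :: "'v::real_normed_vector"
proof -
 have "(norm (x + y))^2 \<le> (norm x + norm y)^2" by (intro power_mono norm_triangle_ineq) auto
 also have "\<dots> \<le> 2 * (norm x)^2 + 2 * (norm y)^2"
  using zero_le_power2[of "norm x - norm y"] by (simp add: power2_eq_square algebra_simps)
 finally show ?thesis .
qed

lemma norm_sum_sq_le:
 "finite I ==> (norm (\<Sum>i\<in>I. f i))^2 \<le> real (card I) * (\<Sum>i\<in>I. (norm (f i :: 'v::real_normed_vector))^2)"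
proof -
 assume "finite I"
 have "(norm (\<Sum>i\<in>I. f i))^2 \<le> (\<Sum>i\<in>I. norm (f i))^2" by (intro power_mono norm_sum) auto
 also have "\<dots> \<le> (\<Sum>i\<in>I. 1^2) * (\<Sum>i\<in>I. (norm (f i))^2)"
  using Cauchy_Schwarz_ineq_sum[of "\<lambda>_. 1" "\<lambda>i. norm (f i)" I] by simp
 finally show ?thesis by simp
qed

definition sq_integrable :: "'w measure => ('w => 'v::euclidean_space) => bool" where
 "sq_integrable P f \<longleftrightarrow> f \<in> borel_measurable P \<and> integrable P (\<lambda>w. (norm (f w))^2)"

lemma sq_integrable_add:
 assumes "sq_integrable P f" "sq_integrable P g" shows "sq_integrable P (\<lambda>w. f w + g w)"
 unfolding sq_integrable_def
proof (intro conjI)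
 have [measurable]: "f \<in> borel_measurable P" "g \<in> borel_measurable P"
  using assms by (auto simp: sq_integrable_def)
 show "(\<lambda>w. f w + g w) \<in> borel_measurable P" by measurable
 show "integrable P (\<lambda>w. (norm (f w + g w))^2)"
 proof (rule Bochner_Integration.integrable_bound)
  show "integrable P (\<lambda>w. 2 * (norm (f w))^2 + 2 * (norm (g w))^2)"
   using assms by (auto simp: sq_integrable_def)
 qed (use norm_add_sq_le[of "f _" "g _"] in auto)
qed

lemma sq_integrable_bound:
 assumes g: "sq_integrable P g" and f: "f \<in> borel_measurable P"
  and le: "\<And>w. w \<in> space P ==> norm (f w) \<le> C * norm (g w)"
 shows "sq_integrable P f"
 unfolding sq_integrable_def
proof (rule conjI[OF f], rule Bochner_Integration.integrable_bound)
 show "integrable P (\<lambda>w. C^2 * (norm (g w))^2)" using g by (auto simp: sq_integrable_def)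
 show "AE w in P. norm ((norm (f w))^2) \<le> norm (C^2 * (norm (g w))^2)"
  using power_mono[OF le, where n=2] by (intro AE_I2) (simp add: power_mult_distrib)
 show "(\<lambda>w. (norm (f w))^2) \<in> borel_measurable P" using f by simp
qed

lemma sq_integrable_scaleR: "sq_integrable P f ==> sq_integrable P (\<lambda>w. c *\<^sub>R f w)"
 by (rule sq_integrable_bound[of P f _ "\<bar>c\<bar>"]) (auto simp: sq_integrable_def)

lemma (in finite_measure) sq_integrable_const: "sq_integrable M (\<lambda>w. c)"
 by (simp add: sq_integrable_def)

lemma sq_integrable_sum:
 assumes "finite I" "\<And>i. i \<in> I ==> sq_integrable P (f i)" "finite_measure P"
 shows "sq_integrable P (\<lambda>w. \<Sum>i\<in>I. f i w)"
 using assms(1,2)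
 by (induction I rule: finite_induct)
   (auto intro: sq_integrable_add finite_measure.sq_integrable_const[OF assms(3)])

lemma sq_integrable_inner:
 fixes f g :: "'w => 'v::euclidean_space"
 assumes "sq_integrable P f" "sq_integrable P g"
 shows "integrable P (\<lambda>w. f w \<bullet> g w)"
proof (rule Bochner_Integration.integrable_bound)
 show "integrable P (\<lambda>w. (norm (f w))^2 + (norm (g w))^2)"
  using assms by (auto simp: sq_integrable_def)
 have "\<bar>x \<bullet> y\<bar> \<le> (norm x)^2 + (norm y)^2" for x y :: 'v
 proof -
  have "\<bar>x \<bullet> y\<bar> \<le> norm x * norm y" by (rule Cauchy_Schwarz_ineq2)
  also have "2 * (norm x * norm y) \<le> (norm x)^2 + (norm y)^2"
   using zero_le_power2[of "norm x - norm y"] by (simp add: power2_eq_square algebra_simps)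
  then have "norm x * norm y \<le> (norm x)^2 + (norm y)^2"
   using zero_le_power2[of "norm x"] zero_le_power2[of "norm y"] by linarith
  finally show ?thesis .
 qed
 then show "AE w in P. norm (f w \<bullet> g w) \<le> norm ((norm (f w))^2 + (norm (g w))^2)" by auto
qed (use assms in \<open>auto simp: sq_integrable_def\<close>)

lemma (in prob_space) sq_integrable_norm:
 assumes "sq_integrable M f" shows "integrable M (\<lambda>w. norm (f w))"
proof (rule Bochner_Integration.integrable_bound)
 show "integrable M (\<lambda>w. 1 + (norm (f w))^2)" using assms by (simp add: sq_integrable_def)
 have "x \<le> 1 + x^2" for x :: real
  using zero_le_power2[of "x - 1/2"] by (simp add: power2_eq_square algebra_simps)
 then show "AE w in M. norm (norm (f w)) \<le> norm (1 + (norm (f w))^2)" by auto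
 show "(\<lambda>w. norm (f w)) \<in> borel_measurable M" using assms by (auto simp: sq_integrable_def)
qed

lemma (in prob_space) prob_norm_ge_le:
 assumes "sq_integrable M f" "0 < a" "moment2 f \<le> c"
 shows "prob {w \<in> space M. a \<le> norm (f w)} \<le> c / a^2"
proof -
 have "prob {w \<in> space M. a \<le> norm (f w)} = prob {w \<in> space M. a^2 \<le> (norm (f w))^2}"
  using assms(2) by (intro arg_cong[where f=prob]) (auto simp: power2_le_iff_abs_le)
 also have "\<dots> \<le> moment2 f / a^2"
  using assms by (intro integral_Markov_inequality_measure[where A="{}"]) (auto simp: sq_integrable_def)
 also have "\<dots> \<le> c / a^2" using assms(3) by (rule divide_right_mono) simp
 finally show ?thesis .
qed

lemma Int_stable_vimage: "Int_stable {X -` A \<inter> S | A. A \<in> sets N}"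
proof (rule Int_stableI, safe)
 fix A B assume "A \<in> sets N" "B \<in> sets N"
 then show "\<exists>C. X -` A \<inter> S \<inter> (X -` B \<inter> S) = X -` C \<inter> S \<and> C \<in> sets N"
  by (intro exI[of _ "A \<inter> B"]) auto
qed

text \<open>
 Martingale differences with conditional variances at most \<open>v\<^sub>k\<close>, where conditioning on \<open>F\<^sub>k\<close> is expressed by
 multiplication with \<open>F\<^sub>k\<close>-measurable test functions. Increments of Brownian motion on a grid, the
 independent variables of the model and their sums over blocks all have these properties.
\<close>

locale noise_sequence = prob_space P for P :: "'w measure" +
 fixes F :: "nat => 'w measure" and b :: "nat => 'w => real" and v :: "nat => real" and N :: nat
 assumes space_F: "\<And>k. k \<le> N ==> space (F k) = space P"
  and sets_F: "\<And>k. k \<le> N ==> sets (F k) \<subseteq> sets P"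
  and mono_F: "\<And>k l. k \<le> l ==> l \<le> N ==> sets (F k) \<subseteq> sets (F l)"
  and b_adapted: "\<And>k. k < N ==> b k \<in> borel_measurable (F (Suc k))"
  and b_times: "\<And>k \<eta>. k < N ==> \<eta> \<in> borel_measurable (F k) ==> integrable P \<eta> ==>
   integrable P (\<lambda>w. b k w * \<eta> w) \<and> expectation (\<lambda>w. b k w * \<eta> w) = 0"
  and b_sq_times: "\<And>k \<eta>. k < N ==> \<eta> \<in> borel_measurable (F k) ==> integrable P \<eta> ==> (\<And>w. 0 \<le> \<eta> w) ==>
   integrable P (\<lambda>w. (b k w)^2 * \<eta> w) \<and> expectation (\<lambda>w. (b k w)^2 * \<eta> w) \<le> v k * expectation \<eta>"

lemma (in prob_space) indep_var_if_indep_set: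
 assumes G: "sets G \<subseteq> events" "space G = space M" and X: "X \<in> borel_measurable M"
  and indep: "indep_set (sets G) {X -` A \<inter> space M | A. A \<in> sets borel}"
  and \<eta>: "\<eta> \<in> borel_measurable G"
 shows "indep_var borel \<eta> borel X"
 unfolding indep_var_eq
proof (intro conjI indep_set_sigma_sets)
 show "random_variable borel \<eta>"
  by (rule measurable_mono[THEN subsetD, OF order_refl _ G(1) _ \<eta>]) (use G in auto)
 have "{\<eta> -` A \<inter> space M |A. A \<in> sets borel} \<subseteq> sets G"
  using measurable_sets[OF \<eta>] G(2) by auto
 then show "indep_set {\<eta> -` A \<inter> space M |A. A \<in> sets borel} {X -` A \<inter> space M |A. A \<in> sets borel}"
  using indep unfolding indep_sets2_eq by blast
qed (rule X Int_stable_vimage)+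

lemma (in prob_space) noise_if_indep:
 assumes space_F: "\<And>k. k \<le> N ==> space (F k) = space M"
  and sets_F: "\<And>k. k \<le> N ==> sets (F k) \<subseteq> events"
  and mono_F: "\<And>k l. k \<le> l ==> l \<le> N ==> sets (F k) \<subseteq> sets (F l)"
  and b_adapted: "\<And>k. k < N ==> b k \<in> borel_measurable (F (Suc k))"
  and b_indep: "\<And>k. k < N ==> indep_set (sets (F k)) {b k -` A \<inter> space M | A. A \<in> sets borel}"
  and b_sq: "\<And>k. k < N ==> integrable M (\<lambda>w. (b k w)^2)"
  and b_mean: "\<And>k. k < N ==> expectation (b k) = 0"
  and b_var: "\<And>k. k < N ==> expectation (\<lambda>w. (b k w)^2) \<le> v k"
 shows "noise_sequence M F b v N"
proof (intro noise_sequence.intro noise_sequence_axioms.intro prob_space_axioms space_F sets_F mono_F b_adapted)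
 fix k and \<eta> :: "'a => real" assume k: "k < N" and \<eta>: "\<eta> \<in> borel_measurable (F k)" "integrable M \<eta>"
 have "sets (F (Suc k)) \<subseteq> events" "space (F (Suc k)) = space M" using sets_F[of "Suc k"] space_F[of "Suc k"] k by auto
 then have bm: "b k \<in> borel_measurable M"
  by (intro measurable_mono[THEN subsetD, OF order_refl _ _ _ b_adapted[OF k]]) auto
 have bi: "integrable M (b k)" by (rule square_integrable_imp_integrable[OF bm b_sq[OF k]])
 have i: "indep_var borel \<eta> borel (b k)"
  by (rule indep_var_if_indep_set[OF _ _ bm b_indep[OF k] \<eta>(1)]) (use sets_F[of k] space_F[of k] k in auto)
 show "integrable M (\<lambda>w. b k w * \<eta> w) \<and> expectation (\<lambda>w. b k w * \<eta> w) = 0"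
  using indep_var_integrable[OF i \<eta>(2) bi] indep_var_lebesgue_integral[OF i \<eta>(2) bi] b_mean[OF k]
  by (simp add: mult.commute)
 assume pos: "\<And>w. 0 \<le> \<eta> w"
 have i2: "indep_var borel \<eta> borel (\<lambda>w. (b k w)^2)"
  using indep_var_compose[OF i, of "\<lambda>x. x" borel "\<lambda>x. x^2" borel] by (simp add: comp_def)
 have "expectation (\<lambda>w. (b k w)^2) * expectation \<eta> \<le> v k * expectation \<eta>"
  using b_var[OF k] pos by (intro mult_right_mono integral_nonneg_AE) auto
 then show "integrable M (\<lambda>w. (b k w)^2 * \<eta> w) \<and> expectation (\<lambda>w. (b k w)^2 * \<eta> w) \<le> v k * expectation \<eta>"
  using indep_var_integrable[OF i2 \<eta>(2) b_sq[OF k]] indep_var_lebesgue_integral[OF i2 \<eta>(2) b_sq[OF k]]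
  by (simp add: mult.commute)
qed

context noise_sequence begin

lemma b_var: assumes "k < N" shows "expectation (\<lambda>w. (b k w)^2) \<le> v k"
proof -
 have "expectation (\<lambda>w. (b k w)^2 * 1) \<le> v k * expectation (\<lambda>_. 1)"
  by (rule b_sq_times[OF assms, THEN conjunct2]) auto
 then show ?thesis by (simp add: prob_space)
qed

lemma b_sq: assumes "k < N" shows "integrable P (\<lambda>w. (b k w)^2)"
proof -
 have "integrable P (\<lambda>w. (b k w)^2 * 1)" by (rule b_sq_times[OF assms, THEN conjunct1]) auto
 then show ?thesis by simp
qed

lemma v_nonneg: "k < N ==> 0 \<le> v k"
 using order_trans[OF integral_nonneg_AE b_var] by auto

lemma measurable_F_mono:
 assumes "f \<in> borel_measurable (F k)" "k \<le> l" "l \<le> N" shows "f \<in> borel_measurable (F l)"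
 by (rule measurable_mono[THEN subsetD, OF order_refl _ mono_F _ assms(1)])
   (use assms space_F in auto)

lemma measurable_F: assumes "f \<in> borel_measurable (F k)" "k \<le> N" shows "f \<in> borel_measurable P"
 by (rule measurable_mono[THEN subsetD, OF order_refl _ sets_F _ assms(1)])
   (use assms space_F in auto)

lemma b_measurable: "k < N ==> b k \<in> borel_measurable P"
 using measurable_F[OF b_adapted] by simp

lemma b_scaleR_sq_integrable:
 fixes \<xi> :: "'w => 'v::euclidean_space"
 assumes k: "k < N" and \<xi>: "\<xi> \<in> borel_measurable (F k)" "sq_integrable P \<xi>"
 shows "sq_integrable P (\<lambda>w. b k w *\<^sub>R \<xi> w)"
  "moment2 (\<lambda>w. b k w *\<^sub>R \<xi> w) \<le> v k * moment2 \<xi>"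
proof -
 have [measurable]: "\<xi> \<in> borel_measurable P" "b k \<in> borel_measurable P"
  using \<xi> b_measurable[OF k] by (auto simp: sq_integrable_def)
 have eq: "(norm (b k w *\<^sub>R \<xi> w))^2 = (b k w)^2 * (norm (\<xi> w))^2" for w
  by (simp add: power_mult_distrib)
 have n: "(\<lambda>w. (norm (\<xi> w))^2) \<in> borel_measurable (F k)" using \<xi>(1) by simp
 have i: "integrable P (\<lambda>w. (norm (\<xi> w))^2)" using \<xi>(2) by (simp add: sq_integrable_def)
 show "sq_integrable P (\<lambda>w. b k w *\<^sub>R \<xi> w)"
  unfolding sq_integrable_def eq using b_sq_times[OF k n i] by simp
 show "moment2 (\<lambda>w. b k w *\<^sub>R \<xi> w) \<le> v k * moment2 \<xi>"
  unfolding eq using b_sq_times[OF k n i] by simp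
qed

text \<open>
 The inner product of two \<open>F\<^sub>k\<close>-measurable vectors is a test function for \<open>b\<^sub>k\<close>.
\<close>

lemma b_scaleR_orthogonal:
 fixes \<xi> x :: "'w => 'v::euclidean_space"
 assumes k: "k < N" and \<xi>: "\<xi> \<in> borel_measurable (F k)" "sq_integrable P \<xi>"
  and x: "x \<in> borel_measurable (F k)" "sq_integrable P x"
 shows "integrable P (\<lambda>w. x w \<bullet> (b k w *\<^sub>R \<xi> w))" "expectation (\<lambda>w. x w \<bullet> (b k w *\<^sub>R \<xi> w)) = 0"
proof -
 have m: "(\<lambda>w. x w \<bullet> \<xi> w) \<in> borel_measurable (F k)" using \<xi>(1) x(1) by simp
 show "integrable P (\<lambda>w. x w \<bullet> (b k w *\<^sub>R \<xi> w))" "expectation (\<lambda>w. x w \<bullet> (b k w *\<^sub>R \<xi> w)) = 0"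
  using b_times[OF k m sq_integrable_inner[OF x(2) \<xi>(2)]] by simp_all
qed

lemma noise_sum_adapted:
 fixes \<xi> :: "nat => 'w => 'v::euclidean_space"
 assumes "n \<le> N" "\<And>i. i < n ==> \<xi> i \<in> borel_measurable (F i)"
 shows "(\<lambda>w. \<Sum>i<n. b i w *\<^sub>R \<xi> i w) \<in> borel_measurable (F n)"
proof (intro borel_measurable_sum borel_measurable_scaleR)
 fix i assume "i \<in> {..<n}"
 then show "b i \<in> borel_measurable (F n)" "\<xi> i \<in> borel_measurable (F n)"
  using assms measurable_F_mono[OF b_adapted, of i n] measurable_F_mono[of "\<xi> i" i n] by auto
qed

lemma noise_sum_sq:
 fixes \<xi> :: "nat => 'w => 'v::euclidean_space"
 assumes "n \<le> N" "\<And>i. i < n ==> \<xi> i \<in> borel_measurable (F i)" "\<And>i. i < n ==> sq_integrable P (\<xi> i)"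
 shows "sq_integrable P (\<lambda>w. \<Sum>i<n. b i w *\<^sub>R \<xi> i w)"
  "moment2 (\<lambda>w. \<Sum>i<n. b i w *\<^sub>R \<xi> i w) \<le> (\<Sum>i<n. v i * moment2 (\<xi> i))"
 using assms
proof (induction n)
 case 0
 { case 1 show ?case by (simp add: sq_integrable_def) }
 { case 2 show ?case by simp }
next
 case (Suc n)
 let ?S = "\<lambda>w. \<Sum>i<n. b i w *\<^sub>R \<xi> i w" and ?d = "\<lambda>w. b n w *\<^sub>R \<xi> n w"
 {
  case prems: 1
  then have n: "n < N" and S: "sq_integrable P ?S" using Suc.IH(1) by auto
  have d: "sq_integrable P ?d" using prems n by (intro b_scaleR_sq_integrable) auto
  show ?case using sq_integrable_add[OF S d] by simp
 next
  case prems: 2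
  then have n: "n < N" and S: "sq_integrable P ?S" using Suc.IH(1) by auto
  have d: "sq_integrable P ?d" "moment2 ?d \<le> v n * moment2 (\<xi> n)"
   using prems n by (intro b_scaleR_sq_integrable; auto)+
  have Sa: "?S \<in> borel_measurable (F n)" using prems by (intro noise_sum_adapted) auto
  have o: "integrable P (\<lambda>w. ?S w \<bullet> ?d w)" "expectation (\<lambda>w. ?S w \<bullet> ?d w) = 0"
   using prems n by (intro b_scaleR_orthogonal Sa S; auto)+
  have eq: "(norm (\<Sum>i<Suc n. b i w *\<^sub>R \<xi> i w))^2 = (norm (?S w))^2 + 2 * (?S w \<bullet> ?d w) + (norm (?d w))^2" for w
   by (simp only: sum.lessThan_Suc power2_norm_eq_inner inner_add_left inner_add_right inner_commute[of "?d w" "?S w"])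
  have "moment2 (\<lambda>w. \<Sum>i<Suc n. b i w *\<^sub>R \<xi> i w)
    = moment2 ?S + moment2 ?d"
   unfolding eq using S d(1) o by (simp add: sq_integrable_def)
  also have "\<dots> \<le> (\<Sum>i<n. v i * moment2 (\<xi> i)) + v n * moment2 (\<xi> n)"
   using Suc.IH(2) prems d(2) by (intro add_mono) auto
  finally show ?case by simp
 }
qed

lemma stopped_coeff_measurable:
 fixes \<xi> :: "nat => 'w => 'v::euclidean_space"
 assumes "n \<le> N" "\<And>i. i < n ==> \<xi> i \<in> borel_measurable (F i)" "i < n"
 shows "(\<lambda>w. if \<forall>m\<le>i. norm (\<Sum>j<m. b j w *\<^sub>R \<xi> j w) < a then \<xi> i w else 0) \<in> borel_measurable (F i)"
proof -
 have [measurable]: "(\<lambda>w. \<Sum>j<m. b j w *\<^sub>R \<xi> j w) \<in> borel_measurable (F i)" if "m \<le> i" for m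
  by (rule measurable_F_mono[OF noise_sum_adapted]) (use assms that in auto)
 have [measurable]: "\<xi> i \<in> borel_measurable (F i)" using assms by auto
 have [measurable]: "{w \<in> space (F i). \<forall>m\<le>i. norm (\<Sum>j<m. b j w *\<^sub>R \<xi> j w) < a} \<in> sets (F i)"
 proof -
  have "{w \<in> space (F i). \<forall>m\<in>{..i}. norm (\<Sum>j<m. b j w *\<^sub>R \<xi> j w) < a} \<in> sets (F i)"
   by (rule sets.sets_Collect_finite_All') auto
  then show ?thesis by (simp add: Ball_def)
 qed
 show ?thesis by measurable
qed

text \<open>
 Kolmogorov's inequality: stopping turns the maximum of the partial sums into the final value of another
 noise sum with adapted coefficients, to which Chebyshev's inequality applies.
\<close>

lemma maximal_inequality:
 fixes \<xi> :: "nat => 'w => 'v::euclidean_space"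
 assumes n: "n \<le> N" and \<xi>: "\<And>i. i < n ==> \<xi> i \<in> borel_measurable (F i)" "\<And>i. i < n ==> sq_integrable P (\<xi> i)"
  and a: "0 < a"
 shows "prob {w \<in> space P. \<exists>m\<le>n. a \<le> norm (\<Sum>i<m. b i w *\<^sub>R \<xi> i w)}
  \<le> (\<Sum>i<n. v i * moment2 (\<xi> i)) / a^2"
proof -
 define \<zeta> where "\<zeta> i w = (if \<forall>m\<le>i. norm (\<Sum>j<m. b j w *\<^sub>R \<xi> j w) < a then \<xi> i w else 0)" for i w
 have \<zeta>m: "\<zeta> i \<in> borel_measurable (F i)" if "i < n" for i
  unfolding \<zeta>_def by (rule stopped_coeff_measurable[OF n \<xi>(1) that])
 have \<zeta>s: "sq_integrable P (\<zeta> i)" if "i < n" for i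
  by (rule sq_integrable_bound[OF \<xi>(2)[OF that], of _ 1])
    (use measurable_F[OF \<zeta>m[OF that]] that n in \<open>auto simp: \<zeta>_def\<close>)
 have sub: "{w \<in> space P. \<exists>m\<le>n. a \<le> norm (\<Sum>i<m. b i w *\<^sub>R \<xi> i w)}
   \<subseteq> {w \<in> space P. a \<le> norm (\<Sum>i<n. b i w *\<^sub>R \<zeta> i w)}"
 proof safe
  fix w m assume "m \<le> n" "a \<le> norm (\<Sum>i<m. b i w *\<^sub>R \<xi> i w)"
  then have "a \<le> norm (\<Sum>i<n. if \<forall>m\<le>i. norm (\<Sum>j<m. b j w *\<^sub>R \<xi> j w) < a then b i w *\<^sub>R \<xi> i w else 0)"
   by (intro stopped_sum_reaches) auto
  also have "(\<Sum>i<n. if \<forall>m\<le>i. norm (\<Sum>j<m. b j w *\<^sub>R \<xi> j w) < a then b i w *\<^sub>R \<xi> i w else 0)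
    = (\<Sum>i<n. b i w *\<^sub>R \<zeta> i w)"
   by (rule sum.cong) (auto simp: \<zeta>_def)
  finally show "a \<le> norm (\<Sum>i<n. b i w *\<^sub>R \<zeta> i w)" .
 qed
 note S = noise_sum_sq[OF n \<zeta>m \<zeta>s]
 have "prob {w \<in> space P. \<exists>m\<le>n. a \<le> norm (\<Sum>i<m. b i w *\<^sub>R \<xi> i w)}
   \<le> prob {w \<in> space P. a \<le> norm (\<Sum>i<n. b i w *\<^sub>R \<zeta> i w)}"
  by (rule finite_measure_mono[OF sub]) (use S(1) in \<open>auto simp: sq_integrable_def\<close>)
 also have "\<dots> \<le> (\<Sum>i<n. v i * moment2 (\<zeta> i)) / a^2"
  by (rule prob_norm_ge_le[OF S(1) a S(2)])
 also have "\<dots> \<le> (\<Sum>i<n. v i * moment2 (\<xi> i)) / a^2"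
 proof (intro divide_right_mono sum_mono mult_left_mono integral_mono)
  fix i assume "i \<in> {..<n}"
  then show "integrable P (\<lambda>w. (norm (\<zeta> i w))^2)" "integrable P (\<lambda>w. (norm (\<xi> i w))^2)" "0 \<le> v i"
   using \<zeta>s \<xi>(2) v_nonneg n by (auto simp: sq_integrable_def)
 qed (auto simp: \<zeta>_def)
 finally show ?thesis .
qed

text \<open>
 The coefficients are set to \<open>0\<close> from the first index on at which the bracket exceeds \<open>c\<close>. The bracket up to and
 including step \<open>i\<close> is \<open>F\<^sub>i\<close>-measurable, so the truncated coefficients are adapted; their bracket is at most \<open>c\<close>,
 and they agree with the original ones unless the full bracket exceeds \<open>c\<close>.
\<close>

lemma Lenglart_inequality:
 fixes \<xi> :: "nat => 'w => 'v::euclidean_space"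
 assumes n: "n \<le> N" and \<xi>: "\<And>i. i < n ==> \<xi> i \<in> borel_measurable (F i)"
  and v: "\<And>i. i < n ==> 0 < v i" and a: "0 < a" and c: "0 \<le> c"
 shows "prob {w \<in> space P. \<exists>m\<le>n. a \<le> norm (\<Sum>i<m. b i w *\<^sub>R \<xi> i w)}
  \<le> prob {w \<in> space P. c < (\<Sum>i<n. v i * (norm (\<xi> i w))^2)} + c / a^2"
proof -
 define q where "q i w = (if i < n then v i * (norm (\<xi> i w))^2 else 0)" for i w
 define \<zeta> where "\<zeta> i w = (if (\<Sum>j\<le>i. q j w) \<le> c then \<xi> i w else 0)" for i w
 have q0: "0 \<le> q i w" for i w using v[of i] by (simp add: q_def less_imp_le)
 have qm: "q j \<in> borel_measurable (F i)" if "j \<le> i" "i < n" for i j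
 proof -
  have "\<xi> j \<in> borel_measurable (F i)" using that n \<xi> by (intro measurable_F_mono[of _ j i]) auto
  then show ?thesis using that unfolding q_def by simp
 qed
 have \<zeta>m: "\<zeta> i \<in> borel_measurable (F i)" if "i < n" for i
 proof -
  have [measurable]: "(\<lambda>w. \<Sum>j\<le>i. q j w) \<in> borel_measurable (F i)" using that qm by auto
  have [measurable]: "\<xi> i \<in> borel_measurable (F i)" using that \<xi> by auto
  show ?thesis unfolding \<zeta>_def by measurable
 qed
 have \<zeta>b: "(norm (\<zeta> i w))^2 \<le> c / v i" if "i < n" for i w
 proof (cases "(\<Sum>j\<le>i. q j w) \<le> c")
  case True
  have "q i w \<le> (\<Sum>j\<le>i. q j w)" using q0 by (intro member_le_sum) auto
  then show ?thesis using True v[OF that] that by (simp add: \<zeta>_def q_def field_simps)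
 qed (use v[OF that] c in \<open>simp add: \<zeta>_def\<close>)
 have \<zeta>s: "sq_integrable P (\<zeta> i)" if "i < n" for i
  unfolding sq_integrable_def
  using measurable_F[OF \<zeta>m[OF that]] n that \<zeta>b[OF that]
  by (auto intro!: integrable_const_bound[of _ "c / v i"])
 have sumle: "(\<Sum>i<n. v i * moment2 (\<zeta> i)) \<le> c"
 proof -
  have int: "integrable P (\<lambda>w. (norm (\<zeta> i w))^2)" if "i < n" for i
   using \<zeta>s[OF that] by (simp add: sq_integrable_def)
  have "(\<Sum>i<n. v i * moment2 (\<zeta> i)) = expectation (\<lambda>w. \<Sum>i<n. v i * (norm (\<zeta> i w))^2)"
   using int by (subst Bochner_Integration.integral_sum) auto
  also have "\<dots> \<le> expectation (\<lambda>w. c)"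
  proof (rule integral_mono)
   show "integrable P (\<lambda>w. \<Sum>i<n. v i * (norm (\<zeta> i w))^2)" using int by auto
   fix w
   have "(\<Sum>i<n. v i * (norm (\<zeta> i w))^2) = (\<Sum>i<n. if (\<Sum>j\<le>i. q j w) \<le> c then q i w else 0)"
    by (rule sum.cong) (auto simp: \<zeta>_def q_def)
   also have "\<dots> \<le> c" by (rule truncated_sum_le[OF q0 c])
   finally show "(\<Sum>i<n. v i * (norm (\<zeta> i w))^2) \<le> c" .
  qed simp
  finally show ?thesis by (simp add: prob_space)
 qed
 let ?A = "{w \<in> space P. c < (\<Sum>i<n. v i * (norm (\<xi> i w))^2)}"
 let ?B = "{w \<in> space P. \<exists>m\<le>n. a \<le> norm (\<Sum>i<m. b i w *\<^sub>R \<zeta> i w)}"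
 have \<xi>P: "\<xi> i \<in> borel_measurable P" if "i < n" for i using measurable_F[OF \<xi>] that n by auto
 have Am: "?A \<in> sets P"
 proof -
  have [measurable]: "(\<lambda>w. \<Sum>i<n. v i * (norm (\<xi> i w))^2) \<in> borel_measurable P" using \<xi>P by auto
  show ?thesis by measurable
 qed
 have Bm: "?B \<in> sets P"
 proof -
  have [measurable]: "(\<lambda>w. \<Sum>i<m. b i w *\<^sub>R \<zeta> i w) \<in> borel_measurable P" if "m \<le> n" for m
   by (rule measurable_F[OF noise_sum_adapted]) (use \<zeta>m that n in auto)
  show ?thesis 
  proof -
   have "{w \<in> space P. \<exists>m\<in>{..n}. a \<le> norm (\<Sum>i<m. b i w *\<^sub>R \<zeta> i w)} \<in> sets P"
    by (rule sets.sets_Collect_finite_Ex) auto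
   then show ?thesis by (simp add: Bex_def)
  qed
 qed
 have "{w \<in> space P. \<exists>m\<le>n. a \<le> norm (\<Sum>i<m. b i w *\<^sub>R \<xi> i w)} \<subseteq> ?A \<union> ?B"
 proof safe
  fix w m assume w: "w \<in> space P" "m \<le> n" "a \<le> norm (\<Sum>i<m. b i w *\<^sub>R \<xi> i w)"
   "\<not> (\<exists>m\<le>n. a \<le> norm (\<Sum>i<m. b i w *\<^sub>R \<zeta> i w))"
  have "\<exists>i<n. \<zeta> i w \<noteq> \<xi> i w"
  proof (rule ccontr)
   assume "\<not> ?thesis"
   then have "(\<Sum>i<m. b i w *\<^sub>R \<zeta> i w) = (\<Sum>i<m. b i w *\<^sub>R \<xi> i w)" using w(2) by (intro sum.cong) auto
   then show False using w by metis
  qed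
  then obtain i where i: "i < n" "c < (\<Sum>j\<le>i. q j w)" by (auto simp: \<zeta>_def not_le split: if_splits)
  note i(2)
  also have "(\<Sum>j\<le>i. q j w) \<le> (\<Sum>j<n. q j w)" using i q0 by (intro sum_mono2) auto
  also have "\<dots> = (\<Sum>i<n. v i * (norm (\<xi> i w))^2)" by (simp add: q_def)
  finally show "c < (\<Sum>i<n. v i * (norm (\<xi> i w))^2)" .
 qed
 then have "prob {w \<in> space P. \<exists>m\<le>n. a \<le> norm (\<Sum>i<m. b i w *\<^sub>R \<xi> i w)} \<le> prob (?A \<union> ?B)"
  by (rule finite_measure_mono[OF _ sets.Un[OF Am Bm]])
 also have "\<dots> \<le> prob ?A + prob ?B" using Am Bm by (rule measure_Un_le)
 also have "prob ?B \<le> (\<Sum>i<n. v i * moment2 (\<zeta> i)) / a^2"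
  by (rule maximal_inequality[OF n \<zeta>m \<zeta>s a])
 also have "\<dots> \<le> c / a^2" using sumle by (rule divide_right_mono) simp
 finally show ?thesis by simp
qed

lemma shift: 
 assumes "s + m \<le> N"
 shows "noise_sequence P (\<lambda>k. F (s + k)) (\<lambda>k. b (s + k)) (\<lambda>k. v (s + k)) m"
proof (intro noise_sequence.intro noise_sequence_axioms.intro prob_space_axioms)
 show "sets (F (s + k)) \<subseteq> sets P" if "k \<le> m" for k using sets_F[of "s + k"] that assms by auto
 show "sets (F (s + k)) \<subseteq> sets (F (s + l))" if "k \<le> l" "l \<le> m" for k l using mono_F[of "s + k" "s + l"] that assms by auto
 show "b (s + k) \<in> borel_measurable (F (s + Suc k))" if "k < m" for k using b_adapted[of "s + k"] that assms by auto
 show "space (F (s + k)) = space P" if "k \<le> m" for k using space_F[of "s + k"] that assms by simp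
 fix k and \<eta> :: "'w => real" assume k: "k < m" and \<eta>: "\<eta> \<in> borel_measurable (F (s + k))" "integrable P \<eta>"
 have sk: "s + k < N" using k assms by simp
 show "integrable P (\<lambda>w. b (s + k) w * \<eta> w) \<and> expectation (\<lambda>w. b (s + k) w * \<eta> w) = 0"
  by (rule b_times[OF sk \<eta>])
 assume "\<And>w. 0 \<le> \<eta> w"
 then show "integrable P (\<lambda>w. (b (s + k) w)^2 * \<eta> w) \<and> expectation (\<lambda>w. (b (s + k) w)^2 * \<eta> w) \<le> v (s + k) * expectation \<eta>"
  by (rule b_sq_times[OF sk \<eta>])
qed

text \<open>
 By induction on \<open>m\<close> with \<open>abs_add_cubed_le\<close>: in step \<open>m\<close> the linear term vanishes, the quadratic term is at most
 \<open>3 \<alpha>\<^sup>2\<close> times the first absolute moment of the sum, hence at most \<open>3 \<alpha>\<^sup>3 sqrt n\<close>, and the last term is at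
 most \<open>C \<alpha>\<^sup>3\<close>.
\<close>

lemma noise_sum_third_moment:
 assumes n: "n \<le> N" and \<xi>: "\<And>i. i < n ==> \<xi> i \<in> borel_measurable (F i)"
  and \<alpha>: "\<And>i w. i < n ==> \<bar>\<xi> i w\<bar> \<le> \<alpha>"
  and v: "\<And>i. i < n ==> v i \<le> 1"
  and b3: "\<And>i. i < n ==> integrable P (\<lambda>w. \<bar>b i w\<bar>^3)" "\<And>i. i < n ==> expectation (\<lambda>w. \<bar>b i w\<bar>^3) \<le> C"
  and mn: "m \<le> n" and \<alpha>0: "0 \<le> \<alpha>"
 shows "integrable P (\<lambda>w. \<bar>\<Sum>i<m. b i w * \<xi> i w\<bar>^3) \<and>
  expectation (\<lambda>w. \<bar>\<Sum>i<m. b i w * \<xi> i w\<bar>^3) \<le> \<alpha>^3 * (real m * (3 * sqrt (real n) + C))"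
 using mn
proof (induction m)
 case (Suc m)
 let ?S = "\<lambda>w. \<Sum>i<m. b i w * \<xi> i w"
 have m: "m < n" "m < N" using Suc.prems n by auto
 have Sa: "?S \<in> borel_measurable (F m)"
  using noise_sum_adapted[of m \<xi>] \<xi> m by simp
 have \<xi>s: "sq_integrable P (\<xi> i)" if "i < n" for i
 proof -
  have m: "\<xi> i \<in> borel_measurable P" using measurable_F[OF \<xi>[OF that]] that n by simp
  have "(norm (\<xi> i w))^2 \<le> \<alpha>^2" for w using power_mono[OF \<alpha>[OF that], of w 2] by simp
  then show ?thesis unfolding sq_integrable_def using m by (auto intro!: integrable_const_bound[of _ "\<alpha>^2"])
 qed
 have E\<xi>: "expectation (\<lambda>w. (\<xi> i w)^2) \<le> \<alpha>^2" if "i < n" for i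
 proof -
  have "expectation (\<lambda>w. (\<xi> i w)^2) \<le> expectation (\<lambda>w. \<alpha>^2)"
   using \<xi>s[OF that] \<alpha>[OF that] power_mono[of "\<bar>\<xi> i _\<bar>" \<alpha> 2]
   by (intro integral_mono) (auto simp: sq_integrable_def)
  then show ?thesis by (simp add: prob_space)
 qed
 have Ss: "sq_integrable P ?S" "expectation (\<lambda>w. (?S w)^2) \<le> \<alpha>^2 * real n"
 proof -
  show "sq_integrable P ?S" using noise_sum_sq(1)[of m \<xi>] \<xi> \<xi>s m by simp
  have "expectation (\<lambda>w. (?S w)^2) \<le> (\<Sum>i<m. v i * expectation (\<lambda>w. (\<xi> i w)^2))"
   using noise_sum_sq(2)[of m \<xi>] \<xi> \<xi>s m by simp
  also have "\<dots> \<le> (\<Sum>i<m. 1 * \<alpha>^2)"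
   using m E\<xi> v v_nonneg by (intro sum_mono mult_mono) auto
  also have "\<dots> \<le> \<alpha>^2 * real n" using m by (simp add: mult.commute mult_right_mono)
  finally show "expectation (\<lambda>w. (?S w)^2) \<le> \<alpha>^2 * real n" .
 qed
 have Si: "integrable P (\<lambda>w. \<bar>?S w\<bar>)"
  using sq_integrable_norm[OF Ss(1)] by simp
 have S1: "expectation (\<lambda>w. \<bar>?S w\<bar>) \<le> \<alpha> * sqrt (real n)"
 proof -
  have "(expectation (\<lambda>w. \<bar>?S w\<bar>))^2 \<le> expectation (\<lambda>w. \<bar>?S w\<bar>\<^sup>2)"
  proof -
   have "integrable P (\<lambda>w. \<bar>?S w\<bar>\<^sup>2)" using Ss(1) by (simp add: sq_integrable_def)
   then show ?thesis
    using variance_eq[OF Si] variance_positive[of "\<lambda>w. \<bar>?S w\<bar>"] by linarith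
  qed
  also have "\<dots> \<le> (\<alpha> * sqrt (real n))^2" using Ss(2) by (simp add: power_mult_distrib)
  finally show ?thesis by (rule power2_le_imp_le) (use \<alpha>0 in auto)
 qed
 have c1: "integrable P (\<lambda>w. b m w * (?S w * \<bar>?S w\<bar> * \<xi> m w))"
  "expectation (\<lambda>w. b m w * (?S w * \<bar>?S w\<bar> * \<xi> m w)) = 0"
 proof -
  have me: "(\<lambda>w. ?S w * \<bar>?S w\<bar> * \<xi> m w) \<in> borel_measurable (F m)" using Sa \<xi>[OF m(1)] by simp
  have "integrable P (\<lambda>w. ?S w * \<bar>?S w\<bar> * \<xi> m w)"
  proof (rule Bochner_Integration.integrable_bound)
   show "integrable P (\<lambda>w. \<alpha> * (?S w)^2)" using Ss(1) by (simp add: sq_integrable_def)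
   show "AE w in P. norm (?S w * \<bar>?S w\<bar> * \<xi> m w) \<le> norm (\<alpha> * (?S w)^2)"
    using \<alpha>[OF m(1)] \<alpha>0 by (intro AE_I2) (auto simp: abs_mult power2_eq_square mult.commute intro: mult_right_mono)
  qed (rule measurable_F[OF me], use m in simp)
  then show "integrable P (\<lambda>w. b m w * (?S w * \<bar>?S w\<bar> * \<xi> m w))"
   "expectation (\<lambda>w. b m w * (?S w * \<bar>?S w\<bar> * \<xi> m w)) = 0"
   using b_times[OF m(2) me] by auto
 qed
 have c2: "integrable P (\<lambda>w. (b m w)^2 * (\<alpha>^2 * \<bar>?S w\<bar>))"
  "expectation (\<lambda>w. (b m w)^2 * (\<alpha>^2 * \<bar>?S w\<bar>)) \<le> \<alpha>^2 * (\<alpha> * sqrt (real n))"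
 proof -
  have me: "(\<lambda>w. \<alpha>^2 * \<bar>?S w\<bar>) \<in> borel_measurable (F m)" using Sa by simp
  have i: "integrable P (\<lambda>w. \<alpha>^2 * \<bar>?S w\<bar>)" using Si by simp
  show "integrable P (\<lambda>w. (b m w)^2 * (\<alpha>^2 * \<bar>?S w\<bar>))" using b_sq_times[OF m(2) me i] by simp
  have "expectation (\<lambda>w. (b m w)^2 * (\<alpha>^2 * \<bar>?S w\<bar>)) \<le> v m * (\<alpha>^2 * expectation (\<lambda>w. \<bar>?S w\<bar>))"
   using b_sq_times[OF m(2) me i] by simp
  also have "\<dots> \<le> 1 * (\<alpha>^2 * (\<alpha> * sqrt (real n)))"
   using v[OF m(1)] S1 by (intro mult_mono mult_nonneg_nonneg) auto
  finally show "expectation (\<lambda>w. (b m w)^2 * (\<alpha>^2 * \<bar>?S w\<bar>)) \<le> \<alpha>^2 * (\<alpha> * sqrt (real n))" by simp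
 qed
 let ?U = "\<lambda>w. \<bar>?S w\<bar>^3 + 3 * (b m w * (?S w * \<bar>?S w\<bar> * \<xi> m w)) + 3 * ((b m w)^2 * (\<alpha>^2 * \<bar>?S w\<bar>)) + \<alpha>^3 * \<bar>b m w\<bar>^3"
 have le: "\<bar>\<Sum>i<Suc m. b i w * \<xi> i w\<bar>^3 \<le> ?U w" for w
 proof -
  have s: "(\<xi> m w)^2 \<le> \<alpha>^2" "\<bar>\<xi> m w\<bar>^3 \<le> \<alpha>^3"
   using \<alpha>[OF m(1), of w] power_mono[of "\<bar>\<xi> m w\<bar>" \<alpha> 2] power_mono[of "\<bar>\<xi> m w\<bar>" \<alpha> 3] by auto
  have "\<bar>\<Sum>i<Suc m. b i w * \<xi> i w\<bar>^3 \<le> \<bar>?S w\<bar>^3 + 3 * (?S w * \<bar>?S w\<bar>) * (b m w * \<xi> m w)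
    + 3 * \<bar>?S w\<bar> * (b m w * \<xi> m w)^2 + \<bar>b m w * \<xi> m w\<bar>^3"
   by (simp only: sum.lessThan_Suc) (rule abs_add_cubed_le)
  also have "3 * \<bar>?S w\<bar> * (b m w * \<xi> m w)^2 \<le> 3 * ((b m w)^2 * (\<alpha>^2 * \<bar>?S w\<bar>))"
  proof -
   have "((b m w)^2 * \<bar>?S w\<bar>) * (\<xi> m w)^2 \<le> ((b m w)^2 * \<bar>?S w\<bar>) * \<alpha>^2" using s by (intro mult_left_mono) auto
   then show ?thesis by (simp add: power_mult_distrib mult_ac)
  qed
  also have "\<bar>b m w * \<xi> m w\<bar>^3 \<le> \<alpha>^3 * \<bar>b m w\<bar>^3"
   using mult_right_mono[OF s(2), of "\<bar>b m w\<bar>^3"] by (simp add: abs_mult power_mult_distrib mult_ac)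
  finally show ?thesis by (simp add: mult_ac)
 qed
 have IH: "integrable P (\<lambda>w. \<bar>?S w\<bar>^3)" "expectation (\<lambda>w. \<bar>?S w\<bar>^3) \<le> \<alpha>^3 * (real m * (3 * sqrt (real n) + C))"
  using Suc.IH m by auto
 have Ui: "integrable P ?U" using IH(1) c1(1) c2(1) b3(1)[OF m(1)] by auto
 have int: "integrable P (\<lambda>w. \<bar>\<Sum>i<Suc m. b i w * \<xi> i w\<bar>^3)"
 proof (rule Bochner_Integration.integrable_bound[OF Ui])
  have "(\<lambda>w. \<Sum>i<Suc m. b i w * \<xi> i w) \<in> borel_measurable P"
   using measurable_F[OF noise_sum_adapted[of "Suc m" \<xi>]] \<xi> Suc.prems n by simp
  then show "(\<lambda>w. \<bar>\<Sum>i<Suc m. b i w * \<xi> i w\<bar>^3) \<in> borel_measurable P" by simp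
  show "AE w in P. norm (\<bar>\<Sum>i<Suc m. b i w * \<xi> i w\<bar>^3) \<le> norm (?U w)"
   using le by (intro AE_I2) (smt (verit) real_norm_def zero_le_power abs_ge_zero)
 qed
 have "expectation (\<lambda>w. \<bar>\<Sum>i<Suc m. b i w * \<xi> i w\<bar>^3) \<le> expectation ?U"
  by (rule integral_mono[OF int Ui le])
 also have "\<dots> = expectation (\<lambda>w. \<bar>?S w\<bar>^3) + 3 * 0 + 3 * expectation (\<lambda>w. (b m w)^2 * (\<alpha>^2 * \<bar>?S w\<bar>))
   + \<alpha>^3 * expectation (\<lambda>w. \<bar>b m w\<bar>^3)"
  using IH(1) c1 c2(1) b3(1)[OF m(1)] by simp
 also have "\<dots> \<le> \<alpha>^3 * (real m * (3 * sqrt (real n) + C)) + 3 * 0 + 3 * (\<alpha>^2 * (\<alpha> * sqrt (real n))) + \<alpha>^3 * C"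
  using IH(2) c2(2) b3(2)[OF m(1)] \<alpha>0 by (intro add_mono mult_left_mono) auto
 also have "\<dots> = \<alpha>^3 * (real (Suc m) * (3 * sqrt (real n) + C))"
  by (simp add: algebra_simps power3_eq_cube power2_eq_square)
 finally show ?case using int by blast
qed simp

text \<open>
 The bound is of order \<open>n\<close> to the power \<open>3/2\<close>. Added up over \<open>K\<close> blocks of length \<open>n/K\<close>, with \<open>\<alpha>\<close> of order \<open>1 / sqrt n\<close>,
 it tends to \<open>0\<close> as \<open>K\<close> grows; the bound by second moments does not.
\<close>

lemma third_moment_maximal_inequality:
 assumes n: "n \<le> N" and v: "\<And>i. i < n ==> v i \<le> 1"
  and \<alpha>: "\<And>i. i < n ==> \<bar>c i\<bar> \<le> \<alpha>" and \<alpha>0: "0 \<le> \<alpha>" and a: "0 < a"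
  and b3: "\<And>i. i < n ==> integrable P (\<lambda>w. \<bar>b i w\<bar>^3)" "\<And>i. i < n ==> expectation (\<lambda>w. \<bar>b i w\<bar>^3) \<le> C"
 shows "prob {w \<in> space P. \<exists>m\<le>n. a \<le> \<bar>\<Sum>i<m. b i w * c i\<bar>} \<le> \<alpha>^3 * (real n * (3 * sqrt (real n) + C)) / a^3"
proof -
 define \<zeta> where "\<zeta> i w = (if \<forall>m\<le>i. norm (\<Sum>j<m. b j w *\<^sub>R c j) < a then c i else 0)" for i w
 have \<zeta>m: "\<zeta> i \<in> borel_measurable (F i)" if "i < n" for i
  unfolding \<zeta>_def by (rule stopped_coeff_measurable[OF n _ that]) simp
 have sub: "{w \<in> space P. \<exists>m\<le>n. a \<le> \<bar>\<Sum>i<m. b i w * c i\<bar>} \<subseteq> {w \<in> space P. a^3 \<le> \<bar>\<Sum>i<n. b i w * \<zeta> i w\<bar>^3}"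
 proof safe
  fix w m assume "m \<le> n" "a \<le> \<bar>\<Sum>i<m. b i w * c i\<bar>"
  then have "a \<le> norm (\<Sum>i<n. if \<forall>m\<le>i. norm (\<Sum>j<m. b j w *\<^sub>R c j) < a then b i w *\<^sub>R c i else 0)"
   by (intro stopped_sum_reaches) auto
  also have "(\<Sum>i<n. if \<forall>m\<le>i. norm (\<Sum>j<m. b j w *\<^sub>R c j) < a then b i w *\<^sub>R c i else 0)
    = (\<Sum>i<n. b i w * \<zeta> i w)"
   by (rule sum.cong) (auto simp: \<zeta>_def)
  finally have "a \<le> \<bar>\<Sum>i<n. b i w * \<zeta> i w\<bar>" by simp
  then show "a^3 \<le> \<bar>\<Sum>i<n. b i w * \<zeta> i w\<bar>^3" using a by (intro power_mono) auto
 qed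
 have T: "integrable P (\<lambda>w. \<bar>\<Sum>i<n. b i w * \<zeta> i w\<bar>^3) \<and>
   expectation (\<lambda>w. \<bar>\<Sum>i<n. b i w * \<zeta> i w\<bar>^3) \<le> \<alpha>^3 * (real n * (3 * sqrt (real n) + C))"
  by (rule noise_sum_third_moment[OF n \<zeta>m _ v b3 order_refl \<alpha>0]) (use \<alpha> \<alpha>0 in \<open>auto simp: \<zeta>_def\<close>)
 have "prob {w \<in> space P. \<exists>m\<le>n. a \<le> \<bar>\<Sum>i<m. b i w * c i\<bar>} \<le> prob {w \<in> space P. a^3 \<le> \<bar>\<Sum>i<n. b i w * \<zeta> i w\<bar>^3}"
  by (rule finite_measure_mono[OF sub]) (use T in auto)
 also have "\<dots> \<le> expectation (\<lambda>w. \<bar>\<Sum>i<n. b i w * \<zeta> i w\<bar>^3) / a^3"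
  using T a by (intro integral_Markov_inequality_measure[where A="{}"]) auto
 also have "\<dots> \<le> \<alpha>^3 * (real n * (3 * sqrt (real n) + C)) / a^3"
  using T a by (intro divide_right_mono) auto
 finally show ?thesis .
qed

end

section \<open>Stability of Euler schemes\<close>

text \<open>
 The sequence \<open>D\<close> satisfies the recursion of the Euler scheme with step \<open>h\<close>, coefficients \<open>A\<close>, \<open>C\<close> and noise \<open>b\<close> exactly if
 its defect is constant.
\<close>

definition Euler_defect ::
 "real => ('v => 'v) => (nat => 'd::finite => 'v => 'v) => (nat => 'w => real^'d) => (nat => 'w => 'v::euclidean_space) => nat => 'w => 'v" where
 "Euler_defect h A C b D k w =
   D k w - (\<Sum>i<k. h *\<^sub>R A (D i w) + (\<Sum>j\<in>UNIV. (b i w $ j) *\<^sub>R C i j (D i w)))"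

text \<open>
 Constants of the stability estimate: \<open>c\<close> bounds the linear coefficients, \<open>\<kappa> h\<close> the variances of the
 noise, \<open>\<tau>\<close> the total time, and \<open>d\<close> is the number of noise coordinates. One step multiplies the second moment by
 \<open>1 + O(h)\<close>, with \<open>step_const\<close> in the \<open>O\<close>; \<open>growth_const\<close> accumulates this over time \<open>\<tau>\<close>.
\<close>

definition step_const :: "real => real => real => real => real" where
 "step_const c \<kappa> \<tau> d = (\<tau> + 1) * c^2 + d^2 * \<kappa> * c^2"

definition growth_const :: "real => real => real => real => real" where
 "growth_const c \<kappa> \<tau> d = 2 * (2 * step_const c \<kappa> \<tau> d * \<tau> * exp ((1 + 2 * step_const c \<kappa> \<tau> d) * \<tau>)) + 2"

definition stab_const :: "real => real => real => real => real" where
 "stab_const c \<kappa> \<tau> d = 4 * c^2 * \<tau> * growth_const c \<kappa> \<tau> d * (\<tau> + d ^ 3 * \<kappa>)"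

lemma borel_measurable_linear:
 fixes A :: "'v::euclidean_space => 'u::euclidean_space"
 assumes "linear A" "f \<in> borel_measurable M" shows "(\<lambda>w. A (f w)) \<in> borel_measurable M"
 using measurable_compose[OF assms(2) borel_measurable_continuous_onI[OF linear_continuous_on[OF linear_conv_bounded_linear[THEN iffD1, OF assms(1)]]]] .

lemma norm_add_scaled_sq_le:
 fixes x y :: "'v::real_normed_vector"
 assumes h: "0 \<le> h" "h \<le> \<tau>" and y: "norm y \<le> c * norm u" "0 \<le> c"
 shows "(norm (x + h *\<^sub>R y))^2 \<le> (1 + h) * (norm x)^2 + h * (\<tau> + 1) * c^2 * (norm u)^2"
proof -
 have "(norm (x + h *\<^sub>R y))^2 \<le> (norm x + h * norm y)^2"
  using h norm_triangle_ineq[of x "h *\<^sub>R y"] by (intro power_mono) auto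
 also have "\<dots> = (norm x)^2 + h * (2 * norm x * norm y) + h^2 * (norm y)^2"
  by (simp add: power2_eq_square algebra_simps)
 also have "\<dots> \<le> (norm x)^2 + h * ((norm x)^2 + (norm y)^2) + h * \<tau> * (norm y)^2"
 proof (intro add_mono mult_left_mono mult_right_mono)
  show "2 * norm x * norm y \<le> (norm x)^2 + (norm y)^2"
   using zero_le_power2[of "norm x - norm y"] by (simp add: power2_eq_square algebra_simps)
  show "h^2 \<le> h * \<tau>" using h by (simp add: power2_eq_square mult_left_mono)
 qed (use h in auto)
 also have "\<dots> = (1 + h) * (norm x)^2 + h * (\<tau> + 1) * (norm y)^2" by (simp add: algebra_simps)
 also have "(norm y)^2 \<le> c^2 * (norm u)^2"
  using power_mono[OF y(1), of 2] by (simp add: power_mult_distrib)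
 then have "(1 + h) * (norm x)^2 + h * (\<tau> + 1) * (norm y)^2 \<le> (1 + h) * (norm x)^2 + h * (\<tau> + 1) * (c^2 * (norm u)^2)"
  using h by (intro add_left_mono mult_left_mono) auto
 finally show ?thesis by (simp add: mult_ac)
qed

text \<open>
 The discrete Gronwall lemma.
\<close>

lemma linear_recursion_le:
 fixes e :: "nat => real"
 assumes e0: "e 0 = 0" and rec: "\<And>k. k < N ==> e (Suc k) \<le> (1 + h * p) * e k + h * q"
  and h: "0 \<le> h" "0 \<le> p" "0 \<le> q" and N: "real N * h \<le> \<tau>" and k: "k \<le> N"
 shows "e k \<le> q * \<tau> * exp (p * \<tau>)"
proof -
 have "e k \<le> (1 + h * p) ^ k * (real k * (h * q))"
  using k
 proof (induction k)
  case (Suc k)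
  have "e (Suc k) \<le> (1 + h * p) * ((1 + h * p) ^ k * (real k * (h * q))) + 1 * (h * q)"
   using rec[of k] Suc h by (intro order_trans[OF rec] add_mono mult_left_mono) auto
  also have "\<dots> \<le> (1 + h * p) ^ Suc k * (real k * (h * q)) + (1 + h * p) ^ Suc k * (h * q)"
   using h by (intro add_mono mult_right_mono one_le_power) auto
  finally show ?case by (simp add: algebra_simps)
 qed (simp add: e0)
 also have "\<dots> \<le> exp (p * \<tau>) * (\<tau> * q)"
 proof (rule mult_mono)
  have kh: "real k * h \<le> \<tau>" using k h N by (meson mult_right_mono of_nat_mono order_trans)
  have "(1 + h * p) ^ k \<le> exp (h * p) ^ k" using h by (intro power_mono exp_ge_add_one_self) auto
  also have "\<dots> = exp (real k * h * p)" by (simp add: exp_of_nat_mult[symmetric] mult_ac)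
  also have "\<dots> \<le> exp (p * \<tau>)" using mult_right_mono[OF kh h(2)] by (simp add: mult.commute)
  finally show "(1 + h * p) ^ k \<le> exp (p * \<tau>)" .
  show "real k * (h * q) \<le> \<tau> * q" using mult_right_mono[OF kh h(3)] by (simp add: mult_ac)
 qed (use h in auto)
 finally show ?thesis by (simp add: mult_ac)
qed

lemma sets_ex_norm_ge:
 fixes f :: "nat => 'w => 'v::euclidean_space"
 assumes "\<And>k. k \<le> N ==> f k \<in> borel_measurable P"
 shows "{w \<in> space P. \<exists>k\<le>N. a \<le> norm (f k w)} \<in> sets P"
proof -
 have "{w \<in> space P. \<exists>k\<in>{..N}. a \<le> norm (f k w)} \<in> sets P"
 proof (rule sets.sets_Collect_finite_Ex)
  fix k assume "k \<in> {..N}"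
  then have [measurable]: "f k \<in> borel_measurable P" using assms by simp
  show "{w \<in> space P. a \<le> norm (f k w)} \<in> sets P" by measurable
 qed simp
 then show ?thesis by (simp only: Bex_def atMost_iff)
qed

lemma sets_ex_norm_gt:
 fixes f :: "nat => 'w => 'v::euclidean_space"
 assumes "\<And>k. k \<le> N ==> f k \<in> borel_measurable P"
 shows "{w \<in> space P. \<exists>k\<le>N. a < norm (f k w)} \<in> sets P"
proof -
 have "{w \<in> space P. \<exists>k\<in>{..N}. a < norm (f k w)} \<in> sets P"
 proof (rule sets.sets_Collect_finite_Ex)
  fix k assume "k \<in> {..N}"
  then have [measurable]: "f k \<in> borel_measurable P" using assms by simp
  show "{w \<in> space P. a < norm (f k w)} \<in> sets P" by measurable
 qed simp
 then show ?thesis by (simp only: Bex_def atMost_iff)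
qed

text \<open>
 Write \<open>r\<close> for the defect and truncate it to \<open>r'\<close>, bounded by \<open>\<eta>\<close>. The linear recursion for \<open>E = D - r\<close> only contains \<open>E + r\<close>;
 solving it with \<open>r'\<close> in place of \<open>r\<close> defines a process \<open>E\<close> with second moments of order \<open>\<eta>\<^sup>2\<close>, by the Gronwall lemma.
 Its maximum is controlled by the maximal inequality. Where the defect never exceeds \<open>\<eta>\<close>, indeed \<open>D = E + r\<close>.
 In this way the defect alone controls \<open>D\<close> in probability.
\<close>

theorem Euler_stability:
 fixes b :: "nat => 'w => real^'d" and D :: "nat => 'w => 'v::euclidean_space"
  and A :: "'v => 'v" and C :: "nat => 'd => 'v => 'v"
 assumes noise: "\<And>j. noise_sequence P F (\<lambda>k w. b k w $ j) v N"
  and D: "\<And>k. k \<le> N ==> D k \<in> borel_measurable (F k)"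
  and A: "linear A" "\<And>x. norm (A x) \<le> c * norm x"
  and C: "\<And>i j. linear (C i j)" "\<And>i j x. i < N ==> norm (C i j x) \<le> c * norm x"
  and v: "\<And>i. i < N ==> v i \<le> \<kappa> * h"
  and c: "0 \<le> c" "0 \<le> \<kappa>" "0 \<le> h" "real N * h \<le> \<tau>"
  and \<eta>: "0 < \<eta>" and a: "0 < a"
 shows "measure P {w \<in> space P. \<exists>k\<le>N. a + \<eta> \<le> norm (D k w)}
  \<le> measure P {w \<in> space P. \<exists>k\<le>N. \<eta> < norm (Euler_defect h A C b D k w)}
   + stab_const c \<kappa> \<tau> (real CARD('d)) * \<eta>^2 / a^2"
proof (cases "N = 0")
 case True
 interpret noise_sequence P F "\<lambda>k w. b k w $ undefined" v N by (rule noise)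
 have t0: "0 \<le> \<tau>" using c True by simp
 have "{w \<in> space P. \<exists>k\<le>N. \<eta> < norm (Euler_defect h A C b D k w)} \<in> sets P"
  using measurable_F[OF D[of 0]] True by (simp add: Euler_defect_def)
 then have "prob {w \<in> space P. \<exists>k\<le>N. a + \<eta> \<le> norm (D k w)}
  \<le> prob {w \<in> space P. \<exists>k\<le>N. \<eta> < norm (Euler_defect h A C b D k w)}"
  using True a by (intro finite_measure_mono) (auto simp: Euler_defect_def)
 moreover have "0 \<le> stab_const c \<kappa> \<tau> (real CARD('d)) * \<eta>^2 / a^2"
  unfolding stab_const_def growth_const_def step_const_def using t0 c
  by (intro divide_nonneg_nonneg mult_nonneg_nonneg add_nonneg_nonneg) auto
 ultimately show ?thesis by linarith
next
 case False
 interpret n0: noise_sequence P F "\<lambda>k w. b k w $ undefined" v N by (rule noise)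
 let ?d = "real CARD('d)"
 let ?r = "Euler_defect h A C b D"
 have h\<tau>: "h \<le> \<tau>"
 proof -
  have "1 * h \<le> real N * h" using False c by (intro mult_right_mono) auto
  then show ?thesis using c by simp
 qed
 then have \<tau>: "0 \<le> \<tau>" using c by linarith
 have bm: "(\<lambda>w. b i w $ j) \<in> borel_measurable (F k)" if "i < k" "k \<le> N" for i j k
 proof -
  interpret n: noise_sequence P F "\<lambda>k w. b k w $ j" v N by (rule noise)
  show ?thesis using that by (intro n.measurable_F_mono[OF n.b_adapted, of i k]) auto
 qed
 have rm: "?r k \<in> borel_measurable (F k)" if "k \<le> N" for k
 proof -
  have [measurable]: "D i \<in> borel_measurable (F k)" if "i \<le> k" for i
   using that \<open>k \<le> N\<close> by (intro n0.measurable_F_mono[OF D, of i k]) auto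
  have [measurable]: "(\<lambda>w. b i w $ j) \<in> borel_measurable (F k)" if "i < k" for i j
   using that \<open>k \<le> N\<close> by (rule bm)
  have [measurable]: "(\<lambda>w. A (D i w)) \<in> borel_measurable (F k)"
   "(\<lambda>w. C i j (D i w)) \<in> borel_measurable (F k)" if "i < k" for i j
   using that by (simp_all add: borel_measurable_linear[OF A(1)] borel_measurable_linear[OF C(1)])
  show ?thesis unfolding Euler_defect_def by measurable
 qed
 (* A truncated value is replaced by 0, so that r' stays adapted and bounded. *)
 define r' where "r' k w = (if norm (?r k w) \<le> \<eta> then ?r k w else 0)" for k w
 have r'm: "r' k \<in> borel_measurable (F k)" if "k \<le> N" for k
  unfolding r'_def using rm[OF that] by measurable
 have r'b: "norm (r' k w) \<le> \<eta>" for k w using \<eta> by (simp add: r'_def)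
 (* The recursion that D - r satisfies as long as r = r'. *)
 define E where "E = rec_nat (\<lambda>w. 0) (\<lambda>k e w. e w + h *\<^sub>R A (e w + r' k w) + (\<Sum>j\<in>UNIV. (b k w $ j) *\<^sub>R C k j (e w + r' k w)))"
 define y where "y k w = E k w + r' k w" for k w
 have E0: "E 0 w = 0" for w by (simp add: E_def)
 have ES: "E (Suc k) w = (E k w + h *\<^sub>R A (y k w)) + (\<Sum>j\<in>UNIV. (b k w $ j) *\<^sub>R C k j (y k w))" for k w
  by (simp add: E_def y_def)
 have Em: "E k \<in> borel_measurable (F k)" if "k \<le> N" for k
  using that
 proof (induction k)
  case (Suc k)
  have [measurable]: "E k \<in> borel_measurable (F (Suc k))" "r' k \<in> borel_measurable (F (Suc k))"
   using Suc r'm[of k] by (auto intro: n0.measurable_F_mono[of _ k])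
  have [measurable]: "y k \<in> borel_measurable (F (Suc k))" unfolding y_def by measurable
  have [measurable]: "(\<lambda>w. b k w $ j) \<in> borel_measurable (F (Suc k))" for j using Suc bm by simp
  have [measurable]: "(\<lambda>w. A (y k w)) \<in> borel_measurable (F (Suc k))"
   "(\<lambda>w. C k j (y k w)) \<in> borel_measurable (F (Suc k))" for j
   by (simp_all add: borel_measurable_linear[OF A(1)] borel_measurable_linear[OF C(1)])
  show ?case unfolding ES by measurable
 qed (simp add: E_def)
 have ym: "y k \<in> borel_measurable (F k)" if "k \<le> N" for k
  unfolding y_def using Em[OF that] r'm[OF that] by measurable
 have r's: "sq_integrable P (r' k)" if "k \<le> N" for k
  by (rule sq_integrable_bound[OF n0.sq_integrable_const[of "1::real"], of _ \<eta>])
    (use r'b n0.measurable_F[OF r'm[OF that] that] in auto)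
 have lin_s: "sq_integrable P (\<lambda>w. A (f w))" "i < N ==> sq_integrable P (\<lambda>w. C i j (f w))"
  if f: "sq_integrable P f" for f i j
 proof -
  have fm: "f \<in> borel_measurable P" using f by (simp add: sq_integrable_def)
  show "sq_integrable P (\<lambda>w. A (f w))"
   by (rule sq_integrable_bound[OF f borel_measurable_linear[OF A(1) fm] A(2)])
  show "sq_integrable P (\<lambda>w. C i j (f w))" if "i < N"
   by (rule sq_integrable_bound[OF f borel_measurable_linear[OF C(1) fm] C(2)[OF that]])
 qed
 have step: "sq_integrable P (E (Suc k)) \<and>
   n0.moment2 (E (Suc k))
    \<le> (1 + h) * n0.moment2 (E k) + h * step_const c \<kappa> \<tau> ?d * n0.moment2 (y k)"
  if Es: "sq_integrable P (E k)" and k: "k < N" for k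
 proof -
  have ys: "sq_integrable P (y k)" unfolding y_def using k by (intro sq_integrable_add Es r's) auto
  let ?x = "\<lambda>w. E k w + h *\<^sub>R A (y k w)"
  let ?u = "\<lambda>w. \<Sum>j\<in>UNIV. (b k w $ j) *\<^sub>R C k j (y k w)"
  have xs: "sq_integrable P ?x" by (intro sq_integrable_add Es sq_integrable_scaleR lin_s ys)
  have xm: "?x \<in> borel_measurable (F k)"
   using Em[of k] borel_measurable_linear[OF A(1) ym[of k]] k by simp
  have cm: "(\<lambda>w. C k j (y k w)) \<in> borel_measurable (F k)" for j
   using borel_measurable_linear[OF C(1) ym[of k]] k by simp
  have cs: "sq_integrable P (\<lambda>w. C k j (y k w))" for j using lin_s(2)[OF ys k] .
  have bs: "sq_integrable P (\<lambda>w. (b k w $ j) *\<^sub>R C k j (y k w))"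
   "n0.moment2 (\<lambda>w. (b k w $ j) *\<^sub>R C k j (y k w)) \<le> v k * n0.moment2 (\<lambda>w. C k j (y k w))"
   "integrable P (\<lambda>w. ?x w \<bullet> ((b k w $ j) *\<^sub>R C k j (y k w)))"
   "n0.expectation (\<lambda>w. ?x w \<bullet> ((b k w $ j) *\<^sub>R C k j (y k w))) = 0" for j
  proof -
   interpret n: noise_sequence P F "\<lambda>k w. b k w $ j" v N by (rule noise)
   show "sq_integrable P (\<lambda>w. (b k w $ j) *\<^sub>R C k j (y k w))"
    "n0.moment2 (\<lambda>w. (b k w $ j) *\<^sub>R C k j (y k w)) \<le> v k * n0.moment2 (\<lambda>w. C k j (y k w))"
    using n.b_scaleR_sq_integrable[OF k cm cs] by auto
   show "integrable P (\<lambda>w. ?x w \<bullet> ((b k w $ j) *\<^sub>R C k j (y k w)))"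
    "n0.expectation (\<lambda>w. ?x w \<bullet> ((b k w $ j) *\<^sub>R C k j (y k w))) = 0"
    using n.b_scaleR_orthogonal[OF k cm cs xm xs] by auto
  qed
  have us: "sq_integrable P ?u" using n0.finite_measure_axioms by (intro sq_integrable_sum bs) auto
  have E1: "E (Suc k) = (\<lambda>w. ?x w + ?u w)" using ES by auto
  have Esuc: "sq_integrable P (E (Suc k))" unfolding E1 by (intro sq_integrable_add xs us)
  have yi: "integrable P (\<lambda>w. (norm (y k w))^2)" and Ei: "integrable P (\<lambda>w. (norm (E k w))^2)"
   using ys Es by (auto simp: sq_integrable_def)
  have xi: "integrable P (\<lambda>w. ?x w \<bullet> ?u w)" "n0.expectation (\<lambda>w. ?x w \<bullet> ?u w) = 0"
   using bs(3,4) by (auto simp: inner_sum_right)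
  have "n0.moment2 (E (Suc k))
    = n0.expectation (\<lambda>w. (norm (?x w))^2 + 2 * (?x w \<bullet> ?u w) + (norm (?u w))^2)"
   unfolding E1 by (intro Bochner_Integration.integral_cong refl)
    (simp only: power2_norm_eq_inner inner_add_left inner_add_right inner_commute[of "?u _" "E k _"] inner_commute[of "?u _" "h *\<^sub>R _"], simp)
  also have "\<dots> = n0.moment2 ?x + n0.moment2 ?u"
   using xs us xi by (simp add: sq_integrable_def)
  also have "n0.moment2 ?x
    \<le> n0.expectation (\<lambda>w. (1 + h) * (norm (E k w))^2 + h * (\<tau> + 1) * c^2 * (norm (y k w))^2)"
   using xs yi Ei c h\<tau> A(2) by (intro integral_mono norm_add_scaled_sq_le) (auto simp: sq_integrable_def)
  also have "\<dots> = (1 + h) * n0.moment2 (E k) + h * (\<tau> + 1) * c^2 * n0.moment2 (y k)"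
   using yi Ei by simp
  also have "n0.moment2 ?u
    \<le> n0.expectation (\<lambda>w. ?d * (\<Sum>j\<in>UNIV. (norm ((b k w $ j) *\<^sub>R C k j (y k w)))^2))"
  proof (rule integral_mono)
   show "integrable P (\<lambda>w. ?d * (\<Sum>j\<in>UNIV. (norm ((b k w $ j) *\<^sub>R C k j (y k w)))^2))"
    using bs(1) unfolding sq_integrable_def by (intro integrable_mult_right Bochner_Integration.integrable_sum) auto
   show "integrable P (\<lambda>w. (norm (?u w))^2)" using us by (simp only: sq_integrable_def)
  qed (rule norm_sum_sq_le, simp)
  also have "\<dots> = ?d * (\<Sum>j\<in>UNIV. n0.moment2 (\<lambda>w. (b k w $ j) *\<^sub>R C k j (y k w)))"
   using bs(1) unfolding sq_integrable_def by (subst integral_mult_right_zero, subst Bochner_Integration.integral_sum) auto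
  also have "\<dots> \<le> ?d * (\<Sum>j\<in>(UNIV::'d set). (\<kappa> * h) * (c^2 * n0.moment2 (y k)))"
  proof (intro mult_left_mono sum_mono)
   fix j :: 'd
   have "n0.moment2 (\<lambda>w. C k j (y k w)) \<le> n0.expectation (\<lambda>w. c^2 * (norm (y k w))^2)"
    using cs[of j] yi power_mono[OF C(2)[OF k], of _ _ 2]
    by (intro integral_mono) (auto simp: sq_integrable_def power_mult_distrib)
   then have "v k * n0.moment2 (\<lambda>w. C k j (y k w)) \<le> (\<kappa> * h) * (c^2 * n0.moment2 (y k))"
    using v[OF k] c by (intro mult_mono) auto
   then show "n0.moment2 (\<lambda>w. (b k w $ j) *\<^sub>R C k j (y k w)) \<le> (\<kappa> * h) * (c^2 * n0.moment2 (y k))"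
    using bs(2)[of j] by linarith
  qed auto
  also have "\<dots> = h * (?d^2 * \<kappa> * c^2) * n0.moment2 (y k)"
   by (simp add: power2_eq_square mult_ac)
  finally show ?thesis using Esuc by (simp add: step_const_def algebra_simps)
 qed
 have Es: "sq_integrable P (E k)" if "k \<le> N" for k
  using that
 proof (induction k)
  case 0
  have "E 0 = (\<lambda>_. 0)" using E0 by auto
  then show ?case by (simp add: sq_integrable_def)
 qed (use step in auto)
 have ys: "sq_integrable P (y k)" if "k \<le> N" for k
  unfolding y_def using that by (intro sq_integrable_add Es r's)
 have sc: "0 \<le> step_const c \<kappa> \<tau> ?d" using c \<tau> by (simp add: step_const_def)
 have yE: "n0.moment2 (y k) \<le> 2 * n0.moment2 (E k) + 2 * \<eta>^2" if "k \<le> N" for k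
 proof -
  have "n0.moment2 (y k) \<le> n0.expectation (\<lambda>w. 2 * (norm (E k w))^2 + 2 * \<eta>^2)"
  proof (rule integral_mono)
   fix w
   have "(norm (y k w))^2 \<le> 2 * (norm (E k w))^2 + 2 * (norm (r' k w))^2" unfolding y_def by (rule norm_add_sq_le)
   also have "(norm (r' k w))^2 \<le> \<eta>^2" using r'b by (intro power_mono) auto
   finally show "(norm (y k w))^2 \<le> 2 * (norm (E k w))^2 + 2 * \<eta>^2" by simp
  qed (use ys[OF that] Es[OF that] in \<open>auto simp: sq_integrable_def\<close>)
  then show ?thesis using Es[OF that] by (simp add: sq_integrable_def n0.prob_space)
 qed
 let ?p = "1 + 2 * step_const c \<kappa> \<tau> ?d"
 have Eb: "n0.moment2 (E k) \<le> (2 * step_const c \<kappa> \<tau> ?d * \<eta>^2) * \<tau> * exp (?p * \<tau>)" if "k \<le> N" for k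
 proof (rule linear_recursion_le[OF _ _ c(3) _ _ c(4) that])
  fix k assume k: "k < N"
  have "h * step_const c \<kappa> \<tau> ?d * n0.moment2 (y k)
    \<le> h * step_const c \<kappa> \<tau> ?d * (2 * n0.moment2 (E k) + 2 * \<eta>^2)"
   using yE[of k] k sc c by (intro mult_left_mono) auto
  then show "n0.moment2 (E (Suc k)) \<le> (1 + h * ?p) * n0.moment2 (E k) + h * (2 * step_const c \<kappa> \<tau> ?d * \<eta>^2)"
   using step[OF Es[of k] k] k by (simp add: algebra_simps)
 qed (use sc in \<open>auto simp: E0\<close>)
 let ?Y = "growth_const c \<kappa> \<tau> ?d * \<eta>^2"
 have yb: "n0.moment2 (y k) \<le> ?Y" if "k \<le> N" for k
  using yE[OF that] Eb[OF that] by (simp add: growth_const_def algebra_simps)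
 have Y0: "0 \<le> ?Y" using sc \<tau> by (simp add: growth_const_def)
 have Esum: "E k w = (\<Sum>i<k. h *\<^sub>R A (y i w)) + (\<Sum>j\<in>UNIV. \<Sum>i<k. (b i w $ j) *\<^sub>R C i j (y i w))" for k w
  by (induction k) (simp_all add: E0 ES sum.distrib)
 define G where "G w = (\<Sum>i<N. h * (c * norm (y i w)))" for w
 let ?R = "{w \<in> space P. \<exists>k\<le>N. \<eta> < norm (?r k w)}"
 let ?G = "{w \<in> space P. a / 2 \<le> norm (G w)}"
 let ?H = "\<lambda>j. {w \<in> space P. \<exists>m\<le>N. a / (2 * ?d) \<le> norm (\<Sum>i<m. (b i w $ j) *\<^sub>R C i j (y i w))}"
 have d: "?d > 0" by simp
 have sub: "{w \<in> space P. \<exists>k\<le>N. a + \<eta> \<le> norm (D k w)} \<subseteq> ?R \<union> (?G \<union> (\<Union>j\<in>UNIV. ?H j))"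
 proof (rule subsetI, rule ccontr)
  fix w assume w: "w \<in> {w \<in> space P. \<exists>k\<le>N. a + \<eta> \<le> norm (D k w)}"
   and n: "w \<notin> ?R \<union> (?G \<union> (\<Union>j\<in>UNIV. ?H j))"
  then have wP: "w \<in> space P" by simp
  have r: "norm (?r k w) \<le> \<eta>" if "k \<le> N" for k using n wP that by (auto simp: not_less)
  then have r': "r' k w = ?r k w" if "k \<le> N" for k using that by (simp add: r'_def)
  have ED: "E k w = D k w - ?r k w" if "k \<le> N" for k
   using that
  proof (induction k)
   case (Suc k)
   then have "y k w = D k w" using r'[of k] by (simp add: y_def)
   then show ?case using Suc by (simp add: ES Euler_defect_def)
  qed (simp add: E0 Euler_defect_def)
  have "norm (E k w) < a" if k: "k \<le> N" for k
  proof -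
   have "norm (\<Sum>i<k. h *\<^sub>R A (y i w)) \<le> (\<Sum>i<k. h * (c * norm (y i w)))"
    using A(2) c by (intro sum_norm_le) (simp add: mult_left_mono)
   also have "\<dots> \<le> G w" unfolding G_def using k c by (intro sum_mono2) auto
   also have "G w < a / 2"
   proof -
    have "\<not> a / 2 \<le> norm (G w)" using n wP by blast
    then show ?thesis by simp
   qed
   finally have 1: "norm (\<Sum>i<k. h *\<^sub>R A (y i w)) < a / 2" .
   have "norm (\<Sum>j\<in>UNIV. \<Sum>i<k. (b i w $ j) *\<^sub>R C i j (y i w)) \<le> (\<Sum>j\<in>(UNIV::'d set). a / (2 * ?d))"
   proof (intro sum_norm_le)
    fix j
    have "w \<notin> ?H j" using n by auto
    then show "norm (\<Sum>i<k. (b i w $ j) *\<^sub>R C i j (y i w)) \<le> a / (2 * ?d)" using wP k by force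
   qed
   also have "\<dots> = a / 2" using d by simp
   finally have 2: "norm (\<Sum>j\<in>UNIV. \<Sum>i<k. (b i w $ j) *\<^sub>R C i j (y i w)) \<le> a / 2" .
   show ?thesis unfolding Esum by (rule order.strict_trans1[OF norm_triangle_ineq]) (use 1 2 in linarith)
  qed
  moreover obtain k where k: "k \<le> N" "a + \<eta> \<le> norm (D k w)" using w by blast
  moreover have "D k w = E k w + ?r k w" using ED[OF k(1)] by simp
  ultimately show False using r[OF k(1)] norm_triangle_ineq[of "E k w" "?r k w"] by (metis add_mono_thms_linordered_field(3) leD order_trans)
 qed
 have Rm: "?R \<in> sets P" by (rule sets_ex_norm_gt, rule n0.measurable_F[OF rm])
 have Gs: "sq_integrable P G"
  unfolding G_def
 proof (intro sq_integrable_sum finite_lessThan n0.finite_measure_axioms)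
  fix i assume "i \<in> {..<N}"
  then have s: "sq_integrable P (y i)" using ys by simp
  then have [measurable]: "y i \<in> borel_measurable P" by (simp add: sq_integrable_def)
  show "sq_integrable P (\<lambda>w. h * (c * norm (y i w)))"
   by (rule sq_integrable_bound[OF s, of _ "h * c"]) (use c in \<open>auto simp: abs_mult\<close>)
 qed
 have Gb: "n0.moment2 G \<le> (\<tau> * c)^2 * ?Y"
 proof -
  have "n0.moment2 G \<le> n0.expectation (\<lambda>w. real N * (\<Sum>i<N. (h * c)^2 * (norm (y i w))^2))"
  proof (rule integral_mono)
   show "integrable P (\<lambda>w. real N * (\<Sum>i<N. (h * c)^2 * (norm (y i w))^2))" using ys by (auto simp: sq_integrable_def)
   fix w
   show "(norm (G w))^2 \<le> real N * (\<Sum>i<N. (h * c)^2 * (norm (y i w))^2)"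
    using norm_sum_sq_le[of "{..<N}" "\<lambda>i. h * (c * norm (y i w))"] by (simp add: G_def power_mult_distrib mult_ac)
  qed (use Gs in \<open>simp add: sq_integrable_def\<close>)
  also have "\<dots> = real N * (\<Sum>i<N. (h * c)^2 * n0.moment2 (y i))"
   using ys by (subst integral_mult_right_zero, subst Bochner_Integration.integral_sum) (auto simp: sq_integrable_def)
  also have "\<dots> \<le> real N * (\<Sum>i<N. (h * c)^2 * ?Y)"
   using yb by (intro mult_left_mono sum_mono) auto
  also have "\<dots> = (real N * h * c)^2 * ?Y" by (simp add: power2_eq_square mult_ac)
  also have "\<dots> \<le> (\<tau> * c)^2 * ?Y" using c Y0 by (intro mult_right_mono power_mono) auto
  finally show ?thesis .
 qed
 have PG: "n0.prob ?G \<le> (\<tau> * c)^2 * ?Y / (a / 2)^2"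
  using a by (intro n0.prob_norm_ge_le Gs Gb) auto
 have Hm: "?H j \<in> sets P" and PH: "n0.prob (?H j) \<le> \<kappa> * \<tau> * c^2 * ?Y / (a / (2 * ?d))^2" for j
 proof -
  interpret n: noise_sequence P F "\<lambda>k w. b k w $ j" v N by (rule noise)
  have cm: "(\<lambda>w. C i j (y i w)) \<in> borel_measurable (F i)" if "i < N" for i
   using borel_measurable_linear[OF C(1) ym[of i]] that by simp
  have cs: "sq_integrable P (\<lambda>w. C i j (y i w))" if "i < N" for i using lin_s(2)[OF ys] that by simp
  show "?H j \<in> sets P"
   by (rule sets_ex_norm_ge, rule n.measurable_F[OF n.noise_sum_adapted]) (use cm in auto)
  have "n0.prob (?H j) \<le> (\<Sum>i<N. v i * n0.moment2 (\<lambda>w. C i j (y i w))) / (a / (2 * ?d))^2"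
   using a d by (intro n.maximal_inequality cm cs order_refl) auto
  also have "\<dots> \<le> (\<Sum>i<N. (\<kappa> * h) * (c^2 * ?Y)) / (a / (2 * ?d))^2"
  proof (intro divide_right_mono sum_mono)
   fix i assume "i \<in> {..<N}"
   then have i: "i < N" by simp
   have "n0.moment2 (\<lambda>w. C i j (y i w)) \<le> n0.expectation (\<lambda>w. c^2 * (norm (y i w))^2)"
    using cs[OF i] ys[of i] i power_mono[OF C(2)[OF i], of _ _ 2]
    by (intro integral_mono) (auto simp: sq_integrable_def power_mult_distrib)
   also have "\<dots> \<le> c^2 * ?Y" using yb[of i] i by (simp add: mult_left_mono)
   finally show "v i * n0.moment2 (\<lambda>w. C i j (y i w)) \<le> (\<kappa> * h) * (c^2 * ?Y)"
    using v[OF i] c by (intro mult_mono) auto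
  qed simp
  also have "\<dots> = (real N * h) * (\<kappa> * c^2 * ?Y) / (a / (2 * ?d))^2" by (simp add: mult_ac)
  also have "\<dots> \<le> \<tau> * (\<kappa> * c^2 * ?Y) / (a / (2 * ?d))^2"
   using c Y0 by (intro divide_right_mono mult_right_mono) auto
  finally show "n0.prob (?H j) \<le> \<kappa> * \<tau> * c^2 * ?Y / (a / (2 * ?d))^2" by (simp add: mult_ac)
 qed
 have Gm: "?G \<in> sets P"
 proof -
  have [measurable]: "G \<in> borel_measurable P" using Gs by (simp add: sq_integrable_def)
  show ?thesis by measurable
 qed
 have HUm: "(\<Union>j\<in>UNIV. ?H j) \<in> sets P" by (rule sets.finite_UN[OF finite_class.finite_UNIV Hm])
 have "n0.prob {w \<in> space P. \<exists>k\<le>N. a + \<eta> \<le> norm (D k w)} \<le> n0.prob (?R \<union> (?G \<union> (\<Union>j\<in>UNIV. ?H j)))"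
  by (rule n0.finite_measure_mono[OF sub sets.Un[OF Rm sets.Un[OF Gm HUm]]])
 also have "\<dots> \<le> n0.prob ?R + (n0.prob ?G + n0.prob (\<Union>j\<in>UNIV. ?H j))"
  using measure_Un_le[OF Rm sets.Un[OF Gm HUm]] measure_Un_le[OF Gm HUm] by linarith
 also have "n0.prob (\<Union>j\<in>UNIV. ?H j) \<le> (\<Sum>j\<in>UNIV. n0.prob (?H j))"
  by (rule n0.finite_measure_subadditive_finite[OF finite_class.finite_UNIV]) (use Hm in blast)
 also have "\<dots> \<le> (\<Sum>j\<in>(UNIV::'d set). \<kappa> * \<tau> * c^2 * ?Y / (a / (2 * ?d))^2)" by (intro sum_mono PH)
 also have "n0.prob ?R + (n0.prob ?G + (\<Sum>j\<in>(UNIV::'d set). \<kappa> * \<tau> * c^2 * ?Y / (a / (2 * ?d))^2))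
   \<le> n0.prob ?R + ((\<tau> * c)^2 * ?Y / (a / 2)^2 + (\<Sum>j\<in>(UNIV::'d set). \<kappa> * \<tau> * c^2 * ?Y / (a / (2 * ?d))^2))"
  using PG by simp
 also have "\<dots> = n0.prob ?R + stab_const c \<kappa> \<tau> ?d * \<eta>^2 / a^2"
  using d a by (simp add: stab_const_def power2_eq_square power3_eq_cube field_simps)
 finally show ?thesis by simp
qed
section \<open>Brownian increments and elementary integrals\<close>

context brownian_motion begin

lemma increment_measurable:
 assumes "0 \<le> s" "s \<le> t" "t \<le> u" shows "(\<lambda>w. B t w - B s w) \<in> borel_measurable (F u)"
proof -
 have "B r \<in> borel_measurable (F u)" if "0 \<le> r" "r \<le> u" for r
  by (rule measurable_mono[THEN subsetD, OF order_refl _ sets_F_mono[OF that(2)] _ adapted[OF that(1)]])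
    (auto simp: space_F)
 then show ?thesis using assms by auto
qed

lemma F_measurable_imp: "f \<in> borel_measurable (F t) ==> f \<in> borel_measurable P"
 by (rule measurable_mono[THEN subsetD, OF order_refl _ sets_F]) (auto simp: space_F)

lemma F_measurable_mono: "f \<in> borel_measurable (F s) ==> s \<le> t ==> f \<in> borel_measurable (F t)"
 by (rule measurable_mono[THEN subsetD, OF order_refl _ sets_F_mono]) (auto simp: space_F)

lemma increment_moments:
 assumes "0 \<le> s" "s < t"
 shows "integrable P (\<lambda>w. ((B t w - B s w) $ j)^2)"
  "expectation (\<lambda>w. (B t w - B s w) $ j) = 0"
  "expectation (\<lambda>w. ((B t w - B s w) $ j)^2) = t - s"
proof -
 let ?\<sigma> = "sqrt (t - s)"
 have \<sigma>: "0 < ?\<sigma>" using assms by simp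
 note D = increment_normal[OF assms, of j]
 show m: "expectation (\<lambda>w. (B t w - B s w) $ j) = 0"
  by (rule normal_distributed_expectation[OF \<sigma> D])
 show "integrable P (\<lambda>w. ((B t w - B s w) $ j)^2)"
  using distributed_integrable[OF D, of "\<lambda>x. x^2"] integrable_normal_moment[OF \<sigma>, of 0 2] by simp
 show "expectation (\<lambda>w. ((B t w - B s w) $ j)^2) = t - s"
  using normal_distributed_variance[OF \<sigma> D] assms unfolding m by simp
qed

lemma increment_noise:
 fixes d :: "nat => real"
 assumes d: "\<And>i. i < N ==> d i < d (Suc i)" "0 \<le> d 0"
 shows "noise_sequence P (\<lambda>k. F (d k)) (\<lambda>k w. (B (d (Suc k)) w - B (d k) w) $ j) (\<lambda>k. d (Suc k) - d k) N"
proof -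
 have mono: "d k \<le> d l" if "k \<le> l" "l \<le> N" for k l
  using that
 proof (induction l)
  case (Suc l)
  then show ?case using d(1)[of l] by (cases "k = Suc l") auto
 qed simp
 have d0: "0 \<le> d k" if "k \<le> N" for k using mono[of 0 k] that d(2) by simp
 show ?thesis
 proof (rule noise_if_indep)
  show "(\<lambda>w. (B (d (Suc k)) w - B (d k) w) $ j) \<in> borel_measurable (F (d (Suc k)))" if "k < N" for k
  proof -
   have "(\<lambda>w. B (d (Suc k)) w - B (d k) w) \<in> borel_measurable (F (d (Suc k)))"
    using d0[of k] less_imp_le[OF d(1)[OF that]] that by (intro increment_measurable) auto
   then show ?thesis by (rule measurable_compose) (intro borel_measurable_continuous_onI continuous_intros)
  qed
  show "indep_set (sets (F (d k))) {(\<lambda>w. (B (d (Suc k)) w - B (d k) w) $ j) -` A \<inter> space P | A. A \<in> sets borel}" if "k < N" for k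
  proof -
   have "{(\<lambda>w. (B (d (Suc k)) w - B (d k) w) $ j) -` A \<inter> space P | A. A \<in> sets borel}
     \<subseteq> {(\<lambda>w. B (d (Suc k)) w - B (d k) w) -` A \<inter> space P | A. A \<in> sets borel}"
   proof safe
    fix A :: "real set" assume A: "A \<in> sets borel"
    have "(\<lambda>x :: real^'d. x $ j) -` A \<inter> space borel \<in> sets borel"
     by (rule measurable_sets[OF _ A]) simp
    then show "\<exists>A'. (\<lambda>w. (B (d (Suc k)) w - B (d k) w) $ j) -` A \<inter> space P
      = (\<lambda>w. B (d (Suc k)) w - B (d k) w) -` A' \<inter> space P \<and> A' \<in> sets borel"
     by (intro exI[of _ "(\<lambda>x. x $ j) -` A"]) auto
   qed
   then show ?thesis
    using increment_indep_past[OF d0[OF less_imp_le[OF that]] d(1)[OF that]]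
    unfolding indep_sets2_eq by (meson subset_iff)
  qed
 qed (use increment_moments d(1) d0 mono sets_F sets_F_mono in \<open>auto simp: space_F\<close>)
qed

end

lemma sum_grid_interval:
 fixes X :: "nat => real"
 assumes "\<alpha> \<le> \<beta>" "\<beta> \<le> p"
 shows "(\<Sum>i<p. if \<alpha> \<le> i \<and> i < \<beta> then X (Suc i) - X i else 0) = X \<beta> - X \<alpha>"
proof -
 have "(\<Sum>i<p. if \<alpha> \<le> i \<and> i < \<beta> then X (Suc i) - X i else 0) = (\<Sum>i\<in>{\<alpha>..<\<beta>}. X (Suc i) - X i)"
  using assms by (subst sum.inter_filter[symmetric]) (auto intro!: sum.cong)
 also have "\<dots> = X \<beta> - X \<alpha>" using assms(1) by (rule sum_Suc_diff')
 finally show ?thesis .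
qed

text \<open>
 The grid \<open>d\<close> contains all times \<open>\<tau>\<^sub>k\<close> up to \<open>d\<^sub>N\<close>. Elementary processes over \<open>\<tau>\<close> are constant on its cells, so elementary
 processes with different time grids can be compared on a common refinement.
\<close>

locale refining_grid =
 fixes d :: "nat => real" and N m :: nat and \<tau> :: "nat => real"
 assumes d: "\<And>i. i < N ==> d i < d (Suc i)"
  and \<tau>: "\<And>k. k < m ==> \<tau> k \<le> \<tau> (Suc k)"
  and mem: "\<And>k. k \<le> m ==> min (d N) (\<tau> k) \<in> d ` {..N}"
begin

lemma less: "i < j ==> j \<le> N ==> d i < d j"
proof (induction j)
 case (Suc j)
 then show ?case using d[of j] by (cases "i = j") auto
qed simp

lemma less_iff: "i \<le> N ==> j \<le> N ==> d i < d j \<longleftrightarrow> i < j"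
 using less[of i j] less[of j i] by (metis linorder_neqE_nat order_less_asym)

lemma le_iff: "i \<le> N ==> j \<le> N ==> d i \<le> d j \<longleftrightarrow> i \<le> j"
 using less_iff[of j i] by (simp add: not_less[symmetric])

lemma tau_less_iff:
 assumes "k \<le> m" "i < N" shows "\<tau> k < d (Suc i) \<longleftrightarrow> \<tau> k \<le> d i"
proof
 assume l: "\<tau> k < d (Suc i)"
 obtain q where q: "q \<le> N" "min (d N) (\<tau> k) = d q" using mem[OF assms(1)] by auto
 have "d (Suc i) \<le> d N" using le_iff assms by simp
 then have "\<tau> k = d q" using l q by linarith
 then have "q < Suc i" using l less_iff[of q "Suc i"] q assms by simp
 then show "\<tau> k \<le> d i" using \<open>\<tau> k = d q\<close> le_iff[of q i] q assms by simp
qed (use d[OF assms(2)] in linarith)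

lemma elementary_value_cell:
 assumes "i < N" "d i < s" "s \<le> d (Suc i)"
 shows "elementary_value m \<tau> \<xi> s w = elementary_value m \<tau> \<xi> (d (Suc i)) w"
 unfolding elementary_value_def
proof (rule sum.cong[OF refl])
 fix k assume "k \<in> {..<m}"
 then have k: "k \<le> m" "Suc k \<le> m" by auto
 have "\<tau> k < s \<longleftrightarrow> \<tau> k < d (Suc i)" using tau_less_iff[OF k(1) assms(1)] assms by linarith
 moreover have "s \<le> \<tau> (Suc k) \<longleftrightarrow> d (Suc i) \<le> \<tau> (Suc k)" using tau_less_iff[OF k(2) assms(1)] assms by linarith
 ultimately show "indicator {\<tau> k<..\<tau> (Suc k)} s *\<^sub>R \<xi> k w = indicator {\<tau> k<..\<tau> (Suc k)} (d (Suc i)) *\<^sub>R \<xi> k w"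
  by (simp add: indicator_def)
qed

text \<open>
 Each term of the elementary integral telescopes over the cells between its two times.
\<close>

lemma elementary_integral_grid:
 assumes p: "p \<le> N"
 shows "elementary_integral m \<tau> \<xi> X (d p) w
  = (\<Sum>i<p. (X (d (Suc i)) w - X (d i) w) *\<^sub>R elementary_value m \<tau> \<xi> (d (Suc i)) w)"
proof -
 have key: "(\<Sum>i<p. (X (d (Suc i)) w - X (d i) w) * indicator {\<tau> k<..\<tau> (Suc k)} (d (Suc i)))
   = X (min (d p) (\<tau> (Suc k))) w - X (min (d p) (\<tau> k)) w" if k: "k < m" for k
 proof -
  have mp: "\<exists>\<alpha>\<le>p. min (d p) (\<tau> l) = d \<alpha>" if l: "l \<le> m" for l
  proof -
   obtain q where q: "q \<le> N" "min (d N) (\<tau> l) = d q" using mem[OF l] by auto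
   have "min (d p) (\<tau> l) = min (d p) (d q)" using q le_iff[of p N] p by linarith
   also have "\<dots> = d (min p q)" using le_iff[of p q] p q by (auto simp: min_def)
   finally show ?thesis by (intro exI[of _ "min p q"]) simp
  qed
  obtain \<alpha> \<beta> where \<alpha>: "\<alpha> \<le> p" "min (d p) (\<tau> k) = d \<alpha>" and \<beta>: "\<beta> \<le> p" "min (d p) (\<tau> (Suc k)) = d \<beta>"
   using mp[of k] mp[of "Suc k"] k by auto
  have "d \<alpha> \<le> d \<beta>" using \<alpha>(2) \<beta>(2) \<tau>[OF k] by linarith
  then have \<alpha>\<beta>: "\<alpha> \<le> \<beta>" using le_iff \<alpha> \<beta> p by simp
  have "(X (d (Suc i)) w - X (d i) w) * indicator {\<tau> k<..\<tau> (Suc k)} (d (Suc i))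
    = (if \<alpha> \<le> i \<and> i < \<beta> then X (d (Suc i)) w - X (d i) w else 0)" if i: "i < p" for i
  proof -
   have di: "d (Suc i) \<le> d p" using le_iff[of "Suc i" p] i p by simp
   have "\<tau> k < d (Suc i) \<longleftrightarrow> d \<alpha> < d (Suc i)" using \<alpha>(2) di by linarith
   also have "\<dots> \<longleftrightarrow> \<alpha> \<le> i" using less_iff[of \<alpha> "Suc i"] \<alpha>(1) i p by (simp add: less_Suc_eq_le)
   finally have 1: "\<tau> k < d (Suc i) \<longleftrightarrow> \<alpha> \<le> i" .
   have "d (Suc i) \<le> \<tau> (Suc k) \<longleftrightarrow> d (Suc i) \<le> d \<beta>" using \<beta>(2) di by linarith
   also have "\<dots> \<longleftrightarrow> i < \<beta>" using le_iff[of "Suc i" \<beta>] \<beta>(1) i p by (simp add: Suc_le_eq)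
   finally have 2: "d (Suc i) \<le> \<tau> (Suc k) \<longleftrightarrow> i < \<beta>" .
   show ?thesis using 1 2 by (simp add: indicator_def)
  qed
  then have "(\<Sum>i<p. (X (d (Suc i)) w - X (d i) w) * indicator {\<tau> k<..\<tau> (Suc k)} (d (Suc i)))
    = (\<Sum>i<p. if \<alpha> \<le> i \<and> i < \<beta> then X (d (Suc i)) w - X (d i) w else 0)" by simp
  also have "\<dots> = X (d \<beta>) w - X (d \<alpha>) w"
   using sum_grid_interval[OF \<alpha>\<beta> \<beta>(1), of "\<lambda>i. X (d i) w"] .
  finally show ?thesis using \<alpha>(2) \<beta>(2) by simp
 qed
 have "(\<Sum>i<p. (X (d (Suc i)) w - X (d i) w) *\<^sub>R elementary_value m \<tau> \<xi> (d (Suc i)) w)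
   = (\<Sum>i<p. \<Sum>k<m. ((X (d (Suc i)) w - X (d i) w) * indicator {\<tau> k<..\<tau> (Suc k)} (d (Suc i))) *\<^sub>R \<xi> k w)"
  by (simp only: elementary_value_def scaleR_sum_right scaleR_scaleR)
 also have "\<dots> = (\<Sum>k<m. (\<Sum>i<p. (X (d (Suc i)) w - X (d i) w) * indicator {\<tau> k<..\<tau> (Suc k)} (d (Suc i))) *\<^sub>R \<xi> k w)"
  by (subst sum.swap) (simp only: scaleR_sum_left)
 also have "\<dots> = elementary_integral m \<tau> \<xi> X (d p) w"
  unfolding elementary_integral_def using key by simp
 finally show ?thesis ..
qed

end

lemma (in brownian_motion) elementary_value_adapted:
 assumes "refining_grid d N m \<tau>" "i < N"
  and \<xi>: "\<And>k. k < m ==> \<xi> k \<in> borel_measurable (F (\<tau> k))"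
 shows "elementary_value m \<tau> \<xi> (d (Suc i)) \<in> borel_measurable (F (d i))"
proof -
 interpret refining_grid d N m \<tau> by fact
 have "(\<lambda>w. indicator {\<tau> k<..\<tau> (Suc k)} (d (Suc i)) *\<^sub>R \<xi> k w) \<in> borel_measurable (F (d i))" if k: "k < m" for k
 proof (cases "\<tau> k < d (Suc i)")
  case True
  then have "\<tau> k \<le> d i" using tau_less_iff[of k i] k assms(2) by simp
  from F_measurable_mono[OF \<xi>[OF k] this] show ?thesis by simp
 qed (simp add: indicator_def)
 then show ?thesis unfolding elementary_value_def by (intro borel_measurable_sum) auto
qed

text \<open>
 The grid lists \<open>0\<close>, \<open>T\<close> and the elements of \<open>A\<close> in increasing order.
\<close>

lemma exists_refining_grid:
 assumes T: "0 < T" and fin: "finite A" "A \<subseteq> {0..T}"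
 shows "\<exists>d N. (\<forall>i<N. d i < d (Suc i)) \<and> d 0 = 0 \<and> d N = (T::real) \<and> A \<subseteq> d ` {..N} \<and> d ` {..N} \<subseteq> {0..T}"
proof -
 let ?D = "insert 0 (insert T A)"
 let ?l = "sorted_list_of_set ?D"
 have fD: "finite ?D" using fin by simp
 have ne: "?D \<noteq> {}" by simp
 have len: "length ?l = card ?D" by simp
 have c: "card ?D > 0" using fD by (simp add: card_gt_0_iff)
 define N where "N = card ?D - 1"
 have N: "{..N} = {..<length ?l}" using c by (auto simp: N_def len simp del: sorted_list_of_set_insert_remove)
 have img: "(\<lambda>i. ?l ! i) ` {..N} = ?D"
  unfolding N using fD by (metis (no_types, lifting) list.set_map map_nth set_upt atLeast0LessThan sorted_list_of_set.set_sorted_key_list_of_set)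
 have sl: "sorted_wrt (<) ?l" by (rule strict_sorted_list_of_set)
 have lt: "?l ! i < ?l ! Suc i" if "i < N" for i
  using sorted_wrt_nth_less[OF sl, of i "Suc i"] that N by (metis lessI lessThan_iff Suc_leI atMost_iff)
 have lem: "?l ! i \<le> ?l ! j" if "i \<le> j" "j \<le> N" for i j
  using that
 proof (induction j)
  case (Suc j)
  then show ?case using lt[of j] by (cases "i = Suc j") auto
 qed simp
 have bnd: "?D \<subseteq> {0..T}" using fin T by auto
 have "?l ! 0 = 0"
 proof -
  obtain i where i: "i \<le> N" "?l ! i = 0" using img by (metis (no_types, lifting) atMost_iff image_iff insertI1)
  then have "?l ! 0 \<le> 0" using lem[of 0 i] by simp
  moreover have "?l ! 0 \<in> ?D" using img by blast
  ultimately show ?thesis using bnd by force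
 qed
 moreover have "?l ! N = T"
 proof -
  obtain i where i: "i \<le> N" "?l ! i = T" using img by (metis (no_types, lifting) atMost_iff image_iff insertI1 insertI2)
  then have "T \<le> ?l ! N" using lem[of i N] by simp
  moreover have "?l ! N \<in> ?D" using img by blast
  ultimately show ?thesis using bnd by force
 qed
 ultimately show ?thesis using lt img bnd
  by (intro exI[of _ "\<lambda>i. ?l ! i"] exI[of _ N]) blast
qed
section \<open>Events of path processes\<close>

lemma sets_path_event:
 assumes "V \<in> measurable M (borel_of X)" "openin X U" shows "{w \<in> space M. V w \<in> U} \<in> sets M"
proof -
 have sub: "{U. openin X U} \<subseteq> Pow (topspace X)" by (auto dest: openin_subset)
 have "U \<in> sets (borel_of X)"
  unfolding borel_of_def sets_measure_of[OF sub] using assms(2) by (intro sigma_sets.Basic) simp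
 from measurable_sets[OF assms(1) this] show ?thesis by (simp add: vimage_def Int_def conj_commute)
qed

lemma openin_path_large:
 fixes e :: real
 assumes "S \<subseteq> {0..<1}"
 shows "openin (uniform_on_compacts {0..<1}) {u \<in> paths. \<exists>s\<in>S. e < norm (u s :: 'v::real_normed_vector)}"
 unfolding openin_uniform_on_compacts
proof (intro conjI ballI)
 fix u :: "real => 'v" assume "u \<in> {u \<in> paths. \<exists>s\<in>S. e < norm (u s)}"
 then obtain s where s: "s \<in> S" "e < norm (u s)" by blast
 have "\<exists>s\<in>S. e < norm (v s)" if "\<forall>t\<in>{s}. dist (u t) (v t) < norm (u s) - e" for v
 proof -
  have "dist (u s) (v s) < norm (u s) - e" using that by simp
  then have "e < norm (v s)" using norm_triangle_ineq3[of "u s" "v s"] by (simp add: dist_norm)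
  then show ?thesis using s(1) by blast
 qed
 then show "\<exists>K d. compact K \<and> K \<subseteq> {0..<1} \<and> 0 < d \<and>
   (\<forall>v\<in>paths. (\<forall>t\<in>K. dist (u t) (v t) < d) \<longrightarrow> v \<in> {u \<in> paths. \<exists>s\<in>S. e < norm (u s)})"
  using s assms by (intro exI[of _ "{s}"] exI[of _ "norm (u s) - e"]) auto
qed auto

lemma openin_path_modulus:
 fixes \<delta> :: real
 assumes "S \<subseteq> {0..<1}"
 shows "openin (uniform_on_compacts {0..<1})
  {u \<in> paths. \<exists>s\<in>S. \<exists>t\<in>S. \<bar>s - t\<bar> \<le> \<theta> \<and> \<delta> < dist (u s :: 'v::metric_space) (u t)}"
 unfolding openin_uniform_on_compacts
proof (intro conjI ballI)
 fix u :: "real => 'v" assume "u \<in> {u \<in> paths. \<exists>s\<in>S. \<exists>t\<in>S. \<bar>s - t\<bar> \<le> \<theta> \<and> \<delta> < dist (u s) (u t)}"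
 then obtain s t where s: "s \<in> S" "t \<in> S" "\<bar>s - t\<bar> \<le> \<theta>" "\<delta> < dist (u s) (u t)" by blast
 let ?d = "(dist (u s) (u t) - \<delta>) / 2"
 have "\<exists>s\<in>S. \<exists>t\<in>S. \<bar>s - t\<bar> \<le> \<theta> \<and> \<delta> < dist (v s) (v t)" if "\<forall>r\<in>{s,t}. dist (u r) (v r) < ?d" for v
 proof -
  have "dist (u s) (v s) < ?d" "dist (u t) (v t) < ?d" using that by auto
  moreover have "dist (u s) (u t) \<le> dist (u s) (v s) + dist (v s) (v t) + dist (u t) (v t)"
   by (metis add.commute add_left_mono dist_commute dist_triangle2 dist_triangle_le group_cancel.add1 order_trans add_right_mono dist_triangle)
  ultimately have "\<delta> < dist (v s) (v t)" by argo
  then show ?thesis using s by blast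
 qed
 then show "\<exists>K d. compact K \<and> K \<subseteq> {0..<1} \<and> 0 < d \<and>
   (\<forall>v\<in>paths. (\<forall>t\<in>K. dist (u t) (v t) < d) \<longrightarrow>
     v \<in> {u \<in> paths. \<exists>s\<in>S. \<exists>t\<in>S. \<bar>s - t\<bar> \<le> \<theta> \<and> \<delta> < dist (u s) (u t)})"
  using s assms by (intro exI[of _ "{s,t}"] exI[of _ ?d]) auto
qed auto

context
 fixes P :: "'w measure" and Y :: "real => 'w => 'v::euclidean_space" and T :: real
 assumes P: "prob_space P" and T: "0 \<le> T" "T < 1"
  and Y: "\<And>t. t \<in> {0..<1} ==> Y t \<in> borel_measurable P"
  and cont: "\<And>w. w \<in> space P ==> continuous_on {0..<1} (\<lambda>t. Y t w)"
begin

lemma sets_path_large: "{w \<in> space P. \<exists>s\<in>{0..T}. e < norm (Y s w)} \<in> sets P"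
proof -
 have "{0..T} \<subseteq> {0..<1}" using T by auto
 note sets_path_event[OF measurable_continuous_path[OF Y cont] openin_path_large[OF this, of e]]
 also have "{w \<in> space P. (\<lambda>t\<in>{0..<1}. Y t w) \<in> {u \<in> paths. \<exists>s\<in>{0..T}. e < norm (u s)}}
   = {w \<in> space P. \<exists>s\<in>{0..T}. e < norm (Y s w)}" using T by auto
 finally show ?thesis .
qed

lemma sets_path_modulus:
 "{w \<in> space P. \<exists>s\<in>{0..T}. \<exists>t\<in>{0..T}. \<bar>s - t\<bar> \<le> \<theta> \<and> \<delta> < dist (Y s w) (Y t w)} \<in> sets P"
proof -
 have "{0..T} \<subseteq> {0..<1}" using T by auto
 note sets_path_event[OF measurable_continuous_path[OF Y cont] openin_path_modulus[OF this, of \<theta> \<delta>]]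
 also have "{w \<in> space P. (\<lambda>t\<in>{0..<1}. Y t w) \<in> {u \<in> paths. \<exists>s\<in>{0..T}. \<exists>t\<in>{0..T}. \<bar>s - t\<bar> \<le> \<theta> \<and> \<delta> < dist (u s) (u t)}}
   = {w \<in> space P. \<exists>s\<in>{0..T}. \<exists>t\<in>{0..T}. \<bar>s - t\<bar> \<le> \<theta> \<and> \<delta> < dist (Y s w) (Y t w)}" using T by auto
 finally show ?thesis .
qed

lemma path_bounded_in_probability:
 assumes e: "0 < e" shows "\<exists>R>0. measure P {w \<in> space P. \<exists>s\<in>{0..T}. R < norm (Y s w)} < e"
proof -
 interpret prob_space P by (rule P)
 let ?A = "\<lambda>n. {w \<in> space P. \<exists>s\<in>{0..T}. real n < norm (Y s w)}"
 have "(\<Inter>n. ?A n) = {}"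
 proof (rule ccontr)
  assume "(\<Inter>n. ?A n) \<noteq> {}"
  then obtain w where "w \<in> (\<Inter>n. ?A n)" by (elim ex_in_conv[THEN iffD2, elim_format] exE)
  then have w: "w \<in> ?A n" for n by (rule INT_D) simp
  have "w \<in> space P" using w[of 0] unfolding mem_Collect_eq by (rule conjunct1)
  have "continuous_on {0..T} (\<lambda>t. Y t w)"
   by (rule continuous_on_subset[OF cont[OF \<open>w \<in> space P\<close>]]) (use T in auto)
  then have "bounded ((\<lambda>t. Y t w) ` {0..T})"
   by (intro compact_imp_bounded compact_continuous_image) auto
  then obtain b where b: "\<And>s. s \<in> {0..T} ==> norm (Y s w) \<le> b" unfolding bounded_iff by blast
  obtain n where "b \<le> real n" using real_arch_simple by blast
  then show False using w[of n] b by force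
 qed
 moreover have "(\<lambda>n. prob (?A n)) \<longlonglongrightarrow> prob (\<Inter>n. ?A n)"
  by (rule finite_Lim_measure_decseq) (use sets_path_large in \<open>auto simp: decseq_def intro: order.strict_trans1 of_nat_mono\<close>)
 ultimately have "(\<lambda>n. prob (?A n)) \<longlonglongrightarrow> 0" by simp
 then have "\<forall>\<^sub>F n in sequentially. prob (?A n) < e" by (rule order_tendstoD) (rule e)
 then have "\<forall>\<^sub>F n in sequentially. prob (?A n) < e \<and> n > 0" using eventually_gt_at_top by (rule eventually_conj)
 then obtain n where "prob (?A n) < e" "n > 0" using eventually_happens'[OF sequentially_bot] by blast
 then show ?thesis by (intro exI[of _ "real n"]) auto
qed

text \<open>
 Paths are uniformly continuous on \<open>[0,T]\<close>, so the events for \<open>\<theta> = 1/(n+1)\<close> decrease to the empty set.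
\<close>

lemma path_modulus_in_probability:
 assumes e: "0 < e" and \<delta>: "0 < \<delta>"
 shows "\<exists>\<theta>>0. measure P {w \<in> space P. \<exists>s\<in>{0..T}. \<exists>t\<in>{0..T}. \<bar>s - t\<bar> \<le> \<theta> \<and> \<delta> < dist (Y s w) (Y t w)} < e"
proof -
 interpret prob_space P by (rule P)
 let ?A = "\<lambda>n. {w \<in> space P. \<exists>s\<in>{0..T}. \<exists>t\<in>{0..T}. \<bar>s - t\<bar> \<le> 1 / real (Suc n) \<and> \<delta> < dist (Y s w) (Y t w)}"
 have "(\<Inter>n. ?A n) = {}"
 proof (rule ccontr)
  assume "(\<Inter>n. ?A n) \<noteq> {}"
  then obtain w where "w \<in> (\<Inter>n. ?A n)" by (elim ex_in_conv[THEN iffD2, elim_format] exE)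
  then have w: "w \<in> ?A n" for n by (rule INT_D) simp
  have "w \<in> space P" using w[of 0] unfolding mem_Collect_eq by (rule conjunct1)
  have "continuous_on {0..T} (\<lambda>t. Y t w)"
   by (rule continuous_on_subset[OF cont[OF \<open>w \<in> space P\<close>]]) (use T in auto)
  then have "uniformly_continuous_on {0..T} (\<lambda>t. Y t w)" by (rule compact_uniformly_continuous) auto
  then obtain \<theta> where \<theta>: "\<theta> > 0" "\<And>s t. s \<in> {0..T} ==> t \<in> {0..T} ==> dist s t < \<theta> ==> dist (Y s w) (Y t w) < \<delta>"
   using \<delta> unfolding uniformly_continuous_on_def by metis
  obtain n where n: "1 / real (Suc n) < \<theta>" using nat_approx_posE[OF \<theta>(1)] by blast
  obtain s t where st: "s \<in> {0..T}" "t \<in> {0..T}" "\<bar>s - t\<bar> \<le> 1 / real (Suc n)" "\<delta> < dist (Y s w) (Y t w)"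
   using w[of n] by blast
  then have "dist s t < \<theta>" using n by (simp add: dist_real_def)
  then show False using \<theta>(2)[OF st(1,2)] st(4) by simp
 qed
 moreover have "(\<lambda>n. prob (?A n)) \<longlonglongrightarrow> prob (\<Inter>n. ?A n)"
 proof (rule finite_Lim_measure_decseq)
  show "decseq ?A"
  proof (rule decseq_SucI, safe)
   fix n w s t assume *: "s \<in> {0..T}" "t \<in> {0..T}" "\<bar>s - t\<bar> \<le> 1 / real (Suc (Suc n))" "\<delta> < dist (Y s w) (Y t w)"
   have "1 / real (Suc (Suc n)) \<le> 1 / real (Suc n)" by (simp add: field_simps)
   then show "\<exists>s\<in>{0..T}. \<exists>t\<in>{0..T}. \<bar>s - t\<bar> \<le> 1 / real (Suc n) \<and> \<delta> < dist (Y s w) (Y t w)"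
    using * by (meson order_trans)
  qed
 qed (use sets_path_modulus in blast)
 ultimately have "(\<lambda>n. prob (?A n)) \<longlonglongrightarrow> 0" by simp
 then have "\<forall>\<^sub>F n in sequentially. prob (?A n) < e" by (rule order_tendstoD) (rule e)
 then obtain n where "prob (?A n) < e" using eventually_happens'[OF sequentially_bot] by blast
 then show ?thesis by (intro exI[of _ "1 / real (Suc n)"]) auto
qed

end

section \<open>Ito integrals and Riemann sums\<close>

lemma elementary_value_eq:
 assumes "\<And>i. i < K ==> t i \<le> t (Suc i)" "i < K" "t i < s" "s \<le> t (Suc i)"
 shows "elementary_value K t \<xi> s w = \<xi> i w"
proof -
 have mono: "t k \<le> t l" if "k \<le> l" "l \<le> K" for k l
  using that
 proof (induction l)
  case (Suc l)
  then show ?case using assms(1)[of l] by (cases "k = Suc l") auto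
 qed simp
 have "indicator {t k<..t (Suc k)} s *\<^sub>R \<xi> k w = (if k = i then \<xi> i w else 0)" if k: "k < K" for k
 proof -
  consider "k < i" | "k = i" | "i < k" by linarith
  then show ?thesis
  proof cases
   case 1
   then have "t (Suc k) \<le> t i" using mono[of "Suc k" i] assms(2) by simp
   then show ?thesis using 1 assms by (simp add: indicator_def)
  next
   case 3
   then have "t (Suc i) \<le> t k" using mono[of "Suc i" k] k by simp
   then show ?thesis using 3 assms by (simp add: indicator_def)
  qed (use assms in \<open>simp add: indicator_def\<close>)
 qed
 then have "elementary_value K t \<xi> s w = (\<Sum>k<K. if k = i then \<xi> i w else 0)"
  unfolding elementary_value_def by simp
 then show ?thesis using assms(2) by simp
qed

lemma elementary_integral_at:
 assumes t: "\<And>i. i < K ==> t i < t (Suc i)" and k: "k \<le> K"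
 shows "elementary_integral K t \<xi> X (t k) w = (\<Sum>i<k. (X (t (Suc i)) w - X (t i) w) *\<^sub>R \<xi> i w)"
proof -
 interpret g: refining_grid t K K t
 proof
  fix k assume k: "k \<le> K"
  then have "t k \<le> t K" using lift_Suc_mono_le[of "\<lambda>i. t (min i K)" k K] t by (fastforce simp: min_def not_less_eq_eq le_less)
  then show "min (t K) (t k) \<in> t ` {..K}" using k by simp
 qed (use t in \<open>auto intro: less_imp_le\<close>)
 show ?thesis unfolding g.elementary_integral_grid[OF k]
  using t k by (intro sum.cong refl) (simp add: elementary_value_eq[of K t] less_imp_le)
qed

context brownian_motion begin

text \<open>
 Clamping the time to \<open>[0,T]\<close> gives a jointly measurable function on the whole line, as the integral over the time
 parameter requires.
\<close>

lemma progressively_measurable_clamp: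
 assumes H: "progressively_measurable F 1 H" and T: "0 \<le> T" "T < 1"
 shows "(\<lambda>(w, s). H (max 0 (min T s)) w) \<in> borel_measurable (P \<Otimes>\<^sub>M lborel)"
proof -
 have 1: "(\<lambda>(s, w). H s w) \<in> borel_measurable (restrict_space borel {0..T} \<Otimes>\<^sub>M F T)"
  using H T unfolding progressively_measurable_def by auto
 have c: "(\<lambda>x. max 0 (min T (snd x))) \<in> measurable (P \<Otimes>\<^sub>M lborel) (restrict_space borel {0..T})"
  by (rule measurable_restrict_space2) (use T in auto)
 have "(\<lambda>w. w) \<in> measurable P (F T)"
 proof (rule measurableI)
  fix A assume A: "A \<in> sets (F T)"
  then have "A \<in> sets P" using sets_F by blast
  then show "(\<lambda>w. w) -` A \<inter> space P \<in> sets P" by simp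
 qed (simp add: space_F)
 then have "fst \<in> measurable (P \<Otimes>\<^sub>M lborel) (F T)" 
  using measurable_compose[OF measurable_fst, of "\<lambda>w. w" P "F T" lborel] by simp
 from measurable_compose[OF measurable_Pair[OF c this] 1] show ?thesis by (simp add: case_prod_beta)
qed

lemma elementary_integral_continuous:
 assumes el: "elementary_process F m \<tau> \<xi>" and w: "w \<in> space P"
 shows "continuous_on {0..<1} (\<lambda>t. elementary_integral m \<tau> \<xi> (\<lambda>t w. B t w $ j) t w)"
proof -
 have \<tau>0: "0 \<le> \<tau> k" if "k \<le> m" for k
  using that
 proof (induction k)
  case (Suc k)
  have "\<tau> k \<le> \<tau> (Suc k)" using el Suc.prems by (auto simp: elementary_process_def)
  then show ?case using Suc by simp
 qed (use el in \<open>simp add: elementary_process_def\<close>)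
 have "continuous_on {0..<1} (\<lambda>t. B (min t (\<tau> k)) w)" if "k \<le> m" for k
  by (rule continuous_on_compose2[OF continuous_paths[OF w]])
    (use \<tau>0[OF that] in \<open>auto intro!: continuous_intros\<close>)
 then show ?thesis unfolding elementary_integral_def
  by (intro continuous_on_sum continuous_on_scaleR continuous_on_diff continuous_on_component continuous_on_const) auto
qed

lemma elementary_integral_measurable:
 assumes el: "elementary_process F m \<tau> \<xi>" and t: "0 \<le> t"
 shows "elementary_integral m \<tau> \<xi> (\<lambda>t w. B t w $ j) t \<in> borel_measurable P"
proof -
 have \<tau>0: "0 \<le> \<tau> k" if "k \<le> m" for k
  using that
 proof (induction k)
  case (Suc k)
  have "\<tau> k \<le> \<tau> (Suc k)" using el Suc.prems by (auto simp: elementary_process_def)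
  then show ?case using Suc by simp
 qed (use el in \<open>simp add: elementary_process_def\<close>)
 have BP: "(\<lambda>w. B s w $ j) \<in> borel_measurable P" if "0 \<le> s" for s
  by (rule measurable_compose[OF F_measurable_imp[OF adapted[OF that]]])
    (intro borel_measurable_continuous_onI continuous_intros)
 have "\<xi> k \<in> borel_measurable P" if "k < m" for k
  using el that F_measurable_imp unfolding elementary_process_def by blast
 then show ?thesis unfolding elementary_integral_def
  using t \<tau>0 by (intro borel_measurable_sum borel_measurable_scaleR borel_measurable_diff BP) auto
qed

text \<open>
 The integrand \<open>H\<close> is within \<open>\<delta>\<close> of the step process of the Riemann sum on the event \<open>A\<close>. By definition \<open>J\<close> is a limit of
 elementary integrals. On a common refinement of both time grids, the difference of an
 approximating elementary integral and the Riemann sum is a noise sum, whose bracket is the integral of the squared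
 difference of the integrands. This is at most \<open>4 \<delta>\<^sup>2 T\<close> on \<open>A\<close> with high probability, and Lenglart's
 inequality applies.
\<close>

lemma ito_integral_near_Riemann_sums:
 fixes H J :: "real => 'w => 'v::euclidean_space"
 assumes I: "has_ito_integral P F (\<lambda>t w. B t w $ j) 1 H J"
  and t: "\<And>i. i < K ==> t i < t (Suc i)" "t 0 = 0" "t K = T" and T: "0 < T" "T < 1"
  and \<xi>: "\<And>i. i < K ==> \<xi> i \<in> borel_measurable (F (t i))"
  and A: "A \<in> sets P" "\<And>w s. w \<in> A ==> s \<in> {0<..T} ==> norm (elementary_value K t \<xi> s w - H s w) \<le> \<delta>"
  and \<delta>: "0 < \<delta>" and a: "0 < a"
 shows "prob {w \<in> space P. \<exists>k\<le>K. a < norm (J (t k) w - (\<Sum>i<k. (B (t (Suc i)) w $ j - B (t i) w $ j) *\<^sub>R \<xi> i w))}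
  \<le> prob (space P - A) + 16 * \<delta>^2 * T / a^2"
proof -
 let ?X = "\<lambda>t w. B t w $ j"
 obtain m \<tau> \<zeta> where el: "\<And>n. elementary_process F (m n) (\<tau> n) (\<zeta> n)"
  and lim1: "\<And>t e. t \<in> {0..<1} ==> e > 0 ==> (\<lambda>n. prob {w \<in> space P.
       (\<integral>\<^sup>+s\<in>{0..t}. ennreal ((norm (elementary_value (m n) (\<tau> n) (\<zeta> n) s w - H s w))^2) \<partial>lborel)
        > ennreal e}) \<longlonglongrightarrow> 0"
  and lim2: "\<And>t e. t \<in> {0..<1} ==> e > 0 ==> (\<lambda>n. prob {w \<in> space P.
       \<exists>s\<in>{0..t}. norm (elementary_integral (m n) (\<tau> n) (\<zeta> n) ?X s w - J s w) > e}) \<longlonglongrightarrow> 0"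
  using I unfolding has_ito_integral_def by blast
 have H: "progressively_measurable F 1 H" and J: "continuous_adapted P F 1 J"
  using I unfolding has_ito_integral_def by auto
 let ?e = "\<delta>^2 * T"
 have e: "0 < ?e" using \<delta> T by simp
 let ?int = "\<lambda>n w. \<integral>\<^sup>+s\<in>{0..T}. ennreal ((norm (elementary_value (m n) (\<tau> n) (\<zeta> n) s w - H s w))^2) \<partial>lborel"
 let ?B1 = "\<lambda>n. {w \<in> space P. ?int n w > ennreal ?e}"
 let ?B2 = "\<lambda>n. {w \<in> space P. \<exists>s\<in>{0..T}. norm (elementary_integral (m n) (\<tau> n) (\<zeta> n) ?X s w - J s w) > a / 2}"
 let ?R = "\<lambda>k w. \<Sum>i<k. (B (t (Suc i)) w $ j - B (t i) w $ j) *\<^sub>R \<xi> i w"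
 let ?L = "{w \<in> space P. \<exists>k\<le>K. a < norm (J (t k) w - ?R k w)}"
 have tmono: "t p \<le> t q" if "p \<le> q" "q \<le> K" for p q
  using that
 proof (induction q)
  case (Suc q)
  then show ?case using t(1)[of q] by (cases "p = Suc q") auto
 qed simp
 have tT: "t k \<in> {0..T}" if "k \<le> K" for k using tmono[of 0 k] tmono[of k K] that t by auto
 have Jm: "J s \<in> borel_measurable P" if "s \<in> {0..<1}" for s
  using J that F_measurable_imp unfolding continuous_adapted_def by blast
 have bound: "prob ?L \<le> prob (?B2 n) + (prob (?B1 n) + prob (space P - A) + 16 * \<delta>^2 * T / a^2)" for n
 proof -
  have \<tau>: "\<tau> n k \<le> \<tau> n (Suc k)" "\<zeta> n k \<in> borel_measurable (F (\<tau> n k))" if "k < m n" for k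
   using el[of n] that unfolding elementary_process_def by auto
  have \<tau>0: "0 \<le> \<tau> n k" if "k \<le> m n" for k
   using that
  proof (induction k)
   case (Suc k)
   then show ?case using \<tau>(1)[of k] by simp
  qed (use el[of n] in \<open>simp add: elementary_process_def\<close>)
  obtain d N where d: "\<And>i. i < N ==> d i < d (Suc i)" "d 0 = 0" "d N = T"
   and dA: "(\<lambda>k. min T (\<tau> n k)) ` {..m n} \<union> t ` {..K} \<subseteq> d ` {..N}" and dT: "d ` {..N} \<subseteq> {0..T}"
  proof -
   let ?A = "(\<lambda>k. min T (\<tau> n k)) ` {..m n} \<union> t ` {..K}"
   have "?A \<subseteq> {0..T}" using \<tau>0 tT T by auto
   from exists_refining_grid[OF T(1) _ this] that show thesis by auto
  qed
  interpret g1: refining_grid d N "m n" "\<tau> n"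
   by unfold_locales (use d dA \<tau> in auto)
  interpret g2: refining_grid d N K t
  proof
   fix k assume "k \<le> K"
   then have "t k \<in> d ` {..N}" "min (d N) (t k) = t k" using dA tT[of k] d by auto
   then show "min (d N) (t k) \<in> d ` {..N}" by simp
  qed (use d t less_imp_le in auto)
  have d0: "0 \<le> d 0" using d by simp
  interpret ns: noise_sequence P "\<lambda>k. F (d k)" "\<lambda>k w. (B (d (Suc k)) w - B (d k) w) $ j" "\<lambda>k. d (Suc k) - d k" N
   by (rule increment_noise[OF d(1) d0])
  let ?v1 = "elementary_value (m n) (\<tau> n) (\<zeta> n)" and ?v2 = "elementary_value K t \<xi>"
  define z where "z i w = ?v1 (d (Suc i)) w - ?v2 (d (Suc i)) w" for i w
  have zm: "z i \<in> borel_measurable (F (d i))" if "i < N" for i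
   unfolding z_def
   using elementary_value_adapted[OF g1.refining_grid_axioms that \<tau>(2)]
    elementary_value_adapted[OF g2.refining_grid_axioms that \<xi>] by simp
  have sumz: "(\<Sum>i<p. (B (d (Suc i)) w - B (d i) w) $ j *\<^sub>R z i w)
    = elementary_integral (m n) (\<tau> n) (\<zeta> n) ?X (d p) w - elementary_integral K t \<xi> ?X (d p) w" if "p \<le> N" for p w
   unfolding g1.elementary_integral_grid[OF that] g2.elementary_integral_grid[OF that] z_def
   by (simp add: sum_subtractf scaleR_diff_right)
  (* Twice the integral of the squared approximation error, up to \<delta>^2 T, plus twice \<delta>^2 T. *)
  let ?c = "4 * \<delta>^2 * T"
  let ?C = "{w \<in> space P. ?c < (\<Sum>i<N. (d (Suc i) - d i) * (norm (z i w))^2)}"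
  let ?D = "{w \<in> space P. \<exists>p\<le>N. a / 2 \<le> norm (\<Sum>i<p. (B (d (Suc i)) w - B (d i) w) $ j *\<^sub>R z i w)}"
  have len: "prob ?D \<le> prob ?C + ?c / (a / 2)^2"
   by (rule ns.Lenglart_inequality) (use zm d a \<delta> T in auto)
  have Hc: "(\<lambda>(w, s). H (max 0 (min T s)) w) \<in> borel_measurable (P \<Otimes>\<^sub>M lborel)"
   using progressively_measurable_clamp[OF H] T by simp
  let ?f = "\<lambda>w s. ennreal ((norm (?v1 s w - H (max 0 (min T s)) w))^2) * indicator {0..T} s"
  have fm[measurable]: "(\<lambda>(w, s). ?f w s) \<in> borel_measurable (P \<Otimes>\<^sub>M lborel)"
  proof -
   have [measurable]: "\<zeta> n k \<in> borel_measurable P" if "k < m n" for k using F_measurable_imp[OF \<tau>(2)[OF that]] .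
   have [measurable]: "(\<lambda>x. H (max 0 (min T (snd x))) (fst x)) \<in> borel_measurable (P \<Otimes>\<^sub>M lborel)"
    using Hc by (simp add: case_prod_beta)
   have [measurable]: "(\<lambda>x. ?v1 (snd x) (fst x)) \<in> borel_measurable (P \<Otimes>\<^sub>M lborel)"
    unfolding elementary_value_def by measurable
   show ?thesis by (simp add: case_prod_beta) measurable
  qed
  have int_eq: "?int n w = (\<integral>\<^sup>+s. ?f w s \<partial>lborel)" for w
   by (rule nn_integral_cong) (auto simp: indicator_def)
  have B1m: "?B1 n \<in> sets P"
  proof -
   have [measurable]: "(\<lambda>w. \<integral>\<^sup>+s. ?f w s \<partial>lborel) \<in> borel_measurable P"
    by (rule lborel.borel_measurable_nn_integral[OF fm])
   show ?thesis unfolding int_eq by measurable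
  qed
  have B2m: "?B2 n \<in> sets P"
  proof (rule sets_path_large[where Y="\<lambda>s w. elementary_integral (m n) (\<tau> n) (\<zeta> n) ?X s w - J s w"])
   show "prob_space P" by (rule prob_space_axioms)
   fix s :: real assume s: "s \<in> {0..<1}"
   show "(\<lambda>w. elementary_integral (m n) (\<tau> n) (\<zeta> n) ?X s w - J s w) \<in> borel_measurable P"
    using elementary_integral_measurable[OF el, of s] Jm[OF s] s by simp
  next
   fix w assume w: "w \<in> space P"
   show "continuous_on {0..<1} (\<lambda>s. elementary_integral (m n) (\<tau> n) (\<zeta> n) ?X s w - J s w)"
    using elementary_integral_continuous[OF el w] J w unfolding continuous_adapted_def
    by (intro continuous_on_diff) auto
  qed (use T in auto)
  have "?C \<subseteq> ?B1 n \<union> (space P - A)"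
  proof (rule subsetI, rule ccontr)
   fix w assume w: "w \<in> ?C" and nw: "w \<notin> ?B1 n \<union> (space P - A)"
   then have wA: "w \<in> A" and wP: "w \<in> space P" and i1: "?int n w \<le> ennreal ?e" by (auto simp: not_less)
   have sec: "(\<lambda>s. ?f w s) \<in> borel_measurable lborel"
    using measurable_compose_Pair1[OF wP fm] by simp
   let ?I = "\<lambda>i. {d i<..d (Suc i)}"
   have "ennreal (\<Sum>i<N. (d (Suc i) - d i) * (norm (z i w))^2)
     = (\<Sum>i<N. ennreal ((norm (z i w))^2) * emeasure lborel (?I i))"
   proof -
    have "ennreal ((d (Suc i) - d i) * (norm (z i w))^2) = ennreal ((norm (z i w))^2) * emeasure lborel (?I i)" if "i < N" for i
     using less_imp_le[OF d(1)[OF that]] by (simp add: ennreal_mult mult.commute)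
    moreover have "ennreal (\<Sum>i<N. (d (Suc i) - d i) * (norm (z i w))^2) = (\<Sum>i<N. ennreal ((d (Suc i) - d i) * (norm (z i w))^2))"
     by (rule sum_ennreal[symmetric]) (use d less_imp_le in \<open>auto intro!: mult_nonneg_nonneg simp: less_imp_le\<close>)
    ultimately show ?thesis by simp
   qed
   also have "\<dots> = (\<integral>\<^sup>+s. (\<Sum>i<N. ennreal ((norm (z i w))^2) * indicator (?I i) s) \<partial>lborel)"
    by (subst nn_integral_sum) (auto simp: nn_integral_cmult_indicator)
   also have "\<dots> \<le> (\<integral>\<^sup>+s. 2 * ?f w s + ennreal (2 * \<delta>^2) * indicator {0..T} s \<partial>lborel)"
   proof (rule nn_integral_mono)
    fix s :: real
    show "(\<Sum>i<N. ennreal ((norm (z i w))^2) * indicator (?I i) s) \<le> 2 * ?f w s + ennreal (2 * \<delta>^2) * indicator {0..T} s"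
    proof (cases "\<exists>i<N. s \<in> ?I i")
     case True
     then obtain i where i: "i < N" "d i < s" "s \<le> d (Suc i)" by auto
     have uniq: "(indicator (?I k) s :: ennreal) = (if k = i then 1 else 0)" if "k < N" for k
     proof -
      have "k = i" if k: "s \<in> ?I k"
      proof (rule ccontr)
       assume "k \<noteq> i"
       then have "Suc k \<le> i \<or> Suc i \<le> k" by linarith
       then show False
        using g1.le_iff[of "Suc k" i] g1.le_iff[of "Suc i" k] i k \<open>k < N\<close> by auto
      qed
      then have "k \<noteq> i ==> s \<notin> ?I k" by blast
      moreover have "s \<in> ?I i" using i by simp
      ultimately show ?thesis by (cases "k = i") (simp_all del: greaterThanAtMost_iff)
     qed
     have "(\<Sum>k<N. ennreal ((norm (z k w))^2) * indicator (?I k) s) = (\<Sum>k<N. if k = i then ennreal ((norm (z i w))^2) else 0)"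
      using uniq by (intro sum.cong) auto
     also have "\<dots> = ennreal ((norm (z i w))^2)" using i by simp
     finally have eq: "(\<Sum>k<N. ennreal ((norm (z k w))^2) * indicator (?I k) s) = ennreal ((norm (z i w))^2)" .
     have dT': "d q \<in> {0..T}" if "q \<le> N" for q by (rule subsetD[OF dT]) (use that in simp)
     have "d i \<in> {0..T}" "d (Suc i) \<in> {0..T}" using i(1) by (auto intro!: dT' simp del: atLeastAtMost_iff)
     then have s: "s \<in> {0<..T}" using i by auto
     have zi: "z i w = (?v1 s w - H s w) + (H s w - ?v2 s w)"
     proof -
      have "?v1 (d (Suc i)) w = ?v1 s w" by (rule g1.elementary_value_cell[OF i, symmetric])
      moreover have "?v2 (d (Suc i)) w = ?v2 s w" by (rule g2.elementary_value_cell[OF i, symmetric])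
      ultimately show ?thesis unfolding z_def by simp
     qed
     have "(norm (z i w))^2 \<le> 2 * (norm (?v1 s w - H s w))^2 + 2 * (norm (H s w - ?v2 s w))^2"
      unfolding zi by (rule norm_add_sq_le)
     also have "norm (H s w - ?v2 s w) \<le> \<delta>" using A(2)[OF wA s] by (simp add: norm_minus_commute)
     then have "(norm (H s w - ?v2 s w))^2 \<le> \<delta>^2" by (intro power_mono) auto
     finally have "(norm (z i w))^2 \<le> 2 * (norm (?v1 s w - H s w))^2 + 2 * \<delta>^2" by simp
     then have "ennreal ((norm (z i w))^2) \<le> ennreal (2 * (norm (?v1 s w - H s w))^2 + 2 * \<delta>^2)" by (rule ennreal_leI)
     also have "\<dots> = 2 * ennreal ((norm (?v1 s w - H s w))^2) + ennreal (2 * \<delta>^2)"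
      by (simp add: ennreal_plus ennreal_mult)
     finally have "ennreal ((norm (z i w))^2) \<le> 2 * ennreal ((norm (?v1 s w - H s w))^2) + ennreal (2 * \<delta>^2)" .
     moreover have "max 0 (min T s) = s" "indicator {0..T} s = (1 :: ennreal)" using s by auto
     ultimately show ?thesis unfolding eq by simp
    next
     case False
     then have "(\<Sum>i<N. ennreal ((norm (z i w))^2) * indicator (?I i) s) = 0"
      by (intro sum.neutral) (auto simp: indicator_def)
     then show ?thesis by simp
    qed
   qed
   also have "\<dots> = 2 * ?int n w + ennreal (2 * \<delta>^2) * ennreal T"
    using sec T unfolding int_eq
    by (subst nn_integral_add) (auto simp: nn_integral_cmult nn_integral_cmult_indicator)
   also have "\<dots> \<le> 2 * ennreal ?e + ennreal (2 * \<delta>^2) * ennreal T"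
    using i1 by (intro add_mono mult_left_mono) auto
   also have "\<dots> = ennreal ?c"
   proof -
    have "ennreal ?c = ennreal (2 * ?e + 2 * \<delta>^2 * T)" by (simp add: mult_ac)
    also have "\<dots> = ennreal (2 * ?e) + ennreal (2 * \<delta>^2 * T)" by (rule ennreal_plus) (use T in auto)
    also have "ennreal (2 * ?e) = 2 * ennreal ?e" by (subst ennreal_mult) (use T in auto)
    also have "ennreal (2 * \<delta>^2 * T) = ennreal (2 * \<delta>^2) * ennreal T" by (rule ennreal_mult) (use T in auto)
    finally show ?thesis ..
   qed
   finally have "(\<Sum>i<N. (d (Suc i) - d i) * (norm (z i w))^2) \<le> ?c"
    using T by (subst (asm) ennreal_le_iff) auto
   then show False using w by auto
  qed
  then have "prob ?C \<le> prob (?B1 n \<union> (space P - A))"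
   using B1m A(1) by (intro finite_measure_mono) auto
  also have "\<dots> \<le> prob (?B1 n) + prob (space P - A)"
   using B1m A(1) by (intro measure_Un_le) auto
  finally have PC: "prob ?C \<le> prob (?B1 n) + prob (space P - A)" .
  have Dm: "?D \<in> sets P"
   by (rule sets_ex_norm_ge, rule ns.measurable_F[OF ns.noise_sum_adapted]) (use zm in auto)
  have "?L \<subseteq> ?B2 n \<union> ?D"
  proof (rule subsetI, rule ccontr)
   fix w assume w: "w \<in> ?L" and nw: "w \<notin> ?B2 n \<union> ?D"
   obtain k where k: "k \<le> K" "a < norm (J (t k) w - ?R k w)" using w by blast
   have wP: "w \<in> space P" using w by simp
   obtain p where p: "p \<le> N" "t k = d p" using dA k(1) by auto
   have R: "?R k w = elementary_integral K t \<xi> ?X (t k) w"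
   proof -
    show ?thesis using elementary_integral_at[of K t k \<xi> ?X w, OF t(1) k(1)] by simp
   qed
   have 1: "norm (elementary_integral (m n) (\<tau> n) (\<zeta> n) ?X (t k) w - J (t k) w) \<le> a / 2"
   proof (rule ccontr)
    assume "\<not> ?thesis"
    then have "w \<in> ?B2 n" using wP tT[OF k(1)] by (intro CollectI conjI bexI[of _ "t k"]) auto
    then show False using nw by blast
   qed
   have "\<not> a / 2 \<le> norm (\<Sum>i<p. (B (d (Suc i)) w - B (d i) w) $ j *\<^sub>R z i w)"
    using nw wP p(1) by blast
   then have 2: "norm (elementary_integral (m n) (\<tau> n) (\<zeta> n) ?X (t k) w - ?R k w) < a / 2"
    unfolding sumz[OF p(1)] R p(2) by simp
   have "norm (J (t k) w - ?R k w) \<le> norm (J (t k) w - elementary_integral (m n) (\<tau> n) (\<zeta> n) ?X (t k) w)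
    + norm (elementary_integral (m n) (\<tau> n) (\<zeta> n) ?X (t k) w - ?R k w)"
    using norm_triangle_ineq[of "J (t k) w - elementary_integral (m n) (\<tau> n) (\<zeta> n) ?X (t k) w"
     "elementary_integral (m n) (\<tau> n) (\<zeta> n) ?X (t k) w - ?R k w"] by simp
   then show False using 1 2 k(2) by (simp add: norm_minus_commute)
  qed
  then have "prob ?L \<le> prob (?B2 n \<union> ?D)" by (rule finite_measure_mono[OF _ sets.Un[OF B2m Dm]])
  also have "\<dots> \<le> prob (?B2 n) + prob ?D" by (rule measure_Un_le[OF B2m Dm])
  also have "prob ?D \<le> prob (?B1 n) + prob (space P - A) + 16 * \<delta>^2 * T / a^2"
   using len PC by (simp add: power_divide)
  finally show ?thesis by simp
 qed
 have l1: "(\<lambda>n. prob (?B1 n)) \<longlonglongrightarrow> 0" using lim1[of T ?e] T e by simp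
 have l2: "(\<lambda>n. prob (?B2 n)) \<longlonglongrightarrow> 0" using lim2[of T "a / 2"] T a by simp
 have "(\<lambda>n. prob (?B2 n) + (prob (?B1 n) + prob (space P - A) + 16 * \<delta>^2 * T / a^2))
   \<longlonglongrightarrow> 0 + (0 + prob (space P - A) + 16 * \<delta>^2 * T / a^2)"
  by (intro tendsto_add l1 l2 tendsto_const)
 then have "prob ?L \<le> 0 + (0 + prob (space P - A) + 16 * \<delta>^2 * T / a^2)"
  by (rule LIMSEQ_le_const) (use bound in blast)
 then show ?thesis by simp
qed

end

section \<open>Euler schemes for linear stochastic differential equations\<close>

primrec Euler_scheme ::
 "real => ('v => 'v) => (nat => 'd::finite => 'v => 'v) => 'v => (nat => real^'d) => nat => 'v::euclidean_space" where
 "Euler_scheme h A C y\<^sub>0 b 0 = y\<^sub>0"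
| "Euler_scheme h A C y\<^sub>0 b (Suc k) = Euler_scheme h A C y\<^sub>0 b k +
   (h *\<^sub>R A (Euler_scheme h A C y\<^sub>0 b k) + (\<Sum>j\<in>UNIV. (b k $ j) *\<^sub>R C k j (Euler_scheme h A C y\<^sub>0 b k)))"

lemma Euler_scheme_eq:
 "Euler_scheme h A C y\<^sub>0 b k = y\<^sub>0 + (\<Sum>i<k. h *\<^sub>R A (Euler_scheme h A C y\<^sub>0 b i)
   + (\<Sum>j\<in>UNIV. (b i $ j) *\<^sub>R C i j (Euler_scheme h A C y\<^sub>0 b i)))"
 by (induction k) (simp_all add: algebra_simps)

lemma Euler_defect_diff:
 assumes "linear A" "\<And>i j. linear (C i j)"
 shows "Euler_defect h A C b (\<lambda>k w. Y k w - Euler_scheme h A C y\<^sub>0 (\<lambda>i. b i w) k) k w = Euler_defect h A C b Y k w - y\<^sub>0"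
proof -
 let ?X = "Euler_scheme h A C y\<^sub>0 (\<lambda>i. b i w)"
 have "(\<Sum>i<k. h *\<^sub>R A (Y i w - ?X i) + (\<Sum>j\<in>UNIV. (b i w $ j) *\<^sub>R C i j (Y i w - ?X i)))
   = (\<Sum>i<k. h *\<^sub>R A (Y i w) + (\<Sum>j\<in>UNIV. (b i w $ j) *\<^sub>R C i j (Y i w)))
    - (\<Sum>i<k. h *\<^sub>R A (?X i) + (\<Sum>j\<in>UNIV. (b i w $ j) *\<^sub>R C i j (?X i)))"
  unfolding sum_subtractf[symmetric]
  by (intro sum.cong refl) (simp add: linear_diff[OF assms(1)] linear_diff[OF assms(2)] scaleR_diff_right sum_subtractf)
 moreover have "?X k = y\<^sub>0 + (\<Sum>i<k. h *\<^sub>R A (?X i) + (\<Sum>j\<in>UNIV. (b i w $ j) *\<^sub>R C i j (?X i)))"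
  by (rule Euler_scheme_eq)
 ultimately show ?thesis unfolding Euler_defect_def by (simp add: algebra_simps)
qed

lemma Euler_scheme_adapted:
 fixes b :: "nat => 'w => real^'d" and A :: "'v => 'v::euclidean_space"
 assumes b: "\<And>i j. i < k ==> (\<lambda>w. b i w $ j) \<in> borel_measurable M"
  and A: "linear A" and C: "\<And>i j. linear (C i j)"
 shows "(\<lambda>w. Euler_scheme h A C y\<^sub>0 (\<lambda>i. b i w) k) \<in> borel_measurable M"
 using b
proof (induction k)
 case (Suc k)
 have [measurable]: "(\<lambda>w. Euler_scheme h A C y\<^sub>0 (\<lambda>i. b i w) k) \<in> borel_measurable M" using Suc by simp
 have [measurable]: "(\<lambda>w. A (Euler_scheme h A C y\<^sub>0 (\<lambda>i. b i w) k)) \<in> borel_measurable M"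
  "(\<lambda>w. C k j (Euler_scheme h A C y\<^sub>0 (\<lambda>i. b i w) k)) \<in> borel_measurable M" for j
  by (simp_all add: borel_measurable_linear[OF A] borel_measurable_linear[OF C])
 have [measurable]: "(\<lambda>w. b k w $ j) \<in> borel_measurable M" for j using Suc.prems by simp
 show ?case by simp
qed simp

lemma integral_near_Riemann_sum:
 fixes f :: "real => 'v::euclidean_space"
 assumes f: "continuous_on {0..T} f" and h: "0 \<le> h" "real k * h \<le> T"
  and osc: "\<And>s t. s \<in> {0..T} ==> t \<in> {0..T} ==> \<bar>s - t\<bar> \<le> h ==> norm (f s - f t) \<le> \<delta>"
 shows "norm (integral {0..real k * h} f - (\<Sum>i<k. h *\<^sub>R f (real i * h))) \<le> real k * h * \<delta>"
 using h(2)
proof (induction k)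
 case (Suc k)
 let ?s = "real k * h" and ?t = "real (Suc k) * h"
 have st: "0 \<le> ?s" "?s \<le> ?t" "?t \<le> T" using h Suc.prems by (auto simp: mult_right_mono)
 have I: "integral {0..?t} f = integral {0..?s} f + integral {?s..?t} f"
  by (rule Henstock_Kurzweil_Integration.integral_combine[OF st(1,2), symmetric],
    rule integrable_continuous_interval, rule continuous_on_subset[OF f]) (use st in simp)
 have b1: "norm (integral {?s..?t} f - h *\<^sub>R f ?s) \<le> h * \<delta>"
 proof -
  have c: "continuous_on {?s..?t} f" using st by (intro continuous_on_subset[OF f]) auto
  have "integral {?s..?t} f - h *\<^sub>R f ?s = integral {?s..?t} (\<lambda>u. f u - f ?s)"
   using integrable_continuous_interval[OF c] st by (subst Henstock_Kurzweil_Integration.integral_diff) (auto simp: algebra_simps)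
  also have "norm \<dots> \<le> \<delta> * (?t - ?s)"
  proof (rule integral_bound)
   show "continuous_on {?s..?t} (\<lambda>u. f u - f ?s)" using c by (intro continuous_intros)
   fix u assume u: "u \<in> {?s..?t}"
   have "?t = ?s + h" by (simp add: algebra_simps)
   then have "u \<in> {0..T}" "?s \<in> {0..T}" "\<bar>u - ?s\<bar> \<le> h" using u st unfolding atLeastAtMost_iff by linarith+
   then show "norm (f u - f ?s) \<le> \<delta>" by (rule osc)
  qed (use st in auto)
  finally show ?thesis by (simp add: algebra_simps)
 qed
 have b2: "norm (integral {0..?s} f - (\<Sum>i<k. h *\<^sub>R f (real i * h))) \<le> ?s * \<delta>" using Suc st by auto
 have "integral {0..?t} f - (\<Sum>i<Suc k. h *\<^sub>R f (real i * h))
   = (integral {0..?s} f - (\<Sum>i<k. h *\<^sub>R f (real i * h))) + (integral {?s..?t} f - h *\<^sub>R f ?s)"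
  unfolding I by simp
 also have "norm \<dots> \<le> ?s * \<delta> + h * \<delta>"
  by (rule order_trans[OF norm_triangle_ineq add_mono[OF b2 b1]])
 finally show ?case by (simp add: algebra_simps)
qed simp

definition mesh :: "real => nat => real" where
 "mesh T K = T / real K"

text \<open>
 The noise coefficients \<open>\<gamma>(t) C\<^sub>j\<close>, frozen at the left end of each cell.
\<close>

definition grid_coeff ::
 "(real => real) => ('d => 'v => 'v::real_vector) => real => nat => nat => 'd => 'v => 'v" where
 "grid_coeff \<gamma> C T K i j x = \<gamma> (real i * mesh T K) *\<^sub>R C j x"

definition grid_incr ::
 "(real => 'w => 'u::real_vector) => real => nat => nat => 'w => 'u" where
 "grid_incr B T K i w = B (real (Suc i) * mesh T K) w - B (real i * mesh T K) w"

text \<open>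
 The factor \<open>\<gamma>\<close> is continuous on \<open>[0,1)\<close> but may be unbounded, as \<open>1 / sqrt (1 - t)\<close> is.
\<close>

locale linear_sde = brownian_motion P F B
 for P :: "'w measure" and F :: "real => 'w measure" and B :: "real => 'w => real^'d" +
 fixes A :: "'v::euclidean_space => 'v" and C :: "'d => 'v => 'v" and \<gamma> :: "real => real"
  and S :: "real => 'v => real^'d => 'v" and y\<^sub>0 :: 'v and Y :: "real => 'w => 'v" and c :: real
 assumes A: "linear A" "\<And>x. norm (A x) \<le> c * norm x"
  and C: "\<And>j. linear (C j)" "\<And>j x. norm (C j x) \<le> c * norm x"
  and c0: "0 \<le> c"
  and \<gamma>: "continuous_on {0..<1} \<gamma>"
  and S: "\<And>t y j. t \<in> {0..<1} ==> S t y (axis j 1) = \<gamma> t *\<^sub>R C j y"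
  and sde: "solves_sde P F B 1 (\<lambda>t. A) S y\<^sub>0 Y"
begin

lemma Y_adapted: "t \<in> {0..<1} ==> Y t \<in> borel_measurable (F t)"
 using sde unfolding solves_sde_def continuous_adapted_def by blast

lemma Y_continuous: "w \<in> space P ==> continuous_on {0..<1} (\<lambda>t. Y t w)"
 using sde unfolding solves_sde_def continuous_adapted_def by blast

lemma Y_measurable: "t \<in> {0..<1} ==> Y t \<in> borel_measurable P"
 using F_measurable_imp[OF Y_adapted] .

lemma coeff_linear: "linear (grid_coeff \<gamma> C T K i j)"
 unfolding grid_coeff_def using linear_compose_scale_right[OF C(1)] .

lemma gamma_bounded: assumes "0 \<le> T" "T < 1" shows "\<exists>G\<ge>1. \<forall>t\<in>{0..T}. \<bar>\<gamma> t\<bar> \<le> G"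
proof -
 have "continuous_on {0..T} \<gamma>" using assms by (intro continuous_on_subset[OF \<gamma>]) auto
 then have "bounded (\<gamma> ` {0..T})" by (intro compact_imp_bounded compact_continuous_image) auto
 then obtain b where "\<forall>t\<in>{0..T}. \<bar>\<gamma> t\<bar> \<le> b" unfolding bounded_iff by auto
 then show ?thesis by (intro exI[of _ "max 1 b"]) auto
qed

text \<open>
 The defect of the solution on the grid is the difference between the integrals in the equation and their
 Riemann sums. On the event \<open>G0\<close> the path is bounded by \<open>R\<close> and varies by at most \<open>\<delta>1\<close> over a cell, and \<open>\<gamma>\<close> varies by at
 most \<open>\<delta>2\<close>; this makes the Riemann sums of the drift accurate and bounds by \<open>\<delta>\<close> the error of the frozen integrand in each Ito integral.
\<close>

lemma Euler_defect_small:
 assumes T: "0 < T" "T < 1" and \<eta>: "0 < \<eta>" and e: "0 < e"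
 shows "\<exists>K0\<ge>1. \<forall>K\<ge>K0. prob {w \<in> space P. \<exists>k\<le>K.
  \<eta> < norm (Euler_defect (mesh T K) A (grid_coeff \<gamma> C T K) (grid_incr B T K) (\<lambda>k. Y (real k * mesh T K)) k w - y\<^sub>0)} \<le> e"
proof -
 let ?d = "real CARD('d)"
 have d: "?d \<ge> 1" by (simp add: Suc_leI)
 obtain J where J: "\<And>j. has_ito_integral P F (\<lambda>t w. B t w $ j) 1 (\<lambda>t w. S t (Y t w) (axis j 1)) (J j)"
  and ae: "AE w in P. \<forall>t\<in>{0..<1}. (\<lambda>s. A (Y s w)) integrable_on {0..t} \<and>
      Y t w = y\<^sub>0 + integral {0..t} (\<lambda>s. A (Y s w)) + (\<Sum>j\<in>UNIV. J j t w)"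
  using sde unfolding solves_sde_def by blast
 (* The event G0 below fails with probability at most 2 e', and each of the d Ito integrals costs 3 e'. *)
 define e' where "e' = e / (2 + 3 * ?d)"
 have e': "e' > 0" using e d by (simp add: e'_def)
 define a where "a = \<eta> / (2 * ?d)"
 have a: "a > 0" using \<eta> d by (simp add: a_def)
 (* The accuracy of the integrand at which Lenglart gives e' beyond the exceptional event. *)
 define \<delta> where "\<delta> = sqrt (e' * a^2 / (16 * T))"
 have \<delta>: "\<delta> > 0" "16 * \<delta>^2 * T / a^2 = e'" using e' a T by (auto simp: \<delta>_def field_simps)
 obtain G where G: "G \<ge> 1" "\<And>t. t \<in> {0..T} ==> \<bar>\<gamma> t\<bar> \<le> G" using gamma_bounded[of T] T by auto
 have T': "0 \<le> T" "T < 1" using T by auto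
 obtain R where R: "R > 0" "prob {w \<in> space P. \<exists>s\<in>{0..T}. R < norm (Y s w)} < e'"
  using path_bounded_in_probability[OF prob_space_axioms T' Y_measurable Y_continuous e'] by auto
 define \<delta>1 where "\<delta>1 = min (\<eta> / (2 * (c + 1) * T)) (\<delta> / (2 * G * (c + 1)))"
 have \<delta>1: "\<delta>1 > 0" using \<eta> T c0 \<delta> G by (auto simp: \<delta>1_def intro!: divide_pos_pos mult_pos_pos)
 obtain \<theta>1 where \<theta>1: "\<theta>1 > 0"
  "prob {w \<in> space P. \<exists>s\<in>{0..T}. \<exists>t\<in>{0..T}. \<bar>s - t\<bar> \<le> \<theta>1 \<and> \<delta>1 < dist (Y s w) (Y t w)} < e'"
  using path_modulus_in_probability[OF prob_space_axioms T' Y_measurable Y_continuous e' \<delta>1] by auto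
 define \<delta>2 where "\<delta>2 = \<delta> / (2 * (c + 1) * R)"
 have \<delta>2: "\<delta>2 > 0" using \<delta> c0 R by (simp add: \<delta>2_def)
 have "uniformly_continuous_on {0..T} \<gamma>"
  using T by (intro compact_uniformly_continuous continuous_on_subset[OF \<gamma>]) auto
 then obtain \<theta>2 where \<theta>2: "\<theta>2 > 0" "\<And>s t. s \<in> {0..T} ==> t \<in> {0..T} ==> dist s t < \<theta>2 ==> dist (\<gamma> s) (\<gamma> t) < \<delta>2"
  using \<delta>2 unfolding uniformly_continuous_on_def by metis
 obtain K0 :: nat where K0: "real K0 > T / min \<theta>1 \<theta>2" using reals_Archimedean2 by blast
 have main: "prob {w \<in> space P. \<exists>k\<le>K.
  \<eta> < norm (Euler_defect (mesh T K) A (grid_coeff \<gamma> C T K) (grid_incr B T K) (\<lambda>k. Y (real k * mesh T K)) k w - y\<^sub>0)} \<le> e"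
  if K: "K \<ge> max 1 K0" for K
 proof -
  have K1: "K \<ge> 1" using K by simp
  define h where "h = mesh T K"
  have h: "h > 0" "real K * h = T" using K1 T by (auto simp: h_def mesh_def)
  have hlt: "h < \<theta>1" "h < \<theta>2"
  proof -
   have "T / min \<theta>1 \<theta>2 < real K" using K0 K by linarith
   then have "T < real K * min \<theta>1 \<theta>2" using \<theta>1 \<theta>2 by (simp add: divide_less_eq)
   moreover have "real K * min \<theta>1 \<theta>2 \<le> real K * \<theta>1" "real K * min \<theta>1 \<theta>2 \<le> real K * \<theta>2"
    by (auto intro!: mult_left_mono)
   ultimately have "T < \<theta>1 * real K" "T < \<theta>2 * real K" by (auto simp: mult.commute)
   then show "h < \<theta>1" "h < \<theta>2" using K1 by (auto simp: h_def mesh_def divide_less_eq)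
  qed
  let ?t = "\<lambda>i. real i * h"
  have tT: "?t i \<in> {0..T}" if "i \<le> K" for i
  proof -
   have "?t i \<le> real K * h" using that h by (intro mult_right_mono) auto
   then show ?thesis using h by simp
  qed
  let ?B1 = "{w \<in> space P. \<exists>s\<in>{0..T}. R < norm (Y s w)}"
  let ?B2 = "{w \<in> space P. \<exists>s\<in>{0..T}. \<exists>t\<in>{0..T}. \<bar>s - t\<bar> \<le> \<theta>1 \<and> \<delta>1 < dist (Y s w) (Y t w)}"
  have Bm: "?B1 \<in> sets P" "?B2 \<in> sets P"
   using sets_path_large[OF prob_space_axioms T' Y_measurable Y_continuous]
    sets_path_modulus[OF prob_space_axioms T' Y_measurable Y_continuous] by auto
  define G0 where "G0 = space P - (?B1 \<union> ?B2)"
  have G0m: "G0 \<in> sets P" unfolding G0_def using Bm by auto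
  have cG0: "space P - G0 = ?B1 \<union> ?B2" unfolding G0_def by blast
  have PG0: "prob (space P - G0) \<le> 2 * e'"
  proof -
   have "prob (?B1 \<union> ?B2) \<le> prob ?B1 + prob ?B2" by (rule measure_Un_le[OF Bm])
   then show ?thesis unfolding cG0 using R(2) \<theta>1(2) by linarith
  qed
  have bd: "norm (Y s w) \<le> R" if "w \<in> G0" "s \<in> {0..T}" for s w
   using that unfolding G0_def by (auto simp: not_less)
  have osc: "norm (Y s w - Y t w) \<le> \<delta>1" if w: "w \<in> G0" and st: "s \<in> {0..T}" "t \<in> {0..T}" "\<bar>s - t\<bar> \<le> h" for s t w
  proof (rule ccontr)
   assume "\<not> ?thesis"
   then have "\<bar>s - t\<bar> \<le> \<theta>1 \<and> \<delta>1 < dist (Y s w) (Y t w)" using st(3) hlt by (simp add: dist_norm)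
   then have "w \<in> ?B2" using st(1,2) w unfolding G0_def by blast
   then show False using w unfolding G0_def by blast
  qed
  let ?\<xi> = "\<lambda>j i w. grid_coeff \<gamma> C T K i j (Y (?t i) w)"
  let ?Rs = "\<lambda>j k w. \<Sum>i<k. (B (?t (Suc i)) w $ j - B (?t i) w $ j) *\<^sub>R ?\<xi> j i w"
  let ?L = "\<lambda>j. {w \<in> space P. \<exists>k\<le>K. a < norm (J j (?t k) w - ?Rs j k w)}"
  have PL: "prob (?L j) \<le> 3 * e'" for j
  proof -
   have "prob (?L j) \<le> prob (space P - G0) + 16 * \<delta>^2 * T / a^2"
   proof (rule ito_integral_near_Riemann_sums[OF J _ _ _ T _ G0m _ \<delta>(1) a])
    show "?t i < ?t (Suc i)" for i using h by simp
    show "?\<xi> j i \<in> borel_measurable (F (?t i))" if "i < K" for i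
     using tT[of i] that T by (intro borel_measurable_linear[OF coeff_linear] Y_adapted) auto
    fix w s assume w: "w \<in> G0" and s: "s \<in> {0<..T}"
    (* The cell with i h < s \<le> (i + 1) h; elementary processes are constant on left-open cells. *)
    define i where "i = nat (\<lceil>s / h\<rceil> - 1)"
    have sh: "0 < s / h" "s / h \<le> real K" using s h by (auto simp: divide_le_eq)
    have ci: "real i = of_int \<lceil>s / h\<rceil> - 1" unfolding i_def using sh(1) by (simp add: of_nat_nat)
    have i1: "real i < s / h" "s / h \<le> real i + 1" unfolding ci by linarith+
    have iK: "i < K" using i1(1) sh(2) by linarith
    have i2: "?t i < s" "s \<le> ?t (Suc i)" using i1 h by (auto simp: field_simps)
    have ev: "elementary_value K ?t (?\<xi> j) s w = ?\<xi> j i w"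
     by (rule elementary_value_eq[OF _ iK i2]) (use h in simp)
    have s': "s \<in> {0..T}" "s \<in> {0..<1}" using s T by auto
    have ti: "?t i \<in> {0..T}" using tT iK by simp
    have ds: "\<bar>?t i - s\<bar> \<le> h" using i2 by (simp add: algebra_simps)
    have "?\<xi> j i w - S s (Y s w) (axis j 1) = \<gamma> (?t i) *\<^sub>R C j (Y (?t i) w - Y s w) + (\<gamma> (?t i) - \<gamma> s) *\<^sub>R C j (Y s w)"
     unfolding S[OF s'(2)] grid_coeff_def h_def[symmetric] by (simp add: linear_diff[OF C(1)] algebra_simps)
    also have "norm \<dots> \<le> G * (c * \<delta>1) + \<delta>2 * (c * R)"
    proof (intro order_trans[OF norm_triangle_ineq] add_mono)
     have "norm (\<gamma> (?t i) *\<^sub>R C j (Y (?t i) w - Y s w)) \<le> \<bar>\<gamma> (?t i)\<bar> * (c * norm (Y (?t i) w - Y s w))"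
      using C(2) by (simp add: mult_left_mono)
     also have "\<dots> \<le> G * (c * \<delta>1)"
      using G(2)[OF ti] osc[OF w ti s'(1) ds] c0 G(1) by (intro mult_mono mult_left_mono) auto
     finally show "norm (\<gamma> (?t i) *\<^sub>R C j (Y (?t i) w - Y s w)) \<le> G * (c * \<delta>1)" .
     have "dist (\<gamma> (?t i)) (\<gamma> s) < \<delta>2" using ds hlt by (intro \<theta>2 ti s') (simp add: dist_real_def)
     then have "norm ((\<gamma> (?t i) - \<gamma> s) *\<^sub>R C j (Y s w)) \<le> \<delta>2 * (c * norm (Y s w))"
      using C(2) \<delta>2 by (simp add: dist_real_def mult_mono)
     also have "\<dots> \<le> \<delta>2 * (c * R)" using bd[OF w s'(1)] c0 \<delta>2 by (intro mult_left_mono) auto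
     finally show "norm ((\<gamma> (?t i) - \<gamma> s) *\<^sub>R C j (Y s w)) \<le> \<delta>2 * (c * R)" .
    qed
    also have "\<dots> \<le> \<delta> / 2 + \<delta> / 2"
    proof (rule add_mono)
     have "G * (c * \<delta>1) \<le> G * ((c + 1) * \<delta>1)" using G \<delta>1 by (intro mult_left_mono mult_right_mono) auto
     also have "\<dots> \<le> G * ((c + 1) * (\<delta> / (2 * G * (c + 1))))"
      using G c0 by (intro mult_left_mono) (auto simp: \<delta>1_def)
     also have "\<dots> = \<delta> / 2"
     proof -
      have "G \<noteq> 0" "c + 1 \<noteq> 0" using G c0 by auto
      then show ?thesis by simp
     qed
     finally show "G * (c * \<delta>1) \<le> \<delta> / 2" .
     have "\<delta>2 * (c * R) \<le> \<delta>2 * ((c + 1) * R)" using \<delta>2 R by (intro mult_left_mono mult_right_mono) auto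
     also have "\<dots> = \<delta> / 2"
     proof -
      have "R \<noteq> 0" "c + 1 \<noteq> 0" using R c0 by auto
      moreover have "\<delta> / (2 * x * y) * (x * y) = \<delta> / 2" if "x \<noteq> 0" "y \<noteq> 0" for x y :: real
       using that by simp
      ultimately show ?thesis unfolding \<delta>2_def by blast
     qed
     finally show "\<delta>2 * (c * R) \<le> \<delta> / 2" .
    qed
    finally show "norm (elementary_value K ?t (?\<xi> j) s w - S s (Y s w) (axis j 1)) \<le> \<delta>" unfolding ev by simp
   qed (use h in auto)
   then show ?thesis using PG0 unfolding \<delta>(2) by linarith
  qed
  let ?def = "\<lambda>k w. Euler_defect h A (grid_coeff \<gamma> C T K) (grid_incr B T K) (\<lambda>k. Y (?t k)) k w - y\<^sub>0"
  let ?bad = "{w \<in> space P. \<exists>k\<le>K. \<eta> < norm (?def k w)}"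
  have Lm: "?L j \<in> sets P" for j
  proof -
   have Jm: "J j (?t k) \<in> borel_measurable P" if "k \<le> K" for k
   proof -
    have tk: "?t k \<in> {0..<1}" using tT[OF that] T by auto
    have "\<forall>t\<in>{0..<1}. J j t \<in> borel_measurable (F t)"
     using J[of j] unfolding has_ito_integral_def continuous_adapted_def by blast
    then show ?thesis using F_measurable_imp tk by blast
   qed
   have Bm: "(\<lambda>w. B (?t k) w $ j) \<in> borel_measurable P" for k
   proof (rule measurable_compose[OF F_measurable_imp[OF adapted]])
    show "0 \<le> ?t k" using h by simp
   qed (intro borel_measurable_continuous_onI continuous_intros)
   have \<xi>m: "(\<lambda>w. ?\<xi> j i w) \<in> borel_measurable P" if "i < K" for i
    using tT[of i] that T by (intro borel_measurable_linear[OF coeff_linear] Y_measurable) auto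
   show ?thesis
   proof (rule sets_ex_norm_gt)
    fix k assume k: "k \<le> K"
    have "(\<lambda>w. (B (?t (Suc i)) w $ j - B (?t i) w $ j) *\<^sub>R ?\<xi> j i w) \<in> borel_measurable P" if "i \<in> {..<k}" for i
     using that k by (intro borel_measurable_scaleR borel_measurable_diff Bm \<xi>m) simp
    then show "(\<lambda>w. J j (?t k) w - ?Rs j k w) \<in> borel_measurable P"
     by (intro borel_measurable_diff Jm[OF k] borel_measurable_sum)
   qed
  qed
  have sub: "AE w in P. w \<in> ?bad \<longrightarrow> w \<in> (space P - G0) \<union> (\<Union>j\<in>UNIV. ?L j)"
   using ae
  proof (eventually_elim, safe)
   fix w k assume eq: "\<forall>t\<in>{0..<1}. (\<lambda>s. A (Y s w)) integrable_on {0..t} \<and>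
      Y t w = y\<^sub>0 + integral {0..t} (\<lambda>s. A (Y s w)) + (\<Sum>j\<in>UNIV. J j t w)"
    and wP: "w \<in> space P" and k: "k \<le> K" and big: "\<eta> < norm (?def k w)"
    and nL: "w \<notin> (\<Union>j\<in>UNIV. ?L j)" and wG: "w \<in> G0"
   have tk: "?t k \<in> {0..<1}" using tT[OF k] T by auto
   have eqk: "Y (?t k) w = y\<^sub>0 + integral {0..?t k} (\<lambda>s. A (Y s w)) + (\<Sum>j\<in>UNIV. J j (?t k) w)"
    using eq tk by blast
   have sw: "(\<Sum>i<k. \<Sum>j\<in>UNIV. (grid_incr B T K i w $ j) *\<^sub>R ?\<xi> j i w) = (\<Sum>j\<in>UNIV. ?Rs j k w)"
    by (subst sum.swap) (simp add: grid_incr_def h_def)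
   have "?def k w = (integral {0..?t k} (\<lambda>s. A (Y s w)) - (\<Sum>i<k. h *\<^sub>R A (Y (?t i) w)))
     + (\<Sum>j\<in>UNIV. J j (?t k) w - ?Rs j k w)"
    unfolding Euler_defect_def sum.distrib sw sum_subtractf eqk by simp
   also have "norm \<dots> \<le> \<eta> / 2 + \<eta> / 2"
   proof (intro order_trans[OF norm_triangle_ineq] add_mono)
    have cont: "continuous_on {0..T} (\<lambda>s. A (Y s w))"
     using T by (intro linear_continuous_on_compose[OF continuous_on_subset[OF Y_continuous[OF wP]] A(1)]) auto
    have "norm (integral {0..?t k} (\<lambda>s. A (Y s w)) - (\<Sum>i<k. h *\<^sub>R A (Y (?t i) w))) \<le> ?t k * (c * \<delta>1)"
    proof (rule integral_near_Riemann_sum[OF cont])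
     fix s t assume "s \<in> {0..T}" "t \<in> {0..T}" "\<bar>s - t\<bar> \<le> h"
     from osc[OF wG this] show "norm (A (Y s w) - A (Y t w)) \<le> c * \<delta>1"
      using A(2)[of "Y s w - Y t w"] c0 unfolding linear_diff[OF A(1), symmetric] by (meson mult_left_mono order_trans)
    qed (use h tT[OF k] in auto)
    also have "\<dots> \<le> T * ((c + 1) * (\<eta> / (2 * (c + 1) * T)))"
     using tT[OF k] c0 \<delta>1 T by (intro mult_mono) (auto simp: \<delta>1_def)
    also have "\<dots> = \<eta> / 2"
    proof -
     have "T \<noteq> 0" "c + 1 \<noteq> 0" using T c0 by auto
     moreover have "x * (y * (\<eta> / (2 * y * x))) = \<eta> / 2" if "x \<noteq> 0" "y \<noteq> 0" for x y :: real
      using that by simp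
     ultimately show ?thesis by blast
    qed
    finally show "norm (integral {0..?t k} (\<lambda>s. A (Y s w)) - (\<Sum>i<k. h *\<^sub>R A (Y (?t i) w))) \<le> \<eta> / 2" .
    have "norm (\<Sum>j\<in>UNIV. J j (?t k) w - ?Rs j k w) \<le> (\<Sum>j\<in>(UNIV::'d set). a)"
    proof (rule sum_norm_le)
     fix j
     show "norm (J j (?t k) w - ?Rs j k w) \<le> a"
     proof (rule ccontr)
      assume "\<not> ?thesis"
      then have "a < norm (J j (?t k) w - ?Rs j k w)" by simp
      then have "w \<in> ?L j" using wP k by blast
      then show False using nL by blast
     qed
    qed
    also have "\<dots> = \<eta> / 2" using d by (simp add: a_def)
    finally show "norm (\<Sum>j\<in>UNIV. J j (?t k) w - ?Rs j k w) \<le> \<eta> / 2" .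
   qed
   finally show False using big by simp
  qed
  have Um: "(\<Union>j\<in>UNIV. ?L j) \<in> sets P" by (rule sets.finite_UN[OF finite_class.finite_UNIV Lm])
  have cm: "space P - G0 \<in> sets P" using G0m by auto
  have "prob ?bad \<le> prob ((space P - G0) \<union> (\<Union>j\<in>UNIV. ?L j))"
   by (rule finite_measure_mono_AE[OF sub sets.Un[OF cm Um]])
  also have "\<dots> \<le> prob (space P - G0) + prob (\<Union>j\<in>UNIV. ?L j)" by (rule measure_Un_le[OF cm Um])
  also have "prob (\<Union>j\<in>UNIV. ?L j) \<le> (\<Sum>j\<in>UNIV. prob (?L j))"
   by (rule finite_measure_subadditive_finite[OF finite_class.finite_UNIV]) (use Lm in blast)
  also have "\<dots> \<le> (\<Sum>j\<in>(UNIV::'d set). 3 * e')" by (intro sum_mono PL)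
  also have "prob (space P - G0) + (\<Sum>j\<in>(UNIV::'d set). 3 * e') \<le> e"
   using PG0 d by (simp add: e'_def field_simps)
  finally show ?thesis unfolding h_def by simp
 qed
 show ?thesis by (intro exI[of _ "max 1 K0"] conjI allI impI main) auto
qed

text \<open>
 The difference of the solution and the scheme has, up to the initial value, the same defect as the solution.
\<close>

theorem Euler_scheme_converges:
 assumes T: "0 < T" "T < 1" and a: "0 < a" and e: "0 < e"
 shows "\<exists>K0\<ge>1. \<forall>K\<ge>K0. prob {w \<in> space P. \<exists>k\<le>K.
  a \<le> norm (Y (real k * mesh T K) w - Euler_scheme (mesh T K) A (grid_coeff \<gamma> C T K) y\<^sub>0 (\<lambda>i. grid_incr B T K i w) k)} \<le> e"
proof -
 let ?d = "real CARD('d)"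
 obtain G where G: "G \<ge> 1" "\<And>t. t \<in> {0..T} ==> \<bar>\<gamma> t\<bar> \<le> G" using gamma_bounded[of T] T by auto
 define s where "s = stab_const (c * G) 1 T ?d"
 have s: "0 \<le> s" unfolding s_def stab_const_def growth_const_def step_const_def
  using T by (intro mult_nonneg_nonneg add_nonneg_nonneg) auto
 (* The stability bound s \<eta>^2 / (a / 2)^2 is then at most e / 2. *)
 define \<eta> where "\<eta> = min (a / 2) (sqrt (e / 2 * (a / 2)^2 / (s + 1)))"
 have \<eta>: "0 < \<eta>" "\<eta> \<le> a / 2" using a e s by (auto simp: \<eta>_def)
 have s\<eta>: "s * \<eta>^2 / (a / 2)^2 \<le> e / 2"
 proof -
  have "\<eta>^2 \<le> (sqrt (e / 2 * (a / 2)^2 / (s + 1)))^2" using \<eta>(1) by (intro power_mono) (auto simp: \<eta>_def)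
  also have "\<dots> = e / 2 * (a / 2)^2 / (s + 1)" using e a s by simp
  finally have "(s + 1) * \<eta>^2 \<le> e / 2 * (a / 2)^2" using s by (simp add: field_simps)
  moreover have "s * \<eta>^2 \<le> (s + 1) * \<eta>^2" by (intro mult_right_mono) auto
  ultimately have "s * \<eta>^2 \<le> e / 2 * (a / 2)^2" by linarith
  then show ?thesis using a by (simp add: divide_le_eq)
 qed
 obtain K0 where K0: "K0 \<ge> 1" "\<And>K. K \<ge> K0 ==> prob {w \<in> space P. \<exists>k\<le>K.
  \<eta> < norm (Euler_defect (mesh T K) A (grid_coeff \<gamma> C T K) (grid_incr B T K) (\<lambda>k. Y (real k * mesh T K)) k w - y\<^sub>0)} \<le> e / 2"
  using Euler_defect_small[OF T \<eta>(1), of "e/2"] e by auto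
 have "prob {w \<in> space P. \<exists>k\<le>K. a \<le> norm (Y (real k * mesh T K) w - Euler_scheme (mesh T K) A (grid_coeff \<gamma> C T K) y\<^sub>0 (\<lambda>i. grid_incr B T K i w) k)} \<le> e"
  if K: "K \<ge> K0" for K
 proof -
  have K1: "K \<ge> 1" using K K0 by simp
  define h where "h = mesh T K"
  have h: "h > 0" "real K * h = T" using K1 T by (auto simp: h_def mesh_def)
  let ?t = "\<lambda>i. real i * h"
  have tT: "?t i \<in> {0..T}" if "i \<le> K" for i
  proof -
   have "?t i \<le> real K * h" using that h by (intro mult_right_mono) auto
   then show ?thesis using h by simp
  qed
  let ?D = "\<lambda>k w. Y (?t k) w - Euler_scheme h A (grid_coeff \<gamma> C T K) y\<^sub>0 (\<lambda>i. grid_incr B T K i w) k"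
  have noise: "noise_sequence P (\<lambda>k. F (?t k)) (\<lambda>k w. grid_incr B T K k w $ j) (\<lambda>k. h) K" for j
  proof -
   have "noise_sequence P (\<lambda>k. F (?t k)) (\<lambda>k w. (B (?t (Suc k)) w - B (?t k) w) $ j) (\<lambda>k. ?t (Suc k) - ?t k) K"
    by (rule increment_noise) (use h in auto)
   then show ?thesis by (simp add: grid_incr_def h_def[symmetric] algebra_simps)
  qed
  have Dm: "?D k \<in> borel_measurable (F (?t k))" if k: "k \<le> K" for k
  proof (intro borel_measurable_diff Y_adapted Euler_scheme_adapted A coeff_linear)
   show "?t k \<in> {0..<1}" using tT[OF k] T by auto
   fix i j assume "i < k"
   then show "(\<lambda>w. grid_incr B T K i w $ j) \<in> borel_measurable (F (?t k))"
    using noise_sequence.measurable_F_mono[OF noise noise_sequence.b_adapted[OF noise], of i k j] k by auto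
  qed
  have "prob {w \<in> space P. \<exists>k\<le>K. a / 2 + \<eta> \<le> norm (?D k w)}
   \<le> prob {w \<in> space P. \<exists>k\<le>K. \<eta> < norm (Euler_defect h A (grid_coeff \<gamma> C T K) (grid_incr B T K) ?D k w)}
    + stab_const (c * G) 1 T ?d * \<eta>^2 / (a / 2)^2"
  proof (rule Euler_stability[OF noise Dm A(1) _ coeff_linear])
   show "norm (A x) \<le> c * G * norm x" for x
    using A(2)[of x] mult_right_mono[OF G(1), of "c * norm x"] c0 by (simp add: mult_ac)
   show "norm (grid_coeff \<gamma> C T K i j x) \<le> c * G * norm x" if "i < K" for i j x
    using mult_mono[OF G(2)[OF tT[of i]] C(2)[of j x]] that G(1) by (simp add: grid_coeff_def h_def mult_ac)
  qed (use h c0 G a \<eta> in auto)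
  also have "{w \<in> space P. \<exists>k\<le>K. \<eta> < norm (Euler_defect h A (grid_coeff \<gamma> C T K) (grid_incr B T K) ?D k w)}
    = {w \<in> space P. \<exists>k\<le>K. \<eta> < norm (Euler_defect h A (grid_coeff \<gamma> C T K) (grid_incr B T K) (\<lambda>k. Y (?t k)) k w - y\<^sub>0)}"
   by (simp only: Euler_defect_diff[OF A(1) coeff_linear])
  also have "prob \<dots> \<le> e / 2" using K0(2)[OF K] by (simp add: h_def)
  finally have "prob {w \<in> space P. \<exists>k\<le>K. a / 2 + \<eta> \<le> norm (?D k w)} \<le> e" using s\<eta> unfolding s_def by linarith
  moreover have "prob {w \<in> space P. \<exists>k\<le>K. a \<le> norm (?D k w)} \<le> prob {w \<in> space P. \<exists>k\<le>K. a / 2 + \<eta> \<le> norm (?D k w)}"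
  proof (rule finite_measure_mono)
   show "{w \<in> space P. \<exists>k\<le>K. a / 2 + \<eta> \<le> norm (?D k w)} \<in> sets P"
    by (rule sets_ex_norm_ge[OF F_measurable_imp[OF Dm]])
   have "a / 2 + \<eta> \<le> a" using \<eta>(2) by simp
   then show "{w \<in> space P. \<exists>k\<le>K. a \<le> norm (?D k w)} \<subseteq> {w \<in> space P. \<exists>k\<le>K. a / 2 + \<eta> \<le> norm (?D k w)}"
    by (blast intro: order_trans)
  qed
  ultimately show ?thesis unfolding h_def by linarith
 qed
 then show ?thesis using K0(1) by blast
qed

end

section \<open>Linear recursions with slowly varying noise\<close>

lemma norm_add_sq: "(norm (x + y))^2 = (norm x)^2 + 2 * (x \<bullet> y) + (norm y)^2" for x y :: "'v::real_inner"
 by (simp add: power2_norm_eq_inner inner_add_left inner_add_right inner_commute)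

text \<open>
 The indices are divided into consecutive blocks \<open>l\<^sub>k \<le> i < l\<^sub>k\<^sub>+\<^sub>1\<close>.
\<close>

locale blocks =
 fixes l :: "nat => nat"
 assumes l0: "l 0 = 0" and mono: "\<And>k. l k \<le> l (Suc k)"
begin

lemma le: "j \<le> k ==> l j \<le> l k"
 using mono by (rule lift_Suc_mono_le)

definition block_of :: "nat => nat" where
 "block_of i = (LEAST k. i < l (Suc k))"

lemma block_of_eq: assumes "l m \<le> i" "i < l (Suc m)" shows "block_of i = m"
 unfolding block_of_def
proof (rule Least_equality)
 show "i < l (Suc m)" by (rule assms(2))
 fix k assume "i < l (Suc k)"
 then show "m \<le> k" using assms le[of "Suc k" m] by (meson not_less not_less_eq_eq order_trans leD)
qed

lemma block_of_props: assumes "i < l K" shows "block_of i < K" "l (block_of i) \<le> i" "i < l (Suc (block_of i))"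
proof -
 obtain K' where K: "K = Suc K'" using assms l0 by (cases K) auto
 show 1: "i < l (Suc (block_of i))" unfolding block_of_def by (rule LeastI[of _ K']) (use assms K in simp)
 show "block_of i < K" using assms K unfolding block_of_def by (metis Least_le le_imp_less_Suc)
 show "l (block_of i) \<le> i"
 proof (cases "block_of i")
  case (Suc k)
  then have "k < block_of i" by simp
  then have "\<not> i < l (Suc k)" using not_less_Least unfolding block_of_def by blast
  then show ?thesis using Suc by simp
 qed (simp add: l0)
qed

lemma sum_blocks: "(\<Sum>i<l k. f i) = (\<Sum>m<k. \<Sum>i\<in>{l m..<l (Suc m)}. f i :: 'v::comm_monoid_add)"
proof (induction k)
 case (Suc k)
 have "(\<Sum>i<l (Suc k). f i) = (\<Sum>i<l k. f i) + (\<Sum>i\<in>{l k..<l (Suc k)}. f i)"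
  using sum.atLeastLessThan_concat[of 0 "l k" "l (Suc k)" f] mono by (simp add: atLeast0LessThan)
 then show ?case using Suc by simp
qed (simp add: l0)

end

text \<open>
 The indices \<open>i\<close> with \<open>i/n\<close> in a cell of the time grid form a block, up to rounding.
\<close>

definition cell :: "real => nat => nat => nat => nat" where
 "cell T K n k = nat \<lfloor>real n * (real k * mesh T K)\<rfloor>"

lemma cell_bounds:
 assumes "0 \<le> T"
 shows "real (cell T K n k) \<le> real n * (real k * mesh T K)" "real n * (real k * mesh T K) < real (cell T K n k) + 1"
proof -
 have "0 \<le> real n * (real k * mesh T K)" using assms by (simp add: mesh_def)
 then have "real (cell T K n k) = of_int \<lfloor>real n * (real k * mesh T K)\<rfloor>" unfolding cell_def by (simp add: of_nat_nat)
 then show "real (cell T K n k) \<le> real n * (real k * mesh T K)" "real n * (real k * mesh T K) < real (cell T K n k) + 1"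
  by linarith+
qed

lemma blocks_cell: assumes "0 \<le> T" shows "blocks (cell T K n)"
proof
 show "cell T K n 0 = 0" by (simp add: cell_def)
 show "cell T K n k \<le> cell T K n (Suc k)" for k
 proof -
  have "0 \<le> mesh T K" using assms by (simp add: mesh_def)
  then show ?thesis unfolding cell_def by (intro nat_mono floor_mono mult_left_mono mult_right_mono) auto
 qed
qed

text \<open>
 A linear recursion with drift \<open>A\<close>, oscillating terms \<open>Os\<^sub>i\<close>, and scalar noise \<open>\<beta>\<^sub>i\<close> that enters in the direction \<open>u\<^sub>i\<close>
 with amplitude \<open>\<gamma>(i/n)\<close>.
\<close>

primrec evolve ::
 "('v => 'v) => (nat => 'v => 'v) => ('d::finite => 'v => 'v) => (nat => real^'d) => (real => real) => 'v =>
  nat => (nat => real) => nat => 'v::euclidean_space" where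
 "evolve A Os C u \<gamma> y\<^sub>0 n \<beta> 0 = y\<^sub>0"
| "evolve A Os C u \<gamma> y\<^sub>0 n \<beta> (Suc i) = evolve A Os C u \<gamma> y\<^sub>0 n \<beta> i
   + (1 / real n) *\<^sub>R (A (evolve A Os C u \<gamma> y\<^sub>0 n \<beta> i) + Os i (evolve A Os C u \<gamma> y\<^sub>0 n \<beta> i))
   + \<beta> i *\<^sub>R ((\<gamma> (real i / real n) / sqrt (real n)) *\<^sub>R (\<Sum>j\<in>UNIV. (u i $ j) *\<^sub>R C j (evolve A Os C u \<gamma> y\<^sub>0 n \<beta> i)))"

text \<open>
 The oscillating terms are bounded uniformly over all intervals of indices (\<open>Os_sum\<close>). This is what makes them negligible
 after division by \<open>n\<close>, although each of them is as large as the drift.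
\<close>

locale discrete_evolution = prob_space M
 for M :: "'w measure" +
 fixes F :: "nat => 'w measure" and b :: "nat => 'w => real" and C3 :: real
  and A :: "'v::euclidean_space => 'v" and Os :: "nat => 'v => 'v" and C :: "'d::finite => 'v => 'v"
  and u :: "nat => real^'d" and \<gamma> :: "real => real" and y\<^sub>0 :: 'v and c \<upsilon> \<Gamma> T :: real
 assumes noise: "\<And>N. noise_sequence M F b (\<lambda>_. 1) N"
  and b3: "\<And>i. integrable M (\<lambda>w. \<bar>b i w\<bar>^3)" "\<And>i. expectation (\<lambda>w. \<bar>b i w\<bar>^3) \<le> C3"
  and A: "linear A" "\<And>x. norm (A x) \<le> c * norm x"
  and Os: "\<And>i. linear (Os i)" "\<And>i x. norm (Os i x) \<le> c * norm x"
  and Os_sum: "\<And>p q x. norm (\<Sum>i\<in>{p..<q}. Os i x) \<le> c * norm x"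
  and C: "\<And>j. linear (C j)" "\<And>j x. norm (C j x) \<le> c * norm x"
  and u: "\<And>i j. \<bar>u i $ j\<bar> \<le> \<upsilon>"
  and c0: "0 \<le> c" and \<upsilon>0: "0 \<le> \<upsilon>" and T: "0 < T" "T < 1"
  and \<gamma>: "continuous_on {0..<1} \<gamma>" and \<Gamma>: "1 \<le> \<Gamma>" "\<And>t. t \<in> {0..T} ==> \<bar>\<gamma> t\<bar> \<le> \<Gamma>"
begin

text \<open>
 \<open>X n i\<close> is the solution of the recursion, and step \<open>i\<close> adds \<open>drf n i / n\<close> and \<open>b\<^sub>i\<close> times the martingale
 coefficient \<open>mart n i\<close>. The number \<open>\<nu>\<close> bounds the operators \<open>U i\<close>.
\<close>

definition "U i x = (\<Sum>j\<in>UNIV. (u i $ j) *\<^sub>R C j x)"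
definition "\<nu> = real CARD('d) * \<upsilon> * c"
definition "X n i w = evolve A Os C u \<gamma> y\<^sub>0 n (\<lambda>i. b i w) i"
definition "drf n i w = A (X n i w) + Os i (X n i w)"
definition "mart n i w = (\<gamma> (real i / real n) / sqrt (real n)) *\<^sub>R U i (X n i w)"

lemma X_0: "X n 0 w = y\<^sub>0" by (simp add: X_def)

lemma X_Suc: "X n (Suc i) w = X n i w + (1 / real n) *\<^sub>R drf n i w + b i w *\<^sub>R mart n i w"
 by (simp add: X_def drf_def mart_def U_def)

lemma \<nu>0: "0 \<le> \<nu>" using \<upsilon>0 c0 by (simp add: \<nu>_def)

lemma U_linear: "linear (U i)"
 unfolding U_def using C(1) by (intro linear_compose_sum ballI linear_compose_scale_right) auto

lemma U_bound: "norm (U i x) \<le> \<nu> * norm x"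
proof -
 have "norm (U i x) \<le> (\<Sum>j\<in>(UNIV::'d set). \<upsilon> * (c * norm x))"
  unfolding U_def
 proof (rule sum_norm_le)
  fix j show "norm ((u i $ j) *\<^sub>R C j x) \<le> \<upsilon> * (c * norm x)"
   using mult_mono[OF u[of i j] C(2)[of j x]] \<upsilon>0 by simp
 qed
 then show ?thesis by (simp add: \<nu>_def mult_ac)
qed

lemma drf_bound: "norm (drf n i w) \<le> 2 * c * norm (X n i w)"
 unfolding drf_def using norm_triangle_ineq[of "A (X n i w)" "Os i (X n i w)"] A(2)[of "X n i w"] Os(2)[of i "X n i w"] by linarith

lemma b_measurable_F: "i < k ==> b i \<in> borel_measurable (F k)"
proof -
 assume "i < k"
 interpret noise_sequence M F b "\<lambda>_. 1" k by (rule noise)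
 show ?thesis using measurable_F_mono[OF b_adapted, of i k] \<open>i < k\<close> by simp
qed

lemma measurable_F_le:
 assumes "f \<in> borel_measurable (F k)" "k \<le> l" shows "f \<in> borel_measurable (F l)"
proof -
 interpret noise_sequence M F b "\<lambda>_. 1" l by (rule noise)
 show ?thesis by (rule measurable_F_mono[OF assms order_refl])
qed

lemma measurable_F_M:
 assumes "f \<in> borel_measurable (F k)" shows "f \<in> borel_measurable M"
proof -
 interpret noise_sequence M F b "\<lambda>_. 1" k by (rule noise)
 show ?thesis by (rule measurable_F[OF assms order_refl])
qed

lemma X_adapted: "X n i \<in> borel_measurable (F i)"
 and drf_adapted: "drf n i \<in> borel_measurable (F i)"
 and mart_adapted: "mart n i \<in> borel_measurable (F i)"
proof -
 have d: "drf n i \<in> borel_measurable (F i)" "mart n i \<in> borel_measurable (F i)" if "X n i \<in> borel_measurable (F i)" for i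
 proof -
  have "(\<lambda>w. A (X n i w) + Os i (X n i w)) \<in> borel_measurable (F i)"
   by (rule borel_measurable_add[OF borel_measurable_linear[OF A(1) that] borel_measurable_linear[OF Os(1) that]])
  then show "drf n i \<in> borel_measurable (F i)" unfolding drf_def .
  have "(\<lambda>w. (\<gamma> (real i / real n) / sqrt (real n)) *\<^sub>R U i (X n i w)) \<in> borel_measurable (F i)"
   by (rule borel_measurable_scaleR[OF borel_measurable_const borel_measurable_linear[OF U_linear that]])
  then show "mart n i \<in> borel_measurable (F i)" unfolding mart_def .
 qed
 have X: "X n i \<in> borel_measurable (F i)" for i
 proof (induction i)
  case 0
  have "X n 0 = (\<lambda>_. y\<^sub>0)" by (auto simp: X_0)
  then show ?case by simp
 next
  case (Suc i)
  have "X n i \<in> borel_measurable (F (Suc i))" "drf n i \<in> borel_measurable (F (Suc i))" "mart n i \<in> borel_measurable (F (Suc i))"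
   using measurable_F_le[of _ i "Suc i"] Suc d[OF Suc] by auto
  moreover have "X n (Suc i) = (\<lambda>w. X n i w + (1 / real n) *\<^sub>R drf n i w + b i w *\<^sub>R mart n i w)" using X_Suc by auto
  ultimately show ?case using b_measurable_F[of i "Suc i"] by simp
 qed
 then show "X n i \<in> borel_measurable (F i)" "drf n i \<in> borel_measurable (F i)" "mart n i \<in> borel_measurable (F i)"
  using d by auto
qed

lemma mart_le: "norm (mart n i w) \<le> (\<bar>\<gamma> (real i / real n) / sqrt (real n)\<bar> * \<nu>) * norm (X n i w)"
 unfolding mart_def by (simp only: norm_scaleR mult.assoc) (rule mult_left_mono[OF U_bound abs_ge_zero])

lemma mart_bound:
 assumes "0 < n" "real i \<le> real n * T"
 shows "(norm (mart n i w))^2 \<le> \<Gamma>^2 * \<nu>^2 / real n * (norm (X n i w))^2"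
proof -
 have "real i / real n \<in> {0..T}" using assms by (simp add: divide_le_eq mult.commute)
 then have "norm (mart n i w) \<le> \<Gamma> / sqrt (real n) * (\<nu> * norm (X n i w))"
  unfolding mart_def using \<Gamma> U_bound[of i "X n i w"] \<nu>0
  by (simp only: norm_scaleR) (intro mult_mono, auto simp: divide_right_mono)
 then have "(norm (mart n i w))^2 \<le> (\<Gamma> / sqrt (real n) * (\<nu> * norm (X n i w)))^2" by (intro power_mono) auto
 then show ?thesis using assms by (simp add: power_mult_distrib power_divide mult_ac)
qed

text \<open>
 \<open>p\<close> is the growth rate of the second moment, and \<open>CQ\<close> the resulting bound up to time \<open>T\<close>.
\<close>

definition "p = 1 + 8 * c^2 + \<Gamma>^2 * \<nu>^2"
definition "CQ = exp (p * T) * (norm y\<^sub>0)^2"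

lemma CQ0: "0 \<le> CQ" by (simp add: CQ_def)

text \<open>
 The noise of a step is orthogonal to the past and of order \<open>1 / sqrt n\<close>, the drift is of order \<open>1/n\<close>; so one step multiplies
 the second moment by at most \<open>1 + p/n\<close>.
\<close>

lemma X_second_moment_aux:
 assumes n: "0 < n" and i: "real i \<le> real n * T"
 shows "sq_integrable M (X n i) \<and> moment2 (X n i) \<le> (1 + p / real n) ^ i * (norm y\<^sub>0)^2"
 using i
proof (induction i)
 case 0
 have "X n 0 = (\<lambda>_. y\<^sub>0)" by (auto simp: X_0)
 then show ?case by (simp add: sq_integrable_const prob_space)
next
 case (Suc i)
 interpret noise_sequence M F b "\<lambda>_. 1" "Suc i" by (rule noise)
 have Xs: "sq_integrable M (X n i)" and XE: "moment2 (X n i) \<le> (1 + p / real n) ^ i * (norm y\<^sub>0)^2"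
  using Suc by auto
 have ds: "sq_integrable M (drf n i)"
  by (rule sq_integrable_bound[OF Xs measurable_F_M[OF drf_adapted] drf_bound])
 have ms: "sq_integrable M (mart n i)"
  by (rule sq_integrable_bound[OF Xs measurable_F_M[OF mart_adapted] mart_le])
 let ?x = "\<lambda>w. X n i w + (1 / real n) *\<^sub>R drf n i w" and ?d = "\<lambda>w. b i w *\<^sub>R mart n i w"
 have xs: "sq_integrable M ?x" by (intro sq_integrable_add Xs sq_integrable_scaleR ds)
 have xm: "?x \<in> borel_measurable (F i)" using X_adapted drf_adapted by simp
 have bs: "sq_integrable M ?d" "moment2 ?d \<le> 1 * moment2 (mart n i)"
  using b_scaleR_sq_integrable[OF _ mart_adapted ms] by auto
 have o: "integrable M (\<lambda>w. ?x w \<bullet> ?d w)" "expectation (\<lambda>w. ?x w \<bullet> ?d w) = 0"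
  using b_scaleR_orthogonal[OF _ mart_adapted ms xm xs] by auto
 have E1: "X n (Suc i) = (\<lambda>w. ?x w + ?d w)" using X_Suc by auto
 have "moment2 (X n (Suc i)) = expectation (\<lambda>w. (norm (?x w))^2 + 2 * (?x w \<bullet> ?d w) + (norm (?d w))^2)"
  unfolding E1 by (intro Bochner_Integration.integral_cong refl)
   (rule norm_add_sq)
 also have "\<dots> = moment2 ?x + moment2 ?d"
  using xs bs(1) o by (simp add: sq_integrable_def)
 finally have E_square_less: "moment2 (X n (Suc i)) = moment2 ?x + moment2 ?d" .
 have "moment2 ?x \<le> expectation (\<lambda>w. (1 + 1 / real n) * (norm (X n i w))^2 + (1 / real n) * (1 + 1) * (2 * c)^2 * (norm (X n i w))^2)"
 proof (rule integral_mono)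
  show "integrable M (\<lambda>w. (norm (?x w))^2)" using xs by (simp only: sq_integrable_def)
  show "integrable M (\<lambda>w. (1 + 1 / real n) * (norm (X n i w))^2 + (1 / real n) * (1 + 1) * (2 * c)^2 * (norm (X n i w))^2)"
   using Xs unfolding sq_integrable_def by (intro Bochner_Integration.integrable_add integrable_mult_right) auto
  show "(norm (?x w))^2 \<le> (1 + 1 / real n) * (norm (X n i w))^2 + (1 / real n) * (1 + 1) * (2 * c)^2 * (norm (X n i w))^2" for w
   by (rule norm_add_scaled_sq_le[OF _ _ drf_bound]) (use n c0 in auto)
 qed
 also have "\<dots> = (1 + 1 / real n) * moment2 (X n i) + (1 / real n) * (1 + 1) * (2 * c)^2 * moment2 (X n i)"
 proof -
  have "integrable M (\<lambda>w. k * (norm (X n i w))^2)" for k using Xs by (intro integrable_mult_right) (simp add: sq_integrable_def)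
  from Bochner_Integration.integral_add[OF this this] show ?thesis by (simp only: integral_mult_right_zero)
 qed
 finally have Ex: "moment2 ?x \<le> (1 + 1 / real n) * moment2 (X n i) + (1 / real n) * (1 + 1) * (2 * c)^2 * moment2 (X n i)" .
 have "moment2 ?d \<le> expectation (\<lambda>w. \<Gamma>^2 * \<nu>^2 / real n * (norm (X n i w))^2)"
 proof -
  have "moment2 (mart n i) \<le> expectation (\<lambda>w. \<Gamma>^2 * \<nu>^2 / real n * (norm (X n i w))^2)"
  proof (rule integral_mono)
   show "integrable M (\<lambda>w. (norm (mart n i w))^2)" using ms by (simp add: sq_integrable_def)
   show "integrable M (\<lambda>w. \<Gamma>^2 * \<nu>^2 / real n * (norm (X n i w))^2)" using Xs by (simp add: sq_integrable_def)
   show "(norm (mart n i w))^2 \<le> \<Gamma>^2 * \<nu>^2 / real n * (norm (X n i w))^2" for w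
    by (rule mart_bound[OF n]) (use Suc.prems in simp)
  qed
  then show ?thesis using bs(2) by linarith
 qed
 also have "\<dots> = \<Gamma>^2 * \<nu>^2 / real n * moment2 (X n i)" by (rule integral_mult_right_zero)
 finally have Ed: "moment2 ?d \<le> \<Gamma>^2 * \<nu>^2 / real n * moment2 (X n i)" .
 have "(1 + 1 / real n) * e + (1 / real n) * (1 + 1) * (2 * c)^2 * e + \<Gamma>^2 * \<nu>^2 / real n * e = (1 + p / real n) * e" for e
  using n by (simp add: p_def field_simps)
 then have "moment2 (X n (Suc i)) \<le> (1 + p / real n) * moment2 (X n i)"
  using E_square_less Ex Ed by (metis (no_types, lifting) add_mono)
 also have "\<dots> \<le> (1 + p / real n) * ((1 + p / real n) ^ i * (norm y\<^sub>0)^2)"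
  using XE n by (intro mult_left_mono) (auto simp: p_def)
 finally show ?case unfolding E1 using sq_integrable_add[OF xs bs(1)] by (simp add: mult.assoc)
qed

lemma X_second_moment:
 assumes n: "0 < n" and i: "real i \<le> real n * T"
 shows "sq_integrable M (X n i)" "moment2 (X n i) \<le> CQ"
proof -
 show "sq_integrable M (X n i)" using X_second_moment_aux[OF assms] by simp
 have p0: "0 \<le> p" by (simp add: p_def)
 have "(1 + p / real n) ^ i \<le> exp (p / real n) ^ i" using p0 n by (intro power_mono exp_ge_add_one_self) auto
 also have "\<dots> = exp (p * (real i / real n))" by (simp add: exp_of_nat_mult[symmetric] mult_ac)
 also have "\<dots> \<le> exp (p * T)"
 proof -
  have "real i / real n \<le> T" using n i by (simp add: divide_le_eq mult.commute)
  from mult_left_mono[OF this p0] show ?thesis by simp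
 qed
 finally have "(1 + p / real n) ^ i * (norm y\<^sub>0)^2 \<le> CQ" unfolding CQ_def by (intro mult_right_mono) auto
 then show "moment2 (X n i) \<le> CQ" using X_second_moment_aux[OF assms] by linarith
qed

lemma drf_sq: assumes "0 < n" "real i \<le> real n * T"
 shows "sq_integrable M (drf n i)" "moment2 (drf n i) \<le> 4 * c^2 * CQ"
proof -
 note Xs = X_second_moment[OF assms]
 show s: "sq_integrable M (drf n i)"
  by (rule sq_integrable_bound[OF Xs(1) measurable_F_M[OF drf_adapted] drf_bound])
 have "moment2 (drf n i) \<le> expectation (\<lambda>w. (2 * c)^2 * (norm (X n i w))^2)"
  using s Xs(1) power_mono[OF drf_bound, of n i _ 2] by (intro integral_mono) (auto simp: sq_integrable_def power_mult_distrib)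
 also have "\<dots> \<le> (2 * c)^2 * CQ" using Xs(2) by (simp add: mult_left_mono)
 finally show "moment2 (drf n i) \<le> 4 * c^2 * CQ" by (simp add: power_mult_distrib)
qed

lemma mart_sq: assumes "0 < n" "real i \<le> real n * T"
 shows "sq_integrable M (mart n i)" "moment2 (mart n i) \<le> \<Gamma>^2 * \<nu>^2 * CQ / real n"
proof -
 note Xs = X_second_moment[OF assms]
 show s: "sq_integrable M (mart n i)"
  by (rule sq_integrable_bound[OF Xs(1) measurable_F_M[OF mart_adapted] mart_le])
 have "moment2 (mart n i) \<le> expectation (\<lambda>w. \<Gamma>^2 * \<nu>^2 / real n * (norm (X n i w))^2)"
  using s Xs(1) mart_bound[OF assms] by (intro integral_mono) (auto simp: sq_integrable_def)
 also have "\<dots> = \<Gamma>^2 * \<nu>^2 / real n * moment2 (X n i)" by (rule integral_mult_right_zero)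
 also have "\<dots> \<le> \<Gamma>^2 * \<nu>^2 / real n * CQ" by (rule mult_left_mono[OF Xs(2)]) simp
 finally show "moment2 (mart n i) \<le> \<Gamma>^2 * \<nu>^2 * CQ / real n" by (simp add: mult_ac)
qed

lemma X_increment:
 assumes "k \<le> i"
 shows "X n i w - X n k w = (1 / real n) *\<^sub>R (\<Sum>m\<in>{k..<i}. drf n m w) + (\<Sum>m\<in>{k..<i}. b m w *\<^sub>R mart n m w)"
 using assms
proof (induction i rule: dec_induct)
 case (step i)
 then show ?case by (simp add: X_Suc scaleR_add_right algebra_simps)
qed simp

lemma noise_block_sum_sq:
 fixes \<xi> :: "nat => 'w => 'v"
 assumes "\<And>m. m < i ==> \<xi> m \<in> borel_measurable (F m)" "\<And>m. m < i ==> sq_integrable M (\<xi> m)" "k \<le> i"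
 shows "sq_integrable M (\<lambda>w. \<Sum>m\<in>{k..<i}. b m w *\<^sub>R \<xi> m w)"
  "moment2 (\<lambda>w. \<Sum>m\<in>{k..<i}. b m w *\<^sub>R \<xi> m w) \<le> (\<Sum>m\<in>{k..<i}. moment2 (\<xi> m))"
proof -
 interpret noise_sequence M F b "\<lambda>_. 1" i by (rule noise)
 let ?z = "\<lambda>m w. if k \<le> m then \<xi> m w else 0"
 have zm: "?z m \<in> borel_measurable (F m)" "sq_integrable M (?z m)" if "m < i" for m
  using assms that by (cases "k \<le> m"; simp add: sq_integrable_const)+
 have eq: "(\<Sum>m<i. if k \<le> m then f m else 0) = (\<Sum>m\<in>{k..<i}. f m)" for f :: "nat => 'z::comm_monoid_add"
  by (subst sum.inter_filter[symmetric]) (auto intro!: sum.cong)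
 have e1: "(\<Sum>m<i. b m w *\<^sub>R ?z m w) = (\<Sum>m\<in>{k..<i}. b m w *\<^sub>R \<xi> m w)" for w
  unfolding eq[symmetric] by (rule sum.cong) auto
 have e2: "(\<Sum>m<i. 1 * moment2 (?z m)) = (\<Sum>m\<in>{k..<i}. moment2 (\<xi> m))"
  unfolding eq[symmetric] by (rule sum.cong) auto
 show "sq_integrable M (\<lambda>w. \<Sum>m\<in>{k..<i}. b m w *\<^sub>R \<xi> m w)"
  using noise_sum_sq(1)[OF order_refl zm] unfolding e1 by simp
 show "moment2 (\<lambda>w. \<Sum>m\<in>{k..<i}. b m w *\<^sub>R \<xi> m w) \<le> (\<Sum>m\<in>{k..<i}. moment2 (\<xi> m))"
  using noise_sum_sq(2)[OF order_refl zm] unfolding e1 e2 by simp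
qed

lemma expectation_sum_sq_le:
 assumes "finite I" "\<And>m. m \<in> I ==> sq_integrable M (f m)" "\<And>m. m \<in> I ==> moment2 (f m) \<le> K"
 shows "moment2 (\<lambda>w. \<Sum>m\<in>I. f m w :: 'z::euclidean_space) \<le> (real (card I))^2 * K"
proof -
 have "moment2 (\<lambda>w. \<Sum>m\<in>I. f m w) \<le> expectation (\<lambda>w. real (card I) * (\<Sum>m\<in>I. (norm (f m w))^2))"
  using sq_integrable_sum[OF assms(1,2) finite_measure_axioms] assms(2) norm_sum_sq_le[OF assms(1)]
  by (intro integral_mono) (auto simp: sq_integrable_def)
 also have "\<dots> = real (card I) * (\<Sum>m\<in>I. moment2 (f m))"
  using assms(2) by (subst integral_mult_right_zero, subst Bochner_Integration.integral_sum) (auto simp: sq_integrable_def)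
 also have "\<dots> \<le> real (card I) * (\<Sum>m\<in>I. K)" using assms(3) by (intro mult_left_mono sum_mono) auto
 finally show ?thesis by (simp add: power2_eq_square mult.assoc)
qed

text \<open>
 \<open>Cd\<close> bounds the second moment of an increment per unit of time; \<open>Cm\<close> plays the same role for the maximum over \<open>[0,T]\<close>.
\<close>

definition "Cd = 8 * c^2 * CQ + 2 * \<Gamma>^2 * \<nu>^2 * CQ"

lemma Cd0: "0 \<le> Cd" using CQ0 by (simp add: Cd_def)

text \<open>
 Over a time \<open>r \<le> 1\<close> the drift contributes order \<open>r\<^sup>2\<close>, the martingale part order \<open>r\<close>.
\<close>

lemma X_increment_sq:
 assumes n: "0 < n" and i: "real i \<le> real n * T" and k: "k \<le> i"
 shows "moment2 (\<lambda>w. X n i w - X n k w) \<le> Cd * (real (i - k) / real n)"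
proof -
 have iT: "real m \<le> real n * T" if "m < i" for m using that i by linarith
 let ?D = "\<lambda>w. (1 / real n) *\<^sub>R (\<Sum>m\<in>{k..<i}. drf n m w)" and ?S = "\<lambda>w. \<Sum>m\<in>{k..<i}. b m w *\<^sub>R mart n m w"
 let ?r = "real (i - k) / real n"
 have r: "0 \<le> ?r" "?r \<le> 1"
 proof -
  have "real (i - k) \<le> real n * T" using i k by linarith
  also have "\<dots> \<le> real n * 1" using T by (intro mult_left_mono) auto
  finally show "?r \<le> 1" using n by simp
 qed simp
 have Ss: "sq_integrable M ?S" "moment2 ?S \<le> (\<Sum>m\<in>{k..<i}. moment2 (mart n m))"
  using noise_block_sum_sq[OF mart_adapted mart_sq(1)[OF n iT] k] by auto
 have Sb: "moment2 ?S \<le> \<Gamma>^2 * \<nu>^2 * CQ * ?r"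
 proof -
  have "(\<Sum>m\<in>{k..<i}. moment2 (mart n m)) \<le> (\<Sum>m\<in>{k..<i}. \<Gamma>^2 * \<nu>^2 * CQ / real n)"
   using iT by (intro sum_mono mart_sq(2)[OF n]) auto
  then show ?thesis using Ss(2) by (simp add: mult_ac)
 qed
 have ds: "sq_integrable M (\<lambda>w. \<Sum>m\<in>{k..<i}. drf n m w)"
  using drf_sq(1)[OF n iT] by (intro sq_integrable_sum finite_measure_axioms) auto
 have Ds: "sq_integrable M ?D" by (rule sq_integrable_scaleR[OF ds])
 have "moment2 (\<lambda>w. \<Sum>m\<in>{k..<i}. drf n m w) \<le> (real (card {k..<i}))^2 * (4 * c^2 * CQ)"
  using iT by (intro expectation_sum_sq_le drf_sq[OF n]) auto
 then have Db: "moment2 ?D \<le> 4 * c^2 * CQ * ?r"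
 proof -
  assume a: "moment2 (\<lambda>w. \<Sum>m\<in>{k..<i}. drf n m w) \<le> (real (card {k..<i}))^2 * (4 * c^2 * CQ)"
  have "moment2 ?D = (1 / real n)^2 * moment2 (\<lambda>w. \<Sum>m\<in>{k..<i}. drf n m w)"
   by (simp add: power_mult_distrib power_divide)
  also have "\<dots> \<le> (1 / real n)^2 * ((real (card {k..<i}))^2 * (4 * c^2 * CQ))" using a by (intro mult_left_mono) auto
  also have "\<dots> = ?r^2 * (4 * c^2 * CQ)" by (simp add: power_divide)
  also have "\<dots> \<le> ?r * (4 * c^2 * CQ)" 
  proof (rule mult_right_mono)
   show "?r^2 \<le> ?r" using mult_left_mono[OF r(2) r(1)] by (simp only: power2_eq_square mult_1_right)
  qed (use CQ0 in simp)
  finally show ?thesis by (simp add: mult_ac)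
 qed
 have "moment2 (\<lambda>w. X n i w - X n k w) \<le> expectation (\<lambda>w. 2 * (norm (?D w))^2 + 2 * (norm (?S w))^2)"
 proof (rule integral_mono)
  show "integrable M (\<lambda>w. (norm (X n i w - X n k w))^2)"
   unfolding X_increment[OF k] using sq_integrable_add[OF Ds Ss(1)] by (simp add: sq_integrable_def)
  show "integrable M (\<lambda>w. 2 * (norm (?D w))^2 + 2 * (norm (?S w))^2)" using Ds Ss(1) unfolding sq_integrable_def by auto
 qed (unfold X_increment[OF k], rule norm_add_sq_le)
 also have "\<dots> = 2 * moment2 ?D + 2 * moment2 ?S"
  using Ds Ss(1) unfolding sq_integrable_def by (subst Bochner_Integration.integral_add) auto
 also have "\<dots> \<le> 2 * (4 * c^2 * CQ * ?r) + 2 * (\<Gamma>^2 * \<nu>^2 * CQ * ?r)"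
  by (intro add_mono mult_left_mono Db Sb) auto
 also have "\<dots> = Cd * ?r"
 proof -
  have "2 * (4 * c^2 * CQ * x) + 2 * (\<Gamma>^2 * \<nu>^2 * CQ * x) = Cd * x" for x by (simp add: Cd_def algebra_simps)
  then show ?thesis .
 qed
 finally show ?thesis .
qed

definition "Cm = 16 * c^2 * CQ + 4 * \<Gamma>^2 * \<nu>^2 * CQ"

lemma X_maximal:
 assumes n: "0 < n" and N: "real N \<le> real n * T" and R: "0 < R"
 shows "prob {w \<in> space M. \<exists>i\<le>N. norm y\<^sub>0 + R \<le> norm (X n i w)} \<le> Cm / R^2"
proof -
 interpret noise_sequence M F b "\<lambda>_. 1" N by (rule noise)
 have iT: "real m \<le> real n * T" if "m < N" for m using that N by linarith
 define G where "G w = (\<Sum>m<N. norm (drf n m w))" for w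
 let ?B1 = "{w \<in> space M. real n * R / 2 \<le> norm (G w)}"
 let ?B2 = "{w \<in> space M. \<exists>i\<le>N. R / 2 \<le> norm (\<Sum>m<i. b m w *\<^sub>R mart n m w)}"
 have nd: "sq_integrable M (\<lambda>w. norm (drf n m w))" "moment2 (\<lambda>w. norm (drf n m w)) \<le> 4 * c^2 * CQ" if "m < N" for m
  using drf_sq[OF n iT[OF that]] by (auto simp: sq_integrable_def)
 have Gs: "sq_integrable M G" unfolding G_def using nd by (intro sq_integrable_sum finite_measure_axioms) auto
 have GE: "moment2 G \<le> (real N)^2 * (4 * c^2 * CQ)"
  unfolding G_def using expectation_sum_sq_le[of "{..<N}" "\<lambda>m w. norm (drf n m w)"] nd by simp
 have NT: "(real N)^2 \<le> (real n)^2"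
 proof -
  have "real N \<le> real n * 1" using N T mult_left_mono[of T 1 "real n"] by linarith
  then show ?thesis by simp
 qed
 have P1: "prob ?B1 \<le> 16 * c^2 * CQ / R^2"
 proof -
  have "prob ?B1 \<le> ((real n)^2 * (4 * c^2 * CQ)) / (real n * R / 2)^2"
   using n R GE mult_right_mono[OF NT, of "4 * c^2 * CQ"] CQ0 by (intro prob_norm_ge_le Gs) auto
  also have "\<dots> = 16 * c^2 * CQ / R^2" using n by (simp add: power_mult_distrib power_divide field_simps)
  finally show ?thesis .
 qed
 have P2: "prob ?B2 \<le> 4 * \<Gamma>^2 * \<nu>^2 * CQ / R^2"
 proof -
  have "prob ?B2 \<le> (\<Sum>i<N. 1 * moment2 (mart n i)) / (R / 2)^2"
   using R iT by (intro maximal_inequality mart_adapted mart_sq(1)[OF n]) auto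
  also have "\<dots> \<le> (\<Sum>i<N. \<Gamma>^2 * \<nu>^2 * CQ / real n) / (R / 2)^2"
   using iT mart_sq(2)[OF n] by (intro divide_right_mono sum_mono) auto
  also have "\<dots> = (real N / real n) * (\<Gamma>^2 * \<nu>^2 * CQ) / (R / 2)^2" by simp
  also have "\<dots> \<le> 1 * (\<Gamma>^2 * \<nu>^2 * CQ) / (R / 2)^2"
   using n NT CQ0 by (intro divide_right_mono mult_right_mono) (auto simp: divide_le_eq)
  finally show ?thesis by (simp add: power_divide mult_ac)
 qed
 have Bm: "?B1 \<in> sets M" "?B2 \<in> sets M"
 proof -
  have [measurable]: "G \<in> borel_measurable M" using Gs by (simp add: sq_integrable_def)
  show "?B1 \<in> sets M" by measurable
  show "?B2 \<in> sets M" by (rule sets_ex_norm_ge, rule measurable_F[OF noise_sum_adapted]) (auto intro: mart_adapted)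
 qed
 have "{w \<in> space M. \<exists>i\<le>N. norm y\<^sub>0 + R \<le> norm (X n i w)} \<subseteq> ?B1 \<union> ?B2"
 proof (rule subsetI, rule ccontr)
  fix w assume w: "w \<in> {w \<in> space M. \<exists>i\<le>N. norm y\<^sub>0 + R \<le> norm (X n i w)}" and nw: "w \<notin> ?B1 \<union> ?B2"
  then obtain i where i: "i \<le> N" "norm y\<^sub>0 + R \<le> norm (X n i w)" and wP: "w \<in> space M" by blast
  have 1: "norm (G w) < real n * R / 2" using nw wP by (simp add: not_le)
  have 2: "norm (\<Sum>m<i. b m w *\<^sub>R mart n m w) < R / 2"
  proof (rule ccontr)
   assume "\<not> ?thesis"
   then have "w \<in> ?B2" using wP i(1) by (intro CollectI conjI exI[of _ i]) auto
   then show False using nw by blast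
  qed
  have "X n i w = y\<^sub>0 + ((1 / real n) *\<^sub>R (\<Sum>m<i. drf n m w) + (\<Sum>m<i. b m w *\<^sub>R mart n m w))"
   using X_increment[of 0 i n w] by (simp add: X_0 atLeast0LessThan algebra_simps)
  then have "norm (X n i w) \<le> norm y\<^sub>0 + (norm ((1 / real n) *\<^sub>R (\<Sum>m<i. drf n m w)) + norm (\<Sum>m<i. b m w *\<^sub>R mart n m w))"
   by (simp only:) (rule order_trans[OF norm_triangle_ineq add_left_mono[OF norm_triangle_ineq]])
  moreover have "norm ((1 / real n) *\<^sub>R (\<Sum>m<i. drf n m w)) < R / 2"
  proof -
   have "norm (\<Sum>m<i. drf n m w) \<le> (\<Sum>m<i. norm (drf n m w))" by (rule norm_sum)
   also have "\<dots> \<le> G w" unfolding G_def using i(1) by (intro sum_mono2) auto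
   also have "\<dots> < real n * R / 2" using 1 by simp
   finally show ?thesis using n by (simp add: divide_less_eq mult_ac)
  qed
  ultimately show False using i(2) 2 by linarith
 qed
 then have "prob {w \<in> space M. \<exists>i\<le>N. norm y\<^sub>0 + R \<le> norm (X n i w)} \<le> prob (?B1 \<union> ?B2)"
  by (rule finite_measure_mono[OF _ sets.Un[OF Bm]])
 also have "\<dots> \<le> prob ?B1 + prob ?B2" by (rule measure_Un_le[OF Bm])
 also have "\<dots> \<le> Cm / R^2" using P1 P2 by (simp add: Cm_def add_divide_distrib)
 finally show ?thesis .
qed

end

section \<open>The recursion on a grid\<close>

context discrete_evolution begin

definition block_noise :: "nat => nat => nat => 'w => real^'d" where
 "block_noise n K k w = (\<chi> j. \<Sum>i\<in>{cell T K n k..<cell T K n (Suc k)}. b i w * (u i $ j / sqrt (real n)))"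

abbreviation "Eul n K w \<equiv> Euler_scheme (mesh T K) A (grid_coeff \<gamma> C T K) y\<^sub>0 (\<lambda>i. block_noise n K i w)"

definition close_to_Euler :: "nat => nat => real => 'w => bool" where
 "close_to_Euler n K a w \<longleftrightarrow> (\<forall>k\<le>K. \<forall>i. cell T K n k \<le> i \<and> i \<le> cell T K n (if k < K then Suc k else k) \<longrightarrow>
   norm (X n i w - Eul n K w k) \<le> a)"

text \<open>
 Together with \<open>noise_block_quadratic\<close>: sums of the noise over blocks are again martingale noise for the filtration
 at the block ends.
\<close>

lemma noise_block_linear:
 assumes k: "k \<le> i" and a: "\<And>m. \<bar>a m\<bar> \<le> \<alpha>"
  and \<eta>: "\<eta> \<in> borel_measurable (F k)" "integrable M \<eta>"
 shows "integrable M (\<lambda>w. (\<Sum>m\<in>{k..<i}. b m w * a m) * \<eta> w)"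
  "expectation (\<lambda>w. (\<Sum>m\<in>{k..<i}. b m w * a m) * \<eta> w) = 0"
proof -
 interpret noise_sequence M F b "\<lambda>_. 1" i by (rule noise)
 have t: "integrable M (\<lambda>w. b m w * \<eta> w) \<and> expectation (\<lambda>w. b m w * \<eta> w) = 0" if "m \<in> {k..<i}" for m
  using that \<eta> by (intro b_times measurable_F_le[of \<eta> k m]) auto
 have eq: "(\<Sum>m\<in>{k..<i}. b m w * a m) * \<eta> w = (\<Sum>m\<in>{k..<i}. a m * (b m w * \<eta> w))" for w
  unfolding sum_distrib_right by (intro sum.cong refl) (simp add: mult_ac)
 show "integrable M (\<lambda>w. (\<Sum>m\<in>{k..<i}. b m w * a m) * \<eta> w)"
  unfolding eq using t by (intro Bochner_Integration.integrable_sum integrable_mult_right) auto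
 have "expectation (\<lambda>w. \<Sum>m\<in>{k..<i}. a m * (b m w * \<eta> w)) = (\<Sum>m\<in>{k..<i}. expectation (\<lambda>w. a m * (b m w * \<eta> w)))"
  using t by (intro Bochner_Integration.integral_sum integrable_mult_right) auto
 also have "\<dots> = 0" using t by (intro sum.neutral) auto
 finally show "expectation (\<lambda>w. (\<Sum>m\<in>{k..<i}. b m w * a m) * \<eta> w) = 0" unfolding eq .
qed

lemma noise_block_quadratic:
 assumes k: "k \<le> i" and a: "\<And>m. \<bar>a m\<bar> \<le> \<alpha>"
  and \<eta>: "\<eta> \<in> borel_measurable (F k)" "integrable M \<eta>" "\<And>w. 0 \<le> \<eta> w"
 shows "integrable M (\<lambda>w. (\<Sum>m\<in>{k..<i}. b m w * a m)^2 * \<eta> w)"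
  "expectation (\<lambda>w. (\<Sum>m\<in>{k..<i}. b m w * a m)^2 * \<eta> w) \<le> (real (i - k) * \<alpha>^2) * expectation \<eta>"
proof -
 let ?\<xi> = "\<lambda>m w. if k \<le> m then a m * sqrt (\<eta> w) else 0"
 have \<xi>m: "?\<xi> m \<in> borel_measurable (F m)" for m
  using measurable_F_le[OF \<eta>(1), of m] by (cases "k \<le> m") auto
 have sq: "(norm (?\<xi> m w))^2 = (if k \<le> m then (a m)\<^sup>2 * \<eta> w else 0)" for m w
  using \<eta>(3) by (simp add: power_mult_distrib)
 have \<xi>s: "sq_integrable M (?\<xi> m)" for m
  unfolding sq_integrable_def sq using measurable_F_M[OF \<xi>m] \<eta>(2) by (cases "k \<le> m") auto
 have eq: "(norm (\<Sum>m\<in>{k..<i}. b m w *\<^sub>R ?\<xi> m w))^2 = (\<Sum>m\<in>{k..<i}. b m w * a m)^2 * \<eta> w" for w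
 proof -
  have "(\<Sum>m\<in>{k..<i}. b m w *\<^sub>R ?\<xi> m w) = (\<Sum>m\<in>{k..<i}. b m w * a m) * sqrt (\<eta> w)"
   unfolding sum_distrib_right by (rule sum.cong) auto
  then show ?thesis using \<eta>(3) by (simp add: power_mult_distrib)
 qed
 have s: "sq_integrable M (\<lambda>w. \<Sum>m\<in>{k..<i}. b m w * ?\<xi> m w)"
  "expectation (\<lambda>w. (\<Sum>m\<in>{k..<i}. b m w * ?\<xi> m w)^2) \<le> (\<Sum>m\<in>{k..<i}. expectation (\<lambda>w. (?\<xi> m w)^2))"
 proof -
  interpret noise_sequence M F b "\<lambda>_. 1" i by (rule noise)
  have "(\<Sum>m\<in>{k..<i}. b m w * ?\<xi> m w) = (\<Sum>m<i. b m w *\<^sub>R ?\<xi> m w)" for w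
   by (rule sum.mono_neutral_cong_left) auto
  moreover have "(\<Sum>m\<in>{k..<i}. expectation (\<lambda>w. (?\<xi> m w)^2)) = (\<Sum>m<i. 1 * moment2 (?\<xi> m))"
   by (rule sum.mono_neutral_cong_left) auto
  ultimately show "sq_integrable M (\<lambda>w. \<Sum>m\<in>{k..<i}. b m w * ?\<xi> m w)"
   "expectation (\<lambda>w. (\<Sum>m\<in>{k..<i}. b m w * ?\<xi> m w)^2) \<le> (\<Sum>m\<in>{k..<i}. expectation (\<lambda>w. (?\<xi> m w)^2))"
   using noise_sum_sq[OF order_refl \<xi>m \<xi>s] by (simp_all only: real_norm_def power2_abs)
 qed
 show "integrable M (\<lambda>w. (\<Sum>m\<in>{k..<i}. b m w * a m)^2 * \<eta> w)"
  using s(1) unfolding sq_integrable_def eq[symmetric] by simp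
 have "expectation (\<lambda>w. (\<Sum>m\<in>{k..<i}. b m w * a m)^2 * \<eta> w) = expectation (\<lambda>w. (\<Sum>m\<in>{k..<i}. b m w * ?\<xi> m w)^2)"
  unfolding eq[symmetric] by simp
 also note s(2)
 also have "(\<Sum>m\<in>{k..<i}. expectation (\<lambda>w. (?\<xi> m w)^2)) \<le> (\<Sum>m\<in>{k..<i}. \<alpha>^2 * expectation \<eta>)"
 proof (rule sum_mono)
  fix m assume "m \<in> {k..<i}"
  then have "expectation (\<lambda>w. (?\<xi> m w)^2) = (a m)^2 * expectation \<eta>"
   using \<eta>(3) by (simp add: power_mult_distrib)
  also have "\<dots> \<le> \<alpha>^2 * expectation \<eta>"
   using power_mono[OF a[of m], of 2] \<eta>(3) by (intro mult_right_mono integral_nonneg_AE) auto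
  finally show "expectation (\<lambda>w. (?\<xi> m w)^2) \<le> \<alpha>^2 * expectation \<eta>" .
 qed
 finally show "expectation (\<lambda>w. (\<Sum>m\<in>{k..<i}. b m w * a m)^2 * \<eta> w) \<le> (real (i - k) * \<alpha>^2) * expectation \<eta>"
  by simp
qed

end

locale discrete_grid = discrete_evolution M F b C3 A Os C u \<gamma> y\<^sub>0 c \<upsilon> \<Gamma> T + blocks "cell T K n"
 for M :: "'w measure" and F b C3 and A :: "'v::euclidean_space => 'v" and Os and C :: "'d::finite => 'v => 'v"
  and u \<gamma> y\<^sub>0 c \<upsilon> \<Gamma> T and K n :: nat +
 assumes K: "0 < K" and n: "0 < n"
begin

abbreviation "l \<equiv> cell T K n"
abbreviation "h \<equiv> mesh T K"
text \<open>
 A bound for the time length of a block, including the rounding error.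
\<close>

definition "\<theta> = h + 1 / real n"

lemma h: "0 < h" "real K * h = T" using K T by (auto simp: mesh_def)

lemma \<theta>0: "0 < \<theta>" using h n by (simp add: \<theta>_def add_pos_pos)

lemma l_bounds: "real (l k) \<le> real n * (real k * h)" "real n * (real k * h) < real (l k) + 1"
 using cell_bounds[where T=T and K=K and n=n and k=k] T by auto

lemma l_len: "real (l (Suc k) - l k) / real n \<le> \<theta>" "\<bar>real (l (Suc k) - l k) / real n - h\<bar> \<le> 1 / real n"
proof -
 have d: "real (l (Suc k) - l k) = real (l (Suc k)) - real (l k)" using mono[of k] by simp
 have e: "real n * (real (Suc k) * h) = real n * (real k * h) + real n * h" by (simp add: algebra_simps)
 have "\<bar>real (l (Suc k) - l k) - real n * h\<bar> \<le> 1"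
  using l_bounds[of k] l_bounds[of "Suc k"] e unfolding d by linarith
 then have "\<bar>(real (l (Suc k) - l k) - real n * h) / real n\<bar> \<le> 1 / real n"
  using n by (simp add: divide_right_mono)
 then show *: "\<bar>real (l (Suc k) - l k) / real n - h\<bar> \<le> 1 / real n"
  using n by (simp add: diff_divide_distrib)
 then show "real (l (Suc k) - l k) / real n \<le> \<theta>" unfolding \<theta>_def by linarith
qed

lemma l_le_nT: "k \<le> K ==> real (l k) \<le> real n * T"
proof -
 assume "k \<le> K"
 then have "real n * (real k * h) \<le> real n * (real K * h)" using h by (intro mult_left_mono mult_right_mono) auto
 then show ?thesis using l_bounds(1)[of k] h(2) by simp
qed

lemma i_le_nT: "i < l K ==> real i \<le> real n * T" using l_le_nT[of K] by simp

lemma t_in: "k \<le> K ==> real k * h \<in> {0..T}"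
proof -
 assume "k \<le> K"
 then have "real k * h \<le> real K * h" using h by (intro mult_right_mono) auto
 then show ?thesis using h by simp
qed

lemma block_time:
 assumes "i < l K" shows "\<bar>real i / real n - real (block_of i) * h\<bar> \<le> \<theta>" "real i / real n \<in> {0..T}"
proof -
 let ?m = "block_of i"
 note bp = block_of_props[OF assms]
 have 1: "real (l ?m) \<le> real i" "real i < real (l (Suc ?m))" using bp by auto
 have e: "real n * (real (Suc ?m) * h) = real n * (real ?m * h) + real n * h" by (simp add: algebra_simps)
 have "\<bar>real i - real n * (real ?m * h)\<bar> \<le> real n * h + 1"
  using l_bounds[of ?m] l_bounds[of "Suc ?m"] 1 h n mult_nonneg_nonneg[of "real n" h] unfolding e by linarith
 then have "\<bar>(real i - real n * (real ?m * h)) / real n\<bar> \<le> (real n * h + 1) / real n"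
  using n by (simp add: divide_right_mono)
 then show "\<bar>real i / real n - real ?m * h\<bar> \<le> \<theta>"
  using n by (simp add: diff_divide_distrib add_divide_distrib \<theta>_def)
 show "real i / real n \<in> {0..T}" using i_le_nT[OF assms] n by (simp add: divide_le_eq mult.commute)
qed

text \<open>
 \<open>q\<close> freezes \<open>X\<close> at the start of each block. The errors of this replacement are \<open>xi\<close> in the martingale
 coefficients, with sum \<open>Mt\<close>, and at most \<open>G1\<close> in the drift; \<open>G2\<close> bounds the oscillating terms and
 the rounding of the block lengths.
\<close>

definition "q i w = X n (l (block_of i)) w"

definition "xi i w = mart n i w - (\<gamma> (real (block_of i) * h) / sqrt (real n)) *\<^sub>R U i (q i w)"

definition "G1 w = (2 * c / real n) * (\<Sum>i<l K. norm (X n i w - q i w))"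
definition "G2 w = (2 * c / real n) * (\<Sum>m<K. norm (X n (l m) w))"
definition "Mt k w = (\<Sum>i<k. b i w *\<^sub>R xi i w)"

lemma q_block: "l m \<le> i ==> i < l (Suc m) ==> q i w = X n (l m) w"
 unfolding q_def using block_of_eq[of m i] by simp

lemma block_noise_apply:
 "(\<Sum>i\<in>{l m..<l (Suc m)}. b i w *\<^sub>R ((g / sqrt (real n)) *\<^sub>R U i x))
  = (\<Sum>j\<in>UNIV. (block_noise n K m w $ j) *\<^sub>R (g *\<^sub>R C j x))"
proof -
 have "(\<Sum>i\<in>{l m..<l (Suc m)}. b i w *\<^sub>R ((g / sqrt (real n)) *\<^sub>R U i x))
   = (\<Sum>i\<in>{l m..<l (Suc m)}. \<Sum>j\<in>UNIV. (b i w * (u i $ j / sqrt (real n))) *\<^sub>R (g *\<^sub>R C j x))"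
  unfolding U_def scaleR_sum_right by (intro sum.cong refl) (simp add: mult_ac)
 also have "\<dots> = (\<Sum>j\<in>UNIV. \<Sum>i\<in>{l m..<l (Suc m)}. (b i w * (u i $ j / sqrt (real n))) *\<^sub>R (g *\<^sub>R C j x))"
  by (rule sum.swap)
 also have "\<dots> = (\<Sum>j\<in>UNIV. (block_noise n K m w $ j) *\<^sub>R (g *\<^sub>R C j x))"
  by (simp only: block_noise_def vec_lambda_beta scaleR_sum_left)
 finally show ?thesis .
qed

text \<open>
 With coefficients frozen in each block, the recursion becomes the Euler scheme driven by the block noise. The
 three terms of the defect are the freezing error of the drift, the rounding and oscillation at frozen arguments, and the
 freezing error of the martingale part.
\<close>

lemma defect_eq:
 assumes k: "k \<le> K"
 shows "Euler_defect h A (grid_coeff \<gamma> C T K) (block_noise n K) (\<lambda>k w. X n (l k) w) k w - y\<^sub>0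
  = (1 / real n) *\<^sub>R (\<Sum>i<l k. drf n i w - (A (q i w) + Os i (q i w)))
   + (\<Sum>m<k. (real (l (Suc m) - l m) / real n - h) *\<^sub>R A (X n (l m) w) + (1 / real n) *\<^sub>R (\<Sum>i\<in>{l m..<l (Suc m)}. Os i (X n (l m) w)))
   + Mt (l k) w"
proof -
 have X: "X n (l k) w - y\<^sub>0 = (1 / real n) *\<^sub>R (\<Sum>i<l k. drf n i w) + (\<Sum>i<l k. b i w *\<^sub>R mart n i w)"
  using X_increment[of 0 "l k" n w] by (simp add: X_0 atLeast0LessThan)
 have Q: "(1 / real n) *\<^sub>R (\<Sum>i<l k. A (q i w) + Os i (q i w))
   = (\<Sum>m<k. (real (l (Suc m) - l m) / real n) *\<^sub>R A (X n (l m) w) + (1 / real n) *\<^sub>R (\<Sum>i\<in>{l m..<l (Suc m)}. Os i (X n (l m) w)))"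
  unfolding sum_blocks scaleR_sum_right[of _ _ "{..<k}"]
 proof (rule sum.cong[OF refl])
  fix m
  have "(\<Sum>i\<in>{l m..<l (Suc m)}. A (q i w) + Os i (q i w)) = (\<Sum>i\<in>{l m..<l (Suc m)}. A (X n (l m) w) + Os i (X n (l m) w))"
   by (intro sum.cong refl) (simp add: q_block[of m])
  also have "\<dots> = real (l (Suc m) - l m) *\<^sub>R A (X n (l m) w) + (\<Sum>i\<in>{l m..<l (Suc m)}. Os i (X n (l m) w))"
   by (simp add: sum.distrib scaleR_conv_of_real sum_constant_scaleR)
  finally show "(1 / real n) *\<^sub>R (\<Sum>i\<in>{l m..<l (Suc m)}. A (q i w) + Os i (q i w))
   = (real (l (Suc m) - l m) / real n) *\<^sub>R A (X n (l m) w) + (1 / real n) *\<^sub>R (\<Sum>i\<in>{l m..<l (Suc m)}. Os i (X n (l m) w))"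
   by (simp add: scaleR_add_right)
 qed
 have S: "(\<Sum>i<l k. b i w *\<^sub>R ((\<gamma> (real (block_of i) * h) / sqrt (real n)) *\<^sub>R U i (q i w)))
   = (\<Sum>m<k. \<Sum>j\<in>UNIV. (block_noise n K m w $ j) *\<^sub>R grid_coeff \<gamma> C T K m j (X n (l m) w))"
  unfolding sum_blocks
 proof (rule sum.cong[OF refl])
  fix m
  have "(\<Sum>i\<in>{l m..<l (Suc m)}. b i w *\<^sub>R ((\<gamma> (real (block_of i) * h) / sqrt (real n)) *\<^sub>R U i (q i w)))
   = (\<Sum>i\<in>{l m..<l (Suc m)}. b i w *\<^sub>R ((\<gamma> (real m * h) / sqrt (real n)) *\<^sub>R U i (X n (l m) w)))"
   by (intro sum.cong refl) (simp add: q_block[of m] block_of_eq[of m])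
  then show "(\<Sum>i\<in>{l m..<l (Suc m)}. b i w *\<^sub>R ((\<gamma> (real (block_of i) * h) / sqrt (real n)) *\<^sub>R U i (q i w)))
   = (\<Sum>j\<in>UNIV. (block_noise n K m w $ j) *\<^sub>R grid_coeff \<gamma> C T K m j (X n (l m) w))"
   unfolding block_noise_apply grid_coeff_def .
 qed
 have M: "Mt (l k) w = (\<Sum>i<l k. b i w *\<^sub>R mart n i w)
   - (\<Sum>m<k. \<Sum>j\<in>UNIV. (block_noise n K m w $ j) *\<^sub>R grid_coeff \<gamma> C T K m j (X n (l m) w))"
  unfolding Mt_def xi_def S[symmetric] sum_subtractf[symmetric] by (simp add: scaleR_diff_right)
 have D: "(1 / real n) *\<^sub>R (\<Sum>i<l k. drf n i w - (A (q i w) + Os i (q i w)))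
   = (1 / real n) *\<^sub>R (\<Sum>i<l k. drf n i w) - (1 / real n) *\<^sub>R (\<Sum>i<l k. A (q i w) + Os i (q i w))"
  by (simp only: sum_subtractf scaleR_diff_right)
 have H: "(\<Sum>m<k. (real (l (Suc m) - l m) / real n - h) *\<^sub>R A (X n (l m) w) + (1 / real n) *\<^sub>R (\<Sum>i\<in>{l m..<l (Suc m)}. Os i (X n (l m) w)))
   = (\<Sum>m<k. (real (l (Suc m) - l m) / real n) *\<^sub>R A (X n (l m) w) + (1 / real n) *\<^sub>R (\<Sum>i\<in>{l m..<l (Suc m)}. Os i (X n (l m) w)))
    - (\<Sum>m<k. h *\<^sub>R A (X n (l m) w))"
  unfolding sum_subtractf[symmetric] by (intro sum.cong refl) (simp add: scaleR_diff_left)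
 have "Euler_defect h A (grid_coeff \<gamma> C T K) (block_noise n K) (\<lambda>k w. X n (l k) w) k w - y\<^sub>0
   = (X n (l k) w - y\<^sub>0) - (\<Sum>m<k. h *\<^sub>R A (X n (l m) w))
    - (\<Sum>m<k. \<Sum>j\<in>UNIV. (block_noise n K m w $ j) *\<^sub>R grid_coeff \<gamma> C T K m j (X n (l m) w))"
  unfolding Euler_defect_def sum.distrib by simp
 also have "\<dots> = (1 / real n) *\<^sub>R (\<Sum>i<l k. drf n i w - (A (q i w) + Os i (q i w)))
   + (\<Sum>m<k. (real (l (Suc m) - l m) / real n - h) *\<^sub>R A (X n (l m) w) + (1 / real n) *\<^sub>R (\<Sum>i\<in>{l m..<l (Suc m)}. Os i (X n (l m) w)))
   + Mt (l k) w"
  unfolding X D H M Q by simp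
 finally show ?thesis .
qed

text \<open>
 At a frozen argument, the oscillating terms add up to at most \<open>c norm x\<close> in each block.
\<close>

lemma defect_le:
 assumes k: "k \<le> K"
 shows "norm (Euler_defect h A (grid_coeff \<gamma> C T K) (block_noise n K) (\<lambda>k w. X n (l k) w) k w - y\<^sub>0)
  \<le> G1 w + G2 w + norm (Mt (l k) w)"
proof -
 have lk: "l k \<le> l K" by (rule le[OF k])
 have 1: "norm ((1 / real n) *\<^sub>R (\<Sum>i<l k. drf n i w - (A (q i w) + Os i (q i w)))) \<le> G1 w"
 proof -
  have "norm (\<Sum>i<l k. drf n i w - (A (q i w) + Os i (q i w))) \<le> (\<Sum>i<l k. 2 * c * norm (X n i w - q i w))"
  proof (rule sum_norm_le)
   fix i
   have e: "drf n i w - (A (q i w) + Os i (q i w)) = A (X n i w - q i w) + Os i (X n i w - q i w)"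
    unfolding drf_def by (simp add: linear_diff[OF A(1)] linear_diff[OF Os(1)])
   have "norm (A (X n i w - q i w) + Os i (X n i w - q i w)) \<le> c * norm (X n i w - q i w) + c * norm (X n i w - q i w)"
    by (rule order_trans[OF norm_triangle_ineq add_mono[OF A(2) Os(2)]])
   then show "norm (drf n i w - (A (q i w) + Os i (q i w))) \<le> 2 * c * norm (X n i w - q i w)"
    unfolding e by linarith
  qed
  also have "\<dots> \<le> (\<Sum>i<l K. 2 * c * norm (X n i w - q i w))" using lk c0 by (intro sum_mono2) auto
  also have "\<dots> = real n * G1 w" using n by (simp add: G1_def sum_distrib_left)
  finally show ?thesis using n by (simp add: divide_le_eq mult.commute)
 qed
 have 2: "norm (\<Sum>m<k. (real (l (Suc m) - l m) / real n - h) *\<^sub>R A (X n (l m) w) + (1 / real n) *\<^sub>R (\<Sum>i\<in>{l m..<l (Suc m)}. Os i (X n (l m) w))) \<le> G2 w"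
 proof -
  have "norm (\<Sum>m<k. (real (l (Suc m) - l m) / real n - h) *\<^sub>R A (X n (l m) w) + (1 / real n) *\<^sub>R (\<Sum>i\<in>{l m..<l (Suc m)}. Os i (X n (l m) w)))
    \<le> (\<Sum>m<k. (2 * c / real n) * norm (X n (l m) w))"
  proof (rule sum_norm_le)
   fix m
   have "norm ((real (l (Suc m) - l m) / real n - h) *\<^sub>R A (X n (l m) w)) \<le> (1 / real n) * (c * norm (X n (l m) w))"
    using l_len(2)[of m] A(2)[of "X n (l m) w"] by (simp only: norm_scaleR real_norm_def) (intro mult_mono, auto)
   moreover have "norm ((1 / real n) *\<^sub>R (\<Sum>i\<in>{l m..<l (Suc m)}. Os i (X n (l m) w))) \<le> (1 / real n) * (c * norm (X n (l m) w))"
   proof -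
    have "\<bar>1 / real n\<bar> = 1 / real n" by simp
    then show ?thesis unfolding norm_scaleR by (simp only:) (rule mult_left_mono[OF Os_sum], simp)
   qed
   ultimately show "norm ((real (l (Suc m) - l m) / real n - h) *\<^sub>R A (X n (l m) w) + (1 / real n) *\<^sub>R (\<Sum>i\<in>{l m..<l (Suc m)}. Os i (X n (l m) w)))
     \<le> (2 * c / real n) * norm (X n (l m) w)"
    by (rule order_trans[OF order_trans[OF norm_triangle_ineq add_mono]]) simp
  qed
  also have "\<dots> \<le> (\<Sum>m<K. (2 * c / real n) * norm (X n (l m) w))" using k c0 by (intro sum_mono2) auto
  finally show ?thesis by (simp only: G2_def sum_distrib_left)
 qed
 show ?thesis unfolding defect_eq[OF k]
  by (rule order_trans[OF norm_triangle_ineq add_right_mono[OF order_trans[OF norm_triangle_ineq add_mono[OF 1 2]]]])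
qed

lemma q_adapted: "i < l K ==> q i \<in> borel_measurable (F i)"
 unfolding q_def by (rule measurable_F_le[OF X_adapted block_of_props(2)])

lemma q_sq:
 assumes "i < l K"
 shows "sq_integrable M (q i)" "moment2 (q i) \<le> CQ"
  "sq_integrable M (\<lambda>w. X n i w - q i w)" "moment2 (\<lambda>w. X n i w - q i w) \<le> Cd * \<theta>"
proof -
 note bp = block_of_props[OF assms]
 have lT: "real (l (block_of i)) \<le> real n * T" using bp(1) by (intro l_le_nT) simp
 show 1: "sq_integrable M (q i)" "moment2 (q i) \<le> CQ"
  unfolding q_def using X_second_moment[OF n lT] by auto
 show "sq_integrable M (\<lambda>w. X n i w - q i w)"
  using sq_integrable_add[OF X_second_moment(1)[OF n i_le_nT[OF assms]] sq_integrable_scaleR[OF 1(1), of "-1"]] by simp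
 have "moment2 (\<lambda>w. X n i w - q i w) \<le> Cd * (real (i - l (block_of i)) / real n)"
  unfolding q_def by (rule X_increment_sq[OF n i_le_nT[OF assms] bp(2)])
 also have "real (i - l (block_of i)) / real n \<le> \<theta>"
 proof -
  have "i - l (block_of i) \<le> l (Suc (block_of i)) - l (block_of i)" using bp(3) by simp
  then have "real (i - l (block_of i)) / real n \<le> real (l (Suc (block_of i)) - l (block_of i)) / real n"
   by (intro divide_right_mono) auto
  then show ?thesis using l_len(1)[of "block_of i"] by linarith
 qed
 then have "Cd * (real (i - l (block_of i)) / real n) \<le> Cd * \<theta>" using Cd0 by (intro mult_left_mono) auto
 finally show "moment2 (\<lambda>w. X n i w - q i w) \<le> Cd * \<theta>" .
qed

lemma xi_adapted: "i < l K ==> xi i \<in> borel_measurable (F i)"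
 unfolding xi_def
 by (intro borel_measurable_diff mart_adapted borel_measurable_scaleR[OF borel_measurable_const borel_measurable_linear[OF U_linear q_adapted]])

text \<open>
 The coefficient changes because \<open>X\<close> moves, by order \<open>sqrt \<theta>\<close> in mean square, and because \<open>\<gamma>\<close> moves, by at most \<open>\<delta>\<close>.
\<close>

lemma xi_sq:
 assumes i: "i < l K" and \<delta>: "0 \<le> \<delta>" "\<And>s t. s \<in> {0..T} ==> t \<in> {0..T} ==> \<bar>s - t\<bar> \<le> \<theta> ==> \<bar>\<gamma> s - \<gamma> t\<bar> \<le> \<delta>"
 shows "sq_integrable M (xi i)" "moment2 (xi i) \<le> (2 * \<nu>^2 / real n) * (\<Gamma>^2 * Cd * \<theta> + \<delta>^2 * CQ)"
proof -
 let ?g = "\<gamma> (real i / real n)" and ?g' = "\<gamma> (real (block_of i) * h)" and ?s = "sqrt (real n)"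
 note bt = block_time[OF i]
 have tk: "real (block_of i) * h \<in> {0..T}" using block_of_props(1)[OF i] by (intro t_in) simp
 have g: "\<bar>?g\<bar> \<le> \<Gamma>" "\<bar>?g - ?g'\<bar> \<le> \<delta>" using \<Gamma>(2)[OF bt(2)] \<delta>(2)[OF bt(2) tk bt(1)] by auto
 note qs = q_sq[OF i]
 show s: "sq_integrable M (xi i)"
 proof -
  have "(\<lambda>w. xi i w) = (\<lambda>w. mart n i w + (- (?g' / ?s)) *\<^sub>R U i (q i w))" by (simp add: xi_def)
  moreover have "sq_integrable M (\<lambda>w. U i (q i w))"
   by (rule sq_integrable_bound[OF qs(1) borel_measurable_linear[OF U_linear measurable_F_M[OF q_adapted[OF i]]] U_bound])
  ultimately show ?thesis using sq_integrable_add[OF mart_sq(1)[OF n i_le_nT[OF i]] sq_integrable_scaleR] by metis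
 qed
 have le: "(norm (xi i w))^2 \<le> (2 * \<nu>^2 / real n) * (\<Gamma>^2 * (norm (X n i w - q i w))^2 + \<delta>^2 * (norm (q i w))^2)" for w
 proof -
  have "xi i w = (?g / ?s) *\<^sub>R U i (X n i w - q i w) + ((?g - ?g') / ?s) *\<^sub>R U i (q i w)"
   unfolding xi_def mart_def by (simp add: linear_diff[OF U_linear] algebra_simps diff_divide_distrib)
  then have "(norm (xi i w))^2 \<le> 2 * (norm ((?g / ?s) *\<^sub>R U i (X n i w - q i w)))^2 + 2 * (norm (((?g - ?g') / ?s) *\<^sub>R U i (q i w)))^2"
   using norm_add_sq_le by metis
  also have "(norm ((?g / ?s) *\<^sub>R U i (X n i w - q i w)))^2 \<le> (\<Gamma> / ?s * (\<nu> * norm (X n i w - q i w)))^2"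
  proof (rule power_mono)
   show "norm ((?g / ?s) *\<^sub>R U i (X n i w - q i w)) \<le> \<Gamma> / ?s * (\<nu> * norm (X n i w - q i w))"
    using g(1) \<Gamma>(1) U_bound by (simp only: norm_scaleR) (intro mult_mono, auto simp: divide_right_mono)
  qed simp
  also have "(norm (((?g - ?g') / ?s) *\<^sub>R U i (q i w)))^2 \<le> (\<delta> / ?s * (\<nu> * norm (q i w)))^2"
  proof (rule power_mono)
   show "norm (((?g - ?g') / ?s) *\<^sub>R U i (q i w)) \<le> \<delta> / ?s * (\<nu> * norm (q i w))"
    using g(2) \<delta>(1) U_bound by (simp only: norm_scaleR) (intro mult_mono, auto simp: divide_right_mono)
  qed simp
  finally show ?thesis using n by (simp add: power_mult_distrib power_divide field_simps)
 qed
 have "moment2 (xi i)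
   \<le> expectation (\<lambda>w. (2 * \<nu>^2 / real n) * (\<Gamma>^2 * (norm (X n i w - q i w))^2 + \<delta>^2 * (norm (q i w))^2))"
 proof (rule integral_mono[OF _ _ le])
  show "integrable M (\<lambda>w. (norm (xi i w))^2)" using s by (simp add: sq_integrable_def)
  show "integrable M (\<lambda>w. (2 * \<nu>^2 / real n) * (\<Gamma>^2 * (norm (X n i w - q i w))^2 + \<delta>^2 * (norm (q i w))^2))"
   using qs(1,3) unfolding sq_integrable_def by (intro integrable_mult_right Bochner_Integration.integrable_add) auto
 qed
 also have "\<dots> = (2 * \<nu>^2 / real n) * (\<Gamma>^2 * moment2 (\<lambda>w. X n i w - q i w) + \<delta>^2 * moment2 (q i))"
 proof -
  have "integrable M (\<lambda>w. \<Gamma>^2 * (norm (X n i w - q i w))^2)" "integrable M (\<lambda>w. \<delta>^2 * (norm (q i w))^2)"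
   using qs(1,3) unfolding sq_integrable_def by (intro integrable_mult_right; auto)+
  from Bochner_Integration.integral_add[OF this] show ?thesis by (simp only: integral_mult_right_zero)
 qed
 also have "\<dots> \<le> (2 * \<nu>^2 / real n) * (\<Gamma>^2 * (Cd * \<theta>) + \<delta>^2 * CQ)"
  using qs(2,4) by (intro mult_left_mono add_mono) auto
 finally show "moment2 (xi i) \<le> (2 * \<nu>^2 / real n) * (\<Gamma>^2 * Cd * \<theta> + \<delta>^2 * CQ)"
  by (simp add: mult.assoc)
qed

lemma lK_le_n: "real (l K) \<le> real n"
 using l_le_nT[of K] T mult_left_mono[of T 1 "real n"] by simp

lemma prob_G1:
 assumes \<eta>: "0 < \<eta>" shows "{w \<in> space M. \<eta> \<le> norm (G1 w)} \<in> sets M" "prob {w \<in> space M. \<eta> \<le> norm (G1 w)} \<le> 4 * c^2 * Cd * \<theta> / \<eta>^2"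
proof -
 let ?f = "\<lambda>i w. norm (X n i w - q i w)"
 have f: "sq_integrable M (?f i)" "moment2 (?f i) \<le> Cd * \<theta>" if "i \<in> {..<l K}" for i
  using q_sq(3,4)[of i] that by (auto simp: sq_integrable_def)
 have s: "sq_integrable M (\<lambda>w. \<Sum>i<l K. ?f i w)" by (intro sq_integrable_sum finite_measure_axioms f) auto
 have G: "sq_integrable M G1"
  unfolding G1_def using sq_integrable_scaleR[OF s, of "2 * c / real n"] by simp
 then have [measurable]: "G1 \<in> borel_measurable M" by (simp add: sq_integrable_def)
 show "{w \<in> space M. \<eta> \<le> norm (G1 w)} \<in> sets M" by measurable
 have "moment2 G1 = (2 * c / real n)^2 * moment2 (\<lambda>w. \<Sum>i<l K. ?f i w)"
  by (simp only: G1_def real_norm_def power2_abs power_mult_distrib integral_mult_right_zero)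
 also have "\<dots> \<le> (2 * c / real n)^2 * ((real (card {..<l K}))^2 * (Cd * \<theta>))"
  by (intro mult_left_mono expectation_sum_sq_le f) auto
 also have "\<dots> \<le> (2 * c / real n)^2 * ((real n)^2 * (Cd * \<theta>))"
  using lK_le_n Cd0 \<theta>0 by (intro mult_left_mono mult_right_mono power_mono) auto
 also have "\<dots> = 4 * c^2 * Cd * \<theta>" using n by (simp add: power_divide power_mult_distrib)
 finally have E: "moment2 G1 \<le> 4 * c^2 * Cd * \<theta>" .
 show "prob {w \<in> space M. \<eta> \<le> norm (G1 w)} \<le> 4 * c^2 * Cd * \<theta> / \<eta>^2" by (rule prob_norm_ge_le[OF G \<eta> E])
qed

lemma prob_G2:
 assumes \<eta>: "0 < \<eta>" shows "{w \<in> space M. \<eta> \<le> norm (G2 w)} \<in> sets M" "prob {w \<in> space M. \<eta> \<le> norm (G2 w)} \<le> (4 * c^2 * (real K)^2 * CQ / (real n)^2) / \<eta>^2"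
proof -
 let ?f = "\<lambda>m w. norm (X n (l m) w)"
 have f: "sq_integrable M (?f m)" "moment2 (?f m) \<le> CQ" if "m \<in> {..<K}" for m
  using X_second_moment[OF n l_le_nT[of m]] that by (auto simp: sq_integrable_def)
 have s: "sq_integrable M (\<lambda>w. \<Sum>m<K. ?f m w)" by (intro sq_integrable_sum finite_measure_axioms f) auto
 have G: "sq_integrable M G2"
  unfolding G2_def using sq_integrable_scaleR[OF s, of "2 * c / real n"] by simp
 then have [measurable]: "G2 \<in> borel_measurable M" by (simp add: sq_integrable_def)
 show "{w \<in> space M. \<eta> \<le> norm (G2 w)} \<in> sets M" by measurable
 have "moment2 G2 = (2 * c / real n)^2 * moment2 (\<lambda>w. \<Sum>m<K. ?f m w)"
  by (simp only: G2_def real_norm_def power2_abs power_mult_distrib integral_mult_right_zero)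
 also have "\<dots> \<le> (2 * c / real n)^2 * ((real (card {..<K}))^2 * CQ)"
  by (intro mult_left_mono expectation_sum_sq_le f) auto
 also have "\<dots> = 4 * c^2 * (real K)^2 * CQ / (real n)^2" using n by (simp add: power_divide power_mult_distrib)
 finally have E: "moment2 G2 \<le> 4 * c^2 * (real K)^2 * CQ / (real n)^2" .
 show "prob {w \<in> space M. \<eta> \<le> norm (G2 w)} \<le> (4 * c^2 * (real K)^2 * CQ / (real n)^2) / \<eta>^2" by (rule prob_norm_ge_le[OF G \<eta> E])
qed

lemma prob_Mt:
 assumes \<eta>: "0 < \<eta>" and \<delta>: "0 \<le> \<delta>" "\<And>s t. s \<in> {0..T} ==> t \<in> {0..T} ==> \<bar>s - t\<bar> \<le> \<theta> ==> \<bar>\<gamma> s - \<gamma> t\<bar> \<le> \<delta>"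
 shows "{w \<in> space M. \<exists>k\<le>l K. \<eta> \<le> norm (Mt k w)} \<in> sets M"
  "prob {w \<in> space M. \<exists>k\<le>l K. \<eta> \<le> norm (Mt k w)} \<le> 2 * \<nu>^2 * (\<Gamma>^2 * Cd * \<theta> + \<delta>^2 * CQ) / \<eta>^2"
proof -
 interpret noise_sequence M F b "\<lambda>_. 1" "l K" by (rule noise)
 show "{w \<in> space M. \<exists>k\<le>l K. \<eta> \<le> norm (Mt k w)} \<in> sets M"
  unfolding Mt_def by (rule sets_ex_norm_ge, rule measurable_F[OF noise_sum_adapted]) (auto intro: xi_adapted)
 have "prob {w \<in> space M. \<exists>k\<le>l K. \<eta> \<le> norm (Mt k w)} \<le> (\<Sum>i<l K. 1 * moment2 (xi i)) / \<eta>^2"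
  unfolding Mt_def by (rule maximal_inequality[OF order_refl xi_adapted xi_sq(1)[OF _ \<delta>] \<eta>])
 also have "\<dots> \<le> (\<Sum>i<l K. (2 * \<nu>^2 / real n) * (\<Gamma>^2 * Cd * \<theta> + \<delta>^2 * CQ)) / \<eta>^2"
  using xi_sq(2)[OF _ \<delta>] by (intro divide_right_mono sum_mono) auto
 also have "\<dots> = (real (l K) / real n) * (2 * \<nu>^2 * (\<Gamma>^2 * Cd * \<theta> + \<delta>^2 * CQ)) / \<eta>^2" by simp
 also have "\<dots> \<le> 1 * (2 * \<nu>^2 * (\<Gamma>^2 * Cd * \<theta> + \<delta>^2 * CQ)) / \<eta>^2"
 proof (intro divide_right_mono mult_right_mono)
  show "real (l K) / real n \<le> 1" using lK_le_n n by simp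
  show "0 \<le> 2 * \<nu>^2 * (\<Gamma>^2 * Cd * \<theta> + \<delta>^2 * CQ)" using Cd0 CQ0 \<theta>0 by simp
 qed simp
 finally show "prob {w \<in> space M. \<exists>k\<le>l K. \<eta> \<le> norm (Mt k w)} \<le> 2 * \<nu>^2 * (\<Gamma>^2 * Cd * \<theta> + \<delta>^2 * CQ) / \<eta>^2" by simp
qed

text \<open>
 The noise in coordinate \<open>j\<close> that has accumulated during the first \<open>i\<close> steps of block \<open>m\<close>.
\<close>

definition "bpart m j i w = (\<Sum>r<i. b (l m + r) w * (u (l m + r) $ j / sqrt (real n)))"

lemma prob_part:
 assumes a: "0 < a"
 shows "{w \<in> space M. \<exists>i\<le>l (Suc m) - l m. a \<le> \<bar>bpart m j i w\<bar>} \<in> sets M"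
  "prob {w \<in> space M. \<exists>i\<le>l (Suc m) - l m. a \<le> \<bar>bpart m j i w\<bar>} \<le> \<upsilon>^3 * (\<theta> * (3 * sqrt \<theta> + C3 / sqrt (real n))) / a^3"
proof -
 let ?L = "l (Suc m) - l m"
 interpret n0: noise_sequence M F b "\<lambda>_. 1" "l m + ?L" by (rule noise)
 interpret noise_sequence M "\<lambda>k. F (l m + k)" "\<lambda>k. b (l m + k)" "\<lambda>_. 1" ?L by (rule n0.shift) simp
 have C30: "0 \<le> C3" by (rule order_trans[OF integral_nonneg_AE b3(2)[of 0]]) auto
 have "bpart m j i \<in> borel_measurable M" if "i \<le> ?L" for i
 proof -
  have "(\<lambda>w. \<Sum>r<i. b (l m + r) w *\<^sub>R (u (l m + r) $ j / sqrt (real n))) \<in> borel_measurable M"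
   using measurable_F[OF noise_sum_adapted[of i "\<lambda>r w. u (l m + r) $ j / sqrt (real n)"]] that by simp
  then show ?thesis unfolding bpart_def by simp
 qed
 from sets_ex_norm_ge[where N="?L" and f="bpart m j" and P=M and a=a, OF this]
 show "{w \<in> space M. \<exists>i\<le>?L. a \<le> \<bar>bpart m j i w\<bar>} \<in> sets M" by (simp only: real_norm_def)
 have "prob {w \<in> space M. \<exists>i\<le>?L. a \<le> \<bar>bpart m j i w\<bar>} \<le> (\<upsilon> / sqrt (real n))^3 * (real ?L * (3 * sqrt (real ?L) + C3)) / a^3"
  unfolding bpart_def
 proof (rule third_moment_maximal_inequality[OF order_refl _ _ _ a b3])
  show "\<bar>u (l m + i) $ j / sqrt (real n)\<bar> \<le> \<upsilon> / sqrt (real n)" for i using u[of "l m + i" j] by (simp add: divide_right_mono)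
 qed (use \<upsilon>0 in auto)
 also have "\<dots> \<le> (\<upsilon> / sqrt (real n))^3 * ((\<theta> * real n) * (3 * sqrt (\<theta> * real n) + C3)) / a^3"
 proof -
  have "real ?L \<le> \<theta> * real n" using l_len(1)[of m] n by (simp add: divide_le_eq)
  then show ?thesis using \<upsilon>0 a C30 \<theta>0 by (intro divide_right_mono mult_left_mono mult_mono add_mono) auto
 qed
 also have "\<dots> = \<upsilon>^3 * (\<theta> * (3 * sqrt \<theta> + C3 / sqrt (real n))) / a^3"
 proof -
  have s: "sqrt (real n) * sqrt (real n) = real n" "sqrt (real n) > 0" using n by auto
  have "(\<upsilon> / s)^3 * ((\<theta> * (s * s)) * (3 * (sqrt \<theta> * s) + C3)) = \<upsilon>^3 * (\<theta> * (3 * sqrt \<theta> + C3 / s))" if "s > 0" for s :: real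
   using that by (simp add: power3_eq_cube field_simps)
  from this[OF s(2)] show ?thesis unfolding s(1) by (simp add: real_sqrt_mult)
 qed
 finally show "prob {w \<in> space M. \<exists>i\<le>?L. a \<le> \<bar>bpart m j i w\<bar>} \<le> \<upsilon>^3 * (\<theta> * (3 * sqrt \<theta> + C3 / sqrt (real n))) / a^3" .
qed

end

context discrete_grid begin

lemma block_noise_noise: "noise_sequence M (\<lambda>k. F (l k)) (\<lambda>k w. block_noise n K k w $ j) (\<lambda>_. \<upsilon>^2 * \<theta>) K"
proof (intro noise_sequence.intro noise_sequence_axioms.intro prob_space_axioms)
 let ?a = "\<lambda>m. u m $ j / sqrt (real n)"
 have a: "\<bar>?a m\<bar> \<le> \<upsilon> / sqrt (real n)" for m using u[of m j] by (simp add: divide_right_mono)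
 have S: "block_noise n K k w $ j = (\<Sum>m\<in>{l k..<l (Suc k)}. b m w * ?a m)" for k w by (simp add: block_noise_def)
 show "space (F (l k)) = space M" "sets (F (l k)) \<subseteq> events" for k
  using noise_sequence.space_F[OF noise, of "l k" "l k"] noise_sequence.sets_F[OF noise, of "l k" "l k"] by auto
 show "sets (F (l k)) \<subseteq> sets (F (l m))" if "k \<le> m" for k m
  using noise_sequence.mono_F[OF noise, of "l k" "l m" "l m"] le[OF that] by auto
 show "(\<lambda>w. block_noise n K k w $ j) \<in> borel_measurable (F (l (Suc k)))" for k
  unfolding S using b_measurable_F by (intro borel_measurable_sum borel_measurable_times) auto
 fix k and \<eta> :: "'w => real" assume \<eta>: "\<eta> \<in> borel_measurable (F (l k))" "integrable M \<eta>"
 show "integrable M (\<lambda>w. block_noise n K k w $ j * \<eta> w) \<and> expectation (\<lambda>w. block_noise n K k w $ j * \<eta> w) = 0"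
  unfolding S using noise_block_linear[where a="?a", OF mono a \<eta>] by blast
 assume pos: "\<And>w. 0 \<le> \<eta> w"
 note q = noise_block_quadratic[where a="?a", OF mono a \<eta> pos]
 have "real (l (Suc k) - l k) * (\<upsilon> / sqrt (real n))^2 = (real (l (Suc k) - l k) / real n) * \<upsilon>^2"
  using n by (simp add: power_divide)
 also have "\<dots> \<le> \<theta> * \<upsilon>^2" by (rule mult_right_mono[OF l_len(1)]) simp
 finally have "(real (l (Suc k) - l k) * (\<upsilon> / sqrt (real n))^2) * expectation \<eta> \<le> (\<upsilon>^2 * \<theta>) * expectation \<eta>"
  using pos by (intro mult_right_mono integral_nonneg_AE) (auto simp: mult.commute)
 with q show "integrable M (\<lambda>w. (block_noise n K k w $ j)^2 * \<eta> w) \<and>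
   expectation (\<lambda>w. (block_noise n K k w $ j)^2 * \<eta> w) \<le> \<upsilon>^2 * \<theta> * expectation \<eta>"
  unfolding S by (meson order_trans)
qed

text \<open>
 Inside a block, \<open>X\<close> moves by the drift, by the freezing error, and by the frozen coefficient times the noise
 accumulated in the block.
\<close>

lemma block_oscillation:
 assumes Mt: "\<And>k. k \<le> l K ==> norm (Mt k w) \<le> \<eta>" and R: "\<And>i. i \<le> l K ==> norm (X n i w) \<le> R"
  and bp: "\<And>i j. i \<le> l (Suc m) - l m ==> \<bar>bpart m j i w\<bar> \<le> a'"
  and m: "m < K" and i: "l m \<le> i" "i \<le> l (Suc m)" and pos: "0 \<le> R" "0 \<le> a'"
 shows "norm (X n i w - X n (l m) w) \<le> 2 * c * \<theta> * R + 2 * \<eta> + real CARD('d) * (a' * (\<Gamma> * (c * R)))"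
proof -
 have lK: "l (Suc m) \<le> l K" using m by (intro le) simp
 have iK: "i \<le> l K" using i lK by simp
 have 1: "norm ((1 / real n) *\<^sub>R (\<Sum>r\<in>{l m..<i}. drf n r w)) \<le> 2 * c * \<theta> * R"
 proof -
  have "norm (\<Sum>r\<in>{l m..<i}. drf n r w) \<le> (\<Sum>r\<in>{l m..<i}. 2 * c * R)"
  proof (rule sum_norm_le)
   fix r assume "r \<in> {l m..<i}"
   then have "norm (X n r w) \<le> R" using iK by (intro R) simp
   then have "2 * c * norm (X n r w) \<le> 2 * c * R" using c0 by (intro mult_left_mono) auto
   then show "norm (drf n r w) \<le> 2 * c * R" using drf_bound[of n r w] by linarith
  qed
  also have "\<dots> = real (i - l m) * (2 * c * R)" by simp
  also have "\<dots> \<le> real (l (Suc m) - l m) * (2 * c * R)" using i c0 pos by (intro mult_right_mono) auto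
  finally have "norm (\<Sum>r\<in>{l m..<i}. drf n r w) / real n \<le> real (l (Suc m) - l m) * (2 * c * R) / real n"
   by (rule divide_right_mono) simp
  also have "\<dots> = (real (l (Suc m) - l m) / real n) * (2 * c * R)" by simp
  also have "\<dots> \<le> \<theta> * (2 * c * R)" using c0 pos by (intro mult_right_mono l_len(1)) auto
  finally show ?thesis by (simp add: mult_ac)
 qed
 have blk: "block_of r = m" "q r w = X n (l m) w" if "r \<in> {l m..<i}" for r
  using that i block_of_eq[of m r] q_block[of m r w] by auto
 have "(\<Sum>r\<in>{l m..<i}. b r w *\<^sub>R mart n r w)
   = (\<Sum>r\<in>{l m..<i}. b r w *\<^sub>R xi r w) + (\<Sum>r\<in>{l m..<i}. b r w *\<^sub>R ((\<gamma> (real m * h) / sqrt (real n)) *\<^sub>R U r (X n (l m) w)))"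
  unfolding sum.distrib[symmetric] by (rule sum.cong[OF refl]) (simp add: xi_def blk scaleR_diff_right)
 moreover have "(\<Sum>r\<in>{l m..<i}. b r w *\<^sub>R xi r w) = Mt i w - Mt (l m) w"
  using sum.atLeastLessThan_concat[of 0 "l m" i "\<lambda>r. b r w *\<^sub>R xi r w"] i(1) by (simp add: Mt_def atLeast0LessThan algebra_simps)
 moreover have "(\<Sum>r\<in>{l m..<i}. b r w *\<^sub>R ((\<gamma> (real m * h) / sqrt (real n)) *\<^sub>R U r (X n (l m) w)))
   = (\<Sum>j\<in>UNIV. bpart m j (i - l m) w *\<^sub>R (\<gamma> (real m * h) *\<^sub>R C j (X n (l m) w)))"
 proof -
  have sh: "(\<Sum>r\<in>{l m..<i}. f r) = (\<Sum>r<i - l m. f (l m + r))" for f :: "nat => 'z::comm_monoid_add"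
   using sum.atLeastLessThan_shift_0[of f "l m" i] by (simp add: atLeast0LessThan)
  have "(\<Sum>r\<in>{l m..<i}. b r w *\<^sub>R ((\<gamma> (real m * h) / sqrt (real n)) *\<^sub>R U r (X n (l m) w)))
   = (\<Sum>r\<in>{l m..<i}. \<Sum>j\<in>UNIV. (b r w * (u r $ j / sqrt (real n))) *\<^sub>R (\<gamma> (real m * h) *\<^sub>R C j (X n (l m) w)))"
   unfolding U_def scaleR_sum_right by (intro sum.cong refl) (simp add: mult_ac)
  also have "\<dots> = (\<Sum>j\<in>UNIV. \<Sum>r\<in>{l m..<i}. (b r w * (u r $ j / sqrt (real n))) *\<^sub>R (\<gamma> (real m * h) *\<^sub>R C j (X n (l m) w)))"
   by (rule sum.swap)
  also have "\<dots> = (\<Sum>j\<in>UNIV. bpart m j (i - l m) w *\<^sub>R (\<gamma> (real m * h) *\<^sub>R C j (X n (l m) w)))"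
   unfolding scaleR_sum_left[symmetric] sh bpart_def ..
  finally show ?thesis .
 qed
 ultimately have 2: "(\<Sum>r\<in>{l m..<i}. b r w *\<^sub>R mart n r w) = (Mt i w - Mt (l m) w)
   + (\<Sum>j\<in>UNIV. bpart m j (i - l m) w *\<^sub>R (\<gamma> (real m * h) *\<^sub>R C j (X n (l m) w)))" by simp
 have 3: "norm (Mt i w - Mt (l m) w) \<le> 2 * \<eta>"
  using norm_triangle_ineq4[of "Mt i w" "Mt (l m) w"] Mt[OF iK] Mt[of "l m"] i(1) iK by fastforce
 have 4: "norm (\<Sum>j\<in>UNIV. bpart m j (i - l m) w *\<^sub>R (\<gamma> (real m * h) *\<^sub>R C j (X n (l m) w))) \<le> real CARD('d) * (a' * (\<Gamma> * (c * R)))"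
 proof -
  have "norm (\<Sum>j\<in>UNIV. bpart m j (i - l m) w *\<^sub>R (\<gamma> (real m * h) *\<^sub>R C j (X n (l m) w))) \<le> (\<Sum>j\<in>(UNIV::'d set). a' * (\<Gamma> * (c * R)))"
  proof (rule sum_norm_le)
   fix j
   have "norm (C j (X n (l m) w)) \<le> c * R"
    by (rule order_trans[OF C(2) mult_left_mono[OF R c0]]) (use i(1) iK in simp)
   moreover have "\<bar>\<gamma> (real m * h)\<bar> \<le> \<Gamma>" using m by (intro \<Gamma> t_in) simp
   ultimately have *: "\<bar>\<gamma> (real m * h)\<bar> * norm (C j (X n (l m) w)) \<le> \<Gamma> * (c * R)"
    using \<Gamma>(1) by (intro mult_mono) auto
   have "\<bar>bpart m j (i - l m) w\<bar> \<le> a'" using i by (intro bp) simp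
   then have "\<bar>bpart m j (i - l m) w\<bar> * (\<bar>\<gamma> (real m * h)\<bar> * norm (C j (X n (l m) w))) \<le> a' * (\<Gamma> * (c * R))"
    by (rule mult_mono[OF _ *]) (use pos in auto)
   then show "norm (bpart m j (i - l m) w *\<^sub>R (\<gamma> (real m * h) *\<^sub>R C j (X n (l m) w))) \<le> a' * (\<Gamma> * (c * R))"
    by (simp only: norm_scaleR)
  qed
  then show ?thesis by simp
 qed
 have "norm (X n i w - X n (l m) w) \<le> 2 * c * \<theta> * R + (2 * \<eta> + real CARD('d) * (a' * (\<Gamma> * (c * R))))"
  unfolding X_increment[OF i(1)] 2
  by (rule order_trans[OF norm_triangle_ineq add_mono[OF 1 order_trans[OF norm_triangle_ineq add_mono[OF 3 4]]]])
 then show ?thesis by simp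
qed

text \<open>
 Stability, applied to the difference of the recursion at the block ends and the Euler scheme; the block noise is a noise
 sequence with variances at most \<open>2 \<upsilon>\<^sup>2 h\<close> once \<open>1/n \<le> h\<close>.
\<close>

lemma Euler_scheme_near_blocks:
 assumes \<eta>: "0 < \<eta>" and a: "0 < a" and n1: "1 / real n \<le> h"
 shows "{w \<in> space M. \<exists>k\<le>K. a + \<eta> \<le> norm (X n (l k) w - Eul n K w k)} \<in> sets M"
  "prob {w \<in> space M. \<exists>k\<le>K. a + \<eta> \<le> norm (X n (l k) w - Eul n K w k)}
  \<le> prob {w \<in> space M. \<exists>k\<le>K. \<eta> < norm (Euler_defect h A (grid_coeff \<gamma> C T K) (block_noise n K) (\<lambda>k w. X n (l k) w) k w - y\<^sub>0)}
   + stab_const (c * \<Gamma>) (2 * \<upsilon>^2) T (real CARD('d)) * \<eta>^2 / a^2"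
proof -
 have lin: "linear (grid_coeff \<gamma> C T K i j)" for i j
  unfolding grid_coeff_def using linear_compose_scale_right[OF C(1)] .
 let ?D = "\<lambda>k w. X n (l k) w - Eul n K w k"
 have Dm: "?D k \<in> borel_measurable (F (l k))" if k: "k \<le> K" for k
 proof (intro borel_measurable_diff X_adapted Euler_scheme_adapted A lin)
  fix i j assume "i < k"
  then show "(\<lambda>w. block_noise n K i w $ j) \<in> borel_measurable (F (l k))"
   using noise_sequence.measurable_F_mono[OF block_noise_noise noise_sequence.b_adapted[OF block_noise_noise], of i k j] k by auto
 qed
 show "{w \<in> space M. \<exists>k\<le>K. a + \<eta> \<le> norm (?D k w)} \<in> sets M"
  by (rule sets_ex_norm_ge[OF measurable_F_M[OF Dm]])
 have "prob {w \<in> space M. \<exists>k\<le>K. a + \<eta> \<le> norm (?D k w)}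
   \<le> prob {w \<in> space M. \<exists>k\<le>K. \<eta> < norm (Euler_defect h A (grid_coeff \<gamma> C T K) (block_noise n K) ?D k w)}
    + stab_const (c * \<Gamma>) (2 * \<upsilon>^2) T (real CARD('d)) * \<eta>^2 / a^2"
 proof (rule Euler_stability[OF block_noise_noise Dm A(1) _ lin])
  show "norm (A x) \<le> c * \<Gamma> * norm x" for x
   using A(2)[of x] mult_right_mono[OF \<Gamma>(1), of "c * norm x"] c0 by (simp add: mult_ac)
  show "norm (grid_coeff \<gamma> C T K i j x) \<le> c * \<Gamma> * norm x" if "i < K" for i j x
   using mult_mono[OF \<Gamma>(2)[OF t_in[of i]] C(2)[of j x]] that \<Gamma>(1) by (simp add: grid_coeff_def mult_ac)
  show "\<upsilon>^2 * \<theta> \<le> 2 * \<upsilon>^2 * h" using n1 mult_left_mono[of \<theta> "2 * h" "\<upsilon>^2"] by (simp add: \<theta>_def)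
  show "real K * h \<le> T" using h by simp
 qed (use h c0 \<Gamma> a \<eta> in auto)
 then show "prob {w \<in> space M. \<exists>k\<le>K. a + \<eta> \<le> norm (?D k w)}
  \<le> prob {w \<in> space M. \<exists>k\<le>K. \<eta> < norm (Euler_defect h A (grid_coeff \<gamma> C T K) (block_noise n K) (\<lambda>k w. X n (l k) w) k w - y\<^sub>0)}
   + stab_const (c * \<Gamma>) (2 * \<upsilon>^2) T (real CARD('d)) * \<eta>^2 / a^2"
  by (simp only: Euler_defect_diff[OF A(1) lin])
qed

text \<open>
 The event \<open>Bad\<close> is the union of the exceptional events in the estimates of the martingale error, of the maximum of \<open>X\<close>, of the
 noise inside blocks, and of the distance to the Euler scheme at the block ends.
\<close>

lemma discrete_near_Euler:
 assumes \<eta>: "0 < \<eta>" and a: "0 < a" and R: "0 < R" and a': "0 < a'" and n1: "1 / real n \<le> h"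
  and \<delta>: "0 \<le> \<delta>" "\<And>s t. s \<in> {0..T} ==> t \<in> {0..T} ==> \<bar>s - t\<bar> \<le> \<theta> ==> \<bar>\<gamma> s - \<gamma> t\<bar> \<le> \<delta>"
  and e1: "0 \<le> e1" "4 * c^2 * Cd * \<theta> / \<eta>^2 \<le> e1" "(4 * c^2 * (real K)^2 * CQ / (real n)^2) / \<eta>^2 \<le> e1"
   "2 * \<nu>^2 * (\<Gamma>^2 * Cd * \<theta> + \<delta>^2 * CQ) / \<eta>^2 \<le> e1" "Cm / R^2 \<le> e1"
   "real K * (real CARD('d) * (\<upsilon>^3 * (\<theta> * (3 * sqrt \<theta> + C3 / sqrt (real n))) / a'^3)) \<le> e1"
   "stab_const (c * \<Gamma>) (2 * \<upsilon>^2) T (real CARD('d)) * (3 * \<eta>)^2 / a^2 \<le> e1"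
 shows "\<exists>Bad\<in>sets M. prob Bad \<le> 9 * e1 \<and> (\<forall>w\<in>space M - Bad.
   close_to_Euler n K ((a + 3 * \<eta>) + (2 * c * \<theta> * (norm y\<^sub>0 + R) + 2 * \<eta> + real CARD('d) * (a' * (\<Gamma> * (c * (norm y\<^sub>0 + R)))))) w)"
proof -
 let ?B1 = "{w \<in> space M. \<eta> \<le> norm (G1 w)}" and ?B2 = "{w \<in> space M. \<eta> \<le> norm (G2 w)}"
 let ?B3 = "{w \<in> space M. \<exists>k\<le>l K. \<eta> \<le> norm (Mt k w)}"
 let ?B4 = "{w \<in> space M. \<exists>i\<le>l K. norm y\<^sub>0 + R \<le> norm (X n i w)}"
 let ?B5 = "\<Union>x\<in>{..<K} \<times> (UNIV :: 'd set). {w \<in> space M. \<exists>i\<le>l (Suc (fst x)) - l (fst x). a' \<le> \<bar>bpart (fst x) (snd x) i w\<bar>}"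
 let ?B6 = "{w \<in> space M. \<exists>k\<le>K. a + 3 * \<eta> \<le> norm (X n (l k) w - Eul n K w k)}"
 let ?Df = "{w \<in> space M. \<exists>k\<le>K. 3 * \<eta> < norm (Euler_defect h A (grid_coeff \<gamma> C T K) (block_noise n K) (\<lambda>k w. X n (l k) w) k w - y\<^sub>0)}"
 have m1: "?B1 \<in> sets M" and p1: "prob ?B1 \<le> e1" by (rule prob_G1(1)[OF \<eta>], rule order_trans[OF prob_G1(2)[OF \<eta>] e1(2)])
 have m2: "?B2 \<in> sets M" and p2: "prob ?B2 \<le> e1" by (rule prob_G2(1)[OF \<eta>], rule order_trans[OF prob_G2(2)[OF \<eta>] e1(3)])
 have m3: "?B3 \<in> sets M" by (rule prob_Mt(1)[OF \<eta> \<delta>])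
 have p3: "prob ?B3 \<le> e1" by (rule order_trans[OF prob_Mt(2)[OF \<eta> \<delta>] e1(4)])
 have m4: "?B4 \<in> sets M" by (rule sets_ex_norm_ge[OF measurable_F_M[OF X_adapted]])
 have p4: "prob ?B4 \<le> e1" using X_maximal[OF n l_le_nT[OF order_refl] R] e1(5) by linarith
 have m5: "?B5 \<in> sets M" by (intro sets.finite_UN prob_part(1)[OF a']) auto
 have p5: "prob ?B5 \<le> e1"
 proof -
  have "prob ?B5 \<le> (\<Sum>x\<in>{..<K} \<times> (UNIV :: 'd set). prob {w \<in> space M. \<exists>i\<le>l (Suc (fst x)) - l (fst x). a' \<le> \<bar>bpart (fst x) (snd x) i w\<bar>})"
   by (rule finite_measure_subadditive_finite[OF _ image_subsetI[OF prob_part(1)[OF a']]]) simp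
  also have "\<dots> \<le> (\<Sum>x\<in>{..<K} \<times> (UNIV :: 'd set). \<upsilon>^3 * (\<theta> * (3 * sqrt \<theta> + C3 / sqrt (real n))) / a'^3)"
   by (rule sum_mono) (rule prob_part(2)[OF a'])
  also have "\<dots> = real K * (real CARD('d) * (\<upsilon>^3 * (\<theta> * (3 * sqrt \<theta> + C3 / sqrt (real n))) / a'^3))"
   by (simp add: card_cartesian_product)
  finally show ?thesis using e1(6) by linarith
 qed
 have "?Df \<subseteq> ?B1 \<union> (?B2 \<union> ?B3)"
 proof (rule subsetI, rule ccontr)
  fix w assume w: "w \<in> ?Df" and nw: "w \<notin> ?B1 \<union> (?B2 \<union> ?B3)"
  obtain k where k: "k \<le> K" "3 * \<eta> < norm (Euler_defect h A (grid_coeff \<gamma> C T K) (block_noise n K) (\<lambda>k w. X n (l k) w) k w - y\<^sub>0)"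
   and wM: "w \<in> space M" using w by blast
  have "\<not> \<eta> \<le> norm (G1 w)" "\<not> \<eta> \<le> norm (G2 w)" using nw wM by blast+
  then have "G1 w < \<eta>" "G2 w < \<eta>" by auto
  moreover have "norm (Mt (l k) w) < \<eta>"
  proof (rule ccontr)
   assume "\<not> ?thesis"
   then have "w \<in> ?B3" using wM le[OF k(1)] by (intro CollectI conjI exI[of _ "l k"]) auto
   then show False using nw by blast
  qed
  ultimately show False using defect_le[OF k(1), of w] k(2) by linarith
 qed
 then have "prob ?Df \<le> prob (?B1 \<union> (?B2 \<union> ?B3))"
  by (rule finite_measure_mono[OF _ sets.Un[OF m1 sets.Un[OF m2 m3]]])
 also have "\<dots> \<le> 3 * e1"
  using measure_Un_le[OF m1 sets.Un[OF m2 m3]] measure_Un_le[OF m2 m3] p1 p2 p3 by linarith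
 finally have pD: "prob ?Df \<le> 3 * e1" .
 have \<eta>3: "0 < 3 * \<eta>" using \<eta> by simp
 have m6: "?B6 \<in> sets M" by (rule Euler_scheme_near_blocks(1)[OF \<eta>3 a n1])
 have p6: "prob ?B6 \<le> 4 * e1"
  using Euler_scheme_near_blocks(2)[OF \<eta>3 a n1] pD e1(7) by linarith
 define Bad where "Bad = ?B3 \<union> (?B4 \<union> (?B5 \<union> ?B6))"
 have Bm: "Bad \<in> sets M" unfolding Bad_def by (intro sets.Un m3 m4 m5 m6)
 have "prob Bad \<le> e1 + (e1 + (e1 + 4 * e1))"
  unfolding Bad_def
  by (intro order_trans[OF measure_Un_le[OF m3 sets.Un[OF m4 sets.Un[OF m5 m6]]]] add_mono p3
    order_trans[OF measure_Un_le[OF m4 sets.Un[OF m5 m6]]] p4 order_trans[OF measure_Un_le[OF m5 m6]] p5 p6)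
 then have pB: "prob Bad \<le> 9 * e1" using e1(1) by linarith
 have "norm (X n i w - Eul n K w k) \<le> (a + 3 * \<eta>) + (2 * c * \<theta> * (norm y\<^sub>0 + R) + 2 * \<eta> + real CARD('d) * (a' * (\<Gamma> * (c * (norm y\<^sub>0 + R)))))"
  if w: "w \<in> space M - Bad" and k: "k \<le> K" and i: "l k \<le> i" "i \<le> l (if k < K then Suc k else k)" for w k i
 proof -
  have wM: "w \<in> space M" and nB: "w \<notin> Bad" using w by auto
  have 1: "norm (X n (l k) w - Eul n K w k) \<le> a + 3 * \<eta>"
  proof (rule ccontr)
   assume "\<not> ?thesis"
   then have "w \<in> ?B6" using wM k by (intro CollectI conjI exI[of _ k]) auto
   then show False using nB unfolding Bad_def by blast
  qed
  have 2: "norm (X n i w - X n (l k) w) \<le> 2 * c * \<theta> * (norm y\<^sub>0 + R) + 2 * \<eta> + real CARD('d) * (a' * (\<Gamma> * (c * (norm y\<^sub>0 + R))))"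
  proof (cases "k < K")
   case True
   show ?thesis
   proof (rule block_oscillation[OF _ _ _ True i(1)])
    show "norm (Mt r w) \<le> \<eta>" if "r \<le> l K" for r
    proof (rule ccontr)
     assume "\<not> ?thesis"
     then have "w \<in> ?B3" using wM that by (intro CollectI conjI exI[of _ r]) auto
     then show False using nB unfolding Bad_def by blast
    qed
    show "norm (X n r w) \<le> norm y\<^sub>0 + R" if "r \<le> l K" for r
    proof (rule ccontr)
     assume "\<not> ?thesis"
     then have "w \<in> ?B4" using wM that by (intro CollectI conjI exI[of _ r]) auto
     then show False using nB unfolding Bad_def by blast
    qed
    show "\<bar>bpart k j r w\<bar> \<le> a'" if "r \<le> l (Suc k) - l k" for r j
    proof (rule ccontr)
     assume "\<not> ?thesis"
     then have "w \<in> {w \<in> space M. \<exists>i\<le>l (Suc (fst (k, j))) - l (fst (k, j)). a' \<le> \<bar>bpart (fst (k, j)) (snd (k, j)) i w\<bar>}"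
      using wM that by (intro CollectI conjI exI[of _ r]) auto
     then have "w \<in> ?B5" using True by (intro UN_I[of "(k, j)"]) auto
     then show False using nB unfolding Bad_def by blast
    qed
   qed (use True i R a' in auto)
  next
   case False
   then have "i = l k" using i by simp
   moreover have "0 \<le> 2 * c * \<theta> * (norm y\<^sub>0 + R) + 2 * \<eta> + real CARD('d) * (a' * (\<Gamma> * (c * (norm y\<^sub>0 + R))))"
    using c0 \<theta>0 R \<eta> a' \<Gamma>(1) by (intro add_nonneg_nonneg mult_nonneg_nonneg) auto
   ultimately show ?thesis by simp
  qed
  have "norm (X n i w - Eul n K w k) \<le> norm (X n (l k) w - Eul n K w k) + norm (X n i w - X n (l k) w)"
   using norm_triangle_ineq[of "X n (l k) w - Eul n K w k" "X n i w - X n (l k) w"] by simp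
  then show ?thesis using 1 2 by linarith
 qed
 then show ?thesis using Bm pB unfolding close_to_Euler_def by blast
qed

end

context discrete_evolution begin

text \<open>
 The parameters are chosen in the order \<open>\<eta>\<close> (size of the defect), \<open>R\<close> (maximum of \<open>X\<close>), \<open>a'\<close> (noise inside
 a block), \<open>\<delta>\<close> (variation of \<open>\<gamma>\<close>), then the bound \<open>\<theta>\<^sub>1\<close> for the block length, hence \<open>K\<close>, and finally \<open>n\<close>.
\<close>

theorem discrete_Euler_scheme:
 assumes a: "0 < a" and e: "0 < e"
 shows "\<exists>K0\<ge>1. \<forall>K\<ge>K0. \<exists>n0. \<forall>n\<ge>n0. \<exists>Bad\<in>sets M. prob Bad \<le> e \<and>
  (\<forall>w\<in>space M - Bad. close_to_Euler n K a w)"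
proof -
 let ?d = "real CARD('d)"
 (* Seven error terms of at most e1 each will be added up; nine leave some room. *)
 define e1 where "e1 = e / 9"
 have e1: "0 < e1" using e by (simp add: e1_def)
 define s where "s = stab_const (c * \<Gamma>) (2 * \<upsilon>^2) T ?d"
 have s: "0 \<le> s" unfolding s_def stab_const_def growth_const_def step_const_def
  using T by (intro mult_nonneg_nonneg add_nonneg_nonneg) auto
 have C30: "0 \<le> C3" by (rule order_trans[OF integral_nonneg_AE b3(2)[of 0]]) auto
 have ex_small: "\<exists>x>0. P x" if "\<forall>\<^sub>F x in at_right (0::real). P x" for P
 proof -
  have "\<forall>\<^sub>F x in at_right (0::real). P x \<and> 0 < x" using that eventually_at_right_less by (rule eventually_conj)
  then show ?thesis using eventually_happens'[OF trivial_limit_at_right_real] by blast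
 qed
 have "((\<lambda>\<eta>. 5 * \<eta>) \<longlongrightarrow> 5 * 0) (at_right (0::real))" and lim\<eta>: "((\<lambda>\<eta>. s * (3 * \<eta>)^2 / (a / 4)^2) \<longlongrightarrow> s * (3 * 0)^2 / (a / 4)^2) (at_right (0::real))"
  using a by (intro tendsto_intros; simp)+
 then have "\<forall>\<^sub>F \<eta> in at_right (0::real). 5 * \<eta> < a / 4" using a by (intro order_tendstoD(2)) auto
 moreover have "\<forall>\<^sub>F \<eta> in at_right (0::real). s * (3 * \<eta>)^2 / (a / 4)^2 < e1"
  by (rule order_tendstoD(2)[OF lim\<eta>]) (use e1 in simp)
 ultimately have "\<forall>\<^sub>F \<eta> in at_right (0::real). 5 * \<eta> < a / 4 \<and> s * (3 * \<eta>)^2 / (a / 4)^2 < e1"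
  by (rule eventually_conj)
 then obtain \<eta> where \<eta>: "0 < \<eta>" "5 * \<eta> < a / 4" "s * (3 * \<eta>)^2 / (a / 4)^2 < e1"
  using ex_small by blast
 define R where "R = sqrt ((Cm + 1) / e1)"
 have Cm0: "0 \<le> Cm" using CQ0 by (simp add: Cm_def)
 have R: "0 < R" "Cm / R^2 \<le> e1"
 proof -
  have p: "0 < (Cm + 1) / e1" using Cm0 e1 by simp
  then show "0 < R" by (simp add: R_def)
  have "R^2 = (Cm + 1) / e1" using p by (simp add: R_def)
  then have "Cm / R^2 = e1 * (Cm / (Cm + 1))" by simp
  also have "\<dots> \<le> e1 * 1" using Cm0 e1 by (intro mult_left_mono) auto
  finally show "Cm / R^2 \<le> e1" by simp
 qed
 let ?R = "norm y\<^sub>0 + R"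
 have "((\<lambda>x. ?d * (x * (\<Gamma> * (c * ?R)))) \<longlongrightarrow> ?d * (0 * (\<Gamma> * (c * ?R)))) (at_right (0::real))" by (intro tendsto_intros)
 then have "\<forall>\<^sub>F x in at_right (0::real). ?d * (x * (\<Gamma> * (c * ?R))) < a / 4"
  by (rule order_tendstoD(2)) (use a in simp)
 then obtain a' where a': "0 < a'" "?d * (a' * (\<Gamma> * (c * ?R))) < a / 4" using ex_small by blast
 have "((\<lambda>x. 2 * \<nu>^2 * (x^2 * CQ) / \<eta>^2) \<longlongrightarrow> 2 * \<nu>^2 * (0^2 * CQ) / \<eta>^2) (at_right (0::real))" using \<eta> by (intro tendsto_intros) simp
 then have "\<forall>\<^sub>F x in at_right (0::real). 2 * \<nu>^2 * (x^2 * CQ) / \<eta>^2 < e1 / 2"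
  by (rule order_tendstoD(2)) (use e1 in simp)
 then obtain \<delta> where \<delta>: "0 < \<delta>" "2 * \<nu>^2 * (\<delta>^2 * CQ) / \<eta>^2 < e1 / 2" using ex_small by blast
 have "uniformly_continuous_on {0..T} \<gamma>"
  using T by (intro compact_uniformly_continuous continuous_on_subset[OF \<gamma>]) auto
 then obtain \<tau> where \<tau>: "\<tau> > 0" "\<And>s t. s \<in> {0..T} ==> t \<in> {0..T} ==> dist s t < \<tau> ==> dist (\<gamma> s) (\<gamma> t) < \<delta>"
  using \<delta> unfolding uniformly_continuous_on_def by metis
 define good where "good x \<longleftrightarrow> x < \<tau> \<and> 4 * c^2 * Cd * x / \<eta>^2 < e1 \<and> 2 * \<nu>^2 * (\<Gamma>^2 * Cd * x) / \<eta>^2 < e1 / 2 \<and>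
  2 * c * x * ?R < a / 4 \<and> 2 * T * (?d * (\<upsilon>^3 * (3 * sqrt x) / a'^3)) < e1 / 2" for x
 have "\<forall>\<^sub>F x in at_right (0::real). good x"
 proof -
  have "((\<lambda>x. x) \<longlongrightarrow> 0) (at_right (0::real))" "((\<lambda>x. 4 * c^2 * Cd * x / \<eta>^2) \<longlongrightarrow> 4 * c^2 * Cd * 0 / \<eta>^2) (at_right (0::real))"
   "((\<lambda>x. 2 * \<nu>^2 * (\<Gamma>^2 * Cd * x) / \<eta>^2) \<longlongrightarrow> 2 * \<nu>^2 * (\<Gamma>^2 * Cd * 0) / \<eta>^2) (at_right (0::real))"
   "((\<lambda>x. 2 * c * x * ?R) \<longlongrightarrow> 2 * c * 0 * ?R) (at_right (0::real))"
   "((\<lambda>x. 2 * T * (?d * (\<upsilon>^3 * (3 * sqrt x) / a'^3))) \<longlongrightarrow> 2 * T * (?d * (\<upsilon>^3 * (3 * sqrt 0) / a'^3))) (at_right (0::real))"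
   using \<eta> a' by (intro tendsto_intros; simp)+
  note lim = this[THEN order_tendstoD(2)]
  show ?thesis unfolding good_def
   by (intro eventually_conj lim) (use \<tau>(1) e1 a in simp_all)
 qed
 then obtain \<theta>\<^sub>1 where \<theta>\<^sub>1: "0 < \<theta>\<^sub>1" "\<And>x. 0 < x ==> x < \<theta>\<^sub>1 ==> good x"
  unfolding eventually_at_right_field by auto
 obtain K0 :: nat where K0: "2 * T / \<theta>\<^sub>1 < real K0" using reals_Archimedean2 by blast
 have "\<exists>n0. \<forall>n\<ge>n0. \<exists>Bad\<in>sets M. prob Bad \<le> e \<and>
  (\<forall>w\<in>space M - Bad. close_to_Euler n K a w)" if K: "K \<ge> max 1 K0" for K
 proof -
  have K1: "0 < K" using K by simp
  let ?h = "mesh T K"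
  have h: "0 < ?h" "real K * ?h = T" using K1 T by (auto simp: mesh_def)
  have h\<theta>: "2 * ?h < \<theta>\<^sub>1"
  proof -
   have "2 * T / \<theta>\<^sub>1 < real K" using K0 K by simp
   then have "2 * T < real K * \<theta>\<^sub>1" using \<theta>\<^sub>1 by (simp add: divide_less_eq)
   then show ?thesis using K1 by (simp add: mesh_def divide_less_eq mult.commute)
  qed
  have "(\<lambda>n. 1 / real n) \<longlonglongrightarrow> 0" by (rule lim_1_over_n)
  then have lims: "(\<lambda>n. 4 * c^2 * (real K)^2 * CQ * (1 / real n)^2 / \<eta>^2) \<longlonglongrightarrow> 4 * c^2 * (real K)^2 * CQ * 0^2 / \<eta>^2"
   "(\<lambda>n. 2 * T * (?d * (\<upsilon>^3 * (C3 * sqrt (1 / real n)) / a'^3))) \<longlonglongrightarrow> 2 * T * (?d * (\<upsilon>^3 * (C3 * sqrt 0) / a'^3))"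
   "(\<lambda>n. 1 / real n) \<longlonglongrightarrow> 0"
   using \<eta> a' by (intro tendsto_intros; simp)+
  have "\<forall>\<^sub>F n in sequentially. 4 * c^2 * (real K)^2 * CQ * (1 / real n)^2 / \<eta>^2 < e1 \<and>
    2 * T * (?d * (\<upsilon>^3 * (C3 * sqrt (1 / real n)) / a'^3)) < e1 / 2 \<and> 1 / real n < ?h \<and> 0 < n"
   by (intro eventually_conj eventually_gt_at_top lims[THEN order_tendstoD(2)]) (use e1 h in simp_all)
  then obtain n0 where n0: "\<And>n. n \<ge> n0 ==> 4 * c^2 * (real K)^2 * CQ * (1 / real n)^2 / \<eta>^2 < e1 \<and>
    2 * T * (?d * (\<upsilon>^3 * (C3 * sqrt (1 / real n)) / a'^3)) < e1 / 2 \<and> 1 / real n < ?h \<and> 0 < n"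
   unfolding eventually_sequentially by blast
  have "\<exists>Bad\<in>sets M. prob Bad \<le> e \<and>
   (\<forall>w\<in>space M - Bad. close_to_Euler n K a w)" if n: "n \<ge> n0" for n
  proof -
   note nn = n0[OF n]
   interpret blocks "cell T K n" using T by (intro blocks_cell) simp
   interpret discrete_grid M F b C3 A Os C u \<gamma> y\<^sub>0 c \<upsilon> \<Gamma> T K n
    by unfold_locales (use K1 nn in auto)
   have \<theta>h: "\<theta> < 2 * ?h" using nn by (simp add: \<theta>_def)
   then have g: "good \<theta>" using h\<theta> \<theta>0 by (intro \<theta>\<^sub>1(2)) simp_all
   have K\<theta>: "real K * \<theta> \<le> 2 * T"
   proof -
    have "real K * \<theta> \<le> real K * (2 * ?h)" using \<theta>h by (intro mult_left_mono) auto
    then show ?thesis using h(2) by simp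
   qed
   have b1: "4 * c^2 * Cd * \<theta> / \<eta>^2 \<le> e1" using g by (simp add: good_def)
   have b2: "(4 * c^2 * (real K)^2 * CQ / (real n)^2) / \<eta>^2 \<le> e1" using nn by (simp add: power_divide)
   have b3': "2 * \<nu>^2 * (\<Gamma>^2 * Cd * \<theta> + \<delta>^2 * CQ) / \<eta>^2 \<le> e1"
   proof -
    have "2 * \<nu>^2 * (\<Gamma>^2 * Cd * \<theta> + \<delta>^2 * CQ) / \<eta>^2 = 2 * \<nu>^2 * (\<Gamma>^2 * Cd * \<theta>) / \<eta>^2 + 2 * \<nu>^2 * (\<delta>^2 * CQ) / \<eta>^2"
     by (simp add: distrib_left add_divide_distrib)
    then show ?thesis using g \<delta>(2) unfolding good_def by linarith
   qed
   have b4: "real K * (?d * (\<upsilon>^3 * (\<theta> * (3 * sqrt \<theta> + C3 / sqrt (real n))) / a'^3)) \<le> e1"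
   proof -
    let ?z = "?d * (\<upsilon>^3 * (3 * sqrt \<theta> + C3 / sqrt (real n)) / a'^3)"
    have "0 \<le> ?z" using \<upsilon>0 a' C30 \<theta>0
     by (intro mult_nonneg_nonneg divide_nonneg_nonneg add_nonneg_nonneg) auto
    then have "(real K * \<theta>) * ?z \<le> (2 * T) * ?z" using K\<theta> by (intro mult_right_mono)
    also have "\<dots> = 2 * T * (?d * (\<upsilon>^3 * (3 * sqrt \<theta>) / a'^3)) + 2 * T * (?d * (\<upsilon>^3 * (C3 * sqrt (1 / real n)) / a'^3))"
     by (simp add: real_sqrt_divide distrib_left add_divide_distrib)
    also have "\<dots> \<le> e1" using g nn unfolding good_def by linarith
    finally show ?thesis by (simp add: mult_ac)
   qed
   have mod: "\<bar>\<gamma> s - \<gamma> t\<bar> \<le> \<delta>" if "s \<in> {0..T}" "t \<in> {0..T}" "\<bar>s - t\<bar> \<le> \<theta>" for s t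
    using \<tau>(2)[OF that(1,2)] that(3) g unfolding good_def by (simp add: dist_real_def)
   have n1: "1 / real n \<le> ?h" using nn by simp
   have a4: "0 < a / 4" using a by simp
   have e10: "0 \<le> e1" using e1 by simp
   have \<delta>0: "0 \<le> \<delta>" using \<delta> by simp
   have st: "stab_const (c * \<Gamma>) (2 * \<upsilon>^2) T ?d * (3 * \<eta>)^2 / (a / 4)^2 \<le> e1" using \<eta>(3) by (simp only: s_def less_imp_le)
   have tot: "(a / 4 + 3 * \<eta>) + (2 * c * \<theta> * ?R + 2 * \<eta> + ?d * (a' * (\<Gamma> * (c * ?R)))) \<le> a"
    using \<eta>(2) a'(2) g unfolding good_def by linarith
   obtain Bad where Bad: "Bad \<in> sets M" "prob Bad \<le> 9 * e1"
    "\<And>w. w \<in> space M - Bad ==> close_to_Euler n K ((a / 4 + 3 * \<eta>) + (2 * c * \<theta> * ?R + 2 * \<eta> + ?d * (a' * (\<Gamma> * (c * ?R))))) w"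
    using discrete_near_Euler[OF \<eta>(1) a4 R(1) a'(1) n1 \<delta>0 mod e10 b1 b2 b3' R(2) b4 st] by blast
   have "prob Bad \<le> e" using Bad(2) by (simp add: e1_def)
   moreover have "close_to_Euler n K a w" if "w \<in> space M - Bad" for w
    using Bad(3)[OF that] tot unfolding close_to_Euler_def by (meson order_trans)
   ultimately show ?thesis using Bad(1) by blast
  qed
  then show ?thesis by blast
 qed
 then show ?thesis by (intro exI[of _ "max 1 K0"]) auto
qed

end

section \<open>Characteristic functions\<close>

lemma borel_measurable_vec_nth:
 fixes f :: "'a => real^'d"
 shows "f \<in> borel_measurable M ==> (\<lambda>w. f w $ j) \<in> borel_measurable M"
 by (erule measurable_compose) (intro borel_measurable_continuous_onI continuous_intros)

lemma (in prob_space) integrable_iexp: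
 "f \<in> borel_measurable M ==> integrable M (\<lambda>w. iexp (f w))"
 by (rule integrable_const_bound[where B=1]) auto

lemma (in prob_space) norm_expectation_iexp_le: "norm (\<integral>w. iexp (f w) \<partial>M) \<le> 1"
proof (cases "integrable M (\<lambda>w. iexp (f w))")
 case True
 have "norm (\<integral>w. iexp (f w) \<partial>M) \<le> (\<integral>w. norm (iexp (f w)) \<partial>M)" by (rule integral_norm_bound)
 also have "\<dots> = 1" by (simp add: prob_space)
 finally show ?thesis .
next
 case False
 then show ?thesis by (simp add: not_integrable_integral_eq)
qed

lemma exp_uminus_approx:
 assumes "0 \<le> (x::real)" shows "\<bar>exp (- x) - (1 - x)\<bar> \<le> x^2 / 2"
proof -
 have "exp (- x) \<le> 1 - x + x^2 / 2"
 proof -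
  have d: "\<And>y. ((\<lambda>y. 1 - y + y^2 / 2 - exp (- y)) has_real_derivative (- 1 + y + exp (- y))) (at y)"
   by (auto intro!: derivative_eq_intros simp: power2_eq_square)
  have "(1 - 0 + 0^2 / 2 - exp (- 0)) \<le> (1 - x + x^2 / 2 - exp (- x))"
  proof (rule DERIV_nonneg_imp_nondecreasing[OF assms])
   fix y :: real assume "0 \<le> y" "y \<le> x"
   have "0 \<le> - 1 + y + exp (- y)" using exp_ge_add_one_self[of "- y"] by simp
   then show "\<exists>z. ((\<lambda>y. 1 - y + y^2 / 2 - exp (- y)) has_real_derivative z) (at y) \<and> 0 \<le> z" using d by blast
  qed
  then show ?thesis by simp
 qed
 moreover have "1 - x \<le> exp (- x)" using exp_ge_add_one_self[of "- x"] by simp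
 ultimately show ?thesis by (simp add: abs_le_iff)
qed

text \<open>
 Taylor expansion of the exponential to second order, both for \<open>X\<close> and for the Gaussian value.
\<close>

lemma (in prob_space) expectation_iexp_approx:
 assumes X: "X \<in> borel_measurable M" "expectation X = 0" "integrable M (\<lambda>w. (X w)^2)" "expectation (\<lambda>w. (X w)^2) = 1"
  and X3: "integrable M (\<lambda>w. \<bar>X w\<bar>^3)" "expectation (\<lambda>w. \<bar>X w\<bar>^3) \<le> C3"
 shows "norm ((\<integral>w. iexp (X w * a) \<partial>M) - of_real (exp (- (a^2) / 2))) \<le> C3 * \<bar>a\<bar>^3 / 6 + a^4 / 8"
proof -
 have iX: "integrable M X" using square_integrable_imp_integrable[OF X(1,3)] .
 define f where "f w = 1 + \<i> * of_real (X w * a) - of_real ((X w)^2 * a^2 / 2)" for w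
 have t: "norm (iexp (X w * a) - f w) \<le> \<bar>X w\<bar>^3 * (\<bar>a\<bar>^3 / 6)" for w
  using iexp_approx1[of "X w * a" 2]
  by (simp add: f_def eval_nat_numeral power_mult_distrib abs_mult field_simps)
 have if1: "integrable M (\<lambda>w. of_real (X w * a) :: complex)" using iX by (intro integrable_of_real integrable_mult_left)
 have if2: "integrable M (\<lambda>w. of_real ((X w)^2 * a^2 / 2) :: complex)" using X(3) by (intro integrable_of_real integrable_divide_zero integrable_mult_left)
 have fi: "integrable M f" unfolding f_def using if1 if2 by (intro Bochner_Integration.integrable_diff Bochner_Integration.integrable_add integrable_mult_right) auto
 have "integral\<^sup>L M f = 1 + \<i> * (\<integral>w. of_real (X w * a) \<partial>M) - (\<integral>w. of_real ((X w)^2 * a^2 / 2) \<partial>M)"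
  unfolding f_def using if1 if2 by (simp add: prob_space del: of_real_mult of_real_divide of_real_power)
 also have "(\<integral>w. complex_of_real (X w * a) \<partial>M) = 0" using X(2) by (simp del: of_real_mult)
 also have "(\<integral>w. complex_of_real ((X w)^2 * a^2 / 2) \<partial>M) = of_real (a^2 / 2)"
  unfolding integral_complex_of_real using X(4) by simp
 finally have If: "integral\<^sup>L M f = of_real (1 - a^2 / 2)" by simp
 have ie: "integrable M (\<lambda>w. iexp (X w * a))" using X(1) by (intro integrable_iexp) auto
 have "norm ((\<integral>w. iexp (X w * a) \<partial>M) - integral\<^sup>L M f) = norm (\<integral>w. iexp (X w * a) - f w \<partial>M)"
  using ie fi by simp
 also have "\<dots> \<le> (\<integral>w. norm (iexp (X w * a) - f w) \<partial>M)" by (rule integral_norm_bound)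
 also have "\<dots> \<le> (\<integral>w. \<bar>X w\<bar>^3 * (\<bar>a\<bar>^3 / 6) \<partial>M)"
  using ie fi X3(1) t by (intro integral_mono integrable_norm Bochner_Integration.integrable_diff integrable_mult_left) auto
 also have "\<dots> \<le> C3 * (\<bar>a\<bar>^3 / 6)" using X3(2) by (simp add: mult_right_mono)
 finally have 1: "norm ((\<integral>w. iexp (X w * a) \<partial>M) - of_real (1 - a^2 / 2)) \<le> C3 * \<bar>a\<bar>^3 / 6" using If by simp
 have "\<bar>exp (- (a^2 / 2)) - (1 - a^2 / 2)\<bar> \<le> (a^2 / 2)^2 / 2" by (rule exp_uminus_approx) simp
 also have "\<dots> = a^4 / 8" by (simp add: power_divide)
 finally have "norm (of_real (1 - a^2 / 2) - complex_of_real (exp (- (a^2) / 2))) \<le> a^4 / 8"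
  by (simp add: abs_minus_commute flip: of_real_diff)
 then show ?thesis by (rule norm_diff_triangle_le[OF 1])
qed

text \<open>
 Both sides are products over \<open>I\<close> of numbers of modulus at most \<open>1\<close>, so the errors of the factors add up.
\<close>

lemma (in prob_space) expectation_iexp_sum_approx:
 fixes b :: "'i => 'a => real"
 assumes I: "finite I" and ind: "indep_vars (\<lambda>_. borel) b I"
  and b: "\<And>i. i \<in> I ==> expectation (b i) = 0" "\<And>i. i \<in> I ==> integrable M (\<lambda>w. (b i w)^2)" "\<And>i. i \<in> I ==> expectation (\<lambda>w. (b i w)^2) = 1"
   "\<And>i. i \<in> I ==> integrable M (\<lambda>w. \<bar>b i w\<bar>^3)" "\<And>i. i \<in> I ==> expectation (\<lambda>w. \<bar>b i w\<bar>^3) \<le> C3"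
  and a: "\<And>i. i \<in> I ==> \<bar>a i\<bar> \<le> \<alpha>" and C3: "0 \<le> C3"
 shows "norm ((\<integral>w. iexp (\<Sum>i\<in>I. b i w * a i) \<partial>M) - of_real (exp (- (\<Sum>i\<in>I. (a i)^2) / 2))) \<le> real (card I) * (C3 * \<alpha>^3 / 6 + \<alpha>^4 / 8)"
proof -
 have bm: "b i \<in> borel_measurable M" if "i \<in> I" for i using ind that by (auto simp: indep_vars_def)
 have "(\<integral>w. iexp (\<Sum>i\<in>I. b i w * a i) \<partial>M) = (\<integral>w. (\<Prod>i\<in>I. iexp (b i w * a i)) \<partial>M)"
  using I by (intro Bochner_Integration.integral_cong refl) (simp add: exp_sum sum_distrib_left)
 also have "\<dots> = (\<Prod>i\<in>I. \<integral>w. iexp (b i w * a i) \<partial>M)"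
 proof (rule indep_vars_lebesgue_integral[OF I])
  show "indep_vars (\<lambda>_. borel) (\<lambda>i w. iexp (b i w * a i)) I"
   by (rule indep_vars_compose2[OF ind]) simp
  show "integrable M (\<lambda>w. iexp (b i w * a i))" if "i \<in> I" for i using bm[OF that] by (intro integrable_iexp) auto
 qed
 finally have 1: "(\<integral>w. iexp (\<Sum>i\<in>I. b i w * a i) \<partial>M) = (\<Prod>i\<in>I. \<integral>w. iexp (b i w * a i) \<partial>M)" .
 have 2: "of_real (exp (- (\<Sum>i\<in>I. (a i)^2) / 2)) = (\<Prod>i\<in>I. complex_of_real (exp (- ((a i)^2) / 2)))"
  using I by (simp add: exp_sum sum_negf[symmetric] sum_divide_distrib flip: of_real_prod)
 have "norm ((\<Prod>i\<in>I. \<integral>w. iexp (b i w * a i) \<partial>M) - (\<Prod>i\<in>I. complex_of_real (exp (- ((a i)^2) / 2))))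
   \<le> (\<Sum>i\<in>I. norm ((\<integral>w. iexp (b i w * a i) \<partial>M) - complex_of_real (exp (- ((a i)^2) / 2))))"
  by (rule norm_prod_diff) (auto simp only: norm_expectation_iexp_le norm_of_real abs_exp_cancel exp_le_one_iff, simp)
 also have "\<dots> \<le> (\<Sum>i\<in>I. C3 * \<alpha>^3 / 6 + \<alpha>^4 / 8)"
 proof (rule sum_mono)
  fix i assume i: "i \<in> I"
  have "\<bar>a i\<bar>^3 \<le> \<alpha>^3" "\<bar>a i\<bar>^4 \<le> \<alpha>^4" using a[OF i] by (intro power_mono; simp)+
  then have "C3 * \<bar>a i\<bar>^3 / 6 + (a i)^4 / 8 \<le> C3 * \<alpha>^3 / 6 + \<alpha>^4 / 8"
   using C3 by (intro add_mono divide_right_mono mult_left_mono) auto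
  then show "norm ((\<integral>w. iexp (b i w * a i) \<partial>M) - complex_of_real (exp (- ((a i)^2) / 2))) \<le> C3 * \<alpha>^3 / 6 + \<alpha>^4 / 8"
   using expectation_iexp_approx[OF bm[OF i] b(1-5)[OF i], of "a i"] by linarith
 qed
 finally show ?thesis unfolding 1 2 by simp
qed

lemma (in prob_space) expectation_iexp_normal:
 assumes X: "distributed M lborel X (normal_density 0 \<sigma>)" and \<sigma>: "0 < \<sigma>"
 shows "(\<integral>w. iexp (X w * a) \<partial>M) = of_real (exp (- (\<sigma>^2 * a^2) / 2))"
proof -
 have D: "distributed M lborel (\<lambda>w. X w / \<sigma>) std_normal_density"
  using X normal_standard_normal_convert[OF \<sigma>, of X 0] by simp
 then have m: "(\<lambda>w. X w / \<sigma>) \<in> borel_measurable M" by (simp add: distributed_def)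
 have "of_real (exp (- ((\<sigma> * a)^2) / 2)) = char std_normal_distribution (\<sigma> * a)" by (simp add: char_std_normal_distribution)
 also have "std_normal_distribution = distr M lborel (\<lambda>w. X w / \<sigma>)" using distributed_distr_eq_density[OF D] by simp
 also have "char \<dots> (\<sigma> * a) = (\<integral>w. iexp (\<sigma> * a * (X w / \<sigma>)) \<partial>M)"
  unfolding char_def using m by (subst integral_distr) auto
 also have "\<dots> = (\<integral>w. iexp (X w * a) \<partial>M)" using \<sigma> by (simp add: mult_ac)
 finally show ?thesis by (simp add: power_mult_distrib)
qed

context brownian_motion begin

text \<open>
 By induction on the number of increments: the last one is independent of the past, and its coordinates are
 independent of each other.
\<close>

lemma grid_incr_iexp:
 assumes h: "0 < mesh T K"
 shows "expectation (\<lambda>w. iexp (\<Sum>k<N. \<Sum>j\<in>UNIV. \<xi> (k, j) * grid_incr B T K k w $ j))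
  = of_real (exp (- (mesh T K * (\<Sum>k<N. \<Sum>j\<in>UNIV. (\<xi> (k, j))^2)) / 2))"
proof (induction N)
 case 0 show ?case by (simp add: prob_space)
next
 case (Suc N)
 let ?h = "mesh T K"
 let ?s = "real N * ?h" and ?t = "real (Suc N) * ?h"
 have st: "0 \<le> ?s" "?s < ?t" using h by auto
 let ?S = "\<lambda>w. \<Sum>k<N. \<Sum>j\<in>UNIV. \<xi> (k, j) * grid_incr B T K k w $ j"
 let ?D = "\<lambda>w. grid_incr B T K N w"
 let ?d = "\<lambda>x. \<Sum>j\<in>UNIV. \<xi> (N, j) * x $ j"
 have D: "?D = (\<lambda>w. B ?t w - B ?s w)" by (simp add: grid_incr_def fun_eq_iff)
 have Dm: "?D \<in> borel_measurable P" unfolding D by (rule F_measurable_imp[OF increment_measurable[of _ _ ?t]]) (use st in auto)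
 have Sm: "?S \<in> borel_measurable (F ?s)"
 proof (intro borel_measurable_sum borel_measurable_times borel_measurable_const)
  fix k j assume "k \<in> {..<N}"
  then have k: "real (Suc k) * ?h \<le> ?s" using h by (intro mult_right_mono) auto
  have "(\<lambda>w. grid_incr B T K k w) \<in> borel_measurable (F ?s)"
   unfolding grid_incr_def using h by (intro increment_measurable k) (auto intro!: mult_right_mono)
  then show "(\<lambda>w. grid_incr B T K k w $ j) \<in> borel_measurable (F ?s)" by (simp add: borel_measurable_vec_nth)
 qed
 have dD: "(\<lambda>w. ?d (?D w)) \<in> borel_measurable P" using Dm by (intro borel_measurable_sum borel_measurable_times borel_measurable_const) (rule borel_measurable_vec_nth)
 have "{(\<lambda>w. ?d (?D w)) -` A \<inter> space P | A. A \<in> sets borel} \<subseteq> {(\<lambda>w. B ?t w - B ?s w) -` A \<inter> space P | A. A \<in> sets borel}"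
 proof safe
  fix A :: "real set" assume A: "A \<in> sets borel"
  have "?d \<in> borel_measurable borel" by (intro borel_measurable_continuous_onI continuous_intros)
  from measurable_sets[OF this A]
  show "\<exists>A'. (\<lambda>w. ?d (?D w)) -` A \<inter> space P = (\<lambda>w. B ?t w - B ?s w) -` A' \<inter> space P \<and> A' \<in> sets borel"
   unfolding D by (intro exI[of _ "?d -` A"]) auto
 qed
 then have "indep_set (sets (F ?s)) {(\<lambda>w. ?d (?D w)) -` A \<inter> space P | A. A \<in> sets borel}"
  using increment_indep_past[OF st] unfolding indep_sets2_eq by (meson subset_iff)
 then have "indep_var borel ?S borel (\<lambda>w. ?d (?D w))"
  by (rule indep_var_if_indep_set[OF sets_F space_F dD _ Sm])
 from indep_var_compose[OF this, where ?Y1.0=iexp and ?N1.0=borel and ?Y2.0=iexp and ?N2.0=borel]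
 have ind: "indep_var borel (\<lambda>w. iexp (?S w)) borel (\<lambda>w. iexp (?d (?D w)))" by (simp add: comp_def)
 have "expectation (\<lambda>w. iexp (\<Sum>k<Suc N. \<Sum>j\<in>UNIV. \<xi> (k, j) * grid_incr B T K k w $ j)) = expectation (\<lambda>w. iexp (?S w) * iexp (?d (?D w)))"
  by (simp add: exp_add distrib_left)
 also have "\<dots> = expectation (\<lambda>w. iexp (?S w)) * expectation (\<lambda>w. iexp (?d (?D w)))"
  by (rule indep_var_lebesgue_integral[OF ind integrable_iexp[OF F_measurable_imp[OF Sm]] integrable_iexp[OF dD]])
 also have "expectation (\<lambda>w. iexp (?d (?D w))) = expectation (\<lambda>w. \<Prod>j\<in>UNIV. iexp ((?D w $ j) * \<xi> (N, j)))"
  by (intro Bochner_Integration.integral_cong refl) (simp add: exp_sum sum_distrib_left mult.commute)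
 also have "\<dots> = (\<Prod>j\<in>UNIV. expectation (\<lambda>w. iexp ((?D w $ j) * \<xi> (N, j))))"
 proof (rule indep_vars_lebesgue_integral)
  have "indep_vars (\<lambda>_. borel) (\<lambda>j w. ?D w $ j) UNIV" using increment_indep_components[OF st] by (simp only: D)
  then show "indep_vars (\<lambda>_. borel) (\<lambda>j w. iexp ((?D w $ j) * \<xi> (N, j))) UNIV"
   by (rule indep_vars_compose2) simp
  show "integrable P (\<lambda>w. iexp ((?D w $ j) * \<xi> (N, j)))" for j
   using Dm by (intro integrable_iexp borel_measurable_times borel_measurable_const) (simp add: borel_measurable_vec_nth)
 qed simp
 also have "\<dots> = (\<Prod>j\<in>UNIV. of_real (exp (- (?h * (\<xi> (N, j))^2) / 2)))"
 proof (rule prod.cong[OF refl])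
  fix j
  have "distributed P lborel (\<lambda>w. ?D w $ j) (normal_density 0 (sqrt ?h))"
   using increment_normal[OF st, of j] by (simp add: D algebra_simps)
  from expectation_iexp_normal[OF this, of "\<xi> (N, j)"] h
  show "expectation (\<lambda>w. iexp ((?D w $ j) * \<xi> (N, j))) = of_real (exp (- (?h * (\<xi> (N, j))^2) / 2))" by simp
 qed
 also have "\<dots> = of_real (exp (- (?h * (\<Sum>j\<in>UNIV. (\<xi> (N, j))^2)) / 2))"
  by (simp add: exp_sum sum_negf[symmetric] sum_divide_distrib sum_distrib_left flip: of_real_prod)
 finally show ?case unfolding Suc.IH
  by (simp add: exp_add[symmetric] distrib_left add_divide_distrib flip: of_real_mult)
qed

end

section \<open>Convergence of expectations from characteristic functions\<close>

definition phase :: "'k set => ('k => real) => ('k => real) => real" where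
 "phase I \<xi> x = (\<Sum>k\<in>I. \<xi> k * x k)"

text \<open>
 Real trigonometric polynomials in the coordinates of \<open>I\<close>, with arbitrary real frequencies. The product formulas for sine and cosine
 make them an algebra.
\<close>

inductive_set trig_polys :: "'k set => (('k => real) => real) set" for I where
 cos: "(\<lambda>x. cos (phase I \<xi> x)) \<in> trig_polys I"
| sin: "(\<lambda>x. sin (phase I \<xi> x)) \<in> trig_polys I"
| add: "p \<in> trig_polys I ==> q \<in> trig_polys I ==> (\<lambda>x. p x + q x) \<in> trig_polys I"
| scale: "p \<in> trig_polys I ==> (\<lambda>x. c * p x) \<in> trig_polys I"

lemma phase_add: "phase I (\<lambda>k. \<xi> k + \<eta> k) x = phase I \<xi> x + phase I \<eta> x"
 by (simp add: phase_def sum.distrib algebra_simps)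

lemma phase_diff: "phase I (\<lambda>k. \<xi> k - \<eta> k) x = phase I \<xi> x - phase I \<eta> x"
 by (simp add: phase_def sum_subtractf algebra_simps)

lemma trig_polys_cos_mult:
 "q \<in> trig_polys I ==> (\<lambda>x. cos (phase I \<xi> x) * q x) \<in> trig_polys I"
proof (induction rule: trig_polys.induct)
 case (cos \<eta>)
 have "(\<lambda>x. cos (phase I \<xi> x) * cos (phase I \<eta> x)) =
  (\<lambda>x. 1/2 * (cos (phase I (\<lambda>k. \<xi> k - \<eta> k) x) + cos (phase I (\<lambda>k. \<xi> k + \<eta> k) x)))"
  by (simp add: phase_add phase_diff cos_times_cos)
 then show ?case by (simp only:) (intro trig_polys.intros)
next
 case (sin \<eta>)
 have "(\<lambda>x. cos (phase I \<xi> x) * sin (phase I \<eta> x)) =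
  (\<lambda>x. 1/2 * (sin (phase I (\<lambda>k. \<xi> k + \<eta> k) x) + (-1) * sin (phase I (\<lambda>k. \<xi> k - \<eta> k) x)))"
  by (simp add: phase_add phase_diff cos_times_sin)
 then show ?case by (simp only:) (intro trig_polys.intros)
next
 case (add p q)
 then show ?case by (simp only: distrib_left) (intro trig_polys.intros)
next
 case (scale p c)
 then show ?case by (simp only: mult.left_commute[of "cos _" c]) (intro trig_polys.intros)
qed

lemma trig_polys_sin_mult:
 "q \<in> trig_polys I ==> (\<lambda>x. sin (phase I \<xi> x) * q x) \<in> trig_polys I"
proof (induction rule: trig_polys.induct)
 case (cos \<eta>)
 have "(\<lambda>x. sin (phase I \<xi> x) * cos (phase I \<eta> x)) =
  (\<lambda>x. 1/2 * (sin (phase I (\<lambda>k. \<xi> k + \<eta> k) x) + sin (phase I (\<lambda>k. \<xi> k - \<eta> k) x)))"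
  by (simp add: phase_add phase_diff sin_times_cos)
 then show ?case by (simp only:) (intro trig_polys.intros)
next
 case (sin \<eta>)
 have "(\<lambda>x. sin (phase I \<xi> x) * sin (phase I \<eta> x)) =
  (\<lambda>x. 1/2 * (cos (phase I (\<lambda>k. \<xi> k - \<eta> k) x) + (-1) * cos (phase I (\<lambda>k. \<xi> k + \<eta> k) x)))"
  by (simp add: phase_add phase_diff sin_times_sin)
 then show ?case by (simp only:) (intro trig_polys.intros)
next
 case (add p q)
 then show ?case by (simp only: distrib_left) (intro trig_polys.intros)
next
 case (scale p c)
 then show ?case by (simp only: mult.left_commute[of "sin _" c]) (intro trig_polys.intros)
qed

lemma trig_polys_mult:
 assumes "p \<in> trig_polys I" and q: "q \<in> trig_polys I"
 shows "(\<lambda>x. p x * q x) \<in> trig_polys I"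
 using assms(1)
proof (induction rule: trig_polys.induct)
 case (add p p')
 then show ?case by (simp only: distrib_right) (intro trig_polys.intros)
next
 case (scale p c)
 then show ?case by (simp only: mult.assoc) (intro trig_polys.intros)
qed (use q in \<open>auto intro: trig_polys_cos_mult trig_polys_sin_mult\<close>)

lemma trig_polys_bounded: "p \<in> trig_polys I ==> \<exists>C. \<forall>x. \<bar>p x\<bar> \<le> C"
proof (induction rule: trig_polys.induct)
 case (add p q)
 then obtain C D where "\<forall>x. \<bar>p x\<bar> \<le> C" "\<forall>x. \<bar>q x\<bar> \<le> D" by blast
 then have "\<forall>x. \<bar>p x + q x\<bar> \<le> C + D" by (meson abs_triangle_ineq add_mono order_trans)
 then show ?case by blast
next
 case (scale p c)
 then obtain C where "\<forall>x. \<bar>p x\<bar> \<le> C" by blast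
 then have "\<forall>x. \<bar>c * p x\<bar> \<le> \<bar>c\<bar> * C" by (simp add: abs_mult mult_left_mono)
 then show ?case by blast
qed (auto intro: exI[of _ 1])

lemma trig_polys_measurable:
 assumes X: "\<And>k. k \<in> I ==> (\<lambda>w. X w k) \<in> borel_measurable M"
 shows "p \<in> trig_polys I ==> (\<lambda>w. p (X w)) \<in> borel_measurable M"
 by (induction rule: trig_polys.induct) (use X in \<open>simp_all add: phase_def\<close>)

lemma trig_polys_expectation_tendsto:
 assumes M: "\<And>n. prob_space (M n)" and P: "prob_space P"
  and X: "\<And>n k. k \<in> I ==> (\<lambda>w. X n w k) \<in> borel_measurable (M n)"
  and Y: "\<And>k. k \<in> I ==> (\<lambda>w. Y w k) \<in> borel_measurable P"
  and cos: "\<And>\<xi>. (\<lambda>n. \<integral>w. cos (phase I \<xi> (X n w)) \<partial>M n) \<longlonglongrightarrow> (\<integral>w. cos (phase I \<xi> (Y w)) \<partial>P)"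
  and sin: "\<And>\<xi>. (\<lambda>n. \<integral>w. sin (phase I \<xi> (X n w)) \<partial>M n) \<longlonglongrightarrow> (\<integral>w. sin (phase I \<xi> (Y w)) \<partial>P)"
  and p: "p \<in> trig_polys I"
 shows "(\<lambda>n. \<integral>w. p (X n w) \<partial>M n) \<longlonglongrightarrow> (\<integral>w. p (Y w) \<partial>P)"
proof -
 have int: "integrable N (\<lambda>w. q (Z w))"
  if q: "q \<in> trig_polys I" and "prob_space N" "\<And>k. k \<in> I ==> (\<lambda>w. Z w k) \<in> borel_measurable N"
  for q and N :: "'w measure" and Z
 proof -
  interpret N: prob_space N by fact
  obtain C where "\<forall>x. \<bar>q x\<bar> \<le> C" using trig_polys_bounded[OF q] by blast
  then show ?thesis
   using trig_polys_measurable[of I Z N q] q that by (intro N.integrable_const_bound[of _ C]) auto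
 qed
 show ?thesis
  using p
 proof (induction rule: trig_polys.induct)
  case (add p q)
  have "(\<integral>w. p (X n w) + q (X n w) \<partial>M n) = (\<integral>w. p (X n w) \<partial>M n) + (\<integral>w. q (X n w) \<partial>M n)" for n
   using int[OF add(1) M] int[OF add(2) M] X by (intro Bochner_Integration.integral_add) auto
  moreover have "(\<integral>w. p (Y w) + q (Y w) \<partial>P) = (\<integral>w. p (Y w) \<partial>P) + (\<integral>w. q (Y w) \<partial>P)"
   using int[OF add(1) P] int[OF add(2) P] Y by (intro Bochner_Integration.integral_add) auto
  ultimately show ?case using add.IH by (simp add: tendsto_add)
 qed (auto intro: cos sin tendsto_mult_left)
qed

text \<open>
 A cube of side \<open>2R\<close>, rolled up to a torus. Coordinates outside \<open>I\<close> are fixed, so that the coordinates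
 in \<open>I\<close> separate its points.
\<close>

definition torus :: "'k set => ('k => complex) set" where
 "torus I = (\<Pi>\<^sub>E k\<in>UNIV. if k \<in> I then sphere 0 1 else {1})"

definition torus_map :: "'k set => real => ('k => real) => 'k => complex" where
 "torus_map I R x k = (if k \<in> I then cis (pi * x k / R) else 1)"

lemma torus_map_in: "torus_map I R x \<in> torus I"
 by (auto simp: torus_def torus_map_def)

lemma compact_torus: "compact (torus I)"
proof -
 have "compactin (product_topology (\<lambda>_. euclidean) UNIV) (torus I)"
  unfolding torus_def compactin_PiE by auto
 then show ?thesis by (simp add: euclidean_product_topology)
qed

text \<open>
 The real and imaginary parts of the coordinates separate points, so the Stone-Weierstrass theorem applies to
 trigonometric polynomials on the torus.
\<close>

lemma torus_function_ring:
 assumes I: "finite I"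
 shows "function_ring_on {f. continuous_on (torus I) f \<and> (\<lambda>x. f (torus_map I R x)) \<in> trig_polys I} (torus I)"
proof
 show "compact (torus I)" by (rule compact_torus)
 have ph: "phase I (\<lambda>j. if j = k then c else 0) x = c * x k" if "k \<in> I" for k c x
  using I that by (simp add: phase_def if_distrib[of "\<lambda>z. z * _"] cong: if_cong)
 show "(\<lambda>_. c) \<in> {f. continuous_on (torus I) f \<and> (\<lambda>x. f (torus_map I R x)) \<in> trig_polys I}" for c
  using trig_polys.scale[OF trig_polys.cos[of I "\<lambda>_. 0"], of c] by (simp add: phase_def)
 show "\<exists>f\<in>{f. continuous_on (torus I) f \<and> (\<lambda>x. f (torus_map I R x)) \<in> trig_polys I}. f x \<noteq> f y"
  if xy: "x \<in> torus I" "y \<in> torus I" "x \<noteq> y" for x y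
 proof -
  obtain k where k: "x k \<noteq> y k" using xy(3) by blast
  then have kI: "k \<in> I" using xy(1,2) by (auto simp: torus_def PiE_iff split: if_splits) metis
  have c: "continuous_on A (\<lambda>y. y k)" for A :: "('a => complex) set"
   by (rule continuous_on_subset[OF continuous_on_product_coordinates]) simp
  have "(\<lambda>x. Re (torus_map I R x k)) \<in> trig_polys I"
   using trig_polys.cos[of I "\<lambda>j. if j = k then pi / R else 0"] kI by (simp add: ph torus_map_def)
  moreover have "(\<lambda>x. Im (torus_map I R x k)) \<in> trig_polys I"
   using trig_polys.sin[of I "\<lambda>j. if j = k then pi / R else 0"] kI by (simp add: ph torus_map_def)
  moreover have "Re (x k) \<noteq> Re (y k) \<or> Im (x k) \<noteq> Im (y k)" using k by (auto simp: complex_eq_iff)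
  ultimately show ?thesis
   using continuous_on_Re[OF c[of "torus I"]] continuous_on_Im[OF c[of "torus I"]] by (elim disjE)
     (rule bexI[where x="\<lambda>x. Re (x k)"], simp, simp, rule bexI[where x="\<lambda>x. Im (x k)"], simp, simp)
 qed
qed (auto intro: trig_polys.add trig_polys_mult continuous_intros)

lemma abs_Arg_sphere: "cmod z = 1 ==> \<bar>Arg z\<bar> = arccos (Re z)"
proof -
 assume z: "cmod z = 1"
 then have "z \<noteq> 0" by auto
 then have "cis (Arg z) = z" using z by (simp add: cis_Arg sgn_div_norm)
 then have "Re z = cos \<bar>Arg z\<bar>" by (metis cis.sel(1) cos_abs_real)
 moreover have "arccos (cos \<bar>Arg z\<bar>) = \<bar>Arg z\<bar>" using Arg_bounded[of z] by (intro arccos_cos) auto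
 ultimately show ?thesis by simp
qed

definition unwrap :: "real => ('k => complex) => 'k => real" where
 "unwrap R y k = R / pi * Arg (y k)"

text \<open>
 Equal to \<open>1\<close> on the cube of radius \<open>R - 1\<close> and to \<open>0\<close> outside the cube of radius \<open>R\<close>.
\<close>

definition cutoff :: "'k set => real => ('k => real) => real" where
 "cutoff I R x = (\<Prod>k\<in>I. max 0 (min 1 (R - \<bar>x k\<bar>)))"

lemma cutoff_01: "0 \<le> cutoff I R x" "cutoff I R x \<le> 1"
 unfolding cutoff_def by (auto intro!: prod_nonneg prod_le_1)

text \<open>
 The inverse of the rolling map jumps where the argument is \<open>\<pi>\<close>, but there the cutoff vanishes continuously.
\<close>

lemma continuous_on_torus_unwrap:
 fixes g :: "('k => real) => real"
 assumes I: "finite I" and R: "R > 0"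
  and g: "continuous_on UNIV g" and C: "\<And>x. \<bar>g x\<bar> \<le> C"
 shows "continuous_on (torus I) (\<lambda>y. g (unwrap R y) * cutoff I R (unwrap R y))"
proof -
 let ?\<chi> = "\<lambda>y. cutoff I R (unwrap R y)"
 let ?h = "\<lambda>y. g (unwrap R y) * ?\<chi> y"
 have c: "continuous_on A (\<lambda>y. y k)" for A :: "('k => complex) set" and k
  by (rule continuous_on_subset[OF continuous_on_product_coordinates]) simp
 have nrm: "cmod (y k) = 1" if "y \<in> torus I" for y k
  using that by (auto simp: torus_def PiE_iff split: if_splits dest!: spec[of _ k])
 have "continuous_on (torus I) (\<lambda>y. \<Prod>k\<in>I. max 0 (min 1 (R - R / pi * arccos (Re (y k)))))"
 proof (intro continuous_intros c ballI conjI)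
  fix y k assume "y \<in> torus I"
  then have "\<bar>Re (y k)\<bar> \<le> 1" using abs_Re_le_cmod[of "y k"] nrm by simp
  then show "- 1 \<le> Re (y k)" "Re (y k) \<le> 1" by auto
 qed
 moreover have "?\<chi> y = (\<Prod>k\<in>I. max 0 (min 1 (R - R / pi * arccos (Re (y k)))))" if "y \<in> torus I" for y
  unfolding cutoff_def unwrap_def using nrm[OF that] R
  by (intro prod.cong) (auto simp: abs_mult abs_Arg_sphere[symmetric])
 ultimately have cont\<chi>: "continuous_on (torus I) ?\<chi>" by (metis (no_types, lifting) continuous_on_cong)
 obtain O' where O': "open O'" "O' \<inter> torus I = ?\<chi> -` (- {0}) \<inter> torus I"
  using cont\<chi> unfolding continuous_on_open_invariant by (metis open_Compl closed_singleton)
 let ?W = "O' \<inter> torus I"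
 have contW: "continuous_on ?W ?h"
 proof (intro continuous_on_mult continuous_on_subset[OF cont\<chi>])
  show "continuous_on ?W (\<lambda>y. g (unwrap R y))"
  proof (rule continuous_on_compose2[OF g], rule continuous_on_coordinatewise_then_product)
   fix k
   have "y k \<notin> \<real>\<^sub>\<le>\<^sub>0" if "y \<in> ?W" for y
   proof
    assume "y k \<in> \<real>\<^sub>\<le>\<^sub>0"
    then obtain r where r: "y k = of_real r" "r \<le> 0" by (auto elim: nonpos_Reals_cases)
    have y: "y \<in> torus I" "?\<chi> y \<noteq> 0" using that O' by auto
    then have "r = -1" using nrm[OF y(1), of k] r by simp
    then have m1: "y k = -1" using r by simp
    then have kI: "k \<in> I" using y(1) by (auto simp: torus_def PiE_iff split: if_splits dest!: spec[of _ k])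
    have "max 0 (min 1 (R - \<bar>unwrap R y k\<bar>)) = 0"
     using R by (simp add: unwrap_def m1 abs_mult abs_Arg_sphere)
    then have "?\<chi> y = 0" unfolding cutoff_def using I kI by (auto intro!: prod_zero)
    then show False using y by simp
   qed
   then show "continuous_on ?W (\<lambda>y. unwrap R y k)"
    unfolding unwrap_def
    by (intro continuous_on_mult_left continuous_on_compose2[OF _ c, of "- \<real>\<^sub>\<le>\<^sub>0" Arg])
      (auto intro!: continuous_at_imp_continuous_on continuous_at_Arg)
  qed auto
 qed auto
 show ?thesis
  unfolding continuous_on_def
 proof (rule ballI)
  fix y assume y: "y \<in> torus I"
  show "(?h \<longlongrightarrow> ?h y) (at y within torus I)"
  proof (cases "?\<chi> y = 0")
   case True
   have "(?\<chi> \<longlongrightarrow> 0) (at y within torus I)"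
    using cont\<chi> y True unfolding continuous_on_def by (metis (no_types, lifting))
   then have "((\<lambda>y. C * ?\<chi> y) \<longlongrightarrow> 0) (at y within torus I)" by (rule tendsto_mult_right_zero)
   then have "(?h \<longlongrightarrow> 0) (at y within torus I)"
   proof (rule Lim_null_comparison[rotated])
    show "\<forall>\<^sub>F y in at y within torus I. norm (?h y) \<le> C * ?\<chi> y"
     using C cutoff_01(1)[of I R] by (intro always_eventually) (auto simp: abs_mult mult_right_mono)
   qed
   then show ?thesis using True by simp
  next
   case False
   then have yW: "y \<in> ?W" using y O' by auto
   have "at y within torus I = at y within ?W"
    by (rule at_within_nhd[of _ O']) (use O' yW in auto)
   then show ?thesis using contW yW unfolding continuous_on_def by metis
  qed
 qed
qed

lemma unwrap_torus_map:
 assumes "k \<in> I" "R > 0" "\<bar>x k\<bar> < R"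
 shows "unwrap R (torus_map I R x) k = x k"
proof -
 have "\<bar>pi * x k / R\<bar> < pi" using assms by (simp add: abs_mult divide_less_eq)
 then have "Arg (cis (pi * x k / R)) = pi * x k / R" by (intro Arg_cis) (simp_all only: abs_less_iff, auto)
 then show ?thesis using assms by (simp add: unwrap_def torus_map_def)
qed

text \<open>
 Cut \<open>g\<close> off outside a large cube, which by the bound on second moments costs little in expectation, uniformly in \<open>n\<close>. What remains
 is a continuous function on the torus and can be replaced by a trigonometric polynomial. The expectations of trigonometric
 polynomials converge by assumption.
\<close>

theorem expectation_tendsto_if_char:
 fixes X :: "nat => 'a => 'k::countable => real" and Y :: "'b => 'k => real"
  and g :: "('k => real) => real"
 assumes I: "finite I" and M: "\<And>n. prob_space (M n)" and P: "prob_space P"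
  and X: "\<And>n k. (\<lambda>w. X n w k) \<in> borel_measurable (M n)"
  and Y: "\<And>k. (\<lambda>w. Y w k) \<in> borel_measurable P"
  and cos: "\<And>\<xi>. (\<lambda>n. \<integral>w. cos (phase I \<xi> (X n w)) \<partial>M n) \<longlonglongrightarrow> (\<integral>w. cos (phase I \<xi> (Y w)) \<partial>P)"
  and sin: "\<And>\<xi>. (\<lambda>n. \<integral>w. sin (phase I \<xi> (X n w)) \<partial>M n) \<longlonglongrightarrow> (\<integral>w. sin (phase I \<xi> (Y w)) \<partial>P)"
  and X2: "\<And>n k. k \<in> I ==> integrable (M n) (\<lambda>w. (X n w k)^2) \<and> (\<integral>w. (X n w k)^2 \<partial>M n) \<le> B"
  and Y2: "\<And>k. k \<in> I ==> integrable P (\<lambda>w. (Y w k)^2) \<and> (\<integral>w. (Y w k)^2 \<partial>P) \<le> B"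
  and g: "continuous_on UNIV g" and C: "\<And>x. \<bar>g x\<bar> \<le> C"
  and dep: "\<And>x y. (\<And>k. k \<in> I ==> x k = y k) ==> g x = g y"
 shows "(\<lambda>n. \<integral>w. g (X n w) \<partial>M n) \<longlonglongrightarrow> (\<integral>w. g (Y w) \<partial>P)"
proof (rule LIMSEQ_I)
 fix e :: real assume e: "e > 0"
 have C0: "C \<ge> 0" using C[of undefined] by linarith
 define \<delta> where "\<delta> = e / (8 * (C + 1))"
 have \<delta>: "\<delta> > 0" using e C0 by (simp add: \<delta>_def)
 (* Chebyshev: each of the processes leaves the cube of radius R - 1 with probability at most \<delta>. *)
 define R where "R = 1 + sqrt ((real (card I) * \<bar>B\<bar> + 1) / \<delta>)"
 have R: "R > 1" using \<delta> by (auto simp: R_def intro!: divide_pos_pos add_nonneg_pos)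
 have R2: "real (card I) * \<bar>B\<bar> / (R - 1)^2 \<le> \<delta>"
 proof -
  have "(R - 1)^2 = (real (card I) * \<bar>B\<bar> + 1) / \<delta>" using \<delta> by (simp add: R_def)
  then have "real (card I) * \<bar>B\<bar> \<le> \<delta> * (R - 1)^2" using \<delta> by simp
  then show ?thesis using R by (simp add: divide_le_eq)
 qed
 define h where "h y = g (unwrap R y) * cutoff I R (unwrap R y)" for y
 interpret ring: function_ring_on
  "{f. continuous_on (torus I) f \<and> (\<lambda>x. f (torus_map I R x)) \<in> trig_polys I}" "torus I"
  by (rule torus_function_ring[OF I])
 have "continuous_on (torus I) h"
  unfolding h_def by (rule continuous_on_torus_unwrap[OF I _ g C]) (use R in auto)
 then obtain f where f: "(\<lambda>x. f (torus_map I R x)) \<in> trig_polys I"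
  and fh: "\<And>y. y \<in> torus I ==> \<bar>h y - f y\<bar> < e / 8"
  using ring.Stone_Weierstrass_basic[of h "e/8"] e by auto
 have hC: "\<bar>h y\<bar> \<le> C" for y
  using mult_mono[OF C[of "unwrap R y"] cutoff_01(2)[of I R "unwrap R y"]] C0 cutoff_01(1)[of I R "unwrap R y"]
  by (simp add: h_def abs_mult)
 let ?p = "\<lambda>x. f (torus_map I R x)"
 have approx: "\<bar>(\<integral>w. g (Z w) \<partial>N) - (\<integral>w. ?p (Z w) \<partial>N)\<bar> \<le> e / 8 + 2 * C * \<delta>"
  if N: "prob_space N" and Z: "\<And>k. (\<lambda>w. Z w k) \<in> borel_measurable N"
   and Z2: "\<And>k. k \<in> I ==> integrable N (\<lambda>w. (Z w k)^2) \<and> (\<integral>w. (Z w k)^2 \<partial>N) \<le> B"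
  for N :: "'w measure" and Z :: "'w => 'k => real"
 proof -
  interpret N: prob_space N by (rule N)
  have Zm: "Z \<in> borel_measurable N" by (rule measurable_coordinatewise_then_product[OF Z])
  have gm[measurable]: "(\<lambda>w. g (Z w)) \<in> borel_measurable N"
   using measurable_compose[OF Zm borel_measurable_continuous_onI[OF g]] by simp
  have pm[measurable]: "(\<lambda>w. ?p (Z w)) \<in> borel_measurable N"
   by (rule trig_polys_measurable[OF Z f])
  obtain D where D: "\<And>x. \<bar>?p x\<bar> \<le> D" using trig_polys_bounded[OF f] by blast
  define A where "A = (\<Union>k\<in>I. {w \<in> space N. R - 1 \<le> \<bar>Z w k\<bar>})"
  have Am[measurable]: "A \<in> sets N" unfolding A_def using I Z by (intro sets.finite_UN) auto
  have "N.prob A \<le> (\<Sum>k\<in>I. N.prob {w \<in> space N. R - 1 \<le> \<bar>Z w k\<bar>})"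
   unfolding A_def using I Z by (intro N.finite_measure_subadditive_finite) auto
  also have "\<dots> \<le> (\<Sum>k\<in>I. \<bar>B\<bar> / (R - 1)^2)"
  proof (rule sum_mono)
   fix k assume k: "k \<in> I"
   have "N.prob {w \<in> space N. R - 1 \<le> \<bar>Z w k\<bar>} = N.prob {w \<in> space N. (R - 1)^2 \<le> (Z w k)^2}"
    using R by (intro arg_cong[where f=N.prob]) (auto simp: abs_le_square_iff[symmetric])
   also have "\<dots> \<le> (\<integral>w. (Z w k)^2 \<partial>N) / (R - 1)^2"
    using Z2[OF k] R by (intro integral_Markov_inequality_measure[where A="{}"]) auto
   also have "\<dots> \<le> \<bar>B\<bar> / (R - 1)^2" using Z2[OF k] by (intro divide_right_mono) auto
   finally show "N.prob {w \<in> space N. R - 1 \<le> \<bar>Z w k\<bar>} \<le> \<bar>B\<bar> / (R - 1)^2" .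
  qed
  also have "\<dots> \<le> \<delta>" using R2 by simp
  finally have PA: "N.prob A \<le> \<delta>" .
  have ig: "integrable N (\<lambda>w. g (Z w))" using C by (intro N.integrable_const_bound[of _ C]) auto
  have ip: "integrable N (\<lambda>w. ?p (Z w))" using D by (intro N.integrable_const_bound[of _ D]) auto
  have iA: "integrable N (indicator A :: _ => real)"
   by (rule N.integrable_const_bound[of _ 1]) (auto simp: indicator_def)
  have ptw: "\<bar>g (Z w) - ?p (Z w)\<bar> \<le> e / 8 + 2 * C * indicator A w" if w: "w \<in> space N" for w
  proof (cases "w \<in> A")
   case True
   have "\<bar>g (Z w) - ?p (Z w)\<bar> \<le> \<bar>g (Z w)\<bar> + \<bar>h (torus_map I R (Z w))\<bar> + \<bar>h (torus_map I R (Z w)) - ?p (Z w)\<bar>"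
    by linarith
   also have "\<dots> \<le> C + C + e / 8"
    using C hC fh[OF torus_map_in] by (intro add_mono) (auto intro: less_imp_le)
   finally show ?thesis using True by simp
  next
   case False
   then have small: "\<bar>Z w k\<bar> < R - 1" if "k \<in> I" for k using that w by (force simp: A_def)
   have un: "unwrap R (torus_map I R (Z w)) k = Z w k" if "k \<in> I" for k
    using small[OF that] R that by (intro unwrap_torus_map) auto
   have "cutoff I R (unwrap R (torus_map I R (Z w))) = 1"
    unfolding cutoff_def using un small by (intro prod.neutral) (use small un in \<open>fastforce simp: max_def min_def\<close>)
   moreover have "g (unwrap R (torus_map I R (Z w))) = g (Z w)" by (rule dep[OF un])
   ultimately have "h (torus_map I R (Z w)) = g (Z w)" by (simp add: h_def)
   then show ?thesis using fh[OF torus_map_in, of R "Z w"] False by simp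
  qed
  have "\<bar>(\<integral>w. g (Z w) \<partial>N) - (\<integral>w. ?p (Z w) \<partial>N)\<bar> = \<bar>\<integral>w. g (Z w) - ?p (Z w) \<partial>N\<bar>"
   using ig ip by simp
  also have "\<dots> \<le> (\<integral>w. \<bar>g (Z w) - ?p (Z w)\<bar> \<partial>N)" by (rule integral_abs_bound)
  also have "\<dots> \<le> (\<integral>w. e / 8 + 2 * C * indicator A w \<partial>N)"
   using ig ip iA ptw by (intro integral_mono) simp_all
  also have "\<dots> = e / 8 + 2 * C * N.prob A"
   using iA by (simp add: N.prob_space)
  also have "\<dots> \<le> e / 8 + 2 * C * \<delta>" using PA C0 by (simp add: mult_left_mono)
  finally show ?thesis .
 qed
 have C\<delta>: "2 * C * \<delta> \<le> e / 4" using e C0 by (simp add: \<delta>_def field_simps)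
 have "(\<lambda>n. \<integral>w. ?p (X n w) \<partial>M n) \<longlonglongrightarrow> (\<integral>w. ?p (Y w) \<partial>P)"
  by (rule trig_polys_expectation_tendsto[OF M P X Y cos sin f])
 then obtain n0 where n0: "\<And>n. n \<ge> n0 ==> \<bar>(\<integral>w. ?p (X n w) \<partial>M n) - (\<integral>w. ?p (Y w) \<partial>P)\<bar> < e / 8"
  using e unfolding LIMSEQ_iff by (metis divide_pos_pos real_norm_def zero_less_numeral)
 have "norm ((\<integral>w. g (X n w) \<partial>M n) - (\<integral>w. g (Y w) \<partial>P)) < e" if n: "n \<ge> n0" for n
  using approx[of "M n" "X n", OF M X X2] approx[of P Y, OF P Y Y2] n0[OF n] C\<delta> e unfolding real_norm_def by linarith
 then show "\<exists>n0. \<forall>n\<ge>n0. norm ((\<integral>w. g (X n w) \<partial>M n) - (\<integral>w. g (Y w) \<partial>P)) < e" by blast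
qed
section \<open>The central limit theorem for the noise on a grid\<close>

lemma cell_div_tendsto:
 assumes T: "0 \<le> T" shows "(\<lambda>n. real (cell T K n k) / real n) \<longlonglongrightarrow> real k * mesh T K"
proof (rule real_tendsto_sandwich)
 let ?x = "real k * mesh T K"
 have "(\<lambda>n. ?x - 1 / real n) \<longlonglongrightarrow> ?x - 0" by (intro tendsto_diff tendsto_const lim_1_over_n)
 then show "(\<lambda>n. ?x - 1 / real n) \<longlonglongrightarrow> ?x" by simp
 show "\<forall>\<^sub>F n in sequentially. ?x - 1 / real n \<le> real (cell T K n k) / real n"
  using eventually_gt_at_top[of 0]
 proof eventually_elim
  case (elim n)
  have "real n * ?x - 1 \<le> real (cell T K n k)" using cell_bounds(2)[OF T, of n k K] by simp
  from divide_right_mono[OF this, of "real n"] show ?case using elim by (simp add: diff_divide_distrib)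
 qed
 show "\<forall>\<^sub>F n in sequentially. real (cell T K n k) / real n \<le> ?x"
  using eventually_gt_at_top[of 0]
 proof eventually_elim
  case (elim n)
  from divide_right_mono[OF cell_bounds(1)[OF T, of K n k], of "real n"] show ?case using elim by simp
 qed
qed simp

context discrete_evolution begin

text \<open>
 The exponent is a single sum of the independent \<open>b\<^sub>i\<close> with coefficients \<open>a\<^sub>n\<^sub>,\<^sub>i\<close> of order \<open>1 / sqrt n\<close>, so its characteristic function is close
 to \<open>exp (- S\<^sub>n / 2)\<close>, where \<open>S\<^sub>n\<close> is the sum of the squares of the coefficients. By the averaging assumption on the directions
 \<open>u\<^sub>i\<close>, \<open>S\<^sub>n\<close> converges to the Gaussian variance.
\<close>

lemma block_noise_iexp_limit:
 assumes ind: "indep_vars (\<lambda>_. borel) b UNIV" and mean: "\<And>i. expectation (b i) = 0"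
  and sq: "\<And>i. integrable M (\<lambda>w. (b i w)^2)" and var: "\<And>i. expectation (\<lambda>w. (b i w)^2) = 1"
  and avg: "\<And>v. \<exists>D. \<forall>p q. p \<le> q \<longrightarrow> \<bar>(\<Sum>i\<in>{p..<q}. (\<Sum>j\<in>UNIV. v j * u i $ j)^2) - real (q - p) * (\<Sum>j\<in>UNIV. (v j)^2)\<bar> \<le> D"
 shows "(\<lambda>n. expectation (\<lambda>w. iexp (\<Sum>k<N. \<Sum>j\<in>UNIV. \<xi> (k, j) * block_noise n K k w $ j)))
  \<longlonglongrightarrow> of_real (exp (- (mesh T K * (\<Sum>k<N. \<Sum>j\<in>UNIV. (\<xi> (k, j))^2)) / 2))"
proof -
 have T0: "0 \<le> T" using T by simp
 let ?l = "\<lambda>n. cell T K n" and ?h = "mesh T K"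
 define a where "a n i = (\<Sum>j\<in>UNIV. \<xi> (blocks.block_of (?l n) i, j) * u i $ j) / sqrt (real n)" for n i
 define S where "S n = (\<Sum>i<?l n N. (a n i)^2)" for n
 define \<alpha> where "\<alpha> = (\<Sum>k<N. \<Sum>j\<in>UNIV. \<bar>\<xi> (k, j)\<bar>) * \<upsilon>"
 have \<alpha>0: "0 \<le> \<alpha>" using \<upsilon>0 by (auto simp: \<alpha>_def intro!: mult_nonneg_nonneg sum_nonneg)
 have C30: "0 \<le> C3" by (rule order_trans[OF integral_nonneg_AE b3(2)[of 0]]) auto
 have ph: "(\<Sum>k<N. \<Sum>j\<in>UNIV. \<xi> (k, j) * block_noise n K k w $ j) = (\<Sum>i<?l n N. b i w * a n i)" for n w
 proof -
  interpret blocks "?l n" by (rule blocks_cell[OF T0])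
  have "(\<Sum>j\<in>UNIV. \<xi> (k, j) * block_noise n K k w $ j) = (\<Sum>i\<in>{?l n k..<?l n (Suc k)}. b i w * a n i)" for k
  proof -
   have "(\<Sum>j\<in>UNIV. \<xi> (k, j) * block_noise n K k w $ j)
     = (\<Sum>j\<in>UNIV. \<Sum>i\<in>{?l n k..<?l n (Suc k)}. \<xi> (k, j) * (b i w * (u i $ j / sqrt (real n))))"
    by (simp add: block_noise_def sum_distrib_left)
   also have "\<dots> = (\<Sum>i\<in>{?l n k..<?l n (Suc k)}. \<Sum>j\<in>UNIV. \<xi> (k, j) * (b i w * (u i $ j / sqrt (real n))))"
    by (rule sum.swap)
   also have "\<dots> = (\<Sum>i\<in>{?l n k..<?l n (Suc k)}. b i w * a n i)"
    by (intro sum.cong refl) (simp add: a_def block_of_eq[of k] sum_distrib_left sum_divide_distrib mult_ac)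
   finally show ?thesis .
  qed
  then show ?thesis by (simp add: sum_blocks)
 qed
 have ab: "\<bar>a n i\<bar> \<le> \<alpha> / sqrt (real n)" if i: "i < ?l n N" for n i
 proof -
  interpret blocks "?l n" by (rule blocks_cell[OF T0])
  have k: "block_of i < N" by (rule block_of_props(1)[OF i])
  have "\<bar>\<Sum>j\<in>UNIV. \<xi> (block_of i, j) * u i $ j\<bar> \<le> (\<Sum>j\<in>UNIV. \<bar>\<xi> (block_of i, j)\<bar> * \<upsilon>)"
   by (rule order_trans[OF sum_abs sum_mono]) (simp add: abs_mult mult_left_mono u)
  also have "\<dots> = (\<Sum>j\<in>UNIV. \<bar>\<xi> (block_of i, j)\<bar>) * \<upsilon>" by (simp add: sum_distrib_right)
  also have "\<dots> \<le> \<alpha>" unfolding \<alpha>_def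
   by (intro mult_right_mono \<upsilon>0 member_le_sum[where f="\<lambda>k. \<Sum>j\<in>UNIV. \<bar>\<xi> (k, j)\<bar>"]) (use k in \<open>auto intro: sum_nonneg\<close>)
  finally show ?thesis unfolding a_def by (simp add: divide_right_mono)
 qed
 define r where "r n = real N * ?h * (C3 * \<alpha>^3 / 6 * sqrt (1 / real n) + \<alpha>^4 / 8 * (1 / real n))" for n
 have near: "norm (expectation (\<lambda>w. iexp (\<Sum>k<N. \<Sum>j\<in>UNIV. \<xi> (k, j) * block_noise n K k w $ j)) - of_real (exp (- S n / 2))) \<le> r n" if n: "0 < n" for n
 proof -
  have "norm (expectation (\<lambda>w. iexp (\<Sum>i<?l n N. b i w * a n i)) - of_real (exp (- S n / 2)))
   \<le> real (card {..<?l n N}) * (C3 * (\<alpha> / sqrt (real n))^3 / 6 + (\<alpha> / sqrt (real n))^4 / 8)"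
   unfolding S_def
   by (rule expectation_iexp_sum_approx[OF _ indep_vars_subset[OF ind]]) (use mean sq var b3 ab C30 in auto)
  also have "\<dots> \<le> (real n * (real N * ?h)) * (C3 * (\<alpha> / sqrt (real n))^3 / 6 + (\<alpha> / sqrt (real n))^4 / 8)"
   using cell_bounds(1)[OF T0, of K n N] C30 \<alpha>0 by (intro mult_right_mono) auto
  also have "\<dots> = r n"
  proof -
   have q: "(sqrt (real n))^4 = (real n)^2" "(sqrt (real n))^3 = real n * sqrt (real n)"
    by (simp_all add: eval_nat_numeral)
   show ?thesis unfolding r_def power_divide q using n by (simp add: real_sqrt_divide field_simps power2_eq_square)
  qed
  finally show ?thesis by (simp only: ph)
 qed
 have r0: "r \<longlonglongrightarrow> 0"
 proof -
  have "r \<longlonglongrightarrow> real N * ?h * (C3 * \<alpha>^3 / 6 * sqrt 0 + \<alpha>^4 / 8 * 0)"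
   unfolding r_def by (intro tendsto_intros lim_1_over_n)
  then show ?thesis by simp
 qed
 have Slim: "S \<longlonglongrightarrow> (\<Sum>k<N. ?h * (\<Sum>j\<in>UNIV. (\<xi> (k, j))^2))"
 proof -
  define g where "g k n = (\<Sum>i\<in>{?l n k..<?l n (Suc k)}. (\<Sum>j\<in>UNIV. \<xi> (k, j) * u i $ j)^2) / real n" for k n
  have S: "S n = (\<Sum>k<N. g k n)" for n
  proof -
   interpret blocks "?l n" by (rule blocks_cell[OF T0])
   show ?thesis unfolding S_def sum_blocks g_def sum_divide_distrib
   proof (intro sum.cong refl)
    fix k i assume "i \<in> {?l n k..<?l n (Suc k)}"
    then show "(a n i)^2 = (\<Sum>j\<in>UNIV. \<xi> (k, j) * u i $ j)^2 / real n"
     by (simp add: a_def block_of_eq[of k] power_divide)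
   qed
  qed
  have "g k \<longlonglongrightarrow> ?h * (\<Sum>j\<in>UNIV. (\<xi> (k, j))^2)" for k
  proof -
   let ?s = "\<Sum>j\<in>UNIV. (\<xi> (k, j))^2"
   obtain D where D: "\<And>p q. p \<le> q ==> \<bar>(\<Sum>i\<in>{p..<q}. (\<Sum>j\<in>UNIV. \<xi> (k, j) * u i $ j)^2) - real (q - p) * ?s\<bar> \<le> D"
    using avg[of "\<lambda>j. \<xi> (k, j)"] by blast
   let ?q = "\<lambda>n. (real (?l n (Suc k)) / real n - real (?l n k) / real n) * ?s"
   have "?q \<longlonglongrightarrow> (real (Suc k) * ?h - real k * ?h) * ?s" by (intro tendsto_intros cell_div_tendsto T0)
   then have q: "?q \<longlonglongrightarrow> ?h * ?s" by (simp add: algebra_simps)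
   have "(\<lambda>n. g k n - ?q n) \<longlonglongrightarrow> 0"
   proof (rule Lim_null_comparison)
    show "(\<lambda>n. D * (1 / real n)) \<longlonglongrightarrow> 0" using tendsto_mult[OF tendsto_const[of D] lim_1_over_n] by simp
    show "\<forall>\<^sub>F n in sequentially. norm (g k n - ?q n) \<le> D * (1 / real n)"
    proof (rule always_eventually, rule allI)
     fix n
     interpret blocks "?l n" by (rule blocks_cell[OF T0])
     have "g k n - ?q n = ((\<Sum>i\<in>{?l n k..<?l n (Suc k)}. (\<Sum>j\<in>UNIV. \<xi> (k, j) * u i $ j)^2) - real (?l n (Suc k) - ?l n k) * ?s) / real n"
      using mono[of k] by (simp add: g_def of_nat_diff diff_divide_distrib left_diff_distrib)
     then show "norm (g k n - ?q n) \<le> D * (1 / real n)"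
      using D[OF mono[of k]] by (simp add: divide_right_mono)
    qed
   qed
   from tendsto_add[OF this q] show ?thesis by simp
  qed
  then show ?thesis unfolding S by (intro tendsto_sum)
 qed
 have e: "(\<lambda>n. complex_of_real (exp (- S n / 2))) \<longlonglongrightarrow> of_real (exp (- (\<Sum>k<N. ?h * (\<Sum>j\<in>UNIV. (\<xi> (k, j))^2)) / 2))"
  by (intro tendsto_intros Slim) simp
 have "(\<lambda>n. expectation (\<lambda>w. iexp (\<Sum>k<N. \<Sum>j\<in>UNIV. \<xi> (k, j) * block_noise n K k w $ j)) - of_real (exp (- S n / 2))) \<longlonglongrightarrow> 0"
  by (rule Lim_null_comparison[OF eventually_mono[OF eventually_gt_at_top[of 0]] r0]) (rule near)
 from tendsto_add[OF this e] show ?thesis by (simp add: sum_distrib_left)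
qed

text \<open>
 The characteristic functions of the block noise converge to those of the Brownian increments, by \<open>block_noise_iexp_limit\<close> and
 \<open>grid_incr_iexp\<close>; their second moments are bounded.
\<close>

theorem block_noise_converges:
 fixes P :: "'p measure" and B :: "real => 'p => real^'d" and g :: "(nat \<times> 'd => real) => real"
 assumes ind: "indep_vars (\<lambda>_. borel) b UNIV" and mean: "\<And>i. expectation (b i) = 0"
  and sq: "\<And>i. integrable M (\<lambda>w. (b i w)^2)" and var: "\<And>i. expectation (\<lambda>w. (b i w)^2) = 1"
  and avg: "\<And>v. \<exists>D. \<forall>p q. p \<le> q \<longrightarrow> \<bar>(\<Sum>i\<in>{p..<q}. (\<Sum>j\<in>UNIV. v j * u i $ j)^2) - real (q - p) * (\<Sum>j\<in>UNIV. (v j)^2)\<bar> \<le> D"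
  and BM: "brownian_motion P F' B" and K: "0 < K"
  and g: "continuous_on UNIV g" "\<And>x. \<bar>g x\<bar> \<le> G" and dep: "\<And>x y. (\<And>k j. k < K ==> x (k, j) = y (k, j)) ==> g x = g y"
 shows "(\<lambda>n. \<integral>w. g (\<lambda>(k, j). block_noise n K k w $ j) \<partial>M) \<longlonglongrightarrow> (\<integral>w. g (\<lambda>(k, j). grid_incr B T K k w $ j) \<partial>P)"
proof -
 interpret P: brownian_motion P F' B by (rule BM)
 let ?I = "{..<K} \<times> (UNIV :: 'd set)" and ?h = "mesh T K"
 let ?X = "\<lambda>n w (k, j). block_noise n K k w $ j" and ?Y = "\<lambda>w (k, j). grid_incr B T K k w $ j"
 have h: "0 < ?h" using T K by (simp add: mesh_def)
 have T0: "0 \<le> T" using T by simp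
 have bm: "b i \<in> borel_measurable M" for i using ind by (auto simp: indep_vars_def)
 have bnm: "(\<lambda>w. block_noise n K k w $ j) \<in> borel_measurable M" for n k j
  using bm by (simp add: block_noise_def)
 have st: "0 \<le> real k * ?h" "real k * ?h < real (Suc k) * ?h" for k using h by auto
 have giv: "(\<lambda>w. grid_incr B T K k w) \<in> borel_measurable P" for k
  unfolding grid_incr_def by (rule P.F_measurable_imp[OF P.increment_measurable[OF st(1) less_imp_le[OF st(2)] order_refl]])
 have gim: "(\<lambda>w. grid_incr B T K k w $ j) \<in> borel_measurable P" for k j by (rule borel_measurable_vec_nth[OF giv])
 have phX: "phase ?I \<xi> (?X n w) = (\<Sum>k<K. \<Sum>j\<in>UNIV. \<xi> (k, j) * block_noise n K k w $ j)" for \<xi> n w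
  unfolding phase_def sum.cartesian_product by (rule sum.cong) auto
 have phY: "phase ?I \<xi> (?Y w) = (\<Sum>k<K. \<Sum>j\<in>UNIV. \<xi> (k, j) * grid_incr B T K k w $ j)" for \<xi> w
  unfolding phase_def sum.cartesian_product by (rule sum.cong) auto
 have mX: "(\<lambda>w. phase ?I \<xi> (?X n w)) \<in> borel_measurable M" for \<xi> n unfolding phX using bnm by simp
 have mY: "(\<lambda>w. phase ?I \<xi> (?Y w)) \<in> borel_measurable P" for \<xi> unfolding phY using gim by simp
 have lim: "(\<lambda>n. \<integral>w. iexp (phase ?I \<xi> (?X n w)) \<partial>M) \<longlonglongrightarrow> (\<integral>w. iexp (phase ?I \<xi> (?Y w)) \<partial>P)" for \<xi>
  using block_noise_iexp_limit[OF ind mean sq var avg, of \<xi> K K] P.grid_incr_iexp[OF h, of \<xi> K] by (simp only: phX phY)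
 show ?thesis
 proof (rule expectation_tendsto_if_char[where M="\<lambda>_. M" and I="?I" and X="?X" and Y="?Y" and B="max (\<upsilon>^2 * (?h + 1)) ?h"])
  show "finite ?I" by simp
  show "prob_space M" "prob_space P" by unfold_locales
  show "(\<lambda>w. ?X n w k) \<in> borel_measurable M" for n k using bnm by (cases k) simp
  show "(\<lambda>w. ?Y w k) \<in> borel_measurable P" for k using gim by (cases k) simp
  fix \<xi> :: "nat \<times> 'd => real"
  have "Re (\<integral>w. iexp (phase ?I \<xi> (?X n w)) \<partial>M) = (\<integral>w. cos (phase ?I \<xi> (?X n w)) \<partial>M)"
   "Im (\<integral>w. iexp (phase ?I \<xi> (?X n w)) \<partial>M) = (\<integral>w. sin (phase ?I \<xi> (?X n w)) \<partial>M)" for n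
   using integral_Re[OF integrable_iexp[OF mX[of \<xi> n]]] integral_Im[OF integrable_iexp[OF mX[of \<xi> n]]] by (simp_all add: Re_exp Im_exp)
  moreover have "Re (\<integral>w. iexp (phase ?I \<xi> (?Y w)) \<partial>P) = (\<integral>w. cos (phase ?I \<xi> (?Y w)) \<partial>P)"
   "Im (\<integral>w. iexp (phase ?I \<xi> (?Y w)) \<partial>P) = (\<integral>w. sin (phase ?I \<xi> (?Y w)) \<partial>P)"
   using integral_Re[OF P.integrable_iexp[OF mY[of \<xi>]]] integral_Im[OF P.integrable_iexp[OF mY[of \<xi>]]] by (simp_all add: Re_exp Im_exp)
  ultimately show "(\<lambda>n. \<integral>w. cos (phase ?I \<xi> (?X n w)) \<partial>M) \<longlonglongrightarrow> (\<integral>w. cos (phase ?I \<xi> (?Y w)) \<partial>P)"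
   "(\<lambda>n. \<integral>w. sin (phase ?I \<xi> (?X n w)) \<partial>M) \<longlonglongrightarrow> (\<integral>w. sin (phase ?I \<xi> (?Y w)) \<partial>P)"
   using tendsto_Re[OF lim[of \<xi>]] tendsto_Im[OF lim[of \<xi>]] by (simp_all only:)
 next
  fix n and kj :: "nat \<times> 'd" assume "kj \<in> ?I"
  obtain k j where kj: "kj = (k, j)" by (cases kj)
  interpret blocks "cell T K n" by (rule blocks_cell[OF T0])
  let ?a = "\<lambda>i. u i $ j / sqrt (real n)"
  have a: "\<bar>?a i\<bar> \<le> \<upsilon> / sqrt (real n)" for i using u[of i j] by (simp add: divide_right_mono)
  have c: "(\<lambda>_. 1) \<in> borel_measurable (F (cell T K n k))" "integrable M (\<lambda>_. 1 :: real)" "0 \<le> (1 :: real)" by auto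
  note q = noise_block_quadratic[where a="?a", OF mono a c]
  have "real (cell T K n (Suc k) - cell T K n k) * (\<upsilon> / sqrt (real n))^2 \<le> \<upsilon>^2 * (?h + 1)"
  proof (cases "n = 0")
   case False
   have "real (cell T K n (Suc k) - cell T K n k) \<le> real n * ?h + 1"
    using cell_bounds(1)[OF T0, of K n "Suc k"] cell_bounds(2)[OF T0, of n k K] mono[of k] by (simp add: of_nat_diff algebra_simps)
   also have "\<dots> \<le> real n * (?h + 1)" using False by (simp add: distrib_left)
   finally have "real (cell T K n (Suc k) - cell T K n k) * (\<upsilon>^2 / real n) \<le> real n * (?h + 1) * (\<upsilon>^2 / real n)"
    by (rule mult_right_mono) simp
   then show ?thesis using False by (simp add: power_divide mult_ac)
  qed (use h in simp)
  then show "integrable M (\<lambda>w. (?X n w kj)^2) \<and> (\<integral>w. (?X n w kj)^2 \<partial>M) \<le> max (\<upsilon>^2 * (?h + 1)) ?h"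
   using q by (simp add: kj block_noise_def prob_space)
 next
  fix kj :: "nat \<times> 'd" assume "kj \<in> ?I"
  obtain k j where kj: "kj = (k, j)" by (cases kj)
  show "integrable P (\<lambda>w. (?Y w kj)^2) \<and> (\<integral>w. (?Y w kj)^2 \<partial>P) \<le> max (\<upsilon>^2 * (?h + 1)) ?h"
   using P.increment_moments(1,3)[OF st[of k], of j] by (simp add: kj grid_incr_def algebra_simps)
 next
  fix x y :: "nat \<times> 'd => real" assume "\<And>k. k \<in> ?I ==> x k = y k"
  then show "g x = g y" by (intro dep) simp
 qed (use g in auto)
qed

end

section \<open>The transfer matrices\<close>

abbreviation mat2 :: "'a::zero => 'a => 'a => 'a => 'a^2^2" where
 "mat2 a b c d \<equiv> vector [vector [a, b], vector [c, d]]"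

lemma mat2_mult: "mat2 a b c d ** mat2 a' b' c' d'
  = mat2 (a * a' + b * c') (a * b' + b * d') (c * a' + d * c') (c * b' + d * (d' :: 'a::semiring_1))"
 by (simp add: vec_eq_iff forall_2 matrix_matrix_mult_def sum_2)

lemma mat2_1: "mat 1 = mat2 1 0 0 (1 :: 'a::semiring_1)"
 by (simp add: vec_eq_iff forall_2 mat_def)

lemma mat2_add: "mat2 a b c d + mat2 a' b' c' d' = mat2 (a + a') (b + b') (c + c') (d + (d' :: 'a::monoid_add))"
 by (simp add: vec_eq_iff forall_2)

lemma mat2_scaleR: "r *\<^sub>R mat2 a b c d = mat2 (r *\<^sub>R a) (r *\<^sub>R b) (r *\<^sub>R c) (r *\<^sub>R (d :: 'a::real_vector))"
 by (simp add: vec_eq_iff forall_2)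

lemma mat2_eqI: "a = a' ==> b = b' ==> c = c' ==> d = d' ==> mat2 a b c d = mat2 a' b' c' d'"
 by simp

lemma matrix_inv_unique:
 fixes A :: "'a::semiring_1^'n^'n"
 assumes "A ** B = mat 1" "B ** A = mat 1" shows "matrix_inv A = B"
proof -
 have *: "A ** matrix_inv A = mat 1 \<and> matrix_inv A ** A = mat 1"
  unfolding matrix_inv_def by (rule someI[of _ B]) (use assms in simp)
 have "matrix_inv A = matrix_inv A ** (A ** B)" using assms by simp
 also have "\<dots> = matrix_inv A ** A ** B" by (rule matrix_mul_assoc)
 finally show ?thesis using * by simp
qed

lemma matrix_add_rdistrib: "(A + B) ** C = A ** C + B ** (C :: 'a::semiring_1^'n^'m)"
 by (simp add: vec_eq_iff matrix_matrix_mult_def sum.distrib distrib_right)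

lemma linear_matrix_mult_left: "linear (\<lambda>X :: complex^'n^'m. X ** A)"
 by (rule linearI) (simp_all add: vec_eq_iff matrix_matrix_mult_def sum.distrib distrib_right scaleR_sum_right)

lemma linear_matrix_mult_right: "linear (\<lambda>X :: complex^'n^'m. A ** X)"
 by (rule linearI) (simp_all add: vec_eq_iff matrix_matrix_mult_def sum.distrib distrib_left scaleR_sum_right)

text \<open>
 The source of all cancellations: the bound does not depend on the length of the interval.
\<close>

lemma geometric_sum_bounded:
 fixes x :: complex
 assumes x: "norm x = 1" "x \<noteq> 1"
 shows "norm (\<Sum>i\<in>{p..<q}. x ^ Suc i) \<le> 2 / norm (1 - x)"
proof (cases "p \<le> q")
 case True
 have "(1 - x) * (\<Sum>i\<in>{p..<q}. x ^ Suc i) = x ^ Suc p - x ^ Suc q"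
  using True
 proof (induction q rule: dec_induct)
  case (step q)
  have "(1 - x) * (\<Sum>i\<in>{p..<Suc q}. x ^ Suc i) = (1 - x) * (\<Sum>i\<in>{p..<q}. x ^ Suc i) + (1 - x) * x ^ Suc q"
   using step(1) by (simp add: distrib_left)
  then show ?case unfolding step.IH by (simp add: algebra_simps)
 qed simp
 then have "norm (1 - x) * norm (\<Sum>i\<in>{p..<q}. x ^ Suc i) = norm (x ^ Suc p - x ^ Suc q)" by (metis norm_mult)
 also have "\<dots> \<le> norm (x ^ Suc p) + norm (x ^ Suc q)" by (rule norm_triangle_ineq4)
 also have "\<dots> = 2" using x by (simp add: norm_power norm_mult)
 finally show ?thesis using x by (simp add: pos_le_divide_eq mult.commute)
qed simp

locale energy =
 fixes E :: real
 assumes E: "E \<in> {-2<..<2} - {0}"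
begin

abbreviation "z \<equiv> z_of E"
abbreviation "Z \<equiv> Z_of E"
abbreviation "\<rho> \<equiv> rho E"

lemma E_square_less: "0 < 1 - E^2 / 4"
 using E abs_square_less_1[of "E / 2"] by (simp add: power_divide abs_less_iff)

lemma rho_pos: "0 < \<rho>" using E_square_less by (simp add: rho_def)

lemma Im_z: "Im z = 1 / \<rho>" "0 < Im z" using E_square_less by (simp_all add: z_of_def rho_def power_divide)

lemma z_add_cnj: "z + cnj z = of_real E" by (simp add: complex_eq_iff z_of_def)

lemma z_mult_cnj: "z * cnj z = 1" "cnj z * z = 1"
 using E_square_less by (simp_all add: complex_eq_iff z_of_def power_divide power2_eq_square[symmetric])

lemma norm_z: "norm z = 1"
proof -
 have "(norm z)^2 = 1" using z_mult_cnj by (simp add: complex_norm_square[symmetric] flip: of_real_eq_iff[where 'a=complex])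
 then show ?thesis by (simp add: abs_square_eq_1)
qed

text \<open>
 On the unit circle, \<open>z\<^sup>2 = 1\<close> means \<open>Im z = 0\<close> and \<open>z\<^sup>2 = -1\<close> means \<open>Re z = 0\<close>, that is \<open>E = 0\<close>.
\<close>

lemma z_square_ne: "z^2 \<noteq> 1" "(z^2)^2 \<noteq> 1"
proof -
 have re: "Re (z^2) = (Re z)^2 - (Im z)^2" "Im (z^2) = 2 * Re z * Im z" by (simp_all add: power2_eq_square)
 have "Im (z^2) \<noteq> 0" unfolding re using Im_z(2) E by (simp add: z_of_def)
 then have "z^2 \<noteq> 1" "z^2 \<noteq> - 1" by auto
 then show "z^2 \<noteq> 1" "(z^2)^2 \<noteq> 1" unfolding power2_eq_1_iff[of "z^2"] by blast+
qed

text \<open>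
 The columns of \<open>Z\<close> are eigenvectors of \<open>T(E)\<close> for \<open>cnj z\<close> and \<open>z\<close>.
\<close>

lemma Z_inv: "matrix_inv Z = mat2 (\<i> * \<rho> / 2) (- (\<i> * \<rho> / 2) * z) (- (\<i> * \<rho> / 2)) ((\<i> * \<rho> / 2) * cnj z)" (is "_ = ?B")
 and Z_inv_mult: "Z ** matrix_inv Z = mat 1" "matrix_inv Z ** Z = mat 1"
proof -
 define \<kappa> where "\<kappa> = \<i> * complex_of_real \<rho> / 2"
 have "cnj z - z = - 2 * \<i> / \<rho>" by (simp add: complex_eq_iff Im_z(1))
 then have d: "\<kappa> * (cnj z - z) = 1" using rho_pos by (simp add: \<kappa>_def field_simps complex_eq_iff)
 have 1: "Z ** ?B = mat 1"
  unfolding Z_of_def mat2_mult mat2_1 \<kappa>_def[symmetric]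
  by (rule mat2_eqI) (use d in algebra)+
 have 2: "?B ** Z = mat 1"
  unfolding Z_of_def mat2_mult mat2_1 \<kappa>_def[symmetric]
  by (rule mat2_eqI) (use d in \<open>simp_all add: algebra_simps\<close>)
 show 3: "matrix_inv Z = ?B" by (rule matrix_inv_unique[OF 1 2])
 show "Z ** matrix_inv Z = mat 1" "matrix_inv Z ** Z = mat 1" unfolding 3 by (rule 1, rule 2)
qed

text \<open>
 \<open>T(E)\<^sup>-\<^sup>l\<close> and \<open>T(E)\<^sup>l\<close> in the basis of eigenvectors.
\<close>

definition "twist = (\<lambda>l. mat2 (z ^ l) 0 0 (cnj z ^ l))"
definition "untwist = (\<lambda>l. mat2 (cnj z ^ l) 0 0 (z ^ l))"

lemma inv_transfer: "matrix_inv (transfer_matrix (of_real E)) = mat2 0 1 (-1) (of_real E)"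
 by (rule matrix_inv_unique) (simp_all add: transfer_matrix_def mat2_mult mat2_1)

lemma inv_transfer_power:
 "((**) (matrix_inv (transfer_matrix (of_real E))) ^^ l) X = Z ** twist l ** matrix_inv Z ** X"
proof (induction l)
 case 0
 show ?case by (simp add: twist_def mat2_1[symmetric] Z_inv_mult)
next
 case (Suc l)
 have "mat2 0 1 (-1) (of_real E) ** Z = Z ** twist 1"
  unfolding Z_of_def twist_def mat2_mult
  by (rule mat2_eqI) (use z_add_cnj z_mult_cnj in \<open>simp_all add: algebra_simps\<close>)
 moreover have "twist 1 ** twist l = twist (Suc l)" by (simp add: twist_def mat2_mult)
 ultimately have "mat2 0 1 (-1) (of_real E) ** Z ** twist l = Z ** twist (Suc l)" by (simp flip: matrix_mul_assoc)
 then show ?case using Suc by (simp add: inv_transfer matrix_mul_assoc)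
qed

text \<open>
 The perturbation of the transfer matrix in step \<open>i + 1\<close>, conjugated to \<open>T(E)^(-(i+1)) \<epsilon> e\<^sub>1\<^sub>1 T(E)^i\<close> and written in the basis of
 eigenvectors.
\<close>

definition kick :: "complex => nat => complex^2^2" where
 "kick \<epsilon> i = (let \<kappa> = \<i> * \<rho> / 2 * \<epsilon>; \<zeta> = (z^2) ^ Suc i in mat2 \<kappa> (\<kappa> * \<zeta>) (- \<kappa> * cnj \<zeta>) (- \<kappa>))"

text \<open>
 Write \<open>T(E + \<epsilon>) = T(E) + \<epsilon> e\<^sub>1\<^sub>1\<close>. The first term reproduces \<open>Q\<^sub>l\<close>, the second one is the conjugated perturbation.
\<close>

lemma Q_discrete_Suc:
 "Q_discrete E \<sigma> \<omega> n lam (Suc l) = Q_discrete E \<sigma> \<omega> n lam l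
   + Z ** kick (eps E \<sigma> \<omega> n lam (Suc l)) l ** matrix_inv Z ** Q_discrete E \<sigma> \<omega> n lam l"
proof -
 let ?\<epsilon> = "eps E \<sigma> \<omega> n lam (Suc l)" and ?M = "transfer_prod E \<sigma> \<omega> n lam l" and ?Q = "Q_discrete E \<sigma> \<omega> n lam l"
 let ?e = "mat2 ?\<epsilon> 0 0 0" and ?Zi = "matrix_inv Z"
 have Q: "?Q = Z ** twist l ** ?Zi ** ?M" by (simp add: Q_discrete_def inv_transfer_power)
 have tw: "untwist l ** twist l = mat 1"
  by (simp add: untwist_def twist_def mat2_mult mat2_1 z_mult_cnj flip: power_mult_distrib)
 have "Z ** untwist l ** ?Zi ** ?Q = Z ** untwist l ** (?Zi ** Z) ** twist l ** ?Zi ** ?M"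
  unfolding Q by (simp add: matrix_mul_assoc)
 also have "\<dots> = Z ** (untwist l ** twist l) ** ?Zi ** ?M" by (simp add: Z_inv_mult matrix_mul_assoc)
 finally have M: "?M = Z ** untwist l ** ?Zi ** ?Q" by (simp add: tw Z_inv_mult)
 have T: "transfer_matrix (of_real E + ?\<epsilon>) = transfer_matrix (of_real E) + ?e"
  by (simp add: transfer_matrix_def mat2_add)
 have zi: "?Zi ** transfer_matrix (of_real E) = untwist 1 ** ?Zi"
  unfolding Z_inv transfer_matrix_def untwist_def mat2_mult
  by (rule mat2_eqI) (use z_mult_cnj in \<open>simp_all add: z_add_cnj[symmetric] algebra_simps\<close>)
 have t1: "twist (Suc l) ** untwist 1 = twist l"
  unfolding twist_def untwist_def mat2_mult
  by (rule mat2_eqI) (simp_all add: z_mult_cnj mult.assoc mult.left_commute[of _ "cnj z"])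
 have a: "Z ** twist (Suc l) ** ?Zi ** transfer_matrix (of_real E) = Z ** twist l ** ?Zi"
 proof -
  have "Z ** twist (Suc l) ** ?Zi ** transfer_matrix (of_real E) = Z ** twist (Suc l) ** (?Zi ** transfer_matrix (of_real E))"
   by (simp add: matrix_mul_assoc)
  also have "\<dots> = Z ** (twist (Suc l) ** untwist 1) ** ?Zi" unfolding zi by (simp add: matrix_mul_assoc)
  finally show ?thesis by (simp only: t1)
 qed
 have k: "twist (Suc l) ** ?Zi ** ?e ** Z ** untwist l = kick ?\<epsilon> l"
 proof -
  have zz: "z ^ l * cnj z ^ l = 1" "cnj z ^ l * z ^ l = 1" by (simp_all add: z_mult_cnj flip: power_mult_distrib)
  have zz': "z ^ l * (cnj z ^ l * x) = x" "cnj z ^ l * (z ^ l * x) = x" "z * (cnj z * x) = x" for x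
   using zz z_mult_cnj by (simp_all flip: mult.assoc)
  show ?thesis
   unfolding Z_inv twist_def untwist_def mat2_mult kick_def Let_def unfolding Z_of_def mat2_mult
   by (rule mat2_eqI) (simp_all add: zz zz' z_mult_cnj power2_eq_square power_mult_distrib mult_ac)
 qed
 have "Q_discrete E \<sigma> \<omega> n lam (Suc l) = Z ** twist (Suc l) ** ?Zi ** ((transfer_matrix (of_real E) + ?e) ** ?M)"
  unfolding Q_discrete_def inv_transfer_power by (simp add: T)
 also have "\<dots> = Z ** twist (Suc l) ** ?Zi ** transfer_matrix (of_real E) ** ?M + Z ** twist (Suc l) ** ?Zi ** ?e ** ?M"
  by (simp add: matrix_mul_assoc matrix_add_ldistrib matrix_add_rdistrib)
 also have "Z ** twist (Suc l) ** ?Zi ** ?e ** ?M = Z ** twist (Suc l) ** ?Zi ** ?e ** (Z ** untwist l ** ?Zi ** ?Q)"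
  by (simp only: M[symmetric])
 also have "\<dots> = Z ** (twist (Suc l) ** ?Zi ** ?e ** Z ** untwist l) ** ?Zi ** ?Q"
  by (simp add: matrix_mul_assoc)
 finally show ?thesis unfolding a k Q[symmetric] .
qed

end

section \<open>The recursion for the transfer products\<close>

text \<open>
 For the filtration generated by the variables themselves, with index \<open>k\<close> for the first \<open>k\<close> of them.
\<close>

lemma (in prob_space) noise_if_indep_vars:
 fixes b :: "nat => 'a => real"
 assumes ind: "indep_vars (\<lambda>_. borel) b UNIV"
  and b: "\<And>i. integrable M (\<lambda>w. (b i w)^2)" "\<And>i. expectation (b i) = 0" "\<And>i. expectation (\<lambda>w. (b i w)^2) = 1"
 shows "\<exists>F. \<forall>N. noise_sequence M F b (\<lambda>_. 1) N"
proof -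
 let ?r = "\<lambda>K w. restrict (\<lambda>i. b i w) K"
 let ?P = "\<lambda>K :: nat set. PiM K (\<lambda>_. borel :: real measure)"
 define F where "F k = vimage_algebra (space M) (?r {..<k}) (?P {..<k})" for k
 have bm: "b i \<in> borel_measurable M" for i using ind by (auto simp: indep_vars_def)
 have rm: "?r K \<in> measurable M (?P K)" for K using bm by (intro measurable_restrict) auto
 have sF: "sets (F k) = {?r {..<k} -` A \<inter> space M | A. A \<in> sets (?P {..<k})}" for k
  unfolding F_def by (rule sets_vimage_algebra2) (use measurable_space[OF rm] in auto)
 have bF: "b i \<in> borel_measurable (F k)" if "i < k" for i k
 proof -
  have "?r {..<k} \<in> measurable (F k) (?P {..<k})"
   unfolding F_def by (rule measurable_vimage_algebra1) (use measurable_space[OF rm] in blast)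
  then have "(\<lambda>w. ?r {..<k} w i) \<in> borel_measurable (F k)"
   by (rule measurable_compose) (use that in \<open>simp add: measurable_component_singleton\<close>)
  then show ?thesis using that by simp
 qed
 have mono: "sets (F k) \<subseteq> sets (F l)" if "k \<le> l" for k l
 proof -
  have "?r {..<k} \<in> measurable (F l) (?P {..<k})" using bF that by (intro measurable_restrict) auto
  from measurable_sets[OF this] have "?r {..<k} -` A \<inter> space M \<in> sets (F l)" if "A \<in> sets (?P {..<k})" for A
   using that by (simp add: F_def)
  then show ?thesis unfolding sF[of k] by blast
 qed
 have "noise_sequence M F b (\<lambda>_. 1) N" for N
 proof (rule noise_if_indep)
  show "sets (F k) \<subseteq> events" for k unfolding sF using measurable_sets[OF rm] by auto
  show "indep_set (sets (F k)) {b k -` A \<inter> space M | A. A \<in> sets borel}" for k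
  proof -
   have "indep_var (?P {..<k}) (?r {..<k}) (?P {k}) (?r {k})"
    using indep_var_restrict[OF ind, of "{..<k}" "{k}"] by simp
   then have "indep_set (sigma_sets (space M) {?r {..<k} -` A \<inter> space M | A. A \<in> sets (?P {..<k})})
     (sigma_sets (space M) {?r {k} -` A \<inter> space M | A. A \<in> sets (?P {k})})"
    unfolding indep_var_eq by blast
   moreover have "sets (F k) \<subseteq> sigma_sets (space M) {?r {..<k} -` A \<inter> space M | A. A \<in> sets (?P {..<k})}"
    unfolding sF by auto
   moreover have "{b k -` A \<inter> space M | A. A \<in> sets borel} \<subseteq> sigma_sets (space M) {?r {k} -` A \<inter> space M | A. A \<in> sets (?P {k})}"
   proof safe
    fix A :: "real set" assume A: "A \<in> sets borel"
    have "(\<lambda>f. f k) -` A \<inter> space (?P {k}) \<in> sets (?P {k})"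
     by (rule measurable_sets[OF _ A]) simp
    moreover have "b k -` A \<inter> space M = ?r {k} -` ((\<lambda>f. f k) -` A \<inter> space (?P {k})) \<inter> space M"
     by (auto simp: space_PiM PiE_def extensional_def)
    ultimately show "b k -` A \<inter> space M \<in> sigma_sets (space M) {?r {k} -` A \<inter> space M | A. A \<in> sets (?P {k})}"
     by (intro sigma_sets.Basic) blast
   qed
   ultimately show ?thesis unfolding indep_sets2_eq by (meson subset_iff)
  qed
 qed (use bF mono b in \<open>auto simp: F_def\<close>)
 then show ?thesis by blast
qed

lemma noise_axis_sum: "noise u = (\<Sum>j\<in>UNIV. (u $ j) *\<^sub>R noise (axis j 1))"
 unfolding sum_3 noise_def Let_def mat2_scaleR mat2_add
 by (rule mat2_eqI) (simp_all add: axis_def complex_eq_iff scaleR_conv_of_real)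

lemma linear_bounded_nonneg:
 assumes "linear (f :: 'a::euclidean_space => 'b::real_normed_vector)"
 obtains c where "0 \<le> c" "\<And>x. norm (f x) \<le> c * norm x"
 using linear_bounded_pos[OF assms] by (metis less_imp_le)

context energy begin

definition dress :: "complex^2^2 => complex^2^2 => complex^2^2" where
 "dress G x = Z ** G ** matrix_inv Z ** x"

lemma dress_linear: "linear (\<lambda>G. dress G x)" "linear (dress G)"
proof -
 have "(\<lambda>G. dress G x) = (\<lambda>Y. Y ** x) \<circ> (\<lambda>Y. Y ** matrix_inv Z) \<circ> (\<lambda>G. Z ** G)" by (simp add: fun_eq_iff dress_def)
 then show "linear (\<lambda>G. dress G x)" by (simp only: linear_compose linear_matrix_mult_left linear_matrix_mult_right)
 show "linear (dress G)" unfolding dress_def by (rule linear_matrix_mult_right)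
qed

abbreviation "\<zeta> i \<equiv> (z^2) ^ Suc i"

text \<open>
 \<open>osc\<close> is the off-diagonal part of the drift, \<open>disp \<sigma> j\<close> the coefficient of the \<open>j\<close>-th Brownian motion at time \<open>0\<close>, and \<open>angle i\<close> the
 direction in which \<open>\<omega>\<^sub>i\<^sub>+\<^sub>1\<close> acts.
\<close>

definition osc :: "complex => nat => complex^2^2 => complex^2^2" where
 "osc lam i x = (1 / 2) *\<^sub>R dress (mat2 0 (\<i> * lam * \<zeta> i) (- \<i> * lam * cnj (\<zeta> i)) 0) x"

definition disp :: "real => 3 => complex^2^2 => complex^2^2" where
 "disp \<sigma> j x = (\<sigma> * \<rho> / 2) *\<^sub>R dress (noise (axis j 1)) x"

definition angle :: "nat => real^3" where
 "angle i = vector [- 1, sqrt 2 * Im (\<zeta> i), - (sqrt 2 * Re (\<zeta> i))]"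

abbreviation "gam t \<equiv> 1 / sqrt (1 - t)"

lemma drift_eq: "drift E lam x = (1 / 2) *\<^sub>R dress (mat2 (\<i> * lam) 0 0 (- \<i> * lam)) x"
 by (simp add: drift_def dress_def)

lemma drift_linear: "linear (drift E lam)"
 unfolding drift_eq[abs_def] by (rule linear_compose_scale_right[OF dress_linear(2)])

lemma osc_linear: "linear (osc lam i)"
 unfolding osc_def[abs_def] by (rule linear_compose_scale_right[OF dress_linear(2)])

lemma disp_linear: "linear (disp \<sigma> j)"
 unfolding disp_def[abs_def] by (rule linear_compose_scale_right[OF dress_linear(2)])

lemma diffusion_axis: "diffusion E \<sigma> t x (axis j 1) = gam t *\<^sub>R disp \<sigma> j x"
 using linear_cmul[OF dress_linear(1)[of x], of "\<sigma> * \<rho> / sqrt (1 - t)" "noise (axis j 1)"]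
 by (simp add: diffusion_def disp_def dress_def)

lemma norm_\<zeta>: "norm (\<zeta> i) = 1" using norm_z by (simp add: norm_power norm_mult)

lemma Re_Im_\<zeta>: "\<bar>Re (\<zeta> i)\<bar> \<le> 1" "\<bar>Im (\<zeta> i)\<bar> \<le> 1"
 using abs_Re_le_cmod[of "\<zeta> i"] abs_Im_le_cmod[of "\<zeta> i"] norm_\<zeta>[of i] by simp_all

lemma angle_bound: "\<bar>angle i $ j\<bar> \<le> sqrt 2"
 using Re_Im_\<zeta>[of i] exhaust_3[of j] mult_left_mono[of _ 1 "sqrt 2"]
 by (auto simp: angle_def abs_mult)

text \<open>
 The variable \<open>\<omega>\<close> multiplies \<open>- \<i>\<close> times the matrix with entries \<open>1\<close>, \<open>\<zeta>\<close>, \<open>- cnj \<zeta>\<close>, \<open>-1\<close>, which is the noise matrix for the direction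
 \<open>angle i\<close>, up to the scalar \<open>\<sigma>\<rho> / (2 sqrt (n + 1 - l))\<close>. Moreover \<open>n + 1 - l = n (1 - i/n)\<close> for \<open>l = i + 1\<close>.
\<close>

lemma kick_eps:
 assumes n: "0 < n"
 shows "kick (eps E \<sigma> \<omega> n lam (Suc i)) i
  = (1 / real n) *\<^sub>R ((1 / 2) *\<^sub>R mat2 (\<i> * lam) 0 0 (- \<i> * lam) + (1 / 2) *\<^sub>R mat2 0 (\<i> * lam * \<zeta> i) (- \<i> * lam * cnj (\<zeta> i)) 0)
   + \<omega> (Suc i) *\<^sub>R ((gam (real i / real n) / sqrt (real n)) *\<^sub>R ((\<sigma> * \<rho> / 2) *\<^sub>R noise (angle i)))"
proof -
 define s where "s = sqrt (real n - real i)"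
 have s: "gam (real i / real n) / sqrt (real n) = 1 / s"
 proof -
  have "sqrt (1 - real i / real n) * sqrt (real n) = s"
   unfolding s_def real_sqrt_mult[symmetric] using n by (simp add: left_diff_distrib)
  then show ?thesis by simp
 qed
 have e: "\<i> * \<rho> / 2 * eps E \<sigma> \<omega> n lam (Suc i) = of_real (1 / real n) * (\<i> * lam / 2) - of_real (\<omega> (Suc i) / s * (\<sigma> * \<rho> / 2)) * \<i>"
  using rho_pos n by (simp add: eps_def potential_def s_def field_simps)
 have w: "Complex (angle i $ 2) (angle i $ 3) / of_real (sqrt 2) = - \<i> * \<zeta> i"
  by (simp add: complex_eq_iff angle_def)
 have a1: "angle i $ 1 = - 1" by (simp add: angle_def)
 show ?thesis
  unfolding kick_def Let_def e s noise_def w a1 mat2_scaleR mat2_add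
  by (rule mat2_eqI) (simp_all add: scaleR_conv_of_real algebra_simps)
qed

lemma Q_discrete_evolve:
 assumes n: "0 < n"
 shows "Q_discrete E \<sigma> \<omega> n lam i = evolve (drift E lam) (osc lam) (disp \<sigma>) angle (\<lambda>t. gam t) (mat 1) n (\<lambda>i. \<omega> (Suc i)) i"
proof (induction i)
 case 0
 show ?case by (simp add: Q_discrete_def)
next
 case (Suc i)
 let ?x = "Q_discrete E \<sigma> \<omega> n lam i" and ?g = "gam (real i / real n) / sqrt (real n)"
 have "Q_discrete E \<sigma> \<omega> n lam (Suc i) = ?x + dress (kick (eps E \<sigma> \<omega> n lam (Suc i)) i) ?x"
  unfolding dress_def by (rule Q_discrete_Suc)
 also have "dress (kick (eps E \<sigma> \<omega> n lam (Suc i)) i) ?x = (1 / real n) *\<^sub>R (drift E lam ?x + osc lam i ?x)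
   + \<omega> (Suc i) *\<^sub>R (?g *\<^sub>R ((\<sigma> * \<rho> / 2) *\<^sub>R dress (noise (angle i)) ?x))"
  unfolding kick_eps[OF n] drift_eq osc_def by (simp only: linear_add[OF dress_linear(1)] linear_cmul[OF dress_linear(1)])
 also have "(\<sigma> * \<rho> / 2) *\<^sub>R dress (noise (angle i)) ?x = (\<Sum>j\<in>UNIV. (angle i $ j) *\<^sub>R disp \<sigma> j ?x)"
  unfolding disp_def by (subst noise_axis_sum)
   (simp add: linear_sum[OF dress_linear(1)] linear_cmul[OF dress_linear(1)] scaleR_sum_right mult.commute)
 finally show ?case by (simp add: Suc.IH)
qed

lemma osc_eq: "osc lam i x = Re (\<zeta> i) *\<^sub>R ((1 / 2) *\<^sub>R dress (mat2 0 (\<i> * lam) (- \<i> * lam) 0) x)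
  + Im (\<zeta> i) *\<^sub>R ((1 / 2) *\<^sub>R dress (mat2 0 (- lam) (- lam) 0) x)"
proof -
 have "mat2 0 (\<i> * lam * w) (- \<i> * lam * cnj w) 0 = Re w *\<^sub>R mat2 0 (\<i> * lam) (- \<i> * lam) 0 + Im w *\<^sub>R mat2 0 (- lam) (- lam) 0" for w
  unfolding mat2_scaleR mat2_add
  by (rule mat2_eqI) (simp_all add: complex_eq_iff algebra_simps)
 from this[of "\<zeta> i"] show ?thesis unfolding osc_def
  by (simp add: linear_add[OF dress_linear(1)] linear_cmul[OF dress_linear(1)] scaleR_add_right mult.commute)
qed

text \<open>
 By \<open>osc_eq\<close> the sums only depend on the geometric sums of \<open>\<zeta>\<close>.
\<close>

lemma osc_bounds:
 obtains c where "0 \<le> c" "\<And>i x. norm (osc lam i x) \<le> c * norm x" "\<And>p q x. norm (\<Sum>i\<in>{p..<q}. osc lam i x) \<le> c * norm x"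
proof -
 let ?f = "\<lambda>x. (1 / 2) *\<^sub>R dress (mat2 0 (\<i> * lam) (- \<i> * lam) 0) x" and ?g = "\<lambda>x. (1 / 2) *\<^sub>R dress (mat2 0 (- lam) (- lam) 0) x"
 have l: "linear ?f" "linear ?g" by (rule linear_compose_scale_right[OF dress_linear(2)])+
 obtain c1 where c1: "0 \<le> c1" "\<And>x. norm (?f x) \<le> c1 * norm x" by (rule linear_bounded_nonneg[OF l(1)]) blast
 obtain c2 where c2: "0 \<le> c2" "\<And>x. norm (?g x) \<le> c2 * norm x" by (rule linear_bounded_nonneg[OF l(2)]) blast
 define m where "m = max 1 (2 / norm (1 - z^2))"
 have m: "1 \<le> m" "2 / norm (1 - z^2) \<le> m" by (simp_all add: m_def)
 have key: "norm (r *\<^sub>R ?f x + s *\<^sub>R ?g x) \<le> (m * (c1 + c2)) * norm x" if "\<bar>r\<bar> \<le> m" "\<bar>s\<bar> \<le> m" for r s x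
 proof -
  have "norm (r *\<^sub>R ?f x) \<le> m * (c1 * norm x)" "norm (s *\<^sub>R ?g x) \<le> m * (c2 * norm x)"
   unfolding norm_scaleR[of r] norm_scaleR[of s] using that m by (intro mult_mono c1(2) c2(2) norm_ge_zero; linarith)+
  then have "norm (r *\<^sub>R ?f x + s *\<^sub>R ?g x) \<le> m * (c1 * norm x) + m * (c2 * norm x)" by (rule norm_triangle_mono)
  then show ?thesis by (simp add: algebra_simps)
 qed
 show ?thesis
 proof
  show "0 \<le> m * (c1 + c2)" using m c1 c2 by simp
  show "norm (osc lam i x) \<le> m * (c1 + c2) * norm x" for i x
   unfolding osc_eq by (rule key) (use Re_Im_\<zeta>[of i] m in linarith)+
  show "norm (\<Sum>i\<in>{p..<q}. osc lam i x) \<le> m * (c1 + c2) * norm x" for p q x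
  proof -
   have *: "(\<Sum>i\<in>{p..<q}. osc lam i x) = Re (\<Sum>i\<in>{p..<q}. \<zeta> i) *\<^sub>R ?f x + Im (\<Sum>i\<in>{p..<q}. \<zeta> i) *\<^sub>R ?g x"
    unfolding osc_eq sum.distrib scaleR_sum_left[symmetric] Re_sum Im_sum ..
   have b: "norm (\<Sum>i\<in>{p..<q}. \<zeta> i) \<le> 2 / norm (1 - z^2)"
    by (rule geometric_sum_bounded) (use z_square_ne norm_z in \<open>simp_all add: norm_power\<close>)
   show ?thesis unfolding *
    by (rule key) (use b m abs_Re_le_cmod[of "\<Sum>i\<in>{p..<q}. \<zeta> i"] abs_Im_le_cmod[of "\<Sum>i\<in>{p..<q}. \<zeta> i"] in linarith)+
  qed
 qed
qed

text \<open>
 The square of \<open>v \<bullet> angle i\<close> is \<open>\<bar>v\<bar>\<^sup>2\<close> plus the real part of a combination of \<open>\<zeta>\<close> and \<open>\<zeta>\<^sup>2\<close>, whose sums are bounded. The factor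
 \<open>sqrt 2\<close> in the definition of \<open>angle\<close> compensates that squares of sine and cosine average to \<open>1/2\<close>.
\<close>

lemma angle_average:
 "\<exists>D. \<forall>p q. p \<le> q \<longrightarrow> \<bar>(\<Sum>i\<in>{p..<q}. (\<Sum>j\<in>UNIV. v j * angle i $ j)^2) - real (q - p) * (\<Sum>j\<in>UNIV. (v j)^2)\<bar> \<le> D"
proof -
 (* The coefficients of \<zeta> and \<zeta>^2 in the square. *)
 define c1 where "c1 = 2 * sqrt 2 * Complex (v 1 * v 3) (v 1 * v 2)"
 define c2 where "c2 = Complex ((v 3)^2 - (v 2)^2) (2 * v 2 * v 3)"
 have e: "(\<Sum>j\<in>UNIV. v j * angle i $ j)^2 = (\<Sum>j\<in>UNIV. (v j)^2) + Re (c1 * \<zeta> i + c2 * ((z^2)^2) ^ Suc i)" for i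
 proof -
  define x y where "x = Re (\<zeta> i)" and "y = Im (\<zeta> i)"
  have \<zeta>: "\<zeta> i = Complex x y" by (simp add: x_def y_def complex_eq_iff del: power_Suc)
  have xy: "y^2 = 1 - x^2" using norm_\<zeta>[of i] unfolding \<zeta> by (simp add: cmod_def)
  have z2: "((z^2)^2) ^ Suc i = Complex (x^2 - y^2) (2 * x * y)"
  proof -
   have "((z^2)^2) ^ Suc i = (\<zeta> i)^2" by (simp only: power_mult[symmetric] mult_ac)
   then show ?thesis unfolding \<zeta> by (simp add: complex_eq_iff power2_eq_square)
  qed
  have "(\<Sum>j\<in>UNIV. v j * angle i $ j) = - v 1 + sqrt 2 * (v 2 * y - v 3 * x)"
   by (simp add: sum_3 angle_def x_def y_def algebra_simps del: power_Suc)
  moreover have "(- v 1 + sqrt 2 * t)^2 = (v 1)^2 + 2 * t^2 - 2 * sqrt 2 * v 1 * t" for t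
   by (simp add: power2_diff power_mult_distrib)
  ultimately have "(\<Sum>j\<in>UNIV. v j * angle i $ j)^2 = (v 1)^2 + 2 * (v 2 * y - v 3 * x)^2 - 2 * sqrt 2 * v 1 * (v 2 * y - v 3 * x)"
   by simp
  also have "2 * (v 2 * y - v 3 * x)^2 = (v 2)^2 * (2 * y^2) + (v 3)^2 * (2 * x^2) - 4 * v 2 * v 3 * x * y"
   by (simp add: power2_eq_square algebra_simps)
  also have "2 * y^2 = 1 - (x^2 - y^2)" using xy by simp
  also have "2 * x^2 = 1 + (x^2 - y^2)" using xy by simp
  finally show ?thesis unfolding z2 \<zeta> c1_def c2_def sum_3 by (simp add: algebra_simps)
 qed
 have "\<bar>(\<Sum>i\<in>{p..<q}. (\<Sum>j\<in>UNIV. v j * angle i $ j)^2) - real (q - p) * (\<Sum>j\<in>UNIV. (v j)^2)\<bar>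
   \<le> norm c1 * (2 / norm (1 - z^2)) + norm c2 * (2 / norm (1 - (z^2)^2))" for p q
 proof -
  let ?S1 = "\<Sum>i\<in>{p..<q}. \<zeta> i" and ?S2 = "\<Sum>i\<in>{p..<q}. ((z^2)^2) ^ Suc i"
  have b1: "norm ?S1 \<le> 2 / norm (1 - z^2)" by (rule geometric_sum_bounded) (use z_square_ne norm_z in \<open>simp_all add: norm_power\<close>)
  have b2: "norm ?S2 \<le> 2 / norm (1 - (z^2)^2)" by (rule geometric_sum_bounded) (use z_square_ne norm_z in \<open>simp_all add: norm_power\<close>)
  have "(\<Sum>i\<in>{p..<q}. (\<Sum>j\<in>UNIV. v j * angle i $ j)^2) - real (q - p) * (\<Sum>j\<in>UNIV. (v j)^2) = Re (c1 * ?S1 + c2 * ?S2)"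
   unfolding e sum.distrib Re_sum[symmetric] sum_distrib_left[symmetric] by simp
  then have "\<bar>(\<Sum>i\<in>{p..<q}. (\<Sum>j\<in>UNIV. v j * angle i $ j)^2) - real (q - p) * (\<Sum>j\<in>UNIV. (v j)^2)\<bar> \<le> norm (c1 * ?S1 + c2 * ?S2)"
   by (simp only: abs_Re_le_cmod)
  also have "\<dots> \<le> norm c1 * norm ?S1 + norm c2 * norm ?S2" by (rule order_trans[OF norm_triangle_ineq]) (simp only: norm_mult)
  also have "\<dots> \<le> norm c1 * (2 / norm (1 - z^2)) + norm c2 * (2 / norm (1 - (z^2)^2))"
   by (intro add_mono mult_left_mono b1 b2 norm_ge_zero)
  finally show ?thesis .
 qed
 then show ?thesis by blast
qed

end

section \<open>Convergence of coupled recursions\<close>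

lemma path_Lipschitz_mono:
 assumes "path_Lipschitz T L f" "0 \<le> T" "T \<le> T'" shows "path_Lipschitz T' L f"
proof -
 have "path_dist T u v \<le> path_dist T' u v" for u v :: "real => 'a"
  by (rule path_dist_least[OF assms(2)], rule path_dist_upper) (use assms in auto)
 then show ?thesis using assms(1) unfolding path_Lipschitz_def by (meson mult_left_mono order_trans)
qed

lemma path_Lipschitz_bounded:
 assumes "path_Lipschitz T L f" "0 \<le> T"
 shows "\<exists>G. \<forall>u\<in>paths. \<bar>f u\<bar> \<le> G"
proof -
 define u0 :: "real => 'a" where "u0 = (\<lambda>t\<in>{0..<1}. undefined)"
 have u0: "u0 \<in> paths" by (simp add: u0_def)
 have "\<bar>f u\<bar> \<le> \<bar>f u0\<bar> + L" if u: "u \<in> paths" for u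
 proof -
  have L: "0 \<le> L" "\<bar>f u - f u0\<bar> \<le> L * path_dist T u u0" using assms u u0 by (auto simp: path_Lipschitz_def)
  have "L * path_dist T u u0 \<le> L * 1" using L path_dist_le_1[OF assms(2)] by (intro mult_left_mono) auto
  then show ?thesis using L by linarith
 qed
 then show ?thesis by blast
qed

text \<open>
 The distance is at most \<open>1\<close> on the exceptional event.
\<close>

lemma (in prob_space) expectation_path_Lipschitz_close:
 assumes \<phi>: "path_Lipschitz T L \<phi>" and T: "0 \<le> T" "T < 1"
  and U: "U \<in> measurable M (borel_of (uniform_on_compacts {0..<1}))" and V: "V \<in> measurable M (borel_of (uniform_on_compacts {0..<1}))"
  and p: "\<And>w. U w \<in> paths" "\<And>w. V w \<in> paths"
  and Bad: "Bad \<in> events" "prob Bad \<le> e" and a: "\<And>w. w \<in> space M - Bad ==> path_dist T (U w) (V w) \<le> a" and a0: "0 \<le> a"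
 shows "\<bar>expectation (\<lambda>w. \<phi> (U w)) - expectation (\<lambda>w. \<phi> (V w))\<bar> \<le> L * (a + e)"
proof -
 have L: "0 \<le> L" "\<And>w. \<bar>\<phi> (U w) - \<phi> (V w)\<bar> \<le> L * path_dist T (U w) (V w)" using \<phi> p by (auto simp: path_Lipschitz_def)
 obtain G where G: "\<And>u. u \<in> paths ==> \<bar>\<phi> u\<bar> \<le> G" using path_Lipschitz_bounded[OF \<phi> T(1)] by blast
 have c: "continuous_map (uniform_on_compacts {0..<1}) euclideanreal \<phi>" by (rule path_Lipschitz_continuous_map[OF \<phi> T])
 have iU: "integrable M (\<lambda>w. \<phi> (U w))" by (rule integrable_const_bound[of _ G]) (use G p continuous_map_borel_of[OF U c] in auto)
 have iV: "integrable M (\<lambda>w. \<phi> (V w))" by (rule integrable_const_bound[of _ G]) (use G p continuous_map_borel_of[OF V c] in auto)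
 have iB: "integrable M (\<lambda>w. L * (a + indicator Bad w))" using Bad by (intro integrable_mult_right Bochner_Integration.integrable_add) (auto simp: emeasure_eq_measure)
 have "\<bar>expectation (\<lambda>w. \<phi> (U w)) - expectation (\<lambda>w. \<phi> (V w))\<bar> = \<bar>expectation (\<lambda>w. \<phi> (U w) - \<phi> (V w))\<bar>" using iU iV by simp
 also have "\<dots> \<le> expectation (\<lambda>w. \<bar>\<phi> (U w) - \<phi> (V w)\<bar>)" using integral_norm_bound[of M "\<lambda>w. \<phi> (U w) - \<phi> (V w)"] by simp
 also have "\<dots> \<le> expectation (\<lambda>w. L * (a + indicator Bad w))"
 proof (rule integral_mono[OF _ iB])
  show "integrable M (\<lambda>w. \<bar>\<phi> (U w) - \<phi> (V w)\<bar>)" using iU iV by (intro integrable_abs Bochner_Integration.integrable_diff)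
  fix w assume w: "w \<in> space M"
  have "path_dist T (U w) (V w) \<le> a + indicator Bad w"
   using a[of w] a0 w path_dist_le_1[OF T(1), of "U w" "V w"] by (cases "w \<in> Bad") auto
  then show "\<bar>\<phi> (U w) - \<phi> (V w)\<bar> \<le> L * (a + indicator Bad w)" using L(2)[of w] mult_left_mono[OF _ L(1)] by (meson order_trans)
 qed
 also have "\<dots> = L * (a + prob Bad)" using Bad by (simp add: prob_space emeasure_eq_measure)
 also have "\<dots> \<le> L * (a + e)" using Bad L by (intro mult_left_mono) auto
 finally show ?thesis .
qed

lemma norm_vec_le_sum: "norm (x :: 'v::real_normed_vector^'i) \<le> (\<Sum>i\<in>UNIV. norm (x $ i))"
 unfolding norm_vec_def by (rule L2_set_le_sum) simp

lemma dist_vec_le: "(\<And>i. dist (x $ i) (y $ i) \<le> a) ==> dist x (y :: 'v::real_normed_vector^'i) \<le> real CARD('i) * a"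
 using order_trans[OF norm_vec_le_sum[of "x - y"] sum_bounded_above[of UNIV "\<lambda>i. norm ((x - y) $ i)" a]] by (simp add: dist_norm)

lemma borel_measurable_vec_lambda:
 fixes f :: "'i::finite => 'a => 'v::euclidean_space"
 assumes "\<And>i. f i \<in> borel_measurable M" shows "(\<lambda>w. \<chi> i. f i w) \<in> borel_measurable M"
proof -
 have l: "linear (axis i :: 'v => 'v^'i)" for i by (rule linearI) (simp_all add: vec_eq_iff axis_def)
 have "(\<lambda>w. \<chi> i. f i w) = (\<lambda>w. \<Sum>i\<in>UNIV. axis i (f i w))"
  by (simp add: fun_eq_iff vec_eq_iff axis_def if_distrib cong: if_cong)
 then show ?thesis by (simp only:) (intro borel_measurable_sum borel_measurable_linear[OF l] assms)
qed

lemma Euler_scheme_cong: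
 "(\<And>i. i < k ==> b i = b' i) ==> Euler_scheme h A C y\<^sub>0 b k = Euler_scheme h A C y\<^sub>0 b' k"
 by (induction k) auto

lemma Euler_scheme_continuous:
 fixes A :: "'v => 'v::euclidean_space" and C :: "nat => 'd::finite => 'v => 'v"
 assumes A: "linear A" and C: "\<And>i j. linear (C i j)"
 shows "continuous_on UNIV (\<lambda>c :: nat \<times> 'd => real. Euler_scheme h A C y\<^sub>0 (\<lambda>k. \<chi> j. c (k, j)) k)"
proof (induction k)
 case (Suc k)
 have l: "continuous_on UNIV (\<lambda>c :: nat \<times> 'd => real. f (Euler_scheme h A C y\<^sub>0 (\<lambda>k. \<chi> j. c (k, j)) k))" if "linear f" for f :: "'v => 'v"
  by (rule continuous_on_compose2[OF linear_continuous_on[where s=UNIV] Suc]) (use that in \<open>simp_all add: linear_conv_bounded_linear\<close>)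
 show ?case
  by (simp, intro continuous_intros l A C Suc continuous_on_sum continuous_on_scaleR continuous_on_product_coordinates)
qed simp

text \<open>
 Finitely many recursions, driven by the same noise in the same directions, and the corresponding equations, driven by the
 same Brownian motion. They differ in the drift and in the oscillating terms.
\<close>

locale coupled_evolutions = brownian_motion P F' B
 for P :: "'p measure" and F' :: "real => 'p measure" and B :: "real => 'p => real^'d" +
 fixes M :: "'w measure" and F :: "nat => 'w measure" and b :: "nat => 'w => real" and C3 :: real
  and A :: "'i::finite => 'v::euclidean_space => 'v" and Os :: "'i => nat => 'v => 'v" and C :: "'d => 'v => 'v"
  and u :: "nat => real^'d" and \<gamma> :: "real => real" and y\<^sub>0 :: 'v and c :: "'i => real" and \<upsilon> :: real
  and S :: "real => 'v => real^'d => 'v" and Y :: "'i => real => 'p => 'v"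
 assumes disc: "\<And>i T. 0 < T ==> T < 1 ==> \<exists>\<Gamma>. discrete_evolution M F b C3 (A i) (Os i) C u \<gamma> (c i) \<upsilon> \<Gamma> T"
  and sde: "\<And>i. linear_sde P F' B (A i) C \<gamma> S y\<^sub>0 (Y i) (c i)"
  and ind: "prob_space.indep_vars M (\<lambda>_. borel) b UNIV" and mean: "\<And>i. prob_space.expectation M (b i) = 0"
  and sq: "\<And>i. integrable M (\<lambda>w. (b i w)^2)" and var: "\<And>i. prob_space.expectation M (\<lambda>w. (b i w)^2) = 1"
  and avg: "\<And>v. \<exists>D. \<forall>p q. p \<le> q \<longrightarrow> \<bar>(\<Sum>i\<in>{p..<q}. (\<Sum>j\<in>UNIV. v j * u i $ j)^2) - real (q - p) * (\<Sum>j\<in>UNIV. (v j)^2)\<bar> \<le> D"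
begin

text \<open>
 \<open>Euler_path T K\<close> maps noise increments, indexed by cell and coordinate, to the path of the Euler scheme that is constant on
 cells. Beyond time \<open>T\<close> it keeps its last value, so it takes at most \<open>K + 1\<close> values.
\<close>

definition "disc_path n w = (\<lambda>t\<in>{0..<1}. \<chi> i. evolve (A i) (Os i) C u \<gamma> y\<^sub>0 n (\<lambda>m. b m w) (nat \<lfloor>real n * t\<rfloor>))"
definition "sde_path w = (\<lambda>t\<in>{0..<1}. \<chi> i. Y i t w)"

definition "Euler_at T K i x k = Euler_scheme (mesh T K) (A i) (grid_coeff \<gamma> C T K) y\<^sub>0 (\<lambda>k. \<chi> j. x (k, j)) k"
definition "cell_of T K t = min K (nat \<lfloor>t / mesh T K\<rfloor>)"
definition "Euler_path T K x = (\<lambda>t\<in>{0..<1}. \<chi> i. Euler_at T K i x (cell_of T K t))"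

definition "disc_incr T n K w = (\<lambda>(k, j). \<Sum>i\<in>{cell T K n k..<cell T K n (Suc k)}. b i w * (u i $ j / sqrt (real n)))"
definition "sde_incr T K w = (\<lambda>(k, j). grid_incr B T K k w $ j)"

lemma C_linear: "linear (C j)" using linear_sde.C(1)[OF sde] .
lemma A_linear: "linear (A i)" using linear_sde.A(1)[OF sde] .

lemma coeff_lin: "linear (grid_coeff \<gamma> C T K i j)"
 unfolding grid_coeff_def by (rule linear_compose_scale_right[OF C_linear])

lemma M_prob: "prob_space M"
proof -
 obtain \<Gamma> where "discrete_evolution M F b C3 (A undefined) (Os undefined) C u \<gamma> (c undefined) \<upsilon> \<Gamma> (1/2)" using disc[of "1/2" undefined] by force
 then interpret D: discrete_evolution M F b C3 "A undefined" "Os undefined" C u \<gamma> y\<^sub>0 "c undefined" \<upsilon> \<Gamma> "1/2" .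
 show ?thesis by (rule D.prob_space_axioms)
qed

sublocale M: prob_space M by (rule M_prob)

lemma b_measurable: "b i \<in> borel_measurable M" using ind by (auto simp: M.indep_vars_def)

lemma evolve_measurable: "(\<lambda>w. evolve (A i) (Os i) C u \<gamma> y\<^sub>0 n (\<lambda>m. b m w) k) \<in> borel_measurable M"
proof -
 obtain \<Gamma> where "discrete_evolution M F b C3 (A i) (Os i) C u \<gamma> (c i) \<upsilon> \<Gamma> (1/2)" using disc[of "1/2"] by force
 then interpret D: discrete_evolution M F b C3 "A i" "Os i" C u \<gamma> y\<^sub>0 "c i" \<upsilon> \<Gamma> "1/2" .
 show ?thesis using D.measurable_F_M[OF D.X_adapted[of n k]] by (simp add: D.X_def[abs_def])
qed

lemma disc_path_measurable: "disc_path n \<in> measurable M (borel_of (uniform_on_compacts {0..<1}))"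
proof -
 have "(\<lambda>w. \<lambda>t\<in>{0..<1}. (\<lambda>k w. \<chi> i. evolve (A i) (Os i) C u \<gamma> y\<^sub>0 n (\<lambda>m. b m w) k) (nat \<lfloor>real n * t\<rfloor>) w)
   \<in> measurable M (borel_of (uniform_on_compacts {0..<1}))"
 proof (rule measurable_step_path[where N=n])
  show "(\<lambda>w. \<chi> i. evolve (A i) (Os i) C u \<gamma> y\<^sub>0 n (\<lambda>m. b m w) k) \<in> borel_measurable M" for k
   by (rule borel_measurable_vec_lambda[OF evolve_measurable])
  fix t :: real assume t: "t \<in> {0..<1}"
  then have "real n * t \<le> real n * 1" by (intro mult_left_mono) auto
  then show "nat \<lfloor>real n * t\<rfloor> \<le> n" by linarith
 qed
 then show ?thesis by (simp add: disc_path_def[abs_def])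
qed

lemma sde_path_measurable: "sde_path \<in> measurable P (borel_of (uniform_on_compacts {0..<1}))"
proof -
 have "(\<lambda>w. \<lambda>t\<in>{0..<1}. (\<lambda>t w. \<chi> i. Y i t w) t w) \<in> measurable P (borel_of (uniform_on_compacts {0..<1}))"
  by (rule measurable_continuous_path)
   (intro borel_measurable_vec_lambda continuous_on_vec_lambda linear_sde.Y_measurable[OF sde] linear_sde.Y_continuous[OF sde]; assumption)+
 then show ?thesis by (simp add: sde_path_def[abs_def])
qed

lemma Euler_path_measurable:
 assumes x: "\<And>k j. (\<lambda>w. x w (k, j)) \<in> borel_measurable N"
 shows "(\<lambda>w. Euler_path T K (x w)) \<in> measurable N (borel_of (uniform_on_compacts {0..<1}))"
proof -
 have "(\<lambda>w. \<lambda>t\<in>{0..<1}. (\<lambda>k w. \<chi> i. Euler_at T K i (x w) k) (cell_of T K t) w) \<in> measurable N (borel_of (uniform_on_compacts {0..<1}))"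
 proof (rule measurable_step_path[where N=K])
  show "(\<lambda>w. \<chi> i. Euler_at T K i (x w) k) \<in> borel_measurable N" for k
   unfolding Euler_at_def
   by (intro borel_measurable_vec_lambda Euler_scheme_adapted A_linear coeff_lin) (simp add: x)
 qed (simp add: cell_of_def)
 then show ?thesis by (simp add: Euler_path_def)
qed

lemma paths_in: "disc_path n w \<in> paths" "sde_path w' \<in> paths" "Euler_path T K x \<in> paths"
 by (simp_all add: disc_path_def sde_path_def Euler_path_def)

lemma disc_incr_measurable: "(\<lambda>w. disc_incr T n K w (k, j)) \<in> borel_measurable M"
 unfolding disc_incr_def using b_measurable by simp

lemma sde_incr_measurable:
 assumes "0 < T" shows "(\<lambda>w. sde_incr T K w (k, j)) \<in> borel_measurable P"
proof -
 have "(\<lambda>w. B (real m * mesh T K) w) \<in> borel_measurable P" for m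
  by (rule F_measurable_imp[OF adapted]) (use assms in \<open>simp add: mesh_def\<close>)
 from borel_measurable_diff[OF this[of "Suc k"] this[of k]] show ?thesis
  unfolding sde_incr_def grid_incr_def prod.case by (rule borel_measurable_vec_nth)
qed

lemma cell_of_bounds:
 assumes T: "0 < T" and K: "0 < K" and t: "t \<in> {0..T}"
 shows "cell_of T K t \<le> K" "real (cell_of T K t) * mesh T K \<le> t" "t \<le> real (if cell_of T K t < K then Suc (cell_of T K t) else cell_of T K t) * mesh T K"
proof -
 have h: "0 < mesh T K" "real K * mesh T K = T" using T K by (auto simp: mesh_def)
 define m where "m = nat \<lfloor>t / mesh T K\<rfloor>"
 have q: "0 \<le> t / mesh T K" using t h by simp
 then have m: "real m \<le> t / mesh T K" "t / mesh T K < real m + 1" unfolding m_def by linarith+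
 have "t < (real m + 1) * mesh T K" using m(2) h by (simp add: pos_divide_less_eq)
 then have m': "real m * mesh T K \<le> t" "t \<le> real (Suc m) * mesh T K"
  using m(1) h by (simp_all add: pos_le_divide_eq add.commute)
 show "cell_of T K t \<le> K" by (simp add: cell_of_def)
 have "real m * mesh T K \<le> real K * mesh T K" using m'(1) t h(2) by simp
 then have "real m \<le> real K" by (rule mult_right_le_imp_le[OF _ h(1)])
 then have mK: "m \<le> K" by simp
 then have c: "cell_of T K t = m" by (simp add: cell_of_def m_def)
 show "real (cell_of T K t) * mesh T K \<le> t" using m' c by simp
 show "t \<le> real (if cell_of T K t < K then Suc (cell_of T K t) else cell_of T K t) * mesh T K"
  using m'(2) c mK t h by auto
qed

text \<open>
 The scheme depends continuously on the increments at each of the \<open>K + 1\<close> grid points.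
\<close>

lemma Euler_path_continuous:
 assumes \<phi>: "path_Lipschitz T L \<phi>" and T: "0 < T" "T < 1"
 shows "continuous_on UNIV (\<lambda>x. \<phi> (Euler_path T K x))"
proof -
 let ?E = "\<lambda>x k. \<chi> i. Euler_at T K i x k"
 have E: "continuous_on UNIV (\<lambda>x. ?E x k)" for k
  unfolding Euler_at_def by (intro continuous_on_vec_lambda Euler_scheme_continuous A_linear coeff_lin)
 have L: "0 \<le> L" "\<bar>\<phi> (Euler_path T K x) - \<phi> (Euler_path T K y)\<bar> \<le> L * path_dist T (Euler_path T K x) (Euler_path T K y)" for x y
  using \<phi> paths_in by (auto simp: path_Lipschitz_def)
 have d: "path_dist T (Euler_path T K x) (Euler_path T K y) \<le> (\<Sum>k\<le>K. dist (?E x k) (?E y k))" for x y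
 proof (rule path_dist_least)
  fix t assume t: "t \<in> {0..T}"
  then have "dist (Euler_path T K x t) (Euler_path T K y t) = dist (?E x (cell_of T K t)) (?E y (cell_of T K t))"
   using T by (simp add: Euler_path_def)
  also have "\<dots> \<le> (\<Sum>k\<le>K. dist (?E x k) (?E y k))"
   by (rule member_le_sum) (auto simp: cell_of_def)
  finally show "min 1 (dist (Euler_path T K x t) (Euler_path T K y t)) \<le> (\<Sum>k\<le>K. dist (?E x k) (?E y k))" by linarith
 qed (use T in simp)
 show ?thesis
  unfolding continuous_on_def
 proof
  fix y
  have "((\<lambda>x. ?E x k) \<longlongrightarrow> ?E y k) (at y)" for k using E[of k] by (simp add: continuous_on_def)
  then have "((\<lambda>x. L * (\<Sum>k\<le>K. dist (?E x k) (?E y k))) \<longlongrightarrow> L * (\<Sum>k\<le>K. dist (?E y k) (?E y k))) (at y)"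
   by (intro tendsto_mult tendsto_const tendsto_sum tendsto_dist)
  then have "((\<lambda>x. L * (\<Sum>k\<le>K. dist (?E x k) (?E y k))) \<longlongrightarrow> 0) (at y)" by simp
  then have "((\<lambda>x. \<phi> (Euler_path T K x) - \<phi> (Euler_path T K y)) \<longlongrightarrow> 0) (at y)"
   by (rule Lim_null_comparison[rotated])
    (use order_trans[OF L(2) mult_left_mono[OF d L(1)]] in \<open>simp add: always_eventually\<close>)
  then show "((\<lambda>x. \<phi> (Euler_path T K x)) \<longlongrightarrow> \<phi> (Euler_path T K y)) (at y within UNIV)"
   by (simp add: LIM_zero_iff)
 qed
qed

lemma Euler_paths_converge:
 assumes \<phi>: "path_Lipschitz T L \<phi>" and T: "0 < T" "T < 1" and K: "0 < K"
 shows "(\<lambda>n. M.expectation (\<lambda>w. \<phi> (Euler_path T K (disc_incr T n K w)))) \<longlonglongrightarrow> expectation (\<lambda>w. \<phi> (Euler_path T K (sde_incr T K w)))"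
proof -
 obtain \<Gamma> where "discrete_evolution M F b C3 (A undefined) (Os undefined) C u \<gamma> (c undefined) \<upsilon> \<Gamma> T" using disc[OF T, of undefined] by blast
 then interpret D: discrete_evolution M F b C3 "A undefined" "Os undefined" C u \<gamma> y\<^sub>0 "c undefined" \<upsilon> \<Gamma> T .
 obtain G where G: "\<And>u. u \<in> paths ==> \<bar>\<phi> u\<bar> \<le> G" using path_Lipschitz_bounded[OF \<phi>] T by force
 have "(\<lambda>n. M.expectation (\<lambda>w. \<phi> (Euler_path T K (\<lambda>(k, j). D.block_noise n K k w $ j)))) \<longlonglongrightarrow> expectation (\<lambda>w. \<phi> (Euler_path T K (\<lambda>(k, j). grid_incr B T K k w $ j)))"
 proof (rule D.block_noise_converges[OF ind mean sq var avg brownian_motion_axioms K Euler_path_continuous[OF \<phi> T] G[OF paths_in(3)]])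
  fix x y :: "nat \<times> 'd => real" assume xy: "\<And>k j. k < K ==> x (k, j) = y (k, j)"
  have "Euler_at T K i x k = Euler_at T K i y k" if "k \<le> K" for i k
   unfolding Euler_at_def by (rule Euler_scheme_cong) (use that xy in auto)
  then have "Euler_path T K x = Euler_path T K y" by (simp add: Euler_path_def cell_of_def fun_eq_iff restrict_def)
  then show "\<phi> (Euler_path T K x) = \<phi> (Euler_path T K y)" by simp
 qed
 then show ?thesis by (simp add: disc_incr_def sde_incr_def D.block_noise_def)
qed

lemma disc_path_close:
 assumes T: "0 < T" "T < 1" and a: "0 < a"
 shows "\<forall>\<^sub>F K in sequentially. \<forall>\<^sub>F n in sequentially. \<exists>Bad\<in>sets M. M.prob Bad \<le> real CARD('i) * a \<and>
  (\<forall>w\<in>space M - Bad. path_dist T (disc_path n w) (Euler_path T K (disc_incr T n K w)) \<le> real CARD('i) * a)"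
proof -
 define near where "near i K n w \<longleftrightarrow> (\<forall>k\<le>K. \<forall>m. cell T K n k \<le> m \<and> m \<le> cell T K n (if k < K then Suc k else k) \<longrightarrow>
    norm (evolve (A i) (Os i) C u \<gamma> y\<^sub>0 n (\<lambda>m. b m w) m - Euler_at T K i (disc_incr T n K w) k) \<le> a)" for i K n w
 have "\<forall>\<^sub>F K in sequentially. \<forall>\<^sub>F n in sequentially. \<exists>Bad\<in>sets M. M.prob Bad \<le> a \<and> (\<forall>w\<in>space M - Bad. near i K n w)" for i
 proof -
  obtain \<Gamma> where "discrete_evolution M F b C3 (A i) (Os i) C u \<gamma> (c i) \<upsilon> \<Gamma> T" using disc[OF T] by blast
  then interpret D: discrete_evolution M F b C3 "A i" "Os i" C u \<gamma> y\<^sub>0 "c i" \<upsilon> \<Gamma> T .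
  have bn: "D.block_noise n K k w = (\<chi> j. disc_incr T n K w (k, j))" for n K k w
   by (simp add: D.block_noise_def disc_incr_def)
  show ?thesis using D.discrete_Euler_scheme[OF a a]
   unfolding near_def D.close_to_Euler_def Euler_at_def bn D.X_def eventually_sequentially by (elim exE conjE) (rule exI)
 qed
 then have "\<forall>\<^sub>F K in sequentially. \<forall>i. \<forall>\<^sub>F n in sequentially. \<exists>Bad\<in>sets M. M.prob Bad \<le> a \<and> (\<forall>w\<in>space M - Bad. near i K n w)"
  by (rule eventually_all_finite)
 then show ?thesis using eventually_gt_at_top[of 0]
 proof eventually_elim
  case (elim K)
  have "\<forall>\<^sub>F n in sequentially. \<forall>i. \<exists>Bad\<in>sets M. M.prob Bad \<le> a \<and> (\<forall>w\<in>space M - Bad. near i K n w)"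
   by (rule eventually_all_finite) (use elim in blast)
  then show ?case
  proof eventually_elim
   fix n assume "\<forall>i. \<exists>Bad\<in>sets M. M.prob Bad \<le> a \<and> (\<forall>w\<in>space M - Bad. near i K n w)"
   then obtain Bad where Bad: "\<And>i. Bad i \<in> sets M" "\<And>i. M.prob (Bad i) \<le> a" "\<And>i w. w \<in> space M - Bad i ==> near i K n w" by metis
   show "\<exists>Bad\<in>sets M. M.prob Bad \<le> real CARD('i) * a \<and>
    (\<forall>w\<in>space M - Bad. path_dist T (disc_path n w) (Euler_path T K (disc_incr T n K w)) \<le> real CARD('i) * a)"
   proof (intro bexI[of _ "\<Union>i. Bad i"] conjI ballI)
    show "(\<Union>i. Bad i) \<in> sets M" using Bad(1) by (intro sets.finite_UN) auto
    have "M.prob (\<Union>i. Bad i) \<le> (\<Sum>i\<in>UNIV. M.prob (Bad i))"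
     by (rule M.finite_measure_subadditive_finite) (use Bad(1) in auto)
    also have "\<dots> \<le> real CARD('i) * a" using sum_bounded_above[of UNIV "\<lambda>i. M.prob (Bad i)" a] Bad(2) by simp
    finally show "M.prob (\<Union>i. Bad i) \<le> real CARD('i) * a" .
    fix w assume w: "w \<in> space M - (\<Union>i. Bad i)"
    show "path_dist T (disc_path n w) (Euler_path T K (disc_incr T n K w)) \<le> real CARD('i) * a"
    proof (rule path_dist_least)
     fix t assume t: "t \<in> {0..T}"
     let ?k = "cell_of T K t"
     note cb = cell_of_bounds[OF T(1) elim(2) t]
     have c1: "cell T K n ?k \<le> nat \<lfloor>real n * t\<rfloor>"
      unfolding cell_def using cb(2) by (intro nat_mono floor_mono mult_left_mono) auto
     have c2: "nat \<lfloor>real n * t\<rfloor> \<le> cell T K n (if ?k < K then Suc ?k else ?k)"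
      unfolding cell_def using cb(3) by (intro nat_mono floor_mono mult_left_mono) auto
     have "norm (evolve (A i) (Os i) C u \<gamma> y\<^sub>0 n (\<lambda>m. b m w) (nat \<lfloor>real n * t\<rfloor>) - Euler_at T K i (disc_incr T n K w) ?k) \<le> a" for i
      using Bad(3)[of w i] w cb(1) c1 c2 unfolding near_def by blast
     then have "dist (disc_path n w t) (Euler_path T K (disc_incr T n K w) t) \<le> real CARD('i) * a"
      using t T by (intro dist_vec_le) (simp add: disc_path_def Euler_path_def dist_norm)
     then show "min 1 (dist (disc_path n w t) (Euler_path T K (disc_incr T n K w) t)) \<le> real CARD('i) * a" by linarith
    qed (use T in simp)
   qed
  qed
 qed
qed

lemma sde_path_close:
 assumes T: "0 < T" "T < 1" and a: "0 < a"
 shows "\<forall>\<^sub>F K in sequentially. \<exists>Bad\<in>sets P. prob Bad \<le> real CARD('i) * (2 * a) \<and>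
  (\<forall>w\<in>space P - Bad. path_dist T (sde_path w) (Euler_path T K (sde_incr T K w)) \<le> real CARD('i) * (2 * a))"
proof -
 have T0: "0 \<le> T" using T by simp
 define E where "E i K w k = Euler_at T K i (sde_incr T K w) k" for i K w k
 define far where "far i K = {w \<in> space P. \<exists>k\<le>K. a \<le> norm (Y i (real k * mesh T K) w - E i K w k)}" for i K
 have "\<forall>\<^sub>F K in sequentially. prob (far i K) \<le> a" for i
  using linear_sde.Euler_scheme_converges[OF sde[of i] T a a]
  unfolding eventually_sequentially far_def by (auto simp: E_def Euler_at_def sde_incr_def)
 then have far: "\<forall>\<^sub>F K in sequentially. \<forall>i. prob (far i K) \<le> a" by (rule eventually_all_finite)
 define osc where "osc i \<theta> = {w \<in> space P. \<exists>s\<in>{0..T}. \<exists>t\<in>{0..T}. \<bar>s - t\<bar> \<le> \<theta> \<and> a < dist (Y i s w) (Y i t w)}" for i \<theta>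
 have "\<exists>\<theta>>0. prob (osc i \<theta>) < a" for i unfolding osc_def
  by (rule path_modulus_in_probability[OF prob_space_axioms T0 T(2) linear_sde.Y_measurable[OF sde] linear_sde.Y_continuous[OF sde] a a])
 then obtain \<theta> where \<theta>: "\<And>i. 0 < \<theta> i" "\<And>i. prob (osc i (\<theta> i)) < a" by metis
 have om: "osc i (\<theta> i) \<in> sets P" for i unfolding osc_def
  by (rule sets_path_modulus[OF prob_space_axioms T0 T(2) linear_sde.Y_measurable[OF sde] linear_sde.Y_continuous[OF sde]])
 have "(\<lambda>K. T * (1 / real K)) \<longlonglongrightarrow> T * 0" by (intro tendsto_intros lim_1_over_n)
 then have lim: "(\<lambda>K. mesh T K) \<longlonglongrightarrow> 0" by (simp add: mesh_def[abs_def])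
 have "\<forall>\<^sub>F K in sequentially. \<forall>i. mesh T K < \<theta> i"
  by (rule eventually_all_finite) (rule order_tendstoD(2)[OF lim \<theta>(1)])
 then show ?thesis using far eventually_gt_at_top[of 0]
 proof eventually_elim
  case (elim K)
  note Kp = elim(3)
  have h: "0 < mesh T K" "real K * mesh T K = T" using Kp T by (auto simp: mesh_def)
  have h\<theta>: "mesh T K \<le> \<theta> i" for i using elim(1) less_imp_le by blast
  have kt: "real k * mesh T K \<in> {0..T}" if "k \<le> K" for k
  proof -
   have "real k * mesh T K \<le> real K * mesh T K" using that h by (intro mult_right_mono) auto
   then show ?thesis using h by simp
  qed
  have Am: "far i K \<in> sets P" for i unfolding far_def
  proof (rule sets_ex_norm_ge)
   fix k assume "k \<le> K"
   then have "real k * mesh T K \<in> {0..<1}" using kt[of k] T by auto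
   moreover have "(\<lambda>w. E i K w k) \<in> borel_measurable P"
    unfolding E_def Euler_at_def
    by (intro Euler_scheme_adapted A_linear coeff_lin) (simp add: sde_incr_measurable[OF T(1)])
   ultimately show "(\<lambda>w. Y i (real k * mesh T K) w - E i K w k) \<in> borel_measurable P"
    by (intro borel_measurable_diff linear_sde.Y_measurable[OF sde])
  qed
  let ?Bad = "\<Union>i. far i K \<union> osc i (\<theta> i)"
  have Bi: "far i K \<union> osc i (\<theta> i) \<in> sets P" for i by (rule sets.Un[OF Am om])
  have pBi: "prob (far i K \<union> osc i (\<theta> i)) \<le> 2 * a" for i
   using measure_Un_le[OF Am[of i] om[of i]] spec[OF elim(2), of i] \<theta>(2)[of i] by linarith
  show "\<exists>Bad\<in>sets P. prob Bad \<le> real CARD('i) * (2 * a) \<and>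
   (\<forall>w\<in>space P - Bad. path_dist T (sde_path w) (Euler_path T K (sde_incr T K w)) \<le> real CARD('i) * (2 * a))"
  proof (intro bexI[of _ ?Bad] conjI ballI)
   show "?Bad \<in> sets P" by (rule sets.finite_UN[OF finite Bi])
   have "prob ?Bad \<le> (\<Sum>i\<in>UNIV. prob (far i K \<union> osc i (\<theta> i)))"
    by (rule finite_measure_subadditive_finite[OF finite image_subsetI[OF Bi]])
   also have "\<dots> \<le> real CARD('i) * (2 * a)" by (rule sum_bounded_above[OF pBi])
   finally show "prob ?Bad \<le> real CARD('i) * (2 * a)" .
   fix w assume w: "w \<in> space P - ?Bad"
   show "path_dist T (sde_path w) (Euler_path T K (sde_incr T K w)) \<le> real CARD('i) * (2 * a)"
   proof (rule path_dist_least)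
    fix t assume t: "t \<in> {0..T}"
    let ?k = "cell_of T K t"
    note cb = cell_of_bounds[OF T(1) Kp t]
    have "\<bar>t - real ?k * mesh T K\<bar> \<le> mesh T K"
     using cb(2,3) h(1) by (auto split: if_splits simp: distrib_right)
    then have cl: "\<bar>t - real ?k * mesh T K\<bar> \<le> \<theta> i" for i using h\<theta>[of i] by linarith
    have "dist (Y i t w) (E i K w ?k) \<le> 2 * a" for i
    proof -
     have wP: "w \<in> space P" and nA: "w \<notin> far i K" and nO: "w \<notin> osc i (\<theta> i)" using w by blast+
     have "dist (Y i t w) (Y i (real ?k * mesh T K) w) \<le> a"
     proof (rule ccontr)
      assume "\<not> ?thesis"
      then have "w \<in> osc i (\<theta> i)"
       unfolding osc_def using wP t kt[OF cb(1)] cl[of i] by (intro CollectI conjI bexI[of _ t] bexI[of _ "real ?k * mesh T K"]) auto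
      then show False using nO by blast
     qed
     moreover have "norm (Y i (real ?k * mesh T K) w - E i K w ?k) \<le> a"
     proof (rule ccontr)
      assume "\<not> ?thesis"
      then have "w \<in> far i K" unfolding far_def using wP cb(1) by (intro CollectI conjI exI[of _ ?k]) auto
      then show False using nA by blast
     qed
     ultimately show ?thesis
      using dist_triangle[of "Y i t w" "E i K w ?k" "Y i (real ?k * mesh T K) w"] by (simp add: dist_norm)
    qed
    then have "dist (sde_path w t) (Euler_path T K (sde_incr T K w) t) \<le> real CARD('i) * (2 * a)"
     using t T by (intro dist_vec_le) (simp add: sde_path_def Euler_path_def E_def)
    then show "min 1 (dist (sde_path w t) (Euler_path T K (sde_incr T K w) t)) \<le> real CARD('i) * (2 * a)" by linarith
   qed (use T in simp)
  qed
 qed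
qed

text \<open>
 Replace both processes by their Euler paths, which converge for fixed \<open>K\<close>.
\<close>

theorem disc_path_converges:
 "converges_in_distribution (uniform_on_compacts {0..<1}) (\<lambda>n. M) disc_path P sde_path"
proof (rule converges_in_distribution_if_Lipschitz[OF M_prob prob_space_axioms disc_path_measurable sde_path_measurable])
 fix T0 L and \<phi> :: "(real => 'v^'i) => real" assume T0: "0 \<le> T0" "T0 < 1" and \<phi>0: "path_Lipschitz T0 L \<phi>"
 (* The grid needs a positive time horizon. *)
 define T where "T = max T0 (1 / 2)"
 have T: "0 < T" "T < 1" using T0 by (auto simp: T_def)
 have \<phi>: "path_Lipschitz T L \<phi>" by (rule path_Lipschitz_mono[OF \<phi>0 T0(1)]) (simp add: T_def)
 have L: "0 \<le> L" using \<phi> by (simp add: path_Lipschitz_def)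
 let ?N = "real CARD('i)"
 show "(\<lambda>n. M.expectation (\<lambda>w. \<phi> (disc_path n w))) \<longlonglongrightarrow> expectation (\<lambda>w. \<phi> (sde_path w))"
 proof (rule LIMSEQ_I)
  fix e :: real assume e: "0 < e"
  (* The two replacements cost 2 a L N and 4 a L N in expectation, together less than e / 2. *)
  define a where "a = e / (12 * (L * ?N + 1))"
  have LN: "0 < L * ?N + 1" using L by (simp add: add_nonneg_pos)
  have a: "0 < a" using e LN by (simp add: a_def)
  have small: "L * (?N * a + ?N * a) + L * (?N * (2 * a) + ?N * (2 * a)) < e / 2"
  proof -
   have "L * (?N * a + ?N * a) + L * (?N * (2 * a) + ?N * (2 * a)) = 6 * a * (L * ?N)" by (simp add: algebra_simps)
   also have "\<dots> < 6 * a * (L * ?N + 1)" using a by simp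
   also have "6 * a * (L * ?N + 1) = e / 2" using LN by (simp add: a_def nonzero_divide_eq_eq)
   finally show ?thesis .
  qed
  obtain K where K: "0 < K"
   and M: "\<forall>\<^sub>F n in sequentially. \<exists>Bad\<in>sets M. M.prob Bad \<le> ?N * a \<and>
    (\<forall>w\<in>space M - Bad. path_dist T (disc_path n w) (Euler_path T K (disc_incr T n K w)) \<le> ?N * a)"
   and P: "\<exists>Bad\<in>sets P. prob Bad \<le> ?N * (2 * a) \<and>
    (\<forall>w\<in>space P - Bad. path_dist T (sde_path w) (Euler_path T K (sde_incr T K w)) \<le> ?N * (2 * a))"
   using eventually_happens'[OF sequentially_bot eventually_conj[OF eventually_gt_at_top[of 0]
     eventually_conj[OF disc_path_close[OF T a] sde_path_close[OF T a]]]] by (elim exE conjE)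
  obtain n1 where n1: "\<And>n. n \<ge> n1 ==> \<exists>Bad\<in>sets M. M.prob Bad \<le> ?N * a \<and>
   (\<forall>w\<in>space M - Bad. path_dist T (disc_path n w) (Euler_path T K (disc_incr T n K w)) \<le> ?N * a)"
   using M unfolding eventually_sequentially by blast
  obtain Bad where Bad: "Bad \<in> sets P" "prob Bad \<le> ?N * (2 * a)"
   "\<And>w. w \<in> space P - Bad ==> path_dist T (sde_path w) (Euler_path T K (sde_incr T K w)) \<le> ?N * (2 * a)"
   using P by blast
  have T0': "0 \<le> T" using T by simp
  have mP: "(\<lambda>w. Euler_path T K (sde_incr T K w)) \<in> measurable P (borel_of (uniform_on_compacts {0..<1}))"
   by (rule Euler_path_measurable, rule sde_incr_measurable[OF T(1)])
  have mM: "(\<lambda>w. Euler_path T K (disc_incr T n K w)) \<in> measurable M (borel_of (uniform_on_compacts {0..<1}))" for n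
   by (rule Euler_path_measurable, rule disc_incr_measurable)
  have s: "\<bar>expectation (\<lambda>w. \<phi> (sde_path w)) - expectation (\<lambda>w. \<phi> (Euler_path T K (sde_incr T K w)))\<bar> \<le> L * (?N * (2 * a) + ?N * (2 * a))"
   by (rule expectation_path_Lipschitz_close[OF \<phi> T0' T(2) sde_path_measurable mP
     paths_in(2) paths_in(3) Bad]) (use a in auto)
  obtain n2 where n2: "\<And>n. n \<ge> n2 ==> norm (M.expectation (\<lambda>w. \<phi> (Euler_path T K (disc_incr T n K w))) - expectation (\<lambda>w. \<phi> (Euler_path T K (sde_incr T K w)))) < e / 2"
   using LIMSEQ_D[OF Euler_paths_converge[OF \<phi> T K], of "e / 2"] e by auto
  show "\<exists>no. \<forall>n\<ge>no. norm (M.expectation (\<lambda>w. \<phi> (disc_path n w)) - expectation (\<lambda>w. \<phi> (sde_path w))) < e"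
  proof (intro exI[of _ "max n1 n2"] allI impI)
   fix n assume n: "max n1 n2 \<le> n"
   obtain Bad' where Bad': "Bad' \<in> sets M" "M.prob Bad' \<le> ?N * a"
    "\<And>w. w \<in> space M - Bad' ==> path_dist T (disc_path n w) (Euler_path T K (disc_incr T n K w)) \<le> ?N * a"
    using n1[of n] n by auto
   have d: "\<bar>M.expectation (\<lambda>w. \<phi> (disc_path n w)) - M.expectation (\<lambda>w. \<phi> (Euler_path T K (disc_incr T n K w)))\<bar> \<le> L * (?N * a + ?N * a)"
    by (rule M.expectation_path_Lipschitz_close[OF \<phi> T0' T(2) disc_path_measurable mM
      paths_in(1) paths_in(3) Bad']) (use a in auto)
   show "norm (M.expectation (\<lambda>w. \<phi> (disc_path n w)) - expectation (\<lambda>w. \<phi> (sde_path w))) < e"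
    using d s n2[of n] n small unfolding real_norm_def by linarith
  qed
 qed
qed

end

section \<open>The decaying model\<close>

lemma (in prob_space) indep_vars_reindex_inj:
 assumes f: "inj_on f I" and X: "indep_vars M' X (f ` I)"
 shows "indep_vars (\<lambda>i. M' (f i)) (\<lambda>i. X (f i)) I"
 unfolding indep_vars_def2
proof (intro conjI ballI indep_setsI)
 let ?S = "\<lambda>i. {X i -` A \<inter> space M | A. A \<in> sets (M' i)}"
 show "random_variable (M' (f i)) (X (f i))" if "i \<in> I" for i using X that by (auto simp: indep_vars_def2)
 then show "?S (f i) \<subseteq> events" if "i \<in> I" for i using that by (auto intro: measurable_sets)
 fix A J assume J: "J \<noteq> {}" "J \<subseteq> I" "finite J" and A: "\<forall>j\<in>J. A j \<in> ?S (f j)"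
 let ?g = "the_inv_into J f"
 have fJ: "inj_on f J" using f J(2) by (rule inj_on_subset)
 have "prob (\<Inter>k\<in>f ` J. A (?g k)) = (\<Prod>k\<in>f ` J. prob (A (?g k)))"
 proof (rule indep_setsD)
  show "indep_sets ?S (f ` I)" using X by (simp add: indep_vars_def2)
 qed (use J A in \<open>auto simp: the_inv_into_f_f[OF fJ]\<close>)
 then show "prob (\<Inter>j\<in>J. A j) = (\<Prod>j\<in>J. prob (A j))"
  by (simp add: the_inv_into_f_f[OF fJ] prod.reindex[OF fJ])
qed

context energy begin

text \<open>
 One constant for all bounds, as the locales of the recursion and of the equation share it.
\<close>

lemma coefficient_bounds:
 "\<exists>c. 0 \<le> c \<and> (\<forall>x. norm (drift E lam x) \<le> c * norm x) \<and> (\<forall>i x. norm (osc lam i x) \<le> c * norm x)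
   \<and> (\<forall>p q x. norm (\<Sum>i\<in>{p..<q}. osc lam i x) \<le> c * norm x) \<and> (\<forall>j x. norm (disp \<sigma> j x) \<le> c * norm x)"
proof -
 obtain c1 where c1: "0 \<le> c1" "\<And>x. norm (drift E lam x) \<le> c1 * norm x"
  by (rule linear_bounded_nonneg[OF drift_linear]) blast
 obtain c2 where c2: "0 \<le> c2" "\<And>i x. norm (osc lam i x) \<le> c2 * norm x" "\<And>p q x. norm (\<Sum>i\<in>{p..<q}. osc lam i x) \<le> c2 * norm x"
  by (rule osc_bounds) blast
 have "\<exists>d. 0 \<le> d \<and> (\<forall>x. norm (disp \<sigma> j x) \<le> d * norm x)" for j
  by (rule linear_bounded_nonneg[OF disp_linear[of \<sigma> j]]) blast
 then obtain d where d: "\<And>j. 0 \<le> d j" "\<And>j x. norm (disp \<sigma> j x) \<le> d j * norm x" by metis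
 define c where "c = c1 + c2 + sum d UNIV"
 have s: "d j \<le> sum d UNIV" for j by (rule member_le_sum) (use d in auto)
 have s0: "0 \<le> sum d UNIV" by (rule sum_nonneg) (use d in auto)
 have c: "c1 \<le> c" "c2 \<le> c" "d j \<le> c" for j using c1(1) c2(1) s[of j] s0 by (auto simp: c_def)
 have le: "r \<le> c * norm x" if "r \<le> d * norm x" "d \<le> c" for r d and x :: "complex^2^2"
  using that mult_right_mono[OF that(2), of "norm x"] by simp
 show ?thesis
 proof (intro exI[of _ c] conjI allI)
  show "0 \<le> c" using c1(1) c2(1) s0 by (simp add: c_def)
 qed (rule le[OF c1(2) c(1)] le[OF c2(2) c(2)] le[OF c2(3) c(2)] le[OF d(2) c(3)])+
qed

lemma gam_continuous: "continuous_on {0..<1} (\<lambda>t. gam t)"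
 by (intro continuous_intros) auto

lemma gam_bound: assumes "T < 1" "t \<in> {0..T}" shows "\<bar>gam t\<bar> \<le> gam T"
 using assms by (auto intro!: divide_left_mono)

lemma gam_ge_1: "0 < T ==> T < 1 ==> 1 \<le> gam T"
 by (simp add: real_le_rsqrt le_divide_eq)

end

theorem theorem14:
  fixes M :: "'a measure" and \<omega> :: "nat \<Rightarrow> 'a \<Rightarrow> real" and E \<sigma> :: real
    and P :: "'b measure" and F :: "real \<Rightarrow> 'b measure" and B :: "real \<Rightarrow> 'b \<Rightarrow> real^3"
    and Q :: "complex \<Rightarrow> real \<Rightarrow> 'b \<Rightarrow> complex^2^2" and \<Lambda> :: "'i::finite \<Rightarrow> complex"
  assumes "prob_space M"
    and "prob_space.indep_vars M (\<lambda>_. borel) \<omega> {1..}"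
    and "\<And>k. 1 \<le> k \<Longrightarrow> prob_space.expectation M (\<omega> k) = 0"
    and "\<And>k. 1 \<le> k \<Longrightarrow> prob_space.variance M (\<omega> k) = 1"
    and "\<exists>C. \<forall>k\<ge>1. integrable M (\<lambda>x. \<bar>\<omega> k x\<bar> ^ 3) \<and>
           prob_space.expectation M (\<lambda>x. \<bar>\<omega> k x\<bar> ^ 3) \<le> C"
    and "\<sigma> > 0"
    and "E \<in> {-2<..<2} - {0}"
    and "brownian_motion P F B"
    and "\<And>lam. solves_sde P F B 1 (\<lambda>t. drift E lam) (diffusion E \<sigma>) (mat 1) (Q lam)"
  shows "converges_in_distribution (uniform_on_compacts {0..<1::real})
    (\<lambda>n. M)
    (\<lambda>n x. \<lambda>t\<in>{0..<1}. \<chi> i. Q_discrete E \<sigma> (\<lambda>k. \<omega> k x) n (\<Lambda> i) (nat \<lfloor>real n * t\<rfloor>))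
    P
    (\<lambda>w. \<lambda>t\<in>{0..<1}. \<chi> i. Q (\<Lambda> i) t w)"
proof -
 interpret energy E by unfold_locales (rule assms(7))
 interpret M: prob_space M by (rule assms(1))
 define b where "b i = \<omega> (Suc i)" for i
 have ind: "M.indep_vars (\<lambda>_. borel) b UNIV"
  unfolding b_def by (rule M.indep_vars_reindex_inj, simp) (rule M.indep_vars_subset[OF assms(2)], auto)
 obtain C3 where C3: "\<And>k. 1 \<le> k ==> integrable M (\<lambda>x. \<bar>\<omega> k x\<bar> ^ 3)" "\<And>k. 1 \<le> k ==> M.expectation (\<lambda>x. \<bar>\<omega> k x\<bar> ^ 3) \<le> C3"
  using assms(5) by blast
 have b3: "integrable M (\<lambda>x. \<bar>b i x\<bar> ^ 3)" "M.expectation (\<lambda>x. \<bar>b i x\<bar> ^ 3) \<le> C3" for i using C3[of "Suc i"] by (simp_all add: b_def)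
 have mean: "M.expectation (b i) = 0" for i using assms(3)[of "Suc i"] by (simp add: b_def)
 have var: "M.expectation (\<lambda>w. (b i w)^2) = 1" for i using assms(4)[of "Suc i"] assms(3)[of "Suc i"] by (simp add: b_def)
 (* A non-integrable function would have integral 0. *)
 have sq: "integrable M (\<lambda>w. (b i w)^2)" for i
  using var[of i] not_integrable_integral_eq by fastforce
 obtain G where G: "\<And>N. noise_sequence M G b (\<lambda>_. 1) N" using M.noise_if_indep_vars[OF ind sq mean var] by blast
 obtain c where c: "\<And>lam. 0 \<le> c lam" "\<And>lam x. norm (drift E lam x) \<le> c lam * norm x" "\<And>lam i x. norm (osc lam i x) \<le> c lam * norm x"
  "\<And>lam p q x. norm (\<Sum>i\<in>{p..<q}. osc lam i x) \<le> c lam * norm x" "\<And>lam j x. norm (disp \<sigma> j x) \<le> c lam * norm x"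
  using choice[OF allI[OF coefficient_bounds[of _ \<sigma>]], of "\<lambda>lam. lam"] by blast
 interpret brownian_motion P F B by (rule assms(8))
 interpret coupled_evolutions P F B M G b C3 "\<lambda>i. drift E (\<Lambda> i)" "\<lambda>i. osc (\<Lambda> i)" "disp \<sigma>" angle "\<lambda>t. gam t" "mat 1"
  "\<lambda>i. c (\<Lambda> i)" "sqrt 2" "diffusion E \<sigma>" "\<lambda>i. Q (\<Lambda> i)"
 proof (intro coupled_evolutions.intro coupled_evolutions_axioms.intro brownian_motion_axioms ind mean sq var angle_average)
  show "\<exists>\<Gamma>. discrete_evolution M G b C3 (drift E (\<Lambda> i)) (osc (\<Lambda> i)) (disp \<sigma>) angle (\<lambda>t. gam t) (c (\<Lambda> i)) (sqrt 2) \<Gamma> T"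
   if "0 < T" "T < 1" for i T
   by (intro exI[of _ "gam T"] discrete_evolution.intro discrete_evolution_axioms.intro assms(1) G b3 drift_linear osc_linear disp_linear
     c angle_bound gam_continuous gam_bound gam_ge_1 that) (simp_all add: that)
  show "linear_sde P F B (drift E (\<Lambda> i)) (disp \<sigma>) (\<lambda>t. gam t) (diffusion E \<sigma>) (mat 1) (Q (\<Lambda> i)) (c (\<Lambda> i))" for i
   by (intro linear_sde.intro linear_sde_axioms.intro brownian_motion_axioms drift_linear disp_linear c gam_continuous diffusion_axis assms(9))
 qed
 (* For n = 0 only the index 0 occurs. *)
 have "Q_discrete E \<sigma> (\<lambda>k. \<omega> k x) n lam (nat \<lfloor>real n * t\<rfloor>)
   = evolve (drift E lam) (osc lam) (disp \<sigma>) angle (\<lambda>t. gam t) (mat 1) n (\<lambda>m. b m x) (nat \<lfloor>real n * t\<rfloor>)" for x n lam t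
  using Q_discrete_evolve[of n \<sigma> "\<lambda>k. \<omega> k x" lam] by (cases "n = 0") (simp_all add: b_def Q_discrete_def)
 then show ?thesis using disc_path_converges by (simp add: disc_path_def[abs_def] sde_path_def[abs_def])
qed

end
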